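(* Let $\Omega\subset\mathbb{R}^n$ be a bounded domain, let $1\le k\le n$ be an integer, and let $\varphi$ be a smooth function on $\partial\Omega$. Let $A=(A_{ij})\in C^2(\bar\Omega\times\mathbb{R}^n)$ be a symmetric $n\times n$ matrix valued function which is regular, i.e. $$\sum_{i,j,k,l} D^2_{p_kp_l}A_{ij}(x,p)\,\xi_i\xi_j\eta_k\eta_l\ge 0\quad\text{for all }(x,p)\in\bar\Omega\times\mathbb{R}^n,\ \xi,\eta\in\mathbb{R}^n\text{ with }\xi\perp\eta .$$ Let $B\in C^2(\bar\Omega\times\mathbb{R}^n)$ satisfy $B>0$ in $\bar\Omega\times\mathbb{R}^n$, and suppose that $\tilde B:=B^{1/k}$ is convex in $p$, i.e. $\sum_{k,l}D^2_{p_kp_l}\tilde B(x,p)\xi_k\xi_l\ge 0$ for all $(x,p)\in\Omega\times\mathbb{R}^n$, $\xi\in\mathbb{R}^n$. Let $u\in C^4(\Omega)\cap C^2(\bar\Omega)$ be an admissible solution of the Dirichlet problem $$S_k[D^2u-A(x,Du)]=B(x,Du)\ \text{ in }\Omega,\qquad u=\varphi\ \text{ on }\partial\Omega .$$ Suppose also that there exists an admissible function $\underline u\in C^2(\bar\Omega)$ satisfying $$D^2\underline u-A(x,D\underline u)\in\Gamma_k^+\quad\text{for all }x\in\bar\Omega .$$ Then $$\sup_\Omega|D^2u|\le C\Bigl(1+\sup_{\partial\Omega}|D^2u|\Bigr),$$ where the constant $C$ depends on $k,n,A,B,\Omega,\underline u$ and $\sup_\Omega(|u|+|Du|)$.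
   Context: For $\lambda\in\mathbb{R}^n$, $S_k(\lambda)=\sum_{1\le i_1<\cdots<i_k\le n}\lambda_{i_1}\cdots\lambda_{i_k}$ is the $k$-th elementary symmetric function; for a symmetric $n\times n$ matrix $W$ with eigenvalues $\lambda=(\lambda_1,\dots,\lambda_n)$, $S_k[W]:=S_k(\lambda)$. The cone $\Gamma_k^+=\{\lambda\in\mathbb{R}^n: S_j(\lambda)>0,\ 1\le j\le k\}$, and $\Gamma_k=\Gamma_k^+\cup\partial\Gamma_k^+$ is its closure; for a symmetric matrix $W$, $W\in\Gamma_k$ (resp. $\Gamma_k^+$) means that its eigenvalue vector lies in $\Gamma_k$ (resp. $\Gamma_k^+$). A $C^2$ function $u$ is called admissible if $D^2u-A(x,Du)\in\Gamma_k$ at every point of $\Omega$. Points of $\Omega\times\mathbb{R}^n$ are written $(x,p)$. "The constant $C$ depends on" a list of data means that $C$ can be chosen as a function of the listed data only, and in particular does not otherwise depend on $u$. *)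

theory Defs
  imports "HOL-Analysis.Analysis"
begin

(* The partial derivative of f in direction b on an open set U, extended to boundary points of U
   by its limit from inside U. On U it is the classical derivative, and it depends only on the
   values of f in U. *)
definition partial_d :: "'a::euclidean_space set \<Rightarrow> 'a \<Rightarrow> ('a \<Rightarrow> real) \<Rightarrow> 'a \<Rightarrow> real" where
  "partial_d U b f x =
     (if x \<in> U then frechet_derivative f (at x) b
      else Lim (at x within U) (\<lambda>y. frechet_derivative f (at y) b))"

(* For U open, Ck m U U is the space C^m(U), and Ck m U (closure U) is the space C^m of the closure
   of U: f is C^m in U, and f and all its partial derivatives of order at most m extend continuously
   to the closure, the boundary values of f being those of the extension. *)
fun Ck :: "nat \<Rightarrow> 'a::euclidean_space set \<Rightarrow> 'a set \<Rightarrow> ('a \<Rightarrow> real) \<Rightarrow> bool" where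
  "Ck 0 U X f \<longleftrightarrow> continuous_on X f"
| "Ck (Suc m) U X f \<longleftrightarrow>
     continuous_on X f \<and> (\<forall>x\<in>U. f differentiable (at x)) \<and>
     (\<forall>b\<in>Basis. Ck m U X (partial_d U b f))"

(* Smoothness on an arbitrary set X: restriction to X of a function smooth near X. *)
definition smooth_on_set :: "'a::euclidean_space set \<Rightarrow> ('a \<Rightarrow> real) \<Rightarrow> bool" where
  "smooth_on_set X f \<longleftrightarrow>
     (\<exists>V g. open V \<and> X \<subseteq> V \<and> (\<forall>m. Ck m V V g) \<and> (\<forall>x\<in>X. f x = g x))"

definition grad :: "(real^'n) set \<Rightarrow> (real^'n \<Rightarrow> real) \<Rightarrow> real^'n \<Rightarrow> real^'n" where
  "grad \<Omega> u x = (\<chi> i. partial_d \<Omega> (axis i 1) u x)"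

definition hess :: "(real^'n) set \<Rightarrow> (real^'n \<Rightarrow> real) \<Rightarrow> real^'n \<Rightarrow> real^'n^'n" where
  "hess \<Omega> u x = (\<chi> i j. partial_d \<Omega> (axis i 1) (partial_d \<Omega> (axis j 1) u) x)"

(* Second derivatives in p_k and p_l of a function of (x, p), with x in the closure of \<Omega>. *)
definition D2p ::
  "(real^'n) set \<Rightarrow> 'n \<Rightarrow> 'n \<Rightarrow> ((real^'n) \<times> (real^'n) \<Rightarrow> real) \<Rightarrow> (real^'n) \<times> (real^'n) \<Rightarrow> real" where
  "D2p \<Omega> k l f =
     partial_d (\<Omega> \<times> UNIV) (0, axis k 1) (partial_d (\<Omega> \<times> UNIV) (0, axis l 1) f)"

definition elem_sym :: "nat \<Rightarrow> real^'n \<Rightarrow> real" where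
  "elem_sym k v = (\<Sum>I | card I = k. \<Prod>i\<in>I. v $ i)"

(* The eigenvalues of W, listed with multiplicity: the roots of its characteristic polynomial.
   Such a vector exists for symmetric W and is unique up to permutation of its entries; the notions
   below do not depend on the choice of order. *)
definition eigenvalue_vector :: "real^'n^'n \<Rightarrow> real^'n" where
  "eigenvalue_vector W = (SOME v. \<forall>t. det (mat t - W) = (\<Prod>i\<in>UNIV. t - v $ i))"

definition S_mat :: "nat \<Rightarrow> real^'n^'n \<Rightarrow> real" where
  "S_mat k W = elem_sym k (eigenvalue_vector W)"

definition Gamma_plus :: "nat \<Rightarrow> (real^'n) set" where
  "Gamma_plus k = {v. \<forall>j\<in>{1..k}. elem_sym j v > 0}"

definition Gamma_cone :: "nat \<Rightarrow> (real^'n) set" where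
  "Gamma_cone k = closure (Gamma_plus k)"

definition aug_hess ::
  "(real^'n) set \<Rightarrow> ((real^'n) \<times> (real^'n) \<Rightarrow> real^'n^'n) \<Rightarrow> (real^'n \<Rightarrow> real) \<Rightarrow> real^'n \<Rightarrow> real^'n^'n"
  where "aug_hess \<Omega> A u x = hess \<Omega> u x - A (x, grad \<Omega> u x)"

definition admissible ::
  "nat \<Rightarrow> (real^'n) set \<Rightarrow> ((real^'n) \<times> (real^'n) \<Rightarrow> real^'n^'n) \<Rightarrow> (real^'n \<Rightarrow> real) \<Rightarrow> bool" where
  "admissible k \<Omega> A u \<longleftrightarrow>
     Ck 2 \<Omega> \<Omega> u \<and> (\<forall>x\<in>\<Omega>. eigenvalue_vector (aug_hess \<Omega> A u x) \<in> Gamma_cone k)"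

definition regular_matrix ::
  "(real^'n) set \<Rightarrow> ((real^'n) \<times> (real^'n) \<Rightarrow> real^'n^'n) \<Rightarrow> bool" where
  "regular_matrix \<Omega> A \<longleftrightarrow>
     (\<forall>x\<in>closure \<Omega>. \<forall>p \<xi> \<eta>. \<xi> \<bullet> \<eta> = 0 \<longrightarrow>
        (\<Sum>i\<in>UNIV. \<Sum>j\<in>UNIV. \<Sum>k\<in>UNIV. \<Sum>l\<in>UNIV.
           D2p \<Omega> k l (\<lambda>z. A z $ i $ j) (x, p) * \<xi> $ i * \<xi> $ j * \<eta> $ k * \<eta> $ l) \<ge> 0)"

definition convex_in_p ::
  "(real^'n) set \<Rightarrow> ((real^'n) \<times> (real^'n) \<Rightarrow> real) \<Rightarrow> bool" where
  "convex_in_p \<Omega> f \<longleftrightarrow>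
     (\<forall>x\<in>\<Omega>. \<forall>p \<xi>. (\<Sum>k\<in>UNIV. \<Sum>l\<in>UNIV. D2p \<Omega> k l f (x, p) * \<xi> $ k * \<xi> $ l) \<ge> 0)"

end

theory Submission imports Defs begin

text \<open>
  Maximum principle for \<open>(\<xi> \<bullet> w \<xi>) exp (\<kappa>\<^sub>1 |Du|\<^sup>2 / 2 + \<kappa>\<^sub>2 exp (K (usub - u)))\<close> over points and unit vectors,
  where \<open>w = D\<^sup>2u - A(x, Du)\<close>. At an interior maximum the equation is differentiated in an eigenframe of
  \<open>w\<close> with eigenvalues \<open>\<lambda>\<close>; write \<open>\<sigma>\<^sub>i = \<partial>S\<^sub>k/\<partial>\<lambda>\<^sub>i\<close> and \<open>m\<close> for the index of the largest eigenvalue. Concavity of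
  \<open>S\<^sub>k\<^sup>1\<^sup>/\<^sup>k\<close> matches the convexity of \<open>B\<^sup>1\<^sup>/\<^sup>k\<close>; regularity of \<open>A\<close> leaves only errors of size \<open>\<sigma>\<^sub>m \<lambda>\<^sub>m\<close> and
  \<open>\<Sum> \<sigma>\<^sub>i\<close>. The term \<open>|Du|\<^sup>2\<close> produces \<open>\<Sum> \<sigma>\<^sub>i \<lambda>\<^sub>i\<^sup>2\<close>, which also dominates every constant because
  \<open>\<sigma>\<^sub>m \<lambda>\<^sub>m \<ge> (k/n) S\<^sub>k\<close>, while the strictly admissible function produces \<open>\<Sum> \<sigma>\<^sub>i\<close>. Choosing \<open>\<kappa>\<^sub>1\<close> small and then
  \<open>\<kappa>\<^sub>2\<close> large bounds \<open>\<lambda>\<^sub>m\<close>. The cone of admissible matrices is handled through the superadditivity of the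
  quotients \<open>S\<^sub>j\<^sub>+\<^sub>1 / S\<^sub>j\<close>.
\<close>

section \<open>Elementary symmetric functions\<close>

text \<open>Eigenvalues and eigenvectors of \<open>w\<close> need not be differentiable. At a
  maximum point the eigenframe \<open>q\<close> is therefore frozen:
  \<open>x \<mapsto> q m \<bullet> (w x *v q m)\<close> is smooth, its product with the weight is
  maximal at the same point, and S_k is differentiated as a sum of principal minors in the fixed
  frame. The obstacle is the sum of \<sigma>_i f_i^2, with f_i the derivatives of the exponent,
  which the second-order condition leaves on the wrong side. At a diagonal matrix the second
  derivative of S_k also contains products of off-diagonal entries; those with one index
  \<open>m\<close> offset this sum up to multiples of \<kappa>1^2 and \<kappa>2^2 / \<lambda>_m^2
  times the sum of \<sigma>_i \<lambda>_i^2. So \<kappa>1 must be small, since its gain is only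
  linear, while \<kappa>2 may be as large as desired once \<lambda>_m is large. All bounds on
  \<open>A\<close> and \<open>B\<close> are taken over one compact set of pairs (x, p) that contains
  the gradients of \<open>u\<close> and \<open>usub\<close> and the segments between them; this
  makes the constant uniform in \<open>u\<close>.\<close>

definition esym :: "nat \<Rightarrow> 'a set \<Rightarrow> ('a \<Rightarrow> real) \<Rightarrow> real" where
  "esym k X f = (\<Sum>I | I \<subseteq> X \<and> card I = k. \<Prod>i\<in>I. f i)"

lemma esym_0 [simp]: "finite X \<Longrightarrow> esym 0 X f = 1"
proof -
  assume X: "finite X"
  have "{I. I \<subseteq> X \<and> card I = 0} = {{}}"
    using X by (auto dest: finite_subset)
  then show ?thesis by (simp add: esym_def)
qed

lemma esym_cong: "(\<And>i. i \<in> X \<Longrightarrow> f i = g i) \<Longrightarrow> esym k X f = esym k X g"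
  unfolding esym_def by (intro sum.cong prod.cong refl) auto

lemma esym_insert:
  assumes "finite X" "i \<notin> X"
  shows "esym (Suc k) (insert i X) f = esym (Suc k) X f + f i * esym k X f"
proof -
  let ?A = "{I. I \<subseteq> X \<and> card I = Suc k}" and ?B = "{I. I \<subseteq> X \<and> card I = k}"
  have *: "{I. I \<subseteq> insert i X \<and> card I = Suc k} = ?A \<union> insert i ` ?B"
  proof (rule set_eqI, rule iffI)
    fix I assume I: "I \<in> {I. I \<subseteq> insert i X \<and> card I = Suc k}"
    then have fin: "finite I" using assms(1) finite_subset by auto
    show "I \<in> ?A \<union> insert i ` ?B"
    proof (cases "i \<in> I")
      case True
      then have "I = insert i (I - {i})" "I - {i} \<in> ?B" using I fin by auto
      then show ?thesis by blast
    qed (use I in auto)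
  next
    fix I assume I: "I \<in> ?A \<union> insert i ` ?B"
    then consider "I \<in> ?A" | J where "J \<in> ?B" "I = insert i J" by blast
    then show "I \<in> {I. I \<subseteq> insert i X \<and> card I = Suc k}"
    proof cases
      case 2
      then have "finite J" "i \<notin> J" using assms finite_subset by auto
      then show ?thesis using 2 by auto
    qed auto
  qed
  have inj: "inj_on (insert i) ?B" using assms(2) by (auto simp: inj_on_def)
  have "(\<Sum>I\<in>insert i ` ?B. \<Prod>j\<in>I. f j) = (\<Sum>I\<in>?B. f i * (\<Prod>j\<in>I. f j))"
  proof (subst sum.reindex[OF inj], intro sum.cong refl)
    fix J assume J: "J \<in> ?B"
    then have "finite J" "i \<notin> J" using assms finite_subset by auto
    then show "((\<lambda>I. prod f I) \<circ> insert i) J = f i * prod f J" by simp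
  qed
  moreover have "?A \<inter> insert i ` ?B = {}" using assms(2) by auto
  ultimately show ?thesis
    unfolding esym_def * using assms(1)
    by (subst sum.union_disjoint) (auto simp: sum_distrib_left)
qed

text \<open>The function of order \<open>Suc k\<close> is affine in the entry \<open>i\<close>, with
  slope \<open>esym k (X - {i}) f\<close>. Index sets vary throughout because such partial
  derivatives delete an index.\<close>

lemma esym_remove:
  assumes "finite X" "i \<in> X"
  shows "esym (Suc k) X f = esym (Suc k) (X - {i}) f + f i * esym k (X - {i}) f"
  using esym_insert[of "X - {i}" i k f] assms by (simp add: insert_absorb)

text \<open>Double counting: a \<open>k\<close>-subset of \<open>X\<close> survives the deletion of
  exactly \<open>card X - k\<close> indices.\<close>

lemma sum_esym_remove:
  assumes "finite X"
  shows "(\<Sum>i\<in>X. esym k (X - {i}) f) = (real (card X) - real k) * esym k X f"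
proof -
  have "(\<Sum>i\<in>X. esym k (X - {i}) f) = (\<Sum>i\<in>X. \<Sum>I | I \<in> {I. I \<subseteq> X \<and> card I = k} \<and> i \<notin> I. prod f I)"
    unfolding esym_def by (intro sum.cong refl) auto
  also have "\<dots> = (\<Sum>I | I \<subseteq> X \<and> card I = k. \<Sum>i | i \<in> X \<and> i \<notin> I. prod f I)"
    using assms by (subst sum.swap_restrict) auto
  also have "\<dots> = (\<Sum>I | I \<subseteq> X \<and> card I = k. (real (card X) - real k) * prod f I)"
  proof (intro sum.cong refl)
    fix I assume I: "I \<in> {I. I \<subseteq> X \<and> card I = k}"
    then have "{i. i \<in> X \<and> i \<notin> I} = X - I" "finite I" "card I \<le> card X"
      using assms by (auto intro: finite_subset card_mono)
    then show "(\<Sum>i | i \<in> X \<and> i \<notin> I. prod f I) = (real (card X) - real k) * prod f I"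
      using I by (simp add: card_Diff_subset of_nat_diff)
  qed
  finally show ?thesis by (simp add: esym_def sum_distrib_left)
qed

text \<open>Euler's identity for a polynomial homogeneous of degree \<open>Suc k\<close>, obtained
  by counting rather than by differentiation.\<close>

lemma sum_mult_esym_remove:
  assumes "finite X"
  shows "(\<Sum>i\<in>X. f i * esym k (X - {i}) f) = real (Suc k) * esym (Suc k) X f"
proof -
  have "(\<Sum>i\<in>X. f i * esym k (X - {i}) f) = (\<Sum>i\<in>X. esym (Suc k) X f - esym (Suc k) (X - {i}) f)"
    using esym_remove[OF assms] by (intro sum.cong refl) (smt (verit))
  also have "\<dots> = real (card X) * esym (Suc k) X f - (real (card X) - real (Suc k)) * esym (Suc k) X f"
    by (simp only: sum_subtractf sum_esym_remove[OF assms]) simp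
  finally show ?thesis by (simp add: algebra_simps)
qed

lemma esym_eq_0: 
  assumes "finite X" "card X < k"
  shows "esym k X f = 0"
proof -
  have "{I. I \<subseteq> X \<and> card I = k} = {}"
  proof -
    have "card I \<le> card X" if "I \<subseteq> X" for I using card_mono[OF assms(1) that] .
    then show ?thesis using assms(2) by (metis (mono_tags, lifting) empty_Collect_eq linorder_not_less)
  qed
  then show ?thesis unfolding esym_def by (simp only: sum.empty)
qed

lemma esym_pos:
  assumes "finite X" "k \<le> card X" "\<And>i. i \<in> X \<Longrightarrow> 0 < f i"
  shows "0 < esym k X f"
  unfolding esym_def
proof (rule sum_pos)
  show "finite {I. I \<subseteq> X \<and> card I = k}" using assms(1) by simp
  show "{I. I \<subseteq> X \<and> card I = k} \<noteq> {}"
    using obtain_subset_with_card_n[OF assms(2)] by blast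
  show "0 < prod f I" if "I \<in> {I. I \<subseteq> X \<and> card I = k}" for I
    using that assms(3) by (intro prod_pos) auto
qed

lemma esym_1: assumes "finite X" shows "esym (Suc 0) X f = (\<Sum>i\<in>X. f i)"
  using sum_mult_esym_remove[OF assms, of f 0] assms by simp

lemma tendsto_esym [tendsto_intros]:
  assumes "finite X" "\<And>i. i \<in> X \<Longrightarrow> ((\<lambda>t. f t i) \<longlongrightarrow> g i) F"
  shows "((\<lambda>t. esym k X (f t)) \<longlongrightarrow> esym k X g) F"
  unfolding esym_def by (intro tendsto_sum tendsto_prod) (use assms in auto)

lemma esym_scale: "esym k X (\<lambda>i. c * f i) = c ^ k * esym k X f"
  unfolding esym_def sum_distrib_left by (intro sum.cong) (auto simp: prod.distrib)

section \<open>The positivity cone and the quotients S_{j+1} / S_j\<close>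

definition esym_cone :: "nat \<Rightarrow> 'a set \<Rightarrow> ('a \<Rightarrow> real) \<Rightarrow> bool" where
  "esym_cone k X f \<longleftrightarrow> (\<forall>j\<le>k. 0 < esym j X f)"

text \<open>These quotients are homogeneous of degree one, so superadditivity amounts to concavity;
  unlike the roots of S_k they are accessible to an induction on the order.\<close>

definition esym_quot :: "nat \<Rightarrow> 'a set \<Rightarrow> ('a \<Rightarrow> real) \<Rightarrow> real" where
  "esym_quot k X f = esym (Suc k) X f / esym k X f"

lemma esym_cone_mono: "esym_cone k X f \<Longrightarrow> j \<le> k \<Longrightarrow> esym_cone j X f"
  by (auto simp: esym_cone_def)

lemma esym_cone_Suc: "esym_cone (Suc k) X f \<longleftrightarrow> esym_cone k X f \<and> 0 < esym (Suc k) X f"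
  by (auto simp: esym_cone_def le_Suc_eq)

lemma esym_cone_card: "finite X \<Longrightarrow> esym_cone k X f \<Longrightarrow> k \<le> card X"
  unfolding esym_cone_def using esym_eq_0[of X k f] by (metis linorder_not_less order_less_irrefl order_refl)

lemma esym_cone_positive:
  "finite X \<Longrightarrow> k \<le> card X \<Longrightarrow> (\<And>i. i \<in> X \<Longrightarrow> 0 < f i) \<Longrightarrow> esym_cone k X f"
  unfolding esym_cone_def by (auto intro: esym_pos)

text \<open>Openness of the cone in the direction of the constant vector; the room gained turns weak
  inequalities into strict ones.\<close>

lemma esym_cone_shift_down:
  assumes "finite X" "esym_cone k X f"
  obtains e where "e > 0" "esym_cone k X (\<lambda>i. f i - e)"
proof -
  have "\<forall>\<^sub>F e in at_right 0. 0 < esym j X (\<lambda>i. f i - e)" if "j \<le> k" for j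
  proof -
    have "((\<lambda>e. esym j X (\<lambda>i. f i - e)) \<longlongrightarrow> esym j X (\<lambda>i. f i - 0)) (at_right 0)"
      by (intro tendsto_intros assms)
    moreover have "0 < esym j X (\<lambda>i. f i - 0)" using assms(2) that by (simp add: esym_cone_def)
    ultimately show ?thesis by (rule order_tendstoD)
  qed
  then have "\<forall>\<^sub>F e in at_right 0. \<forall>j\<in>{..k}. 0 < esym j X (\<lambda>i. f i - e)"
    by (intro eventually_ball_finite) auto
  then have "\<forall>\<^sub>F e in at_right (0::real). e > 0 \<and> esym_cone k X (\<lambda>i. f i - e)"
    by (auto simp: esym_cone_def eventually_at_filter elim!: eventually_mono)
  then obtain e where "e > 0 \<and> esym_cone k X (\<lambda>i. f i - e)"
    by (metis (no_types, lifting) eventually_happens trivial_limit_at_right_real)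
  then show ?thesis using that by blast
qed

text \<open>Euler's identity in degree \<open>k + 2\<close>, with
  \<open>esym (Suc k) (X - {i}) f\<close> eliminated by \<open>esym_remove\<close>. Beside the
  linear term there remain squares divided by
  \<open>esym (Suc k) X f / esym k (X - {i}) f\<close>.\<close>

lemma esym_quot_formula:
  assumes "finite X" "esym_cone (Suc k) X f"
  shows "real (Suc (Suc k)) * esym_quot (Suc k) X f =
    (\<Sum>i\<in>X. f i - (f i)\<^sup>2 * esym k (X - {i}) f / esym (Suc k) X f)"
proof -
  have S: "0 < esym (Suc k) X f" using assms by (simp add: esym_cone_Suc)
  have "real (Suc (Suc k)) * esym_quot (Suc k) X f =
     (\<Sum>i\<in>X. f i * esym (Suc k) (X - {i}) f) / esym (Suc k) X f"
    by (simp only: sum_mult_esym_remove[OF assms(1)] esym_quot_def times_divide_eq_right)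
  also have "\<dots> = (\<Sum>i\<in>X. f i - (f i)\<^sup>2 * esym k (X - {i}) f / esym (Suc k) X f)"
    unfolding sum_divide_distrib
  proof (intro sum.cong refl)
    fix i assume "i \<in> X"
    then have "esym (Suc k) (X - {i}) f = esym (Suc k) X f - f i * esym k (X - {i}) f"
      using esym_remove[OF assms(1)] by (smt (verit))
    then show "f i * esym (Suc k) (X - {i}) f / esym (Suc k) X f
      = f i - (f i)\<^sup>2 * esym k (X - {i}) f / esym (Suc k) X f"
      using S by (simp add: field_simps power2_eq_square distrib_left[symmetric])
  qed
  finally show ?thesis .
qed

text \<open>Quadratic over linear: \<open>a\<^sup>2 / y\<close> is convex and homogeneous of degree
  one, hence subadditive, and it decreases in \<open>y\<close>.\<close>

lemma square_div_superadd:
  fixes a b y z w :: real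
  assumes "y > 0" "z > 0" "w \<ge> y + z"
  shows "(a + b)\<^sup>2 / w \<le> a\<^sup>2 / y + b\<^sup>2 / z"
proof -
  have "(a + b)\<^sup>2 / w \<le> (a + b)\<^sup>2 / (y + z)"
    using assms by (intro divide_left_mono) auto
  also have "\<dots> \<le> a\<^sup>2 / y + b\<^sup>2 / z"
  proof -
    have "a\<^sup>2 / y + b\<^sup>2 / z - (a + b)\<^sup>2 / (y + z) = (a * z - b * y)\<^sup>2 / (y * z * (y + z))"
      using assms by (simp add: divide_simps) (simp add: algebra_simps power2_eq_square)
    also have "\<dots> \<ge> 0" using assms by simp
    finally show ?thesis by simp
  qed
  finally show ?thesis .
qed

text \<open>Induction on \<open>k\<close> after Marcus and Lopes: writing \<open>y\<^sub>i\<close> for the quotient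
  \<open>S\<^sub>k / S\<^sub>k\<^sub>-\<^sub>1\<^sub>;\<^sub>i = f\<^sub>i + S\<^sub>k\<^sub>;\<^sub>i / S\<^sub>k\<^sub>-\<^sub>1\<^sub>;\<^sub>i\<close>, which is superadditive by the induction hypothesis,
  one has \<open>(k+1) S\<^sub>k\<^sub>+\<^sub>1 / S\<^sub>k = \<Sum>\<^sub>i f\<^sub>i - f\<^sub>i\<^sup>2 / y\<^sub>i\<close>.\<close>

lemma esym_cone_step:
  assumes "\<And>j (X :: 'a set) f g. j \<le> k \<Longrightarrow> finite X \<Longrightarrow> esym_cone j X f \<Longrightarrow> esym_cone j X g \<Longrightarrow>
      esym_cone j X (\<lambda>i. f i + g i) \<and>
      esym_quot j X (\<lambda>i. f i + g i) \<ge> esym_quot j X f + esym_quot j X g"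
    and rem: "\<And>j (X :: 'a set) f i. j < k \<Longrightarrow> finite X \<Longrightarrow> i \<in> X \<Longrightarrow> esym_cone (Suc j) X f \<Longrightarrow> esym_cone j (X - {i}) f"
    and X: "finite (X :: 'a set)"
  shows "esym_cone (Suc k) X f \<Longrightarrow> esym_cone (Suc k) X g \<Longrightarrow> esym_cone (Suc k) X (\<lambda>i. f i + g i)"
    and "esym_cone (Suc k) X f \<Longrightarrow> i \<in> X \<Longrightarrow> esym_cone k (X - {i}) f"
    and "esym_cone (Suc k) X f \<Longrightarrow> esym_cone (Suc k) X g \<Longrightarrow>
      esym_quot (Suc k) X (\<lambda>i. f i + g i) \<ge> esym_quot (Suc k) X f + esym_quot (Suc k) X g"
proof -
  \<comment> \<open>Only the sign of the next function is at stake: superadditivity of the quotient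
    keeps it positive.\<close>
  have add: "esym_cone (Suc k) X (\<lambda>i. f i + g i)"
    if f: "esym_cone (Suc k) X f" and g: "esym_cone (Suc k) X g" for f g
  proof -
    have *: "esym_cone k X (\<lambda>i. f i + g i)" "esym_quot k X (\<lambda>i. f i + g i) \<ge> esym_quot k X f + esym_quot k X g"
      using assms(1)[of k X f g] f g X by (auto simp: esym_cone_Suc)
    have "esym_quot k X f > 0" "esym_quot k X g > 0"
      using f g by (auto simp: esym_quot_def esym_cone_def)
    with * have "esym_quot k X (\<lambda>i. f i + g i) > 0" by linarith
    moreover have "esym k X (\<lambda>i. f i + g i) > 0" using * by (auto simp: esym_cone_def)
    ultimately show ?thesis using * by (auto simp: esym_cone_Suc esym_quot_def zero_less_divide_iff)
  qed
  then show "esym_cone (Suc k) X f \<Longrightarrow> esym_cone (Suc k) X g \<Longrightarrow> esym_cone (Suc k) X (\<lambda>i. f i + g i)" .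
  have rm: "esym_cone k (X - {i}) f" if f: "esym_cone (Suc k) X f" and i: "i \<in> X" for f i
  proof (cases k)
    case 0
    then show ?thesis using X by (simp add: esym_cone_def)
  next
    case (Suc l)
    have card: "Suc k \<le> card X" using esym_cone_card[OF X f] .
    obtain e where e: "e > 0" and fe: "esym_cone (Suc k) X (\<lambda>j. f j - e)"
      using esym_cone_shift_down[OF X f] by blast
    obtain e' where e': "e' > 0" and fe': "esym_cone (Suc k) X (\<lambda>j. f j - e - e')"
      using esym_cone_shift_down[OF X fe] by blast
    let ?g = "\<lambda>j. f j - e"
    \<comment> \<open>\<open>esym (Suc k) X\<close> is affine in the entry \<open>i\<close> with
      slope \<open>esym k (X - {i}) ?g\<close>. A negative slope would let it reach zero at the
      increment \<open>s\<close>, although increasing an entry stays in the cone.\<close>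
    have nonneg: "esym k (X - {i}) ?g \<ge> 0"
    proof (rule ccontr)
      assume neg: "\<not> esym k (X - {i}) ?g \<ge> 0"
      define s where "s = - esym (Suc k) X ?g / esym k (X - {i}) ?g"
      have pg: "esym (Suc k) X ?g > 0" using fe by (simp add: esym_cone_Suc)
      have s: "s \<ge> 0" unfolding s_def using neg pg by (simp add: divide_nonneg_neg divide_le_0_iff)
      \<comment> \<open>The second shift \<open>e'\<close> makes the added vector positive in every
        entry, although in total only the entry \<open>i\<close> grows.\<close>
      have "esym_cone (Suc k) X (\<lambda>j. (f j - e - e') + (e' + (if j = i then s else 0)))"
        by (rule add[OF fe']) (rule esym_cone_positive, use X card e' s in auto)
      then have cone: "esym (Suc k) X (\<lambda>j. ?g j + (if j = i then s else 0)) > 0"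
        by (simp add: esym_cone_Suc algebra_simps)
      have off: "esym l (X - {i}) (\<lambda>j. ?g j + (if j = i then s else 0)) = esym l (X - {i}) ?g" for l
        by (rule esym_cong) auto
      then have "esym (Suc k) X (\<lambda>j. ?g j + (if j = i then s else 0))
        = esym (Suc k) (X - {i}) ?g + (?g i + s) * esym k (X - {i}) ?g"
        unfolding esym_remove[OF X i]
        by (simp add: off)
      also have "\<dots> = esym (Suc k) X ?g + s * esym k (X - {i}) ?g"
        unfolding esym_remove[OF X i, of k ?g] by (simp add: algebra_simps)
      also have "\<dots> = 0" unfolding s_def using neg by simp
      finally show False using cone by simp
    qed
    have X': "finite (X - {i})" "k \<le> card (X - {i})" using X i card by auto
    have c1: "esym_cone l (X - {i}) ?g"
      using rem[of l X i ?g] Suc X i fe by (auto simp: esym_cone_Suc)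
    have c2: "esym_cone k (X - {i}) (\<lambda>_. e)" using X' e by (intro esym_cone_positive) auto
    \<comment> \<open>Adding back the first shift \<open>e\<close> upgrades the weak inequality
      \<open>nonneg\<close> to a strict one.\<close>
    have "esym_cone l (X - {i}) (\<lambda>j. ?g j + e) \<and>
      esym_quot l (X - {i}) (\<lambda>j. ?g j + e) \<ge> esym_quot l (X - {i}) ?g + esym_quot l (X - {i}) (\<lambda>_. e)"
      using assms(1)[of l "X - {i}" ?g "\<lambda>_. e"] X' c1 c2 Suc by (auto simp: esym_cone_Suc)
    then have c3: "esym_cone l (X - {i}) f"
      "esym_quot l (X - {i}) f \<ge> esym_quot l (X - {i}) ?g + esym_quot l (X - {i}) (\<lambda>_. e)"
      by auto
    have "esym_quot l (X - {i}) ?g \<ge> 0"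
      using nonneg c1 Suc by (auto simp: esym_quot_def esym_cone_def less_imp_le)
    moreover have "esym_quot l (X - {i}) (\<lambda>_. e) > 0"
      using c2 Suc by (auto simp: esym_quot_def esym_cone_def)
    ultimately have "esym_quot l (X - {i}) f > 0" using c3 by linarith
    then have "esym k (X - {i}) f > 0" using c3(1) Suc
      by (auto simp: esym_quot_def esym_cone_def zero_less_divide_iff dest: spec[of _ l])
    then show ?thesis using c3(1) Suc by (simp add: esym_cone_Suc)
  qed
  then show "esym_cone (Suc k) X f \<Longrightarrow> i \<in> X \<Longrightarrow> esym_cone k (X - {i}) f" .
  show "esym_quot (Suc k) X (\<lambda>i. f i + g i) \<ge> esym_quot (Suc k) X f + esym_quot (Suc k) X g"
    if f: "esym_cone (Suc k) X f" and g: "esym_cone (Suc k) X g"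
  proof -
    define y where "y h i = esym (Suc k) X h / esym k (X - {i}) h" for h i
    let ?h = "\<lambda>i. f i + g i"
    have h: "esym_cone (Suc k) X ?h" using add f g .
    have y_pos: "y u i > 0" if "esym_cone (Suc k) X u" "i \<in> X" for u i
      using rm[OF that] that by (auto simp: y_def esym_cone_def)
    have y_eq: "y u i = u i + esym_quot k (X - {i}) u" if "esym_cone (Suc k) X u" "i \<in> X" for u i
    proof -
      have "esym k (X - {i}) u > 0" using rm[OF that] by (auto simp: esym_cone_def)
      then show ?thesis using esym_remove[OF X that(2), of k u]
        by (simp add: y_def esym_quot_def field_simps)
    qed
    have y_add: "y ?h i \<ge> y f i + y g i" if "i \<in> X" for i
      using y_eq[OF f that] y_eq[OF g that] y_eq[OF h that]
        assms(1)[of k "X - {i}" f g] rm[OF f that] rm[OF g that] X by auto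
    have form: "real (Suc (Suc k)) * esym_quot (Suc k) X u = (\<Sum>i\<in>X. u i - (u i)\<^sup>2 / y u i)"
      if "esym_cone (Suc k) X u" for u
      unfolding esym_quot_formula[OF X that] y_def by simp
    have "real (Suc (Suc k)) * (esym_quot (Suc k) X f + esym_quot (Suc k) X g)
      = (\<Sum>i\<in>X. (f i - (f i)\<^sup>2 / y f i) + (g i - (g i)\<^sup>2 / y g i))"
      unfolding distrib_left form[OF f] form[OF g] by (simp add: sum.distrib)
    also have "\<dots> \<le> (\<Sum>i\<in>X. ?h i - (?h i)\<^sup>2 / y ?h i)"
    proof (rule sum_mono)
      fix i assume i: "i \<in> X"
      show "(f i - (f i)\<^sup>2 / y f i) + (g i - (g i)\<^sup>2 / y g i) \<le> ?h i - (?h i)\<^sup>2 / y ?h i"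
        using square_div_superadd[OF y_pos[OF f i] y_pos[OF g i] y_add[OF i], of "f i" "g i"] by linarith
    qed
    also have "\<dots> = real (Suc (Suc k)) * esym_quot (Suc k) X ?h" unfolding form[OF h] ..
    finally show ?thesis by (rule mult_left_le_imp_le) simp
  qed
qed

text \<open>Joint induction: deleting an index at order \<open>j + 1\<close> relies on
  superadditivity up to order \<open>j\<close>, and superadditivity at order \<open>j + 1\<close>
  relies on that deletion.\<close>

lemma esym_cone_main:
  "(\<forall>j\<le>k. \<forall>(X :: 'a set) f g. finite X \<longrightarrow> esym_cone j X f \<longrightarrow> esym_cone j X g \<longrightarrow>
      esym_cone j X (\<lambda>i. f i + g i) \<and>
      esym_quot j X (\<lambda>i. f i + g i) \<ge> esym_quot j X f + esym_quot j X g) \<and>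
   (\<forall>j<k. \<forall>(X :: 'a set) f i. finite X \<longrightarrow> i \<in> X \<longrightarrow> esym_cone (Suc j) X f \<longrightarrow> esym_cone j (X - {i}) f)"
proof (induction k)
  case 0
  then show ?case by (auto simp: esym_cone_def esym_quot_def esym_1 sum.distrib)
next
  case (Suc k)
  note step = esym_cone_step[where ?'a = 'a and k = k]
  show ?case
  proof (intro conjI allI impI)
    fix j f g and X :: "'a set"
    assume j: "j \<le> Suc k" and X: "finite X" and f: "esym_cone j X f" and g: "esym_cone j X g"
    show "esym_cone j X (\<lambda>i. f i + g i)"
    proof (cases "j = Suc k")
      case True
      show ?thesis using step(1)[of X f g] Suc X f g unfolding True by blast
    qed (use Suc X f g j in auto)
    show "esym_quot j X f + esym_quot j X g \<le> esym_quot j X (\<lambda>i. f i + g i)"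
    proof (cases "j = Suc k")
      case True
      show ?thesis using step(3)[of X f g] Suc X f g unfolding True by blast
    qed (use Suc X f g j in auto)
  next
    fix j f i and X :: "'a set"
    assume j: "j < Suc k" and X: "finite X" "i \<in> X" and f: "esym_cone (Suc j) X f"
    show "esym_cone j (X - {i}) f"
    proof (cases "j = k")
      case True
      show ?thesis using step(2)[of X f i] Suc X f unfolding True by blast
    qed (use Suc X f j in auto)
  qed
qed

section \<open>Inequalities on the cone\<close>

lemma esym_cone_add:
  "finite X \<Longrightarrow> esym_cone k X f \<Longrightarrow> esym_cone k X g \<Longrightarrow> esym_cone k X (\<lambda>i. f i + g i)"
  using esym_cone_main by blast

lemma esym_quot_superadd:
  "finite X \<Longrightarrow> esym_cone k X f \<Longrightarrow> esym_cone k X g \<Longrightarrow>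
    esym_quot k X f + esym_quot k X g \<le> esym_quot k X (\<lambda>i. f i + g i)"
  using esym_cone_main by blast

lemma esym_cone_remove:
  "finite X \<Longrightarrow> i \<in> X \<Longrightarrow> esym_cone (Suc k) X f \<Longrightarrow> esym_cone k (X - {i}) f"
  using esym_cone_main[of "Suc k"] by blast

lemma esym_cone_scale: "c > 0 \<Longrightarrow> esym_cone k X (\<lambda>i. c * f i) \<longleftrightarrow> esym_cone k X f"
  by (simp add: esym_cone_def esym_scale zero_less_mult_iff)

lemma esym_quot_scale: "c > 0 \<Longrightarrow> esym_quot k X (\<lambda>i. c * f i) = c * esym_quot k X f"
  by (simp add: esym_quot_def esym_scale)

text \<open>The squares in \<open>esym_quot_formula\<close> are dropped. The resulting non-strict
  inequality survives the passage to the closure of the cone, where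
  \<open>Gamma_cone_interior\<close> uses it.\<close>

lemma esym_Suc_le:
  assumes "finite X" "esym_cone k X f"
  shows "real (Suc k) * esym (Suc k) X f \<le> (\<Sum>i\<in>X. f i) * esym k X f"
proof (cases k)
  case 0
  then show ?thesis using assms by (simp add: esym_1)
next
  case (Suc l)
  have pos: "esym k X f > 0" using assms by (simp add: esym_cone_def)
  have "real (Suc k) * esym_quot k X f \<le> (\<Sum>i\<in>X. f i)"
    unfolding Suc
  proof (subst esym_quot_formula, goal_cases)
    case 3
    show ?case
    proof (rule sum_mono)
      fix i assume "i \<in> X"
      then have "esym l (X - {i}) f > 0" using esym_cone_remove[of X i l f] assms Suc
        by (auto simp: esym_cone_def)
      then show "f i - (f i)\<^sup>2 * esym l (X - {i}) f / esym (Suc l) X f \<le> f i"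
        using pos Suc by simp
    qed
  qed (use assms Suc in auto)
  then show ?thesis using pos by (simp add: esym_quot_def field_simps)
qed

text \<open>\<open>esym j\<close> is the product of the quotients of lower order, and each of them
  grows by superadditivity.\<close>

lemma esym_mono_add:
  assumes X: "finite X" and f: "esym_cone k X f" and g: "esym_cone k X g" and "j \<le> k"
  shows "esym j X f \<le> esym j X (\<lambda>i. f i + g i)"
  using \<open>j \<le> k\<close>
proof (induction j)
  case 0
  then show ?case using X by simp
next
  case (Suc j)
  have h: "esym_cone k X (\<lambda>i. f i + g i)" using esym_cone_add assms by blast
  have pos: "esym j X f > 0" "esym j X g > 0" "esym j X (\<lambda>i. f i + g i) > 0"
    "esym (Suc j) X f > 0" "esym (Suc j) X g > 0"
    using f g h Suc.prems by (auto simp: esym_cone_def)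
  have "esym_quot j X f + esym_quot j X g \<le> esym_quot j X (\<lambda>i. f i + g i)"
    using Suc.prems X f g esym_cone_mono by (intro esym_quot_superadd) (auto intro: esym_cone_mono)
  moreover have "0 < esym_quot j X f" "0 < esym_quot j X g" using pos by (auto simp: esym_quot_def)
  ultimately have "esym_quot j X f * esym j X f \<le> esym_quot j X (\<lambda>i. f i + g i) * esym j X (\<lambda>i. f i + g i)"
    using Suc pos by (intro mult_mono) auto
  then show ?case using pos by (simp add: esym_quot_def)
qed

text \<open>If deleting \<open>m\<close> leaves a nonpositive function of the same order, the single
  term \<open>f m * esym k (X - {m}) f\<close> is at least the whole. Otherwise
  \<open>f i * esym k (X - {i}) f\<close> is largest at \<open>m\<close>, and Euler's identity
  compares the sum of these terms with \<open>card X\<close> copies of that one.\<close>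

lemma esym_max_weight:
  assumes X: "finite X" and f: "esym_cone (Suc k) X f" and m: "m \<in> X" and max: "\<And>i. i \<in> X \<Longrightarrow> f i \<le> f m"
  shows "real (Suc k) * esym (Suc k) X f \<le> real (card X) * (f m * esym k (X - {m}) f)"
proof -
  have S: "esym (Suc k) X f = esym (Suc k) (X - {m}) f + f m * esym k (X - {m}) f"
    using esym_remove[OF X m] .
  have pos: "esym (Suc k) X f > 0" using f by (simp add: esym_cone_Suc)
  have card: "Suc k \<le> card X" using esym_cone_card[OF X f] .
  show ?thesis
  proof (cases "esym (Suc k) (X - {m}) f > 0")
    case False
    then have "esym (Suc k) X f \<le> f m * esym k (X - {m}) f" using S by linarith
    then show ?thesis using pos card by (intro mult_mono) auto
  next
    case True
    then have c: "esym_cone (Suc k) (X - {m}) f"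
      using esym_cone_remove[OF X m f] by (simp add: esym_cone_Suc)
    have "f i * esym k (X - {i}) f \<le> f m * esym k (X - {m}) f" if i: "i \<in> X" for i
    proof (cases "i = m")
      case False
      have "esym_cone k (X - {m} - {i}) f" using c i X False by (intro esym_cone_remove[of "X - {m}"]) auto
      then have p: "esym k (X - {m} - {i}) f > 0" by (simp add: esym_cone_def)
      have 1: "esym (Suc k) (X - {m}) f = esym (Suc k) (X - {m} - {i}) f + f i * esym k (X - {m} - {i}) f"
        using X i False by (intro esym_remove) auto
      have 2: "esym (Suc k) (X - {i}) f = esym (Suc k) (X - {m} - {i}) f + f m * esym k (X - {m} - {i}) f"
        using X m False esym_remove[of "X - {i}" m k f] by (simp add: Diff_insert2[symmetric] insert_commute)
      have "f m * esym k (X - {m}) f - f i * esym k (X - {i}) f = (f m - f i) * esym k (X - {m} - {i}) f"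
        using S esym_remove[OF X i, of k f] 1 2 by (simp add: algebra_simps)
      also have "\<dots> \<ge> 0" using max[OF i] p by simp
      finally show ?thesis by linarith
    qed simp
    then have "(\<Sum>i\<in>X. f i * esym k (X - {i}) f) \<le> real (card X) * (f m * esym k (X - {m}) f)"
      by (rule sum_bounded_above)
    then show ?thesis using sum_mult_esym_remove[OF X, of f k] by simp
  qed
qed

section \<open>Second-order jets and concavity\<close>

text \<open>Second-order jet at \<open>0\<close> in relational form: jets of composite expressions
  are assembled by introduction rules, without ever naming the derivative function.\<close>

definition J2 :: "(real \<Rightarrow> real) \<Rightarrow> real \<Rightarrow> real \<Rightarrow> real \<Rightarrow> bool" where
  "J2 f a b c \<longleftrightarrow> f 0 = a \<and> (\<exists>g. (\<forall>\<^sub>F t in nhds 0. (f has_real_derivative g t) (at t)) \<and>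
     g 0 = b \<and> (g has_real_derivative c) (at 0))"

lemma J2_I:
  "f 0 = a \<Longrightarrow> \<forall>\<^sub>F t in nhds 0. (f has_real_derivative g t) (at t) \<Longrightarrow> g 0 = b \<Longrightarrow>
    (g has_real_derivative c) (at 0) \<Longrightarrow> J2 f a b c"
  unfolding J2_def by blast

lemma J2_E:
  assumes "J2 f a b c"
  obtains g where "f 0 = a" "\<forall>\<^sub>F t in nhds 0. (f has_real_derivative g t) (at t)" "g 0 = b"
    "(g has_real_derivative c) (at 0)"
  using assms unfolding J2_def by blast

lemma J2_value: "J2 f a b c \<Longrightarrow> f 0 = a"
  by (simp add: J2_def)

lemma J2_DERIV: "J2 f a b c \<Longrightarrow> (f has_real_derivative b) (at 0)"
  unfolding J2_def using eventually_nhds_x_imp_x by blast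

lemma J2_continuous: "J2 f a b c \<Longrightarrow> isCont f 0"
  using J2_DERIV DERIV_isCont by blast

lemma J2_cong_ev:
  assumes "J2 f a b c" "\<forall>\<^sub>F t in nhds 0. f t = g t"
  shows "J2 g a b c"
proof -
  obtain d where d: "f 0 = a" "\<forall>\<^sub>F t in nhds 0. (f has_real_derivative d t) (at t)" "d 0 = b"
    "(d has_real_derivative c) (at 0)" using J2_E[OF assms(1)] by blast
  have "\<forall>\<^sub>F t in nhds 0. \<forall>\<^sub>F s in nhds t. f s = g s"
    using assms(2) by (simp add: eventually_eventually)
  with d(2) have "\<forall>\<^sub>F t in nhds 0. (g has_real_derivative d t) (at t)"
    by eventually_elim (auto intro: DERIV_cong_ev[THEN iffD1, rotated -1])
  moreover have "g 0 = a" using eventually_nhds_x_imp_x[OF assms(2)] d(1) by simp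
  ultimately show ?thesis using d by (intro J2_I) auto
qed

text \<open>Comparing jets of one function computed in two ways is how the equation is
  differentiated later.\<close>

lemma J2_unique:
  assumes "J2 f a b c" "J2 f a' b' c'"
  shows "a = a'" "b = b'" "c = c'"
proof -
  obtain d where d: "f 0 = a" "\<forall>\<^sub>F t in nhds 0. (f has_real_derivative d t) (at t)" "d 0 = b"
    "(d has_real_derivative c) (at 0)" using J2_E[OF assms(1)] by blast
  obtain e where e: "f 0 = a'" "\<forall>\<^sub>F t in nhds 0. (f has_real_derivative e t) (at t)" "e 0 = b'"
    "(e has_real_derivative c') (at 0)" using J2_E[OF assms(2)] by blast
  have ev: "\<forall>\<^sub>F t in nhds 0. d t = e t" using d(2) e(2) by eventually_elim (rule DERIV_unique)
  then have "(e has_real_derivative c) (at 0)" using d(4) DERIV_cong_ev by blast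
  then show "c = c'" using e(4) DERIV_unique by blast
  show "a = a'" using d e by simp
  show "b = b'" using eventually_nhds_x_imp_x[OF ev] d e by simp
qed

lemma J2_const: "J2 (\<lambda>t. k) k 0 0"
  by (rule J2_I[where g = "\<lambda>_. 0"]) (auto intro!: always_eventually derivative_eq_intros)

lemma J2_affine: "J2 (\<lambda>t. a + t * b) a b 0"
  by (rule J2_I[where g = "\<lambda>_. b"]) (auto intro!: always_eventually derivative_eq_intros)

lemma J2_add:
  assumes "J2 f a b c" "J2 g a' b' c'"
  shows "J2 (\<lambda>t. f t + g t) (a + a') (b + b') (c + c')"
proof -
  obtain d where d: "f 0 = a" "\<forall>\<^sub>F t in nhds 0. (f has_real_derivative d t) (at t)" "d 0 = b"
    "(d has_real_derivative c) (at 0)" using J2_E[OF assms(1)] by blast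
  obtain e where e: "g 0 = a'" "\<forall>\<^sub>F t in nhds 0. (g has_real_derivative e t) (at t)" "e 0 = b'"
    "(e has_real_derivative c') (at 0)" using J2_E[OF assms(2)] by blast
  show ?thesis
  proof (rule J2_I[where g = "\<lambda>t. d t + e t"])
    show "\<forall>\<^sub>F t in nhds 0. ((\<lambda>t. f t + g t) has_real_derivative d t + e t) (at t)"
      using d(2) e(2) by eventually_elim (rule DERIV_add)
  qed (use d e in \<open>auto intro: DERIV_add\<close>)
qed

lemma J2_mult:
  assumes "J2 f a b c" "J2 g a' b' c'"
  shows "J2 (\<lambda>t. f t * g t) (a * a') (a * b' + b * a') (a * c' + 2 * (b * b') + c * a')"
proof -
  obtain d where d: "f 0 = a" "\<forall>\<^sub>F t in nhds 0. (f has_real_derivative d t) (at t)" "d 0 = b"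
    "(d has_real_derivative c) (at 0)" using J2_E[OF assms(1)] by blast
  obtain e where e: "g 0 = a'" "\<forall>\<^sub>F t in nhds 0. (g has_real_derivative e t) (at t)" "e 0 = b'"
    "(e has_real_derivative c') (at 0)" using J2_E[OF assms(2)] by blast
  note D = J2_DERIV[OF assms(1)] J2_DERIV[OF assms(2)]
  show ?thesis
  proof (rule J2_I[where g = "\<lambda>t. f t * e t + d t * g t"])
    show "\<forall>\<^sub>F t in nhds 0. ((\<lambda>t. f t * g t) has_real_derivative f t * e t + d t * g t) (at t)"
      using d(2) e(2) by eventually_elim (auto intro!: derivative_eq_intros)
    show "((\<lambda>t. f t * e t + d t * g t) has_real_derivative a * c' + 2 * (b * b') + c * a') (at 0)"
      by (rule derivative_eq_intros d e D refl)+ (simp add: d e algebra_simps)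
  qed (use d e in auto)
qed

lemma J2_cmult: "J2 f a b c \<Longrightarrow> J2 (\<lambda>t. k * f t) (k * a) (k * b) (k * c)"
  using J2_mult[OF J2_const, of f a b c k] by simp

lemma J2_minus: "J2 f a b c \<Longrightarrow> J2 (\<lambda>t. - f t) (- a) (- b) (- c)"
  using J2_cmult[of f a b c "-1"] by simp

lemma J2_diff: "J2 f a b c \<Longrightarrow> J2 g a' b' c' \<Longrightarrow> J2 (\<lambda>t. f t - g t) (a - a') (b - b') (c - c')"
  using J2_add[OF _ J2_minus, of f a b c g a' b' c'] by simp

lemma J2_sum:
  assumes "\<And>i. i \<in> X \<Longrightarrow> J2 (f i) (a i) (b i) (c i)"
  shows "J2 (\<lambda>t. \<Sum>i\<in>X. f i t) (\<Sum>i\<in>X. a i) (\<Sum>i\<in>X. b i) (\<Sum>i\<in>X. c i)"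
  using assms by (induction X rule: infinite_finite_induct) (auto intro: J2_const J2_add)

lemma J2_prod:
  assumes "finite X" "\<And>i. i \<in> X \<Longrightarrow> J2 (f i) (a i) (b i) (c i)"
  shows "J2 (\<lambda>t. \<Prod>i\<in>X. f i t) (\<Prod>i\<in>X. a i) (\<Sum>i\<in>X. b i * (\<Prod>j\<in>X - {i}. a j))
    ((\<Sum>i\<in>X. c i * (\<Prod>j\<in>X - {i}. a j)) + (\<Sum>i\<in>X. \<Sum>l\<in>X - {i}. b i * b l * (\<Prod>j\<in>X - {i} - {l}. a j)))"
proof -
  have "\<exists>d. \<forall>i\<in>X. f i 0 = a i \<and> (\<forall>\<^sub>F t in nhds 0. (f i has_real_derivative d i t) (at t)) \<and> d i 0 = b i \<and>
    (d i has_real_derivative c i) (at 0)"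
    by (rule bchoice) (use assms(2) J2_def in blast)
  then obtain d where d: "\<And>i. i \<in> X \<Longrightarrow> f i 0 = a i"
    "\<And>i. i \<in> X \<Longrightarrow> \<forall>\<^sub>F t in nhds 0. (f i has_real_derivative d i t) (at t)"
    "\<And>i. i \<in> X \<Longrightarrow> d i 0 = b i" "\<And>i. i \<in> X \<Longrightarrow> (d i has_real_derivative c i) (at 0)"
    by blast
  show ?thesis
  proof (rule J2_I[where g = "\<lambda>t. \<Sum>i\<in>X. d i t * (\<Prod>j\<in>X - {i}. f j t)"])
    have "\<forall>\<^sub>F t in nhds 0. \<forall>i\<in>X. (f i has_real_derivative d i t) (at t)"
      using assms(1) d(2) by (intro eventually_ball_finite) auto
    then show "\<forall>\<^sub>F t in nhds 0. ((\<lambda>t. \<Prod>i\<in>X. f i t) has_real_derivative (\<Sum>i\<in>X. d i t * (\<Prod>j\<in>X - {i}. f j t))) (at t)"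
      by eventually_elim (rule has_field_derivative_prod, auto)
    have "((\<lambda>t. \<Sum>i\<in>X. d i t * (\<Prod>j\<in>X - {i}. f j t)) has_real_derivative
        (\<Sum>i\<in>X. d i 0 * (\<Sum>l\<in>X - {i}. b l * (\<Prod>j\<in>X - {i} - {l}. f j 0)) + c i * (\<Prod>j\<in>X - {i}. f j 0))) (at 0)"
    proof (rule DERIV_sum)
      fix i assume i: "i \<in> X"
      have "((\<lambda>t. \<Prod>j\<in>X - {i}. f j t) has_real_derivative (\<Sum>l\<in>X - {i}. b l * (\<Prod>j\<in>X - {i} - {l}. f j 0))) (at 0)"
        by (rule has_field_derivative_prod) (blast intro: J2_DERIV assms(2))
      from DERIV_mult'[OF d(4)[OF i] this]
      show "((\<lambda>t. d i t * (\<Prod>j\<in>X - {i}. f j t)) has_real_derivative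
        d i 0 * (\<Sum>l\<in>X - {i}. b l * (\<Prod>j\<in>X - {i} - {l}. f j 0)) + c i * (\<Prod>j\<in>X - {i}. f j 0)) (at 0)" .
    qed
    also have "(\<Sum>i\<in>X. d i 0 * (\<Sum>l\<in>X - {i}. b l * (\<Prod>j\<in>X - {i} - {l}. f j 0)) + c i * (\<Prod>j\<in>X - {i}. f j 0))
      = (\<Sum>i\<in>X. b i * (\<Sum>l\<in>X - {i}. b l * (\<Prod>j\<in>X - {i} - {l}. a j)) + c i * (\<Prod>j\<in>X - {i}. a j))"
      using d(1,3) by (intro sum.cong arg_cong2[where f = "(+)"] arg_cong2[where f = "(*)"] prod.cong refl) auto
    finally show "((\<lambda>t. \<Sum>i\<in>X. d i t * (\<Prod>j\<in>X - {i}. f j t)) has_real_derivative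
      (\<Sum>i\<in>X. c i * (\<Prod>j\<in>X - {i}. a j)) + (\<Sum>i\<in>X. \<Sum>l\<in>X - {i}. b i * b l * (\<Prod>j\<in>X - {i} - {l}. a j))) (at 0)"
      by (simp add: sum.distrib sum_distrib_left mult.assoc add.commute)
  qed (use d in \<open>auto intro!: prod.cong sum.cong\<close>)
qed

lemma J2_compose:
  assumes "J2 f a b c" and F: "\<forall>\<^sub>F x in nhds a. (F has_real_derivative F' x) (at x)"
    and F': "(F' has_real_derivative F2) (at a)"
  shows "J2 (\<lambda>t. F (f t)) (F a) (F' a * b) (F2 * b\<^sup>2 + F' a * c)"
proof -
  obtain d where d: "f 0 = a" "\<forall>\<^sub>F t in nhds 0. (f has_real_derivative d t) (at t)" "d 0 = b"
    "(d has_real_derivative c) (at 0)" using J2_E[OF assms(1)] by blast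
  have D: "(f has_real_derivative b) (at 0)" using J2_DERIV[OF assms(1)] .
  have "(f \<longlongrightarrow> a) (nhds 0)"
    using J2_continuous[OF assms(1)] d(1) tendsto_at_iff_tendsto_nhds[of f 0] by (simp add: isCont_def)
  then have "\<forall>\<^sub>F t in nhds 0. (F has_real_derivative F' (f t)) (at (f t))"
    by (rule eventually_compose_filterlim[OF F])
  with d(2) have ev: "\<forall>\<^sub>F t in nhds 0. ((\<lambda>t. F (f t)) has_real_derivative F' (f t) * d t) (at t)"
    by eventually_elim (rule DERIV_chain2)
  show ?thesis
  proof (rule J2_I[OF _ ev])
    have "(F' has_real_derivative F2) (at (f 0))" using F' d by simp
    from DERIV_mult'[OF DERIV_chain2[OF this D] d(4)]
    show "((\<lambda>t. F' (f t) * d t) has_real_derivative F2 * b\<^sup>2 + F' a * c) (at 0)"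
      by (simp add: d power2_eq_square algebra_simps)
  qed (use d in auto)
qed

lemma J2_reflect: "J2 f a b c \<Longrightarrow> J2 (\<lambda>t. f (- t)) a (- b) c"
proof -
  assume "J2 f a b c"
  then obtain d where d: "f 0 = a" "\<forall>\<^sub>F t in nhds 0. (f has_real_derivative d t) (at t)" "d 0 = b"
    "(d has_real_derivative c) (at 0)" by (rule J2_E)
  have "filterlim uminus (nhds 0) (nhds (0::real))"
    using tendsto_minus[OF filterlim_ident, of "0::real"] by simp
  then have "\<forall>\<^sub>F t in nhds 0. (f has_real_derivative d (- t)) (at (- t))"
    by (rule eventually_compose_filterlim[OF d(2)])
  then have "\<forall>\<^sub>F t in nhds 0. ((\<lambda>t. f (- t)) has_real_derivative - d (- t)) (at t)"
  proof eventually_elim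
    case (elim t)
    from DERIV_chain2[where f = f and g = uminus, OF elim DERIV_minus[OF DERIV_ident]] show ?case by simp
  qed
  moreover have "((\<lambda>t. - d (- t)) has_real_derivative c) (at 0)"
  proof -
    have "(d has_real_derivative c) (at (- 0))" using d by simp
    from DERIV_chain2[where f = d and g = uminus, OF this DERIV_minus[OF DERIV_ident]]
    have "((\<lambda>t. d (- t)) has_real_derivative - c) (at 0)" by simp
    from DERIV_minus[OF this] show ?thesis by simp
  qed
  ultimately show ?thesis using d by (intro J2_I[where g = "\<lambda>t. - d (- t)"]) auto
qed

lemma J2_local_max:
  assumes J: "J2 f a b c" and max: "\<forall>\<^sub>F t in nhds 0. f t \<le> a"
  shows "b = 0" "c \<le> 0"
proof -
  obtain d where d: "f 0 = a" "\<forall>\<^sub>F t in nhds 0. (f has_real_derivative d t) (at t)" "d 0 = b"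
    "(d has_real_derivative c) (at 0)" using J2_E[OF J] by blast
  obtain e where e: "e > 0" "\<And>t. \<bar>t\<bar> < e \<Longrightarrow> (f has_real_derivative d t) (at t) \<and> f t \<le> a"
    using eventually_conj[OF d(2) max] unfolding eventually_nhds_metric by (auto simp: dist_real_def)
  show b: "b = 0"
    by (rule DERIV_local_max[OF J2_DERIV[OF J] e(1)]) (use e d in auto)
  show "c \<le> 0"
  proof (rule ccontr)
    assume "\<not> c \<le> 0"
    then have "c > 0" by simp
    from DERIV_pos_inc_right[OF d(4) this] obtain r where r: "r > 0" "\<And>h. 0 < h \<Longrightarrow> h < r \<Longrightarrow> d 0 < d h" by auto
    define s where "s = min e r / 2"
    have s: "0 < s" "s < e" "s < r" using e(1) r(1) by (auto simp: s_def min_def)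
    have "f 0 < f s"
    proof (rule DERIV_pos_imp_increasing_open[OF s(1)])
      show "\<exists>y. DERIV f x :> y \<and> 0 < y" if "0 < x" "x < s" for x
        using e(2)[of x] r(2)[of x] that s d(3) b by auto
      show "continuous_on {0..s} f"
      proof (intro continuous_at_imp_continuous_on ballI)
        fix x assume "x \<in> {0..s}"
        then have "\<bar>x\<bar> < e" using s by auto
        then show "isCont f x" using e(2) DERIV_isCont by blast
      qed
    qed
    then show False using e(2)[of s] s d(1) by auto
  qed
qed

section \<open>Jets of elementary symmetric functions\<close>

lemma sum_subsets_remove:
  assumes "finite X"
  shows "(\<Sum>I | I \<subseteq> X \<and> card I = Suc k. \<Sum>i\<in>I. G i (I - {i})) =
    (\<Sum>i\<in>X. \<Sum>J | J \<subseteq> X - {i} \<and> card J = k. G i J)"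
proof -
  have fin: "finite I" if "I \<subseteq> X" for I using that assms finite_subset by blast
  have "(\<Sum>I | I \<subseteq> X \<and> card I = Suc k. \<Sum>i\<in>I. G i (I - {i})) =
    (\<Sum>(I, i)\<in>Sigma {I. I \<subseteq> X \<and> card I = Suc k} (\<lambda>I. I). G i (I - {i}))"
    by (subst sum.Sigma) (use assms fin in auto)
  also have "\<dots> = (\<Sum>(i, J)\<in>Sigma X (\<lambda>i. {J. J \<subseteq> X - {i} \<and> card J = k}). G i J)"
    by (rule sum.reindex_bij_witness[where j = "\<lambda>(I, i). (i, I - {i})" and i = "\<lambda>(i, J). (insert i J, i)"])
      (use fin in \<open>auto simp: insert_absorb\<close>, (subst card_insert_disjoint; auto)+)
  also have "\<dots> = (\<Sum>i\<in>X. \<Sum>J | J \<subseteq> X - {i} \<and> card J = k. G i J)"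
    by (subst sum.Sigma) (use assms in auto)
  finally show ?thesis .
qed

text \<open>S_{k-1} with the convention S_{-1} = 0. Over an index set with two indices deleted it is
  a mixed second derivative of \<open>esym (Suc k)\<close>, which vanishes for
  \<open>k = 0\<close>.\<close>

definition esym_pred :: "nat \<Rightarrow> 'a set \<Rightarrow> ('a \<Rightarrow> real) \<Rightarrow> real" where
  "esym_pred k X f = (case k of 0 \<Rightarrow> 0 | Suc j \<Rightarrow> esym j X f)"

lemma sum_subsets_remove1:
  assumes "finite X"
  shows "(\<Sum>I | I \<subseteq> X \<and> card I = Suc k. \<Sum>i\<in>I. c i * (\<Prod>j\<in>I - {i}. a j)) = (\<Sum>i\<in>X. c i * esym k (X - {i}) a)"
  unfolding sum_subsets_remove[OF assms, where G = "\<lambda>i J. c i * (\<Prod>j\<in>J. a j)"] esym_def sum_distrib_left ..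

lemma sum_subsets_remove2:
  assumes "finite X"
  shows "(\<Sum>I | I \<subseteq> X \<and> card I = Suc k. \<Sum>i\<in>I. \<Sum>l\<in>I - {i}. c i l * (\<Prod>j\<in>I - {i} - {l}. a j)) =
    (\<Sum>i\<in>X. \<Sum>l\<in>X - {i}. c i l * esym_pred k (X - {i} - {l}) a)"
proof -
  have "(\<Sum>I | I \<subseteq> X \<and> card I = Suc k. \<Sum>i\<in>I. \<Sum>l\<in>I - {i}. c i l * (\<Prod>j\<in>I - {i} - {l}. a j)) =
    (\<Sum>i\<in>X. \<Sum>J | J \<subseteq> X - {i} \<and> card J = k. \<Sum>l\<in>J. c i l * (\<Prod>j\<in>J - {l}. a j))"
    by (rule sum_subsets_remove[OF assms, where G = "\<lambda>i J. \<Sum>l\<in>J. c i l * (\<Prod>j\<in>J - {l}. a j)"])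
  also have "\<dots> = (\<Sum>i\<in>X. \<Sum>l\<in>X - {i}. c i l * esym_pred k (X - {i} - {l}) a)"
  proof (intro sum.cong refl)
    fix i
    show "(\<Sum>J | J \<subseteq> X - {i} \<and> card J = k. \<Sum>l\<in>J. c i l * (\<Prod>j\<in>J - {l}. a j)) =
      (\<Sum>l\<in>X - {i}. c i l * esym_pred k (X - {i} - {l}) a)"
    proof (cases k)
      case 0
      have "J = {}" if "J \<subseteq> X - {i}" "card J = 0" for J
        using that assms by (metis card_0_eq finite_Diff finite_subset)
      then show ?thesis unfolding 0 by (auto simp: esym_pred_def intro!: sum.neutral)
    next
      case (Suc j)
      show ?thesis unfolding Suc esym_pred_def using sum_subsets_remove1[of "X - {i}" "c i" a j] assms by simp
    qed
  qed
  finally show ?thesis .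
qed

lemma J2_esym:
  assumes "finite X" "\<And>i. i \<in> X \<Longrightarrow> J2 (f i) (a i) (b i) (c i)"
  shows "J2 (\<lambda>t. esym (Suc k) X (\<lambda>i. f i t)) (esym (Suc k) X a) (\<Sum>i\<in>X. b i * esym k (X - {i}) a)
    ((\<Sum>i\<in>X. c i * esym k (X - {i}) a) + (\<Sum>i\<in>X. \<Sum>l\<in>X - {i}. b i * b l * esym_pred k (X - {i} - {l}) a))"
proof -
  have "J2 (\<lambda>t. \<Sum>I | I \<subseteq> X \<and> card I = Suc k. \<Prod>i\<in>I. f i t) (\<Sum>I | I \<subseteq> X \<and> card I = Suc k. prod a I)
    (\<Sum>I | I \<subseteq> X \<and> card I = Suc k. \<Sum>i\<in>I. b i * prod a (I - {i}))
    (\<Sum>I | I \<subseteq> X \<and> card I = Suc k. (\<Sum>i\<in>I. c i * prod a (I - {i})) +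
      (\<Sum>i\<in>I. \<Sum>l\<in>I - {i}. b i * b l * prod a (I - {i} - {l})))"
  proof (rule J2_sum, rule J2_prod)
    fix I assume I: "I \<in> {I. I \<subseteq> X \<and> card I = Suc k}"
    then show "finite I" using assms(1) finite_subset by auto
    show "J2 (f i) (a i) (b i) (c i)" if "i \<in> I" for i using that I assms(2) by auto
  qed
  then show ?thesis
    unfolding esym_def[of "Suc k"] sum.distrib sum_subsets_remove1[OF assms(1)] sum_subsets_remove2[OF assms(1)] .
qed

lemma eventually_esym_cone:
  assumes "finite X" "esym_cone k X (\<lambda>i. f i 0)" "\<And>i. i \<in> X \<Longrightarrow> isCont (f i) (0::real)"
  shows "\<forall>\<^sub>F t in nhds 0. esym_cone k X (\<lambda>i. f i t)"
proof -
  have "\<forall>\<^sub>F t in nhds 0. 0 < esym j X (\<lambda>i. f i t)" if "j \<le> k" for j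
  proof -
    have "((\<lambda>t. esym j X (\<lambda>i. f i t)) \<longlongrightarrow> esym j X (\<lambda>i. f i 0)) (nhds 0)"
      using assms(3) by (intro tendsto_esym assms(1)) (simp add: continuous_at tendsto_at_iff_tendsto_nhds)
    moreover have "0 < esym j X (\<lambda>i. f i 0)" using assms(2) that by (simp add: esym_cone_def)
    ultimately show ?thesis by (rule order_tendstoD)
  qed
  then have "\<forall>\<^sub>F e in nhds 0. \<forall>j\<in>{..k}. 0 < esym j X (\<lambda>i. f i e)"
    by (intro eventually_ball_finite) auto
  then show ?thesis by (auto simp: esym_cone_def elim!: eventually_mono)
qed

text \<open>The concavity of \<open>S\<^sub>k\<^sup>1\<^sup>/\<^sup>k\<close> in differential form, obtained from that of the quotients.\<close>

lemma esym_concave: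
  assumes X: "finite X"
  shows "esym_cone (Suc k) X a \<Longrightarrow>
    real (Suc k) * (\<Sum>i\<in>X. \<Sum>l\<in>X - {i}. b i * b l * esym_pred k (X - {i} - {l}) a) * esym (Suc k) X a
    \<le> real k * (\<Sum>i\<in>X. b i * esym k (X - {i}) a)\<^sup>2"
proof (induction k)
  case 0
  then show ?case by (simp add: esym_pred_def)
next
  case (Suc k)
  define D1 where "D1 k = (\<Sum>i\<in>X. b i * esym k (X - {i}) a)" for k
  define D2 where "D2 k = (\<Sum>i\<in>X. \<Sum>l\<in>X - {i}. b i * b l * esym_pred k (X - {i} - {l}) a)" for k
  define F where "F k t = esym k X (\<lambda>i. a i + t * b i)" for k t
  have J: "J2 (F (Suc k)) (esym (Suc k) X a) (D1 k) (D2 k)" for k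
    using J2_esym[OF X, of "\<lambda>i t. a i + t * b i" a b "\<lambda>_. 0" k] J2_affine
    by (simp add: F_def[abs_def] D1_def D2_def)
  define N P where "N = esym (Suc (Suc k)) X a" and "P = esym (Suc k) X a"
  have pos: "N > 0" "P > 0" and cone: "esym_cone (Suc k) X a"
    using Suc.prems by (auto simp: N_def P_def esym_cone_Suc)
  \<comment> \<open>The quotient along the line through \<open>a\<close> in direction
    \<open>b\<close>; its second derivative \<open>q2\<close> at \<open>0\<close> is what
    superadditivity controls.\<close>
  define q where "q t = F (Suc (Suc k)) t * inverse (F (Suc k) t)" for t
  have inv: "J2 (\<lambda>t. inverse (F (Suc k) t)) (inverse P) (- (1 / P\<^sup>2) * D1 k)
    (2 / P ^ 3 * (D1 k)\<^sup>2 + - (1 / P\<^sup>2) * D2 k)"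
  proof (rule J2_compose[where F' = "\<lambda>x. - (1 / x\<^sup>2)"])
    show "J2 (F (Suc k)) P (D1 k) (D2 k)" using J by (simp add: P_def)
    have "\<forall>\<^sub>F x in nhds P. x > 0" using pos(2) by (rule order_tendstoD(1)[OF filterlim_ident])
    then show "\<forall>\<^sub>F x in nhds P. (inverse has_real_derivative - (1 / x\<^sup>2)) (at x)"
      by eventually_elim (auto intro!: derivative_eq_intros simp: power2_eq_square divide_simps)
    show "((\<lambda>x. - (1 / x\<^sup>2)) has_real_derivative 2 / P ^ 3) (at P)"
      using pos by (auto intro!: derivative_eq_intros simp: power2_eq_square power3_eq_cube divide_simps)
  qed
  define q1 q2 where "q1 = N * (- (1 / P\<^sup>2) * D1 k) + D1 (Suc k) * inverse P"
    and "q2 = N * (2 / P ^ 3 * (D1 k)\<^sup>2 + - (1 / P\<^sup>2) * D2 k) + 2 * (D1 (Suc k) * (- (1 / P\<^sup>2) * D1 k)) + D2 (Suc k) * inverse P"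
  have Jq: "J2 q (N * inverse P) q1 q2"
    unfolding q_def[abs_def] q1_def q2_def using J[of "Suc k"] by (intro J2_mult inv) (simp add: N_def)
  have "\<forall>\<^sub>F t in nhds 0. esym_cone (Suc k) X (\<lambda>i. a i + t * b i)"
    using cone by (intro eventually_esym_cone[OF X]) (auto intro!: continuous_intros)
  moreover have "\<forall>\<^sub>F t in nhds 0. esym_cone (Suc k) X (\<lambda>i. a i - t * b i)"
    using cone by (intro eventually_esym_cone[OF X]) (auto intro!: continuous_intros)
  \<comment> \<open>Superadditivity and homogeneity say that \<open>q t + q (- t)\<close> is maximal
    at \<open>t = 0\<close>; its second derivative there is twice \<open>q2\<close>.\<close>
  ultimately have "\<forall>\<^sub>F t in nhds 0. q t + q (- t) \<le> N * inverse P + N * inverse P"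
  proof eventually_elim
    case (elim t)
    have "q t = esym_quot (Suc k) X (\<lambda>i. a i + t * b i)" "q (- t) = esym_quot (Suc k) X (\<lambda>i. a i - t * b i)"
      by (simp_all add: q_def F_def esym_quot_def divide_inverse)
    then have "q t + q (- t) \<le> esym_quot (Suc k) X (\<lambda>i. 2 * a i)"
      using esym_quot_superadd[OF X elim] by simp
    also have "\<dots> = N * inverse P + N * inverse P"
      by (subst esym_quot_scale) (auto simp: esym_quot_def N_def P_def divide_inverse)
    finally show ?case .
  qed
  from J2_local_max(2)[OF J2_add[OF Jq J2_reflect[OF Jq]] this] have "q2 \<le> 0" by simp
  have IH: "real (Suc k) * D2 k * P \<le> real k * (D1 k)\<^sup>2"
    using Suc.IH[OF cone] by (simp add: D1_def D2_def P_def)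
  \<comment> \<open>Second derivative of the product S_{k+2} = q S_{k+1}.\<close>
  have N: "D2 (Suc k) = q2 * P + 2 * q1 * D1 k + N / P * D2 k"
    unfolding q1_def q2_def using pos by (simp add: field_simps power2_eq_square power3_eq_cube)
  have D1: "D1 (Suc k) = q1 * P + N / P * D1 k"
    unfolding q1_def using pos by (simp add: field_simps power2_eq_square)
  define r where "r = N / P"
  have r: "r > 0" "N = r * P" using pos by (auto simp: r_def)
  have 1: "real (Suc k) * (real (Suc (Suc k)) * D2 (Suc k) * N)
     \<le> real (Suc k) * (real (Suc (Suc k)) * (2 * q1 * D1 k) * N) + real (Suc (Suc k)) * r * N * (real (Suc k) * D2 k)"
  proof -
    have "q2 * P \<le> 0" using \<open>q2 \<le> 0\<close> pos by (simp add: mult_nonpos_nonneg)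
    then have "D2 (Suc k) \<le> 2 * q1 * D1 k + r * D2 k" unfolding N r_def by simp
    then have "(real (Suc k) * real (Suc (Suc k)) * N) * D2 (Suc k) \<le> (real (Suc k) * real (Suc (Suc k)) * N) * (2 * q1 * D1 k + r * D2 k)"
      using pos by (intro mult_left_mono) auto
    then show ?thesis by (simp only: algebra_simps)
  qed
  have 2: "real (Suc (Suc k)) * r * N * (real (Suc k) * D2 k) = real (Suc (Suc k)) * r\<^sup>2 * (real (Suc k) * D2 k * P)"
    unfolding r(2) by (simp add: power2_eq_square)
  have 3: "real (Suc (Suc k)) * r\<^sup>2 * (real (Suc k) * D2 k * P) \<le> real (Suc (Suc k)) * r\<^sup>2 * (real k * (D1 k)\<^sup>2)"
    using IH by (intro mult_left_mono) auto
  \<comment> \<open>After the induction hypothesis has been inserted, the difference to the claim is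
    an exact square.\<close>
  have 4: "real (Suc k) * (real (Suc (Suc k)) * (2 * q1 * D1 k) * N) + real (Suc (Suc k)) * r\<^sup>2 * (real k * (D1 k)\<^sup>2)
    = real (Suc k) * (real (Suc k) * (D1 (Suc k))\<^sup>2) - (real (Suc k) * (q1 * P) - r * D1 k)\<^sup>2"
    unfolding D1 r_def[symmetric] unfolding r(2) by (simp add: algebra_simps power2_eq_square)
  have "real (Suc k) * (real (Suc (Suc k)) * D2 (Suc k) * N) \<le> real (Suc k) * (real (Suc k) * (D1 (Suc k))\<^sup>2)"
    using 1 2 3 4 zero_le_power2[of "real (Suc k) * (q1 * P) - r * D1 k"] by linarith
  then have "real (Suc (Suc k)) * D2 (Suc k) * N \<le> real (Suc k) * (D1 (Suc k))\<^sup>2"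
    by (rule mult_left_le_imp_le) simp
  then show ?case by (simp only: D1_def D2_def N_def)
qed

text \<open>A negative derivative would make \<open>esym (Suc k)\<close> decrease on moving from
  \<open>a\<close> in the direction \<open>b\<close> of the cone, against
  \<open>esym_mono_add\<close>.\<close>

lemma esym_derivative_nonneg:
  assumes X: "finite X" and a: "esym_cone (Suc k) X a" and b: "esym_cone (Suc k) X b"
  shows "0 \<le> (\<Sum>i\<in>X. b i * esym k (X - {i}) a)"
proof (rule ccontr)
  assume "\<not> ?thesis"
  then have neg: "(\<Sum>i\<in>X. b i * esym k (X - {i}) a) < 0" by simp
  have "((\<lambda>t. esym (Suc k) X (\<lambda>i. a i + t * b i)) has_real_derivative (\<Sum>i\<in>X. b i * esym k (X - {i}) a)) (at 0)"
    by (rule J2_DERIV[OF J2_esym[OF X J2_affine]])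
  from DERIV_neg_dec_right[OF this neg] obtain d where
    d: "d > 0" "\<And>h. 0 < h \<Longrightarrow> h < d \<Longrightarrow> esym (Suc k) X (\<lambda>i. a i + h * b i) < esym (Suc k) X a" by auto
  have "esym_cone (Suc k) X (\<lambda>i. d / 2 * b i)" using b d(1) by (subst esym_cone_scale) auto
  from esym_mono_add[OF X a this, of "Suc k"] show False using d(2)[of "d / 2"] d(1) by simp
qed

lemma esym_pred_nonneg:
  assumes "finite X" "esym_cone (Suc k) X a" "i \<in> X" "l \<in> X" "i \<noteq> l"
  shows "0 \<le> esym_pred k (X - {i} - {l}) a"
proof (cases k)
  case (Suc j)
  then have "esym_cone j (X - {i} - {l}) a"
    using assms by (intro esym_cone_remove[of "X - {i}"] esym_cone_remove[of X]) auto
  then show ?thesis using Suc by (auto simp: esym_pred_def esym_cone_def less_imp_le)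
qed (simp add: esym_pred_def)

text \<open>The divided difference of the weights, written without division so that equal
  eigenvalues are covered.\<close>

lemma esym_pred_diff:
  assumes "finite X" "i \<in> X" "l \<in> X" "i \<noteq> l"
  shows "(a i - a l) * esym_pred k (X - {i} - {l}) a = esym k (X - {l}) a - esym k (X - {i}) a"
proof (cases k)
  case (Suc j)
  have "esym (Suc j) (X - {i}) a = esym (Suc j) (X - {i} - {l}) a + a l * esym j (X - {i} - {l}) a"
    using assms by (intro esym_remove) auto
  moreover have "esym (Suc j) (X - {l}) a = esym (Suc j) (X - {i} - {l}) a + a i * esym j (X - {i} - {l}) a"
    using assms esym_remove[of "X - {l}" i j a] by (simp add: Diff_insert2[symmetric] insert_commute)
  ultimately show ?thesis using Suc by (simp add: esym_pred_def algebra_simps)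
qed (use assms in \<open>simp add: esym_pred_def\<close>)

section \<open>Rearrangement and the spectral theorem\<close>

text \<open>Swapping mass towards the pair formed by the largest \<open>c\<^sub>i\<close> and the smallest \<open>m\<^sub>j\<close> does not
  increase the sum; this replaces the use of Birkhoff's theorem.\<close>

lemma doubly_stochastic_rearrangement:
  fixes c :: "'a \<Rightarrow> real" and m :: "'b \<Rightarrow> real" and P :: "'a \<Rightarrow> 'b \<Rightarrow> real"
  assumes "finite X" "finite Y" "card X = card Y"
    and "\<And>a b. a \<in> X \<Longrightarrow> b \<in> Y \<Longrightarrow> 0 \<le> P a b"
    and "\<And>a. a \<in> X \<Longrightarrow> (\<Sum>b\<in>Y. P a b) = 1" and "\<And>b. b \<in> Y \<Longrightarrow> (\<Sum>a\<in>X. P a b) = 1"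
  shows "\<exists>f. bij_betw f X Y \<and> (\<Sum>a\<in>X. c a * m (f a)) \<le> (\<Sum>a\<in>X. \<Sum>b\<in>Y. c a * P a b * m b)"
  using assms
proof (induction "card X" arbitrary: X Y P)
  case 0
  then have "X = {}" "Y = {}" by auto
  then show ?case by (auto simp: bij_betw_def)
next
  case (Suc n)
  have ne: "X \<noteq> {}" "Y \<noteq> {}" using Suc by auto
  obtain i where i: "i \<in> X" "\<And>a. a \<in> X \<Longrightarrow> c a \<le> c i"
  proof -
    have "Max (c ` X) \<in> c ` X" using ne Suc.prems(1) by (intro Max_in) auto
    then show thesis using that Suc.prems(1) by (metis (no_types, lifting) Max_ge finite_imageI image_iff)
  qed
  obtain j where j: "j \<in> Y" "\<And>b. b \<in> Y \<Longrightarrow> m j \<le> m b"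
  proof -
    have "Min (m ` Y) \<in> m ` Y" using ne Suc.prems(2) by (intro Min_in) auto
    then show thesis using that Suc.prems(2) by (metis (no_types, lifting) Min_le finite_imageI image_iff)
  qed
  define X' Y' where "X' = X - {i}" and "Y' = Y - {j}"
  have X': "finite X'" "X = insert i X'" "i \<notin> X'" and Y': "finite Y'" "Y = insert j Y'" "j \<notin> Y'"
    using i j Suc.prems by (auto simp: X'_def Y'_def)
  define D where "D = 1 - P i j"
  have D1: "D = (\<Sum>b\<in>Y'. P i b)" using Suc.prems(5)[OF i(1)] Y' by (simp add: D_def)
  have D2: "D = (\<Sum>a\<in>X'. P a j)" using Suc.prems(6)[OF j(1)] X' by (simp add: D_def)
  have P: "0 \<le> P a b" if "a \<in> X" "b \<in> Y" for a b using Suc.prems(4) that .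
  have D0: "D \<ge> 0" unfolding D1 using P i Y' by (auto intro: sum_nonneg)
  \<comment> \<open>Row \<open>i\<close> and column \<open>j\<close> are removed; the mass
    \<open>P a j\<close> lost by row \<open>a\<close> is spread over the columns in proportion to
    \<open>P i b\<close>. If \<open>D = 0\<close>, all these masses vanish and the value
    \<open>0\<close> of the division is right.\<close>
  define P' where "P' a b = P a b + P a j * P i b / D" for a b
  have row: "(\<Sum>b\<in>Y'. P' a b) = 1" if "a \<in> X'" for a
  proof -
    have "(\<Sum>b\<in>Y'. P' a b) = (\<Sum>b\<in>Y'. P a b) + P a j * D / D"
      by (simp add: P'_def sum.distrib D1 sum_distrib_left sum_divide_distrib)
    also have "P a j * D / D = P a j"
    proof (cases "D = 0")
      case True
      then have "P a j = 0" using D2 sum_nonneg_eq_0_iff[OF X'(1), of "\<lambda>a. P a j"] P j X' that by auto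
      then show ?thesis by simp
    qed simp
    finally show ?thesis using Suc.prems(5)[of a] that X' Y' by simp
  qed
  have col: "(\<Sum>a\<in>X'. P' a b) = 1" if "b \<in> Y'" for b
  proof -
    have "(\<Sum>a\<in>X'. P' a b) = (\<Sum>a\<in>X'. P a b) + D * P i b / D"
      by (simp add: P'_def sum.distrib D2 sum_distrib_right sum_divide_distrib)
    also have "D * P i b / D = P i b"
    proof (cases "D = 0")
      case True
      then have "P i b = 0" using D1 sum_nonneg_eq_0_iff[OF Y'(1), of "\<lambda>b. P i b"] P i Y' that by auto
      then show ?thesis by simp
    qed simp
    finally show ?thesis using Suc.prems(6)[of b] that X' Y' by simp
  qed
  have nn: "0 \<le> P' a b" if "a \<in> X'" "b \<in> Y'" for a b
    using P that X' Y' D0 by (auto simp: P'_def)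
  have "\<exists>f. bij_betw f X' Y' \<and> (\<Sum>a\<in>X'. c a * m (f a)) \<le> (\<Sum>a\<in>X'. \<Sum>b\<in>Y'. c a * P' a b * m b)"
    by (rule Suc.hyps(1)) (use Suc.hyps(2) Suc.prems(3) X' Y' nn row col in auto)
  then obtain f where f: "bij_betw f X' Y'"
    "(\<Sum>a\<in>X'. c a * m (f a)) \<le> (\<Sum>a\<in>X'. \<Sum>b\<in>Y'. c a * P' a b * m b)" by blast
  define g where "g = f(i := j)"
  have gX: "g a = f a" if "a \<in> X'" for a using that X' by (auto simp: g_def)
  have "bij_betw g X' Y'" using f(1) gX by (simp cong: bij_betw_cong)
  then have g: "bij_betw g X Y"
    unfolding X'(2) Y'(2) using X'(3) Y'(3) notIn_Un_bij_betw[of i X' g Y'] by (simp add: g_def)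
  have key: "c i * m j * D + (\<Sum>a\<in>X'. \<Sum>b\<in>Y'. c a * (P a j * P i b / D) * m b)
    \<le> (\<Sum>b\<in>Y'. c i * P i b * m b) + (\<Sum>a\<in>X'. c a * P a j * m j)"
  proof (cases "D = 0")
    case True
    then have "\<And>b. b \<in> Y' \<Longrightarrow> P i b = 0" "\<And>a. a \<in> X' \<Longrightarrow> P a j = 0"
      using D1 D2 sum_nonneg_eq_0_iff[OF Y'(1), of "\<lambda>b. P i b"] sum_nonneg_eq_0_iff[OF X'(1), of "\<lambda>a. P a j"]
        P i j X' Y' by auto
    then show ?thesis using True by simp
  next
    case False
    have e1: "(\<Sum>b\<in>Y'. c i * P i b * m b) = (\<Sum>a\<in>X'. \<Sum>b\<in>Y'. P a j * P i b / D * (c i * m b))"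
    proof -
      have "(\<Sum>a\<in>X'. \<Sum>b\<in>Y'. P a j * P i b / D * (c i * m b)) = (\<Sum>a\<in>X'. P a j) * (\<Sum>b\<in>Y'. P i b / D * (c i * m b))"
        by (simp add: sum_product mult_ac)
      also have "\<dots> = (\<Sum>b\<in>Y'. c i * P i b * m b)"
        unfolding D2[symmetric] sum_distrib_left using False by (intro sum.cong) auto
      finally show ?thesis by simp
    qed
    have e2: "(\<Sum>a\<in>X'. c a * P a j * m j) = (\<Sum>a\<in>X'. \<Sum>b\<in>Y'. P a j * P i b / D * (c a * m j))"
    proof -
      have "(\<Sum>a\<in>X'. \<Sum>b\<in>Y'. P a j * P i b / D * (c a * m j)) = (\<Sum>a\<in>X'. P a j / D * (c a * m j)) * (\<Sum>b\<in>Y'. P i b)"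
        unfolding sum_product by (intro sum.cong refl) (simp add: mult_ac)
      also have "\<dots> = (\<Sum>a\<in>X'. c a * P a j * m j)"
        unfolding D1[symmetric] sum_distrib_right using False by (intro sum.cong) auto
      finally show ?thesis by simp
    qed
    have e3: "c i * m j * D = (\<Sum>a\<in>X'. \<Sum>b\<in>Y'. P a j * P i b / D * (c i * m j))"
    proof -
      have "(\<Sum>a\<in>X'. \<Sum>b\<in>Y'. P a j * P i b / D * (c i * m j)) = (\<Sum>a\<in>X'. P a j) * (\<Sum>b\<in>Y'. P i b) * (c i * m j) / D"
        by (simp add: sum_product sum_distrib_left sum_distrib_right sum_divide_distrib mult_ac)
      also have "\<dots> = c i * m j * D" unfolding D1[symmetric] D2[symmetric] using False by simp
      finally show ?thesis by simp
    qed
    \<comment> \<open>Moving mass onto the pair of largest \<open>c\<close> and smallest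
      \<open>m\<close> gains a product of two nonnegative differences; this is the whole content of
      \<open>key\<close>.\<close>
    have "0 \<le> (\<Sum>a\<in>X'. \<Sum>b\<in>Y'. P a j * P i b / D * ((c i - c a) * (m b - m j)))"
      using P i j X' Y' D0 by (intro sum_nonneg mult_nonneg_nonneg divide_nonneg_nonneg) auto
    also have "\<dots> = (\<Sum>b\<in>Y'. c i * P i b * m b) + (\<Sum>a\<in>X'. c a * P a j * m j) -
      (c i * m j * D + (\<Sum>a\<in>X'. \<Sum>b\<in>Y'. c a * (P a j * P i b / D) * m b))"
      unfolding e1 e2 e3 by (simp only: sum.distrib[symmetric] sum_subtractf[symmetric])
        (intro sum.cong refl, simp add: algebra_simps)
    finally show ?thesis by simp
  qed
  have "(\<Sum>a\<in>X. c a * m (g a)) = c i * m j + (\<Sum>a\<in>X'. c a * m (f a))"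
    using X' gX by (simp add: g_def)
  also have "\<dots> \<le> c i * m j + (\<Sum>a\<in>X'. \<Sum>b\<in>Y'. c a * P' a b * m b)" using f(2) by simp
  also have "\<dots> = c i * P i j * m j + c i * m j * D + (\<Sum>a\<in>X'. \<Sum>b\<in>Y'. c a * (P a j * P i b / D) * m b) +
      (\<Sum>a\<in>X'. \<Sum>b\<in>Y'. c a * P a b * m b)"
    by (simp add: P'_def D_def algebra_simps sum.distrib)
  also have "\<dots> \<le> c i * P i j * m j + (\<Sum>b\<in>Y'. c i * P i b * m b) + (\<Sum>a\<in>X'. c a * P a j * m j) +
      (\<Sum>a\<in>X'. \<Sum>b\<in>Y'. c a * P a b * m b)" using key by linarith
  also have "\<dots> = (\<Sum>a\<in>X. \<Sum>b\<in>Y. c a * P a b * m b)"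
    using X' Y' by (simp add: sum.distrib)
  finally show ?case using g by blast
qed

section \<open>Orthonormal frames and eigenvectors\<close>

definition orthonormal_frame :: "('n \<Rightarrow> real^'n) \<Rightarrow> bool" where
  "orthonormal_frame q \<longleftrightarrow> (\<forall>a b. q a \<bullet> q b = (if a = b then 1 else 0))"

lemma frame_expand:
  fixes q :: "'n::finite \<Rightarrow> real^'n"
  assumes "orthonormal_frame q"
  shows "x = (\<Sum>a\<in>UNIV. (x \<bullet> q a) *\<^sub>R q a)"
proof -
  define Q where "Q = (\<chi> i j. q j $ i)"
  have "transpose Q ** Q = mat 1"
    using assms by (simp add: vec_eq_iff matrix_matrix_mult_def transpose_def Q_def mat_def
        orthonormal_frame_def inner_vec_def)
  \<comment> \<open>A left inverse of a square matrix is a right inverse; this is the completeness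
    of the frame.\<close>
  then have "Q ** transpose Q = mat 1" by (simp add: matrix_left_right_inverse)
  then have "x = Q *v (transpose Q *v x)" by (simp only: matrix_vector_mul_assoc matrix_vector_mul_lid)
  also have "\<dots> = (\<Sum>a\<in>UNIV. (x \<bullet> q a) *\<^sub>R q a)"
    by (simp add: vec_eq_iff matrix_vector_mult_def transpose_def Q_def inner_vec_def sum_component mult_ac)
  finally show ?thesis .
qed

lemma frame_parseval:
  fixes q :: "'n::finite \<Rightarrow> real^'n"
  assumes "orthonormal_frame q"
  shows "x \<bullet> y = (\<Sum>a\<in>UNIV. (x \<bullet> q a) * (y \<bullet> q a))"
proof -
  have "x \<bullet> y = (\<Sum>a\<in>UNIV. (x \<bullet> q a) *\<^sub>R q a) \<bullet> y"
    using frame_expand[OF assms, of x] by simp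
  also have "\<dots> = (\<Sum>a\<in>UNIV. (x \<bullet> q a) * (y \<bullet> q a))"
    by (simp only: inner_sum_left inner_scaleR_left) (simp add: inner_commute)
  finally show ?thesis .
qed

lemma inner_matrix_symmetric:
  fixes W :: "real^'n^'n"
  assumes "transpose W = W"
  shows "(W *v x) \<bullet> y = x \<bullet> (W *v y)"
  by (metis assms dot_lmul_matrix transpose_matrix_vector)

text \<open>First variation of the Rayleigh quotient at \<open>e\<close> in the directions of
  \<open>S\<close> orthogonal to \<open>e\<close>. Invariance of \<open>S\<close> makes the residual
  \<open>W *v e - l *\<^sub>R e\<close> such a direction, so it is orthogonal to itself.\<close>

lemma rayleigh_maximum_eigenvector:
  fixes W :: "real^'n^'n"
  assumes W: "transpose W = W" and S: "subspace S" "\<And>x. x \<in> S \<Longrightarrow> W *v x \<in> S"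
    and e: "e \<in> S" "norm e = 1"
    and max: "\<And>x. x \<in> S \<Longrightarrow> norm x = 1 \<Longrightarrow> x \<bullet> (W *v x) \<le> e \<bullet> (W *v e)"
  shows "W *v e = (e \<bullet> (W *v e)) *\<^sub>R e"
proof -
  define l where "l = e \<bullet> (W *v e)"
  have le: "x \<bullet> (W *v x) \<le> l * (x \<bullet> x)" if "x \<in> S" for x
  proof (cases "x = 0")
    case False
    have "(x /\<^sub>R norm x) \<bullet> (W *v (x /\<^sub>R norm x)) \<le> l"
      unfolding l_def by (rule max) (use that False S in \<open>auto simp: subspace_scale\<close>)
    then have "x \<bullet> (W *v x) / (norm x)\<^sup>2 \<le> l"
      by (simp add: matrix_vector_mult_scaleR power2_eq_square divide_inverse mult_ac)
    then show ?thesis using False by (simp add: divide_le_eq power2_norm_eq_inner)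
  qed simp
  have orth: "y \<bullet> (W *v e) = 0" if y: "y \<in> S" "y \<bullet> e = 0" for y
  proof (rule ccontr)
    assume "y \<bullet> (W *v e) \<noteq> 0"
    \<comment> \<open>\<open>c\<close> is a positive majorant of the second-order coefficient, so
      that \<open>t = b / c\<close> refutes a nonzero first-order coefficient
      \<open>b\<close>.\<close>
    define b c where "b = y \<bullet> (W *v e)" and "c = \<bar>l * (y \<bullet> y) - y \<bullet> (W *v y)\<bar> + 1"
    have c: "c > 0" by (simp add: c_def)
    have quad: "2 * t * b \<le> t\<^sup>2 * c" for t
    proof -
      have "(e + t *\<^sub>R y) \<bullet> (W *v (e + t *\<^sub>R y)) \<le> l * ((e + t *\<^sub>R y) \<bullet> (e + t *\<^sub>R y))"
        by (rule le) (use y e S in \<open>auto simp: subspace_add subspace_scale\<close>)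
      moreover have "e \<bullet> (W *v y) = b" unfolding b_def
        by (metis W inner_commute inner_matrix_symmetric)
      moreover have "e \<bullet> e = 1" using e(2) by (simp add: dot_square_norm)
      ultimately have "2 * t * b \<le> t\<^sup>2 * (l * (y \<bullet> y) - y \<bullet> (W *v y))"
        using y(2) by (simp add: matrix_vector_right_distrib matrix_vector_mult_scaleR inner_add_left inner_add_right
          inner_commute[of e y] l_def[symmetric] b_def[symmetric] algebra_simps power2_eq_square)
      also have "\<dots> \<le> t\<^sup>2 * c" by (intro mult_left_mono) (auto simp: c_def)
      finally show ?thesis .
    qed
    have "2 * (b / c) * b \<le> (b / c)\<^sup>2 * c" by (rule quad)
    then have "b\<^sup>2 / c \<le> 0" using c by (simp add: power2_eq_square field_simps)
    then show False using c \<open>y \<bullet> (W *v e) \<noteq> 0\<close> by (simp add: b_def divide_le_0_iff)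
  qed
  define z where "z = W *v e - l *\<^sub>R e"
  have ee: "e \<bullet> e = 1" using e(2) by (simp add: dot_square_norm)
  have z: "z \<in> S" unfolding z_def using S e by (simp add: subspace_diff subspace_scale)
  have ze: "z \<bullet> e = 0" unfolding z_def by (simp only: inner_diff_left inner_scaleR_left ee) (simp add: l_def inner_commute)
  have "z \<bullet> z = z \<bullet> (W *v e) - l * (z \<bullet> e)" unfolding z_def by (simp add: inner_diff_right)
  then have "z = 0" using orth[OF z ze] ze by simp
  then show ?thesis by (simp add: z_def l_def)
qed

lemma rayleigh_maximum_exists:
  fixes W :: "real^'n^'n"
  assumes "closed S" "e0 \<in> S" "norm e0 = 1"
  obtains e where "e \<in> S" "norm e = 1" "\<And>x. x \<in> S \<Longrightarrow> norm x = 1 \<Longrightarrow> x \<bullet> (W *v x) \<le> e \<bullet> (W *v e)"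
proof -
  have "compact (S \<inter> sphere 0 1)" using assms(1) by (simp add: closed_Int_compact)
  moreover have "S \<inter> sphere 0 1 \<noteq> {}" using assms(2,3) by auto
  moreover have "continuous_on (S \<inter> sphere 0 1) (\<lambda>x. x \<bullet> (W *v x))"
    by (intro continuous_intros linear_continuous_on matrix_vector_mul_bounded_linear)
  ultimately obtain e where "e \<in> S \<inter> sphere 0 1" "\<forall>x\<in>S \<inter> sphere 0 1. x \<bullet> (W *v x) \<le> e \<bullet> (W *v e)"
    using continuous_attains_sup by blast
  then show thesis using that by auto
qed

text \<open>Formulated for invariant subspaces because the orthogonal complement of an eigenvector
  is again invariant by symmetry, with dimension one less.\<close>

lemma spectral_subspace:
  fixes W :: "real^'n^'n"
  assumes W: "transpose W = W"
  shows "subspace S \<Longrightarrow> (\<And>x. x \<in> S \<Longrightarrow> W *v x \<in> S) \<Longrightarrow> dim S = d \<Longrightarrow>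
    \<exists>B. B \<subseteq> S \<and> finite B \<and> card B = d \<and> pairwise orthogonal B \<and>
      (\<forall>e\<in>B. norm e = 1 \<and> W *v e = (e \<bullet> (W *v e)) *\<^sub>R e)"
proof (induction d arbitrary: S)
  case 0
  then show ?case by (intro exI[of _ "{}"]) auto
next
  case (Suc d)
  have "\<not> S \<subseteq> {0}" using Suc.prems(3) by (metis dim_eq_0 nat.distinct(1))
  then obtain x where x: "x \<in> S" "x \<noteq> 0" by auto
  obtain e where e: "e \<in> S" "norm e = 1"
    and max: "\<And>x. x \<in> S \<Longrightarrow> norm x = 1 \<Longrightarrow> x \<bullet> (W *v x) \<le> e \<bullet> (W *v e)"
    by (rule rayleigh_maximum_exists[where S = S and W = W and ?e0.0 = "x /\<^sub>R norm x"])
      (use x Suc.prems(1) in \<open>auto simp: subspace_scale closed_subspace\<close>)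
  have eig: "W *v e = (e \<bullet> (W *v e)) *\<^sub>R e"
    using rayleigh_maximum_eigenvector[OF W Suc.prems(1,2) e max] .
  define S' where "S' = {y \<in> S. \<forall>x\<in>span {e}. orthogonal x y}"
  have S'_eq: "S' = {y \<in> S. orthogonal e y}"
    unfolding S'_def by (auto simp: span_singleton orthogonal_def intro: span_base)
  have "span {e} \<subseteq> S" using e(1) Suc.prems(1) by (simp add: span_minimal)
  then have "dim S' + dim (span {e}) = dim S"
    unfolding S'_def by (intro dim_subspace_orthogonal_to_vectors) (auto simp: Suc.prems(1))
  moreover have "dim (span {e}) = 1" using e(2) by (auto simp: dim_span)
  ultimately have d: "dim S' = d" using Suc.prems(3) by simp
  have sub: "subspace S'" unfolding S'_eq
    using Suc.prems(1) by (auto simp: subspace_def orthogonal_def inner_add_right)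
  have inv: "W *v y \<in> S'" if "y \<in> S'" for y
  proof -
    have y: "y \<in> S" "e \<bullet> y = 0" using that by (auto simp: S'_eq orthogonal_def)
    have "e \<bullet> (W *v y) = (W *v e) \<bullet> y" using inner_matrix_symmetric[OF W] by simp
    also have "\<dots> = 0" by (subst eig) (simp add: y)
    finally show ?thesis using y Suc.prems(2) by (simp add: S'_eq orthogonal_def)
  qed
  obtain B where B: "B \<subseteq> S'" "finite B" "card B = d" "pairwise orthogonal B"
    "\<forall>e\<in>B. norm e = 1 \<and> W *v e = (e \<bullet> (W *v e)) *\<^sub>R e"
    using Suc.IH[OF sub inv d] by blast
  have "e \<notin> B"
  proof
    assume "e \<in> B"
    then have "orthogonal e e" using B(1) by (auto simp: S'_eq)
    then show False using e(2) by (simp add: orthogonal_self)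
  qed
  then show ?case
    using B e eig by (intro exI[of _ "insert e B"])
      (auto simp: S'_eq pairwise_insert orthogonal_commute)
qed

lemma spectral_theorem:
  fixes W :: "real^'n^'n"
  assumes W: "transpose W = W"
  obtains q \<mu> where "orthonormal_frame q" "\<And>a. W *v q a = \<mu> a *\<^sub>R q a"
proof -
  obtain B where B: "finite B" "card B = CARD('n)" "pairwise orthogonal B"
    "\<forall>e\<in>B. norm e = 1 \<and> W *v e = (e \<bullet> (W *v e)) *\<^sub>R e"
    using spectral_subspace[OF W, of UNIV "CARD('n)"] by auto
  obtain q where q: "bij_betw q (UNIV :: 'n set) B"
    using finite_same_card_bij[of "UNIV :: 'n set" B] B by auto
  have qB: "q a \<in> B" for a using q by (auto simp: bij_betw_def)
  have "orthonormal_frame q"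
    unfolding orthonormal_frame_def
  proof (intro allI)
    fix a b
    show "q a \<bullet> q b = (if a = b then 1 else 0)"
    proof (cases "a = b")
      case True
      then show ?thesis using B(4) qB[of a] by (simp add: dot_square_norm)
    next
      case False
      then have "q a \<noteq> q b" using q by (auto simp: bij_betw_def inj_def)
      then show ?thesis using B(3) qB False by (auto simp: pairwise_def orthogonal_def)
    qed
  qed
  moreover have "W *v q a = (q a \<bullet> (W *v q a)) *\<^sub>R q a" for a using B(4) qB by blast
  ultimately show thesis by (rule that)
qed

section \<open>Sums of principal minors\<close>

text \<open>Replacing the rows outside \<open>I\<close> by those of the identity turns the determinant into the principal
  minor of \<open>M\<close> with index set \<open>I\<close>.\<close>

definition pminor_sum :: "nat \<Rightarrow> real^'n^'n \<Rightarrow> real" where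
  "pminor_sum k M = (\<Sum>I | card I = k. det (\<chi> i. if i \<in> I then M $ i else axis i 1))"

lemma elem_sym_eq_esym: "elem_sym k v = esym k UNIV (($) v)"
  by (simp add: elem_sym_def esym_def)

text \<open>Multilinearity in the rows: \<open>I\<close> records which rows are taken from
  \<open>a\<close>.\<close>

lemma det_row_split:
  fixes a b :: "'n::finite \<Rightarrow> real^'n"
  shows "det (\<chi> i. a i + b i) = (\<Sum>I\<in>UNIV. det (\<chi> i. if i \<in> I then a i else b i))"
proof -
  have "(\<Prod>i\<in>UNIV. a i $ p i + b i $ p i) = (\<Sum>I\<in>UNIV. \<Prod>i\<in>UNIV. (if i \<in> I then a i else b i) $ p i)" for p
  proof -
    have "(\<Prod>i\<in>UNIV. a i $ p i + b i $ p i) = (\<Sum>I\<in>UNIV. (\<Prod>i\<in>I. a i $ p i) * (\<Prod>i\<in>UNIV - I. b i $ p i))"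
      by (simp add: prod_add)
    also have "\<dots> = (\<Sum>I\<in>UNIV. \<Prod>i\<in>UNIV. (if i \<in> I then a i else b i) $ p i)"
    proof (intro sum.cong refl)
      fix I :: "'n set"
      have "(\<Prod>i\<in>UNIV. (if i \<in> I then a i else b i) $ p i) =
        (\<Prod>i\<in>I. (if i \<in> I then a i else b i) $ p i) * (\<Prod>i\<in>UNIV - I. (if i \<in> I then a i else b i) $ p i)"
        using prod.subset_diff[of I "UNIV :: 'n set" "\<lambda>i. (if i \<in> I then a i else b i) $ p i"] by (simp add: mult.commute)
      then show "(\<Prod>i\<in>I. a i $ p i) * (\<Prod>i\<in>UNIV - I. b i $ p i) = (\<Prod>i\<in>UNIV. (if i \<in> I then a i else b i) $ p i)"
        by simp
    qed
    finally show ?thesis .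
  qed
  then show ?thesis
    unfolding det_def vec_lambda_beta vector_add_component
    by (simp add: sum_distrib_left) (rule sum.swap)
qed

lemma sum_group_card:
  fixes h :: "'n::finite set \<Rightarrow> real"
  shows "(\<Sum>I\<in>UNIV. t ^ (CARD('n) - card I) * h I) = (\<Sum>j\<le>CARD('n). (\<Sum>I | card I = CARD('n) - j. h I) * t ^ j)"
proof -
  have le: "card I \<le> CARD('n)" for I :: "'n set" by (simp add: card_mono)
  have "(\<Sum>I\<in>UNIV. t ^ (CARD('n) - card I) * h I) =
    (\<Sum>j\<le>CARD('n). \<Sum>I\<in>{I \<in> UNIV. CARD('n) - card I = j}. t ^ (CARD('n) - card I) * h I)"
    by (rule sum.group[symmetric]) auto
  also have "\<dots> = (\<Sum>j\<le>CARD('n). (\<Sum>I | card I = CARD('n) - j. h I) * t ^ j)"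
  proof (intro sum.cong refl)
    fix j assume "j \<in> {..CARD('n)}"
    then have *: "{I \<in> UNIV. CARD('n) - card I = j} = {I :: 'n set. card I = CARD('n) - j}"
      using le by (auto simp: diff_diff_cancel)
    show "(\<Sum>I\<in>{I \<in> UNIV. CARD('n) - card I = j}. t ^ (CARD('n) - card I) * h I) =
      (\<Sum>I | card I = CARD('n) - j. h I) * t ^ j"
      using * \<open>j \<in> {..CARD('n)}\<close> by (simp add: sum_distrib_left diff_diff_cancel mult.commute)
  qed
  finally show ?thesis .
qed

lemma det_mat_add:
  fixes M :: "real^'n^'n"
  shows "det (mat t + M) = (\<Sum>I\<in>UNIV. t ^ (CARD('n) - card I) * det (\<chi> i. if i \<in> I then M $ i else axis i 1))"
proof -
  have "mat t + M = (\<chi> i. M $ i + t *s axis i 1)"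
    by (simp add: vec_eq_iff mat_def axis_def)
  then have "det (mat t + M) = (\<Sum>I\<in>UNIV. det (\<chi> i. if i \<in> I then M $ i else t *s axis i 1))"
    by (simp add: det_row_split)
  also have "\<dots> = (\<Sum>I\<in>UNIV. t ^ (CARD('n) - card I) * det (\<chi> i. if i \<in> I then M $ i else axis i 1))"
  proof (intro sum.cong refl)
    fix I :: "'n set"
    have "(\<chi> i. if i \<in> I then M $ i else t *s axis i 1) =
      (\<chi> i. (if i \<in> I then 1 else t) *s (if i \<in> I then M $ i else axis i 1))"
      by (simp add: vec_eq_iff)
    then have "det (\<chi> i. if i \<in> I then M $ i else t *s axis i 1) =
      (\<Prod>i\<in>UNIV. if i \<in> I then 1 else t) * det (\<chi> i. if i \<in> I then M $ i else axis i 1)"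
      by (simp only: det_rows_mul)
    also have "(\<Prod>i\<in>UNIV. if i \<in> I then 1 else t) = t ^ (CARD('n) - card I)"
      by (simp add: prod.If_cases card_Diff_subset Compl_eq_Diff_UNIV)
    finally show "det (\<chi> i. if i \<in> I then M $ i else t *s axis i 1) =
      t ^ (CARD('n) - card I) * det (\<chi> i. if i \<in> I then M $ i else axis i 1)" .
  qed
  finally show ?thesis .
qed

lemma pminor_sum_eq_0: "CARD('n) < k \<Longrightarrow> pminor_sum k (M :: real^'n^'n) = 0"
proof -
  assume k: "CARD('n) < k"
  have "card I \<noteq> k" for I :: "'n set" using k card_mono[of UNIV I] by auto
  then show ?thesis unfolding pminor_sum_def by simp
qed

text \<open>By \<open>det_mat_add\<close> these sums are the coefficients of the polynomial
  \<open>det (mat t + M)\<close> in \<open>t\<close>, and a polynomial function determines its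
  coefficients. Invariance under change of frame follows at once.\<close>

lemma pminor_sum_charpoly:
  fixes M N :: "real^'n^'n"
  assumes "\<And>t. det (mat t + M) = det (mat t + N)"
  shows "pminor_sum k M = pminor_sum k N"
proof (cases "k \<le> CARD('n)")
  case True
  have "(\<Sum>j\<le>CARD('n). pminor_sum (CARD('n) - j) M * t ^ j) = (\<Sum>j\<le>CARD('n). pminor_sum (CARD('n) - j) N * t ^ j)" for t
    using assms[of t] unfolding det_mat_add sum_group_card pminor_sum_def .
  then have "\<forall>j\<le>CARD('n). pminor_sum (CARD('n) - j) M = pminor_sum (CARD('n) - j) N"
    by (intro iffD1[OF polyfun_eq_coeffs] allI)
  from this[rule_format, of "CARD('n) - k"] show ?thesis using True by simp
qed (simp add: pminor_sum_eq_0)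

lemma pminor_sum_diagonal:
  fixes M :: "real^'n^'n"
  assumes "\<And>i j. i \<noteq> j \<Longrightarrow> M $ i $ j = 0"
  shows "pminor_sum k M = esym k UNIV (\<lambda>i. M $ i $ i)"
proof -
  have "det (\<chi> i. if i \<in> I then M $ i else axis i 1) = (\<Prod>i\<in>I. M $ i $ i)" for I :: "'n set"
  proof -
    have "det (\<chi> i. if i \<in> I then M $ i else axis i 1) = (\<Prod>i\<in>UNIV. if i \<in> I then M $ i $ i else 1)"
      by (subst det_diagonal) (auto simp: assms axis_def intro!: prod.cong)
    also have "\<dots> = (\<Prod>i\<in>I. M $ i $ i)"
      by (subst prod.inter_restrict[symmetric]) auto
    finally show ?thesis .
  qed
  then show ?thesis unfolding pminor_sum_def esym_def by simp
qed

lemma det_mat_add_diagonal: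
  "det (mat t + (\<chi> i j. if i = j then v i else 0) :: real^'n^'n) = (\<Prod>i\<in>UNIV. t + v i)"
  by (subst det_diagonal) (auto simp: mat_def)

lemma pminor_sum_eq_elem_sym:
  fixes W :: "real^'n^'n" and v :: "real^'n"
  assumes "\<And>t. det (mat t - W) = (\<Prod>i\<in>UNIV. t - v $ i)"
  shows "pminor_sum k W = elem_sym k v"
proof -
  have "det (mat t + W) = det (mat t + (\<chi> i j. if i = j then v $ i else 0) :: real^'n^'n)" for t
  proof -
    have neg: "det (- M) = (-1) ^ CARD('n) * det M" for M :: "real^'n^'n"
    proof -
      have "- M = (\<chi> i. (-1) *s (M $ i))" by (simp add: vec_eq_iff)
      then have "det (- M) = (\<Prod>i\<in>(UNIV :: 'n set). -1) * det (\<chi> i. M $ i)" by (simp only: det_rows_mul)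
      then show ?thesis by simp
    qed
    \<comment> \<open>The eigenvalue vector is defined through \<open>det (mat t - W)\<close>, the
      expansion concerns \<open>det (mat t + W)\<close>; the two are exchanged by changing the sign
      of \<open>t\<close> and of all rows.\<close>
    have "mat t + W = - (mat (- t) - W)" by (simp add: vec_eq_iff mat_def)
    then have "det (mat t + W) = (-1) ^ CARD('n) * (\<Prod>i\<in>UNIV. - t - v $ i)" by (simp only: neg assms)
    also have "\<dots> = (\<Prod>i\<in>UNIV. (-1) * (- t - v $ i))" by (simp only: prod.distrib) simp
    also have "\<dots> = (\<Prod>i\<in>UNIV. t + v $ i)" by (simp add: add.commute)
    finally show ?thesis by (simp add: det_mat_add_diagonal)
  qed
  then have "pminor_sum k W = pminor_sum k (\<chi> i j. if i = j then v $ i else 0)"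
    by (rule pminor_sum_charpoly)
  also have "\<dots> = elem_sym k v" by (subst pminor_sum_diagonal) (auto simp: elem_sym_eq_esym)
  finally show ?thesis .
qed

section \<open>Invariance under change of frame and the eigenvalue vector\<close>

definition frame_matrix :: "('n \<Rightarrow> real^'n) \<Rightarrow> real^'n^'n \<Rightarrow> real^'n^'n" where
  "frame_matrix q W = (\<chi> a b. q a \<bullet> (W *v q b))"

lemma det_frame_matrix:
  fixes q :: "'n::finite \<Rightarrow> real^'n"
  assumes q: "orthonormal_frame q"
  shows "det (mat t + frame_matrix q W) = det (mat t + W)"
proof -
  define Q where "Q = (\<chi> i j. q j $ i)"
  have QQ: "transpose Q ** Q = mat 1"
    using q by (simp add: vec_eq_iff matrix_matrix_mult_def transpose_def Q_def mat_def
        orthonormal_frame_def inner_vec_def)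
  have eq: "frame_matrix q V = transpose Q ** V ** Q" for V
    by (simp add: frame_matrix_def vec_eq_iff matrix_matrix_mult_def transpose_def Q_def inner_vec_def
        matrix_vector_mult_def sum_distrib_left sum_distrib_right mult_ac) (intro allI sum.swap)
  have "frame_matrix q (mat t) = mat t"
    using q by (simp add: frame_matrix_def vec_eq_iff mat_def orthonormal_frame_def matrix_vector_mult_def inner_vec_def
        if_distrib[where f = "\<lambda>x. x * _"] sum.delta' cong: if_cong) (simp add: mult_ac sum_distrib_left[symmetric])
  then have "mat t + frame_matrix q W = frame_matrix q (mat t + W)"
    by (simp add: frame_matrix_def vec_eq_iff matrix_vector_mult_add_rdistrib inner_add_right)
  then have "det (mat t + frame_matrix q W) = det (transpose Q) * det Q * det (mat t + W)"
    by (simp add: eq det_mul)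
  also have "det (transpose Q) * det Q = 1" using QQ det_mul[of "transpose Q" Q] by simp
  finally show ?thesis by simp
qed

lemma pminor_sum_frame_matrix:
  "orthonormal_frame q \<Longrightarrow> pminor_sum k (frame_matrix q W) = pminor_sum k W"
  by (intro pminor_sum_charpoly det_frame_matrix)

lemma frame_matrix_eigen:
  assumes "orthonormal_frame q" "\<And>a. W *v q a = \<mu> a *\<^sub>R q a"
  shows "frame_matrix q W = (\<chi> a b. if a = b then \<mu> a else 0)"
  unfolding frame_matrix_def assms(2) using assms(1) by (simp add: vec_eq_iff orthonormal_frame_def)

lemma pminor_sum_eigen:
  assumes "orthonormal_frame q" "\<And>a. W *v q a = \<mu> a *\<^sub>R q a"
  shows "pminor_sum k W = esym k UNIV \<mu>"
proof -
  have "pminor_sum k W = pminor_sum k (frame_matrix q W)" using pminor_sum_frame_matrix[OF assms(1)] by simp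
  then show ?thesis unfolding frame_matrix_eigen[OF assms] by (subst (asm) pminor_sum_diagonal) auto
qed

text \<open>The choice in the definition of \<open>eigenvalue_vector\<close> succeeds, because the
  eigenvalues along an eigenframe are a witness.\<close>

lemma eigenvalue_vector_charpoly:
  fixes W :: "real^'n^'n"
  assumes W: "transpose W = W"
  shows "det (mat t - W) = (\<Prod>i\<in>UNIV. t - eigenvalue_vector W $ i)"
proof -
  obtain q \<mu> where q: "orthonormal_frame q" "\<And>a. W *v q a = \<mu> a *\<^sub>R q a" using spectral_theorem[OF W] by blast
  have q': "(- W) *v q a = (- \<mu> a) *\<^sub>R q a" for a
  proof -
    have "(- W) *v q a = - (W *v q a)" by (simp add: matrix_vector_mult_def vec_eq_iff sum_negf)
    then show ?thesis using q by simp
  qed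
  have eq: "det (mat t - W) = (\<Prod>i\<in>UNIV. t - (\<chi> i. \<mu> i) $ i)" for t
  proof -
    have "det (mat t - W) = det (mat t + frame_matrix q (- W))" unfolding det_frame_matrix[OF q(1)] by simp
    also have "\<dots> = (\<Prod>i\<in>UNIV. t - (\<chi> i. \<mu> i) $ i)"
      unfolding frame_matrix_eigen[of q "- W" "\<lambda>a. - \<mu> a", OF q(1) q'] by (subst det_mat_add_diagonal) simp
    finally show ?thesis .
  qed
  have "\<exists>v::real^'n. \<forall>t. det (mat t - W) = (\<Prod>i\<in>UNIV. t - v $ i)" by (rule exI, rule allI, rule eq)
  from someI_ex[OF this] show ?thesis unfolding eigenvalue_vector_def by blast
qed

lemma elem_sym_eigenvalue_vector: "transpose W = W \<Longrightarrow> elem_sym k (eigenvalue_vector W) = pminor_sum k W"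
  using pminor_sum_eq_elem_sym[OF eigenvalue_vector_charpoly] by metis

lemma S_mat_eq_pminor_sum: "transpose W = W \<Longrightarrow> S_mat k W = pminor_sum k W"
  by (simp add: S_mat_def elem_sym_eigenvalue_vector)

lemma esym_permute:
  assumes "bij_betw f (UNIV :: 'a set) (UNIV :: 'a::finite set)"
  shows "esym k UNIV (\<lambda>a. \<mu> (f a)) = esym k UNIV \<mu>"
proof -
  have inj: "inj f" and surj: "surj f" using assms by (auto simp: bij_betw_def)
  have "esym k UNIV \<mu> = (\<Sum>I | card I = k. prod \<mu> (f ` I))"
    unfolding esym_def
    by (rule sum.reindex_bij_witness[where i = "\<lambda>I. f ` I" and j = "\<lambda>J. f -` J"])
      (use inj surj in \<open>auto simp: inj_vimage_image_eq surj_image_vimage_eq card_vimage_inj card_image inj_on_subset\<close>)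
  also have "\<dots> = esym k UNIV (\<lambda>a. \<mu> (f a))"
    unfolding esym_def using inj by (intro sum.cong) (auto simp: prod.reindex inj_on_subset)
  finally show ?thesis by simp
qed

text \<open>With \<open>a\<close> in the role of eigenvalues and \<open>q\<close> of an eigenframe, this is the positivity on the cone
  of the linearisation of \<open>S\<^sub>k\<close> at a symmetric matrix.\<close>

lemma esym_derivative_matrix_nonneg:
  fixes W :: "real^'n^'n"
  assumes W: "transpose W = W" and cone: "\<And>j. j \<le> Suc k \<Longrightarrow> 0 < pminor_sum j W"
    and a: "esym_cone (Suc k) UNIV a" and q: "orthonormal_frame q"
  shows "0 \<le> (\<Sum>i\<in>UNIV. (q i \<bullet> (W *v q i)) * esym k (UNIV - {i}) a)"
proof -
  obtain r \<mu> where r: "orthonormal_frame r" "\<And>a. W *v r a = \<mu> a *\<^sub>R r a" using spectral_theorem[OF W] by blast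
  have mu: "esym_cone (Suc k) UNIV \<mu>"
    using cone unfolding esym_cone_def pminor_sum_eigen[OF r] by blast
  define \<sigma> where "\<sigma> i = esym k (UNIV - {i}) a" for i
  \<comment> \<open>Squared coefficients between two orthonormal frames form a doubly stochastic
    matrix by Parseval. Rearrangement then replaces it by a permutation, which reduces the claim to
    the scalar lemma \<open>esym_derivative_nonneg\<close>.\<close>
  define P where "P i j = (q i \<bullet> r j)\<^sup>2" for i j
  have diag: "q i \<bullet> (W *v q i) = (\<Sum>j\<in>UNIV. P i j * \<mu> j)" for i
  proof -
    have "q i \<bullet> (W *v q i) = (\<Sum>j\<in>UNIV. (q i \<bullet> r j) * ((W *v q i) \<bullet> r j))" by (rule frame_parseval[OF r(1)])
    also have "\<dots> = (\<Sum>j\<in>UNIV. P i j * \<mu> j)"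
      unfolding inner_matrix_symmetric[OF W] r(2) P_def by (simp add: power2_eq_square mult_ac)
    finally show ?thesis .
  qed
  have rows: "(\<Sum>j\<in>UNIV. P i j) = 1" for i
    using frame_parseval[OF r(1), of "q i" "q i"] q by (simp add: P_def power2_eq_square orthonormal_frame_def)
  have cols: "(\<Sum>i\<in>UNIV. P i j) = 1" for j
    using frame_parseval[OF q, of "r j" "r j"] r(1) by (simp add: P_def power2_eq_square orthonormal_frame_def inner_commute)
  obtain f where f: "bij_betw f UNIV UNIV"
    "(\<Sum>i\<in>UNIV. \<sigma> i * \<mu> (f i)) \<le> (\<Sum>i\<in>UNIV. \<Sum>j\<in>UNIV. \<sigma> i * P i j * \<mu> j)"
    using doubly_stochastic_rearrangement[of "UNIV :: 'n set" "UNIV :: 'n set" P \<sigma> \<mu>] rows cols by (auto simp: P_def)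
  have "esym_cone (Suc k) UNIV (\<lambda>i. \<mu> (f i))" using mu unfolding esym_cone_def esym_permute[OF f(1)] .
  from esym_derivative_nonneg[OF finite a this]
  have "0 \<le> (\<Sum>i\<in>UNIV. \<sigma> i * \<mu> (f i))" by (simp add: \<sigma>_def mult.commute)
  also note f(2)
  also have "(\<Sum>i\<in>UNIV. \<Sum>j\<in>UNIV. \<sigma> i * P i j * \<mu> j) = (\<Sum>i\<in>UNIV. (q i \<bullet> (W *v q i)) * \<sigma> i)"
    unfolding diag by (simp add: sum_distrib_left sum_distrib_right mult_ac)
  finally show ?thesis by (simp add: \<sigma>_def)
qed

section \<open>Second-order expansion of principal minors at a diagonal matrix\<close>

lemma perm_product_0:
  fixes a :: "'n::finite \<Rightarrow> 'n \<Rightarrow> real"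
  assumes "\<forall>i j. i \<noteq> j \<longrightarrow> a i j = 0" "p j \<noteq> j" "j \<notin> S"
  shows "(\<Prod>j\<in>UNIV - S. a j (p j)) = 0"
proof (rule prod_zero)
  show "\<exists>j\<in>UNIV - S. a j (p j) = 0" using assms(1)[rule_format, of j "p j"] assms(2,3) by (intro bexI[of _ j]) auto
qed simp

lemma permutes_single_moved:
  assumes "p permutes UNIV" "\<And>j. j \<noteq> i \<Longrightarrow> p j = j"
  shows "p = id"
proof
  fix x
  have "inj p" using permutes_inj[OF assms(1)] .
  show "p x = id x"
  proof (cases "x = i")
    case True
    have "p i = i" using \<open>inj p\<close> assms(2)[of "p i"] by (metis injD)
    then show ?thesis using True by simp
  qed (simp add: assms(2))
qed

lemma permutes_two_moved:
  assumes "p permutes UNIV" "\<And>j. j \<noteq> i \<Longrightarrow> j \<noteq> l \<Longrightarrow> p j = j" "i \<noteq> l"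
  shows "p = id \<or> p = Transposition.transpose i l"
proof -
  have inj: "inj p" using permutes_inj[OF assms(1)] .
  have "p i \<in> {i, l}" "p l \<in> {i, l}"
    using assms(2)[of "p i"] assms(2)[of "p l"] inj assms(3) by (auto dest: injD)
  moreover have "p i \<noteq> p l" using inj assms(3) by (auto dest: injD)
  ultimately consider "p i = i" "p l = l" | "p i = l" "p l = i" by auto
  then show ?thesis
  proof cases
    case 1
    then have "p x = id x" for x using assms(2)[of x] by (cases "x = i"; cases "x = l") auto
    then show ?thesis by blast
  next
    case 2
    then have "p x = Transposition.transpose i l x" for x using assms(2)[of x] by (cases "x = i"; cases "x = l") auto
    then show ?thesis by blast
  qed
qed

lemma det_first_jet:
  fixes a c :: "'n::finite \<Rightarrow> 'n \<Rightarrow> real"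
  assumes a: "\<forall>i j. i \<noteq> j \<longrightarrow> a i j = 0"
  shows "(\<Sum>p | p permutes UNIV. of_int (sign p) * (\<Sum>i\<in>UNIV. c i (p i) * (\<Prod>j\<in>UNIV - {i}. a j (p j)))) =
    (\<Sum>i\<in>UNIV. c i i * (\<Prod>j\<in>UNIV - {i}. a j j))"
proof -
  have "(\<Sum>p | p permutes UNIV. of_int (sign p) * (\<Sum>i\<in>UNIV. c i (p i) * (\<Prod>j\<in>UNIV - {i}. a j (p j)))) =
    (\<Sum>i\<in>UNIV. \<Sum>p | p permutes UNIV. of_int (sign p) * (c i (p i) * (\<Prod>j\<in>UNIV - {i}. a j (p j))))"
    unfolding sum_distrib_left by (rule sum.swap)
  also have "\<dots> = (\<Sum>i\<in>UNIV. \<Sum>p\<in>{id}. of_int (sign p) * (c i (p i) * (\<Prod>j\<in>UNIV - {i}. a j (p j))))"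
  proof (rule sum.cong[OF refl], rule sum.mono_neutral_right, goal_cases)
    case (3 i)
    show ?case
    proof
    fix p assume p: "p \<in> {p. p permutes (UNIV :: 'n set)} - {id}"
    then obtain j where "j \<noteq> i" "p j \<noteq> j" using permutes_single_moved[of p i] by auto
    then show "of_int (sign p) * (c i (p i) * (\<Prod>j\<in>UNIV - {i}. a j (p j))) = 0"
      using perm_product_0[where a = a and p = p and S = "{i}", OF a] by simp
    qed
  qed (auto simp: permutes_id)
  finally show ?thesis by (simp add: sign_id)
qed

text \<open>At a diagonal matrix only permutations fixing every index other than \<open>i\<close>
  and \<open>l\<close> contribute. The transposition has sign -1 and yields
  \<open>- b i l * b l i\<close>, the source of the favourable third-order terms.\<close>

lemma det_second_jet:
  fixes a b :: "'n::finite \<Rightarrow> 'n \<Rightarrow> real"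
  assumes a: "\<forall>i j. i \<noteq> j \<longrightarrow> a i j = 0"
  shows "(\<Sum>p | p permutes UNIV. of_int (sign p) *
      (\<Sum>i\<in>UNIV. \<Sum>l\<in>UNIV - {i}. b i (p i) * b l (p l) * (\<Prod>j\<in>UNIV - {i} - {l}. a j (p j)))) =
    (\<Sum>i\<in>UNIV. \<Sum>l\<in>UNIV - {i}. (b i i * b l l - b i l * b l i) * (\<Prod>j\<in>UNIV - {i} - {l}. a j j))"
proof -
  have "(\<Sum>p | p permutes UNIV. of_int (sign p) *
      (\<Sum>i\<in>UNIV. \<Sum>l\<in>UNIV - {i}. b i (p i) * b l (p l) * (\<Prod>j\<in>UNIV - {i} - {l}. a j (p j)))) =
    (\<Sum>i\<in>UNIV. \<Sum>l\<in>UNIV - {i}. \<Sum>p | p permutes UNIV. of_int (sign p) *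
      (b i (p i) * b l (p l) * (\<Prod>j\<in>UNIV - {i} - {l}. a j (p j))))"
    unfolding sum_distrib_left by (subst sum.swap, intro sum.cong refl, rule sum.swap)
  also have "\<dots> = (\<Sum>i\<in>UNIV. \<Sum>l\<in>UNIV - {i}. \<Sum>p\<in>{id, Transposition.transpose i l}. of_int (sign p) *
      (b i (p i) * b l (p l) * (\<Prod>j\<in>UNIV - {i} - {l}. a j (p j))))"
  proof (rule sum.cong[OF refl], rule sum.cong[OF refl], rule sum.mono_neutral_right, goal_cases)
    case (3 i l)
    show ?case
    proof
    fix p assume
      p: "p \<in> {p. p permutes (UNIV :: 'n set)} - {id, Transposition.transpose i l}"
    then obtain j where "j \<noteq> i" "j \<noteq> l" "p j \<noteq> j" using permutes_two_moved[of p i l] 3 by auto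
    then show "of_int (sign p) * (b i (p i) * b l (p l) * (\<Prod>j\<in>UNIV - {i} - {l}. a j (p j))) = 0"
      using perm_product_0[where a = a and p = p and S = "{i, l}", OF a] by (simp add: Diff_insert2[symmetric] insert_commute)
    qed
  qed (auto simp: permutes_id permutes_swap_id)
  also have "\<dots> = (\<Sum>i\<in>UNIV. \<Sum>l\<in>UNIV - {i}. (b i i * b l l - b i l * b l i) * (\<Prod>j\<in>UNIV - {i} - {l}. a j j))"
  proof (intro sum.cong refl)
    fix i l :: 'n assume "l \<in> UNIV - {i}"
    then have il: "i \<noteq> l" by auto
    then have "id \<noteq> Transposition.transpose i l" by (metis id_apply transpose_apply_first)
    moreover have "(\<Prod>j\<in>UNIV - {i} - {l}. a j (Transposition.transpose i l j)) = (\<Prod>j\<in>UNIV - {i} - {l}. a j j)"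
      by (intro prod.cong) auto
    ultimately show "(\<Sum>p\<in>{id, Transposition.transpose i l}. of_int (sign p) *
      (b i (p i) * b l (p l) * (\<Prod>j\<in>UNIV - {i} - {l}. a j (p j)))) =
      (b i i * b l l - b i l * b l i) * (\<Prod>j\<in>UNIV - {i} - {l}. a j j)"
      using il by (simp add: sign_id sign_swap_id algebra_simps)
  qed
  finally show ?thesis .
qed

lemma J2_det:
  fixes M :: "real \<Rightarrow> real^'n^'n"
  assumes M: "\<And>i j. J2 (\<lambda>t. M t $ i $ j) (a i j) (b i j) (c i j)" and a: "\<forall>i j. i \<noteq> j \<longrightarrow> a i j = 0"
  shows "J2 (\<lambda>t. det (M t)) (\<Prod>i\<in>UNIV. a i i) (\<Sum>i\<in>UNIV. b i i * (\<Prod>j\<in>UNIV - {i}. a j j))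
    ((\<Sum>i\<in>UNIV. c i i * (\<Prod>j\<in>UNIV - {i}. a j j)) +
     (\<Sum>i\<in>UNIV. \<Sum>l\<in>UNIV - {i}. (b i i * b l l - b i l * b l i) * (\<Prod>j\<in>UNIV - {i} - {l}. a j j)))"
proof -
  have "J2 (\<lambda>t. det (M t))
    (\<Sum>p | p permutes UNIV. of_int (sign p) * (\<Prod>i\<in>UNIV. a i (p i)))
    (\<Sum>p | p permutes UNIV. of_int (sign p) * (\<Sum>i\<in>UNIV. b i (p i) * (\<Prod>j\<in>UNIV - {i}. a j (p j))))
    (\<Sum>p | p permutes UNIV. of_int (sign p) * ((\<Sum>i\<in>UNIV. c i (p i) * (\<Prod>j\<in>UNIV - {i}. a j (p j))) +
      (\<Sum>i\<in>UNIV. \<Sum>l\<in>UNIV - {i}. b i (p i) * b l (p l) * (\<Prod>j\<in>UNIV - {i} - {l}. a j (p j)))))"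
    unfolding det_def by (intro J2_sum J2_cmult J2_prod M finite)
  moreover have "(\<Sum>p | p permutes UNIV. of_int (sign p) * (\<Prod>i\<in>UNIV. a i (p i))) = (\<Prod>i\<in>UNIV. a i i)"
    using det_diagonal[of "\<chi> i j. a i j"] a by (simp add: det_def)
  ultimately show ?thesis
    unfolding distrib_left sum.distrib det_first_jet[where a = a and c = b, OF a] det_first_jet[where a = a and c = c, OF a]
      det_second_jet[where a = a and b = b, OF a] by simp
qed

lemma J2_pminor_sum:
  fixes M :: "real \<Rightarrow> real^'n^'n"
  assumes M: "\<And>i j. J2 (\<lambda>t. M t $ i $ j) (if i = j then a i else 0) (b i j) (c i j)"
  shows "J2 (\<lambda>t. pminor_sum (Suc k) (M t)) (esym (Suc k) UNIV a) (\<Sum>i\<in>UNIV. b i i * esym k (UNIV - {i}) a)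
    ((\<Sum>i\<in>UNIV. c i i * esym k (UNIV - {i}) a) +
     (\<Sum>i\<in>UNIV. \<Sum>l\<in>UNIV - {i}. (b i i * b l l - b i l * b l i) * esym_pred k (UNIV - {i} - {l}) a))"
proof -
  have "J2 (\<lambda>t. det (\<chi> i. if i \<in> I then M t $ i else axis i 1)) (\<Prod>i\<in>I. a i) (\<Sum>i\<in>I. b i i * (\<Prod>j\<in>I - {i}. a j))
    ((\<Sum>i\<in>I. c i i * (\<Prod>j\<in>I - {i}. a j)) +
     (\<Sum>i\<in>I. \<Sum>l\<in>I - {i}. (b i i * b l l - b i l * b l i) * (\<Prod>j\<in>I - {i} - {l}. a j)))" for I :: "'n set"
  proof -
    \<comment> \<open>Rows outside \<open>I\<close> are constant rows of the identity: diagonal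
      entry \<open>1\<close> and vanishing derivatives, so the matrix stays diagonal at
      \<open>t = 0\<close>.\<close>
    define a' b' c' where "a' i j = (if i = j then if i \<in> I then a i else 1 else 0)"
      and "b' i j = (if i \<in> I then b i j else 0)" and "c' i j = (if i \<in> I then c i j else 0)" for i j
    have prod: "(\<Prod>j\<in>UNIV - S. a' j j) = (\<Prod>j\<in>I - S. a j)" for S
    proof -
      have "(\<Prod>j\<in>UNIV - S. a' j j) = (\<Prod>j\<in>(UNIV - S) \<inter> I. a j)"
        by (simp add: a'_def prod.inter_restrict)
      also have "(UNIV - S) \<inter> I = I - S" by auto
      finally show ?thesis .
    qed
    have prod2: "(\<Prod>j\<in>UNIV - {i} - {l}. a' j j) = (\<Prod>j\<in>I - {i} - {l}. a j)" for i l
      using prod[of "{i, l}"] by (simp add: Diff_insert2[symmetric] insert_commute)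
    have sum: "(\<Sum>i\<in>UNIV - S. if i \<in> I then f i else 0) = (\<Sum>i\<in>I - S. f i)" for f :: "'n \<Rightarrow> real" and S
    proof -
      have "(\<Sum>i\<in>UNIV - S. if i \<in> I then f i else 0) = (\<Sum>i\<in>(UNIV - S) \<inter> I. f i)" by (simp add: sum.inter_restrict)
      also have "(UNIV - S) \<inter> I = I - S" by auto
      finally show ?thesis .
    qed
    have J: "J2 (\<lambda>t. (\<chi> i. if i \<in> I then M t $ i else axis i 1) $ i $ j) (a' i j) (b' i j) (c' i j)" for i j
      using M[of i j] J2_const[of "axis i 1 $ j"] by (auto simp: a'_def b'_def c'_def axis_def)
    have s1: "(\<Sum>i\<in>UNIV. d i i * (\<Prod>j\<in>UNIV - {i}. a' j j)) = (\<Sum>i\<in>I. e i i * (\<Prod>j\<in>I - {i}. a j))"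
      if "\<And>i j. d i j = (if i \<in> I then e i j else 0)" for d e :: "'n \<Rightarrow> 'n \<Rightarrow> real"
    proof -
      have "(\<Sum>i\<in>UNIV. d i i * (\<Prod>j\<in>UNIV - {i}. a' j j)) = (\<Sum>i\<in>UNIV - {}. if i \<in> I then e i i * (\<Prod>j\<in>I - {i}. a j) else 0)"
        unfolding prod that by (intro sum.cong) auto
      then show ?thesis unfolding sum by simp
    qed
    have s2: "(\<Sum>i\<in>UNIV. \<Sum>l\<in>UNIV - {i}. (b' i i * b' l l - b' i l * b' l i) * (\<Prod>j\<in>UNIV - {i} - {l}. a' j j)) =
      (\<Sum>i\<in>I. \<Sum>l\<in>I - {i}. (b i i * b l l - b i l * b l i) * (\<Prod>j\<in>I - {i} - {l}. a j))"
    proof -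
      have "(\<Sum>i\<in>UNIV. \<Sum>l\<in>UNIV - {i}. (b' i i * b' l l - b' i l * b' l i) * (\<Prod>j\<in>UNIV - {i} - {l}. a' j j)) =
        (\<Sum>i\<in>UNIV - {}. if i \<in> I then \<Sum>l\<in>UNIV - {i}. if l \<in> I then (b i i * b l l - b i l * b l i) * (\<Prod>j\<in>I - {i} - {l}. a j) else 0 else 0)"
        unfolding prod2 by (intro sum.cong) (auto simp: b'_def intro!: sum.cong split: if_splits)
      then show ?thesis unfolding sum by simp
    qed
    have p0: "(\<Prod>i\<in>UNIV. a' i i) = (\<Prod>i\<in>I. a i)" using prod[of "{}"] by simp
    have "\<forall>i j. i \<noteq> j \<longrightarrow> a' i j = 0" by (simp add: a'_def)
    from J2_det[OF J this] show ?thesis unfolding p0 s1[where d = b' and e = b, OF b'_def] s1[where d = c' and e = c, OF c'_def] s2 .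
  qed
  then have "J2 (\<lambda>t. pminor_sum (Suc k) (M t)) (\<Sum>I | I \<subseteq> UNIV \<and> card I = Suc k. \<Prod>i\<in>I. a i)
    (\<Sum>I | I \<subseteq> UNIV \<and> card I = Suc k. \<Sum>i\<in>I. b i i * (\<Prod>j\<in>I - {i}. a j))
    (\<Sum>I | I \<subseteq> UNIV \<and> card I = Suc k. (\<Sum>i\<in>I. c i i * (\<Prod>j\<in>I - {i}. a j)) +
     (\<Sum>i\<in>I. \<Sum>l\<in>I - {i}. (b i i * b l l - b i l * b l i) * (\<Prod>j\<in>I - {i} - {l}. a j)))"
    unfolding pminor_sum_def by (simp, intro J2_sum)
  then show ?thesis
    unfolding sum.distrib sum_subsets_remove1[OF finite] sum_subsets_remove2[OF finite]
      esym_def[symmetric] .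
qed

section \<open>Partial derivatives of functions of class \<open>C\<^sup>m\<close>\<close>

lemma frechet_derivative_cong_open:
  assumes "open U" "x \<in> U" "\<And>y. y \<in> U \<Longrightarrow> f y = g y"
  shows "frechet_derivative f (at x) = frechet_derivative g (at x)"
proof -
  have "(f has_derivative f') (at x) \<longleftrightarrow> (g has_derivative f') (at x)" for f'
    using assms has_derivative_transform_within_open[of f f' x UNIV U g]
      has_derivative_transform_within_open[of g f' x UNIV U f] by auto
  then show ?thesis unfolding frechet_derivative_def by simp
qed

lemma partial_d_interior: "x \<in> U \<Longrightarrow> partial_d U b f x = frechet_derivative f (at x) b"
  by (simp add: partial_d_def)

lemma partial_d_cong:
  assumes "open U" "x \<in> U" "\<And>y. y \<in> U \<Longrightarrow> f y = g y"
  shows "partial_d U b f x = partial_d U b g x"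
  using frechet_derivative_cong_open[OF assms] assms(2) by (simp add: partial_d_interior)

lemma partial_d_has_derivative:
  "x \<in> U \<Longrightarrow> f differentiable (at x) \<Longrightarrow> (f has_derivative (\<lambda>v. partial_d U v f x)) (at x)"
  by (simp add: partial_d_interior frechet_derivative_works[symmetric])

lemma partial_d_eqI: "x \<in> U \<Longrightarrow> (f has_derivative f') (at x) \<Longrightarrow> partial_d U v f x = f' v"
  using frechet_derivative_at[of f f' x] by (simp add: partial_d_interior)

lemma Ck_continuous: "Ck m U X f \<Longrightarrow> continuous_on X f"
  by (cases m) auto

lemma Ck_cong:
  assumes "open U"
  shows "(\<And>y. y \<in> U \<Longrightarrow> f y = g y) \<Longrightarrow> Ck m U U f \<Longrightarrow> Ck m U U g"
proof (induction m arbitrary: f g)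
  case 0
  then show ?case by (simp cong: continuous_on_cong)
next
  case (Suc m)
  have "continuous_on U g" using Suc.prems by (simp cong: continuous_on_cong)
  moreover have "g differentiable (at x)" if "x \<in> U" for x
  proof -
    have "(f has_derivative (\<lambda>v. partial_d U v f x)) (at x)"
      using Suc.prems(2) that by (intro partial_d_has_derivative) auto
    then have "(g has_derivative (\<lambda>v. partial_d U v f x)) (at x)"
      using has_derivative_transform_within_open[OF _ assms that] Suc.prems(1) by auto
    then show ?thesis by (rule differentiableI)
  qed
  moreover have "Ck m U U (partial_d U b g)" if "b \<in> Basis" for b
    by (rule Suc.IH[of "partial_d U b f"])
      (use Suc.prems that partial_d_cong[OF assms, of _ f g] in auto)
  ultimately show ?case by simp
qed

lemma Ck_Suc_imp: "Ck (Suc m) U X f \<Longrightarrow> Ck m U X f"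
proof (induction m arbitrary: f)
  case (Suc m)
  then show ?case unfolding Ck.simps(2)[of "Suc m"] Ck.simps(2)[of m] by blast
qed simp

lemma Ck_le: "Ck m U X f \<Longrightarrow> j \<le> m \<Longrightarrow> Ck j U X f"
  by (induction m) (auto simp: le_Suc_eq simp del: Ck.simps dest: Ck_Suc_imp)

lemma Ck_subset: "Ck m U X f \<Longrightarrow> Y \<subseteq> X \<Longrightarrow> Ck m U Y f"
  by (induction m arbitrary: f) (auto intro: continuous_on_subset)

lemma Ck_differentiable: "Ck m U X f \<Longrightarrow> 1 \<le> m \<Longrightarrow> x \<in> U \<Longrightarrow> f differentiable (at x)"
  by (cases m) auto

lemma partial_d_linear:
  assumes "x \<in> U" "f differentiable (at x)"
  shows "partial_d U (\<Sum>i\<in>I. c i *\<^sub>R v i) f x = (\<Sum>i\<in>I. c i * partial_d U (v i) f x)"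
proof -
  have lin: "linear (\<lambda>v. partial_d U v f x)"
    using partial_d_has_derivative[OF assms] by (rule has_derivative_linear)
  show ?thesis using linear_sum[OF lin, of "\<lambda>i. c i *\<^sub>R v i" I] by (simp add: linear_cmul[OF lin])
qed

lemma partial_d_lincomb:
  assumes "x \<in> U" "\<And>i. i \<in> I \<Longrightarrow> f i differentiable (at x)"
  shows "partial_d U v (\<lambda>y. \<Sum>i\<in>I. c i * f i y) x = (\<Sum>i\<in>I. c i * partial_d U v (f i) x)"
  by (rule partial_d_eqI[OF assms(1)])
    (intro has_derivative_sum has_derivative_mult_right partial_d_has_derivative assms)

lemma Ck_lincomb:
  assumes "open U" "finite I"
  shows "(\<And>i. i \<in> I \<Longrightarrow> Ck m U U (f i)) \<Longrightarrow> Ck m U U (\<lambda>y. \<Sum>i\<in>I. c i * f i y)"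
proof (induction m arbitrary: f)
  case 0
  then show ?case by (auto intro!: continuous_intros)
next
  case (Suc m)
  have "Ck m U U (partial_d U b (\<lambda>y. \<Sum>i\<in>I. c i * f i y))" if b: "b \<in> Basis" for b
  proof (rule Ck_cong[OF assms(1)])
    show "Ck m U U (\<lambda>y. \<Sum>i\<in>I. c i * partial_d U b (f i) y)"
      by (rule Suc.IH) (use Suc.prems b in auto)
    show "(\<Sum>i\<in>I. c i * partial_d U b (f i) y) = partial_d U b (\<lambda>y. \<Sum>i\<in>I. c i * f i y) y" if "y \<in> U" for y
      by (rule partial_d_lincomb[symmetric]) (use Suc.prems that in auto)
  qed
  moreover have "(\<lambda>y. \<Sum>i\<in>I. c i * f i y) differentiable (at x)" if "x \<in> U" for x
    using Suc.prems that assms(2) by (intro differentiable_sum differentiable_mult) auto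
  moreover have "continuous_on U (\<lambda>y. \<Sum>i\<in>I. c i * f i y)"
    using Suc.prems by (auto intro!: continuous_intros)
  ultimately show ?case by simp
qed

lemma partial_d_basis:
  assumes "x \<in> U" "f differentiable (at x)"
  shows "partial_d U v f x = (\<Sum>b\<in>Basis. (v \<bullet> b) * partial_d U b f x)"
  using partial_d_linear[OF assms, of "\<lambda>b. v \<bullet> b" "\<lambda>b. b" Basis] by (simp add: euclidean_representation)

text \<open>\<open>Ck\<close> speaks of basis directions only, whereas eigenframes need all
  directions; they are reached by linearity.\<close>

lemma Ck_partial_d:
  assumes "open U" "Ck (Suc m) U U f"
  shows "Ck m U U (partial_d U v f)"
proof (rule Ck_cong[OF assms(1)])
  show "Ck m U U (\<lambda>y. \<Sum>b\<in>Basis. (v \<bullet> b) * partial_d U b f y)"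
    using assms by (intro Ck_lincomb) auto
  show "(\<Sum>b\<in>Basis. (v \<bullet> b) * partial_d U b f y) = partial_d U v f y" if "y \<in> U" for y
    using partial_d_basis[of y U f v] assms that by simp
qed

lemma partial_d_chain:
  assumes "\<gamma> t \<in> U" "f differentiable (at (\<gamma> t))" "(\<gamma> has_vector_derivative v) (at t)"
  shows "((\<lambda>s. f (\<gamma> s)) has_real_derivative partial_d U v f (\<gamma> t)) (at t)"
proof -
  have D: "(f has_derivative (\<lambda>v. partial_d U v f (\<gamma> t))) (at (\<gamma> t))"
    using assms by (intro partial_d_has_derivative)
  have lin: "linear (\<lambda>v. partial_d U v f (\<gamma> t))" using D by (rule has_derivative_linear)
  have "((\<lambda>s. f (\<gamma> s)) has_derivative (\<lambda>s. partial_d U (s *\<^sub>R v) f (\<gamma> t))) (at t)"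
    using has_derivative_compose[OF assms(3)[unfolded has_vector_derivative_def] D] .
  then show ?thesis
    unfolding has_field_derivative_def by (simp add: linear_cmul[OF lin] mult.commute[of _ "partial_d U v f (\<gamma> t)"])
qed

section \<open>Symmetry of second derivatives and the second-order chain rule\<close>

lemma second_difference_mvt:
  assumes U: "open U" and f: "Ck 2 U U f" and t: "t > 0"
    and sub: "\<And>r s. 0 \<le> r \<Longrightarrow> r \<le> t \<Longrightarrow> 0 \<le> s \<Longrightarrow> s \<le> t \<Longrightarrow> x + r *\<^sub>R v + s *\<^sub>R w \<in> U"
  obtains r s where "0 \<le> r" "r \<le> t" "0 \<le> s" "s \<le> t"
    "f (x + t *\<^sub>R v + t *\<^sub>R w) - f (x + t *\<^sub>R v) - f (x + t *\<^sub>R w) + f x =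
      t\<^sup>2 * partial_d U w (partial_d U v f) (x + r *\<^sub>R v + s *\<^sub>R w)"
proof -
  define F where "F r = f (x + r *\<^sub>R v + t *\<^sub>R w) - f (x + r *\<^sub>R v)" for r
  have df: "f differentiable (at y)" if "y \<in> U" for y using f that by (auto simp: numeral_2_eq_2)
  have C1: "Ck 1 U U (partial_d U v f)" using Ck_partial_d[OF U, of 1 f v] f by (simp add: numeral_2_eq_2)
  then have df': "partial_d U v f differentiable (at y)" if "y \<in> U" for y using that by auto
  have dF: "(F has_real_derivative (partial_d U v f (x + r *\<^sub>R v + t *\<^sub>R w) - partial_d U v f (x + r *\<^sub>R v))) (at r)"
    if "0 \<le> r" "r \<le> t" for r
    unfolding F_def
  proof (rule DERIV_diff)
    show "((\<lambda>r. f (x + r *\<^sub>R v + t *\<^sub>R w)) has_real_derivative partial_d U v f (x + r *\<^sub>R v + t *\<^sub>R w)) (at r)"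
      by (rule partial_d_chain) (use sub[of r t] that t df in \<open>auto intro!: derivative_eq_intros\<close>)
    show "((\<lambda>r. f (x + r *\<^sub>R v)) has_real_derivative partial_d U v f (x + r *\<^sub>R v)) (at r)"
      by (rule partial_d_chain) (use sub[of r 0] that t df in \<open>auto intro!: derivative_eq_intros\<close>)
  qed
  obtain r where r: "0 < r" "r < t" and F: "F t - F 0 = (t - 0) * (partial_d U v f (x + r *\<^sub>R v + t *\<^sub>R w) - partial_d U v f (x + r *\<^sub>R v))"
    using MVT2[OF t, of F "\<lambda>r. partial_d U v f (x + r *\<^sub>R v + t *\<^sub>R w) - partial_d U v f (x + r *\<^sub>R v)"] dF by blast
  define G where "G s = partial_d U v f (x + r *\<^sub>R v + s *\<^sub>R w)" for s
  have dG: "(G has_real_derivative partial_d U w (partial_d U v f) (x + r *\<^sub>R v + s *\<^sub>R w)) (at s)"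
    if "0 \<le> s" "s \<le> t" for s
    unfolding G_def
    by (rule partial_d_chain[where f = "partial_d U v f"]) (use sub[of r s] that r df' in \<open>auto intro!: derivative_eq_intros\<close>)
  obtain s where s: "0 < s" "s < t" and G: "G t - G 0 = (t - 0) * partial_d U w (partial_d U v f) (x + r *\<^sub>R v + s *\<^sub>R w)"
    using MVT2[OF t, of G "\<lambda>s. partial_d U w (partial_d U v f) (x + r *\<^sub>R v + s *\<^sub>R w)"] dG by blast
  show thesis
    by (rule that[of r s]) (use r s F G in \<open>auto simp: F_def G_def power2_eq_square algebra_simps\<close>)
qed

text \<open>Both mixed derivatives, taken at points near \<open>x\<close>, equal the same second
  difference divided by \<open>t\<^sup>2\<close>; continuity brings them to
  \<open>x\<close>.\<close>

lemma partial_d_commute: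
  assumes U: "open U" and f: "Ck 2 U U f" and x: "x \<in> U"
  shows "partial_d U v (partial_d U w f) x = partial_d U w (partial_d U v f) x"
proof (rule ccontr)
  let ?A = "partial_d U v (partial_d U w f)" and ?B = "partial_d U w (partial_d U v f)"
  assume ne: "?A x \<noteq> ?B x"
  define e where "e = \<bar>?A x - ?B x\<bar> / 2"
  have e: "e > 0" using ne by (simp add: e_def)
  have lim: "(partial_d U a (partial_d U b f) \<longlongrightarrow> partial_d U a (partial_d U b f) x) (nhds x)" for a b
  proof -
    have "Ck 1 U U (partial_d U b f)" using Ck_partial_d[OF U, of 1 f b] f by (simp add: numeral_2_eq_2)
    then have "Ck 0 U U (partial_d U a (partial_d U b f))" using Ck_partial_d[OF U, of 0 "partial_d U b f" a] by simp
    then have "isCont (partial_d U a (partial_d U b f)) x" using U x by (simp add: continuous_on_eq_continuous_at)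
    then show ?thesis using tendsto_at_iff_tendsto_nhds[of "partial_d U a (partial_d U b f)" x] by (simp add: isCont_def)
  qed
  have "\<forall>\<^sub>F y in nhds x. dist (?A y) (?A x) < e" "\<forall>\<^sub>F y in nhds x. dist (?B y) (?B x) < e"
    by (rule tendstoD[OF lim e])+
  moreover have "\<forall>\<^sub>F y in nhds x. y \<in> U" using U x by (rule eventually_nhds_in_open)
  ultimately have "\<forall>\<^sub>F y in nhds x. y \<in> U \<and> dist (?A y) (?A x) < e \<and> dist (?B y) (?B x) < e"
    by eventually_elim auto
  then obtain d where d: "d > 0"
    "\<And>y. dist y x < d \<Longrightarrow> y \<in> U \<and> dist (?A y) (?A x) < e \<and> dist (?B y) (?B x) < e"
    unfolding eventually_nhds_metric by blast
  \<comment> \<open>Steps of length at most \<open>t\<close> in the directions \<open>v\<close> and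
    \<open>w\<close> stay within \<open>d / 2\<close> of \<open>x\<close>; the summand
    \<open>1\<close> guards against two zero directions.\<close>
  define t where "t = d / (norm v + norm w + 1) / 2"
  have nv: "norm v + norm w + 1 > 0" using norm_ge_zero[of v] norm_ge_zero[of w] by linarith
  have t: "t > 0" using d(1) nv by (simp add: t_def)
  have near: "dist (x + r *\<^sub>R v' + s *\<^sub>R w') x < d"
    if "0 \<le> r" "r \<le> t" "0 \<le> s" "s \<le> t" "norm v' + norm w' \<le> norm v + norm w" for r s v' w'
  proof -
    have "dist (x + r *\<^sub>R v' + s *\<^sub>R w') x \<le> r * norm v' + s * norm w'"
      using norm_triangle_ineq[of "r *\<^sub>R v'" "s *\<^sub>R w'"] that by (simp add: dist_norm add.assoc)
    also have "\<dots> \<le> t * norm v' + t * norm w'" using that by (intro add_mono mult_right_mono) auto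
    also have "\<dots> = t * (norm v' + norm w')" by (simp add: algebra_simps)
    also have "\<dots> \<le> t * (norm v + norm w + 1)" using that t by (intro mult_left_mono) auto
    also have "\<dots> = d / 2" using nv unfolding t_def by (simp add: field_simps)
    finally show ?thesis using d(1) by linarith
  qed
  obtain r s where rs: "0 \<le> r" "r \<le> t" "0 \<le> s" "s \<le> t"
    "f (x + t *\<^sub>R v + t *\<^sub>R w) - f (x + t *\<^sub>R v) - f (x + t *\<^sub>R w) + f x = t\<^sup>2 * ?B (x + r *\<^sub>R v + s *\<^sub>R w)"
    using second_difference_mvt[OF U f t, of x v w] near d(2) by blast
  obtain r' s' where rs': "0 \<le> r'" "r' \<le> t" "0 \<le> s'" "s' \<le> t"
    "f (x + t *\<^sub>R w + t *\<^sub>R v) - f (x + t *\<^sub>R w) - f (x + t *\<^sub>R v) + f x = t\<^sup>2 * ?A (x + r' *\<^sub>R w + s' *\<^sub>R v)"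
    using second_difference_mvt[OF U f t, of x w v] near[of _ _ w v] d(2) by (auto simp: add.commute)
  have "?B (x + r *\<^sub>R v + s *\<^sub>R w) = ?A (x + r' *\<^sub>R w + s' *\<^sub>R v)"
    using rs(5) rs'(5) t by (simp add: algebra_simps)
  moreover have "dist (?B (x + r *\<^sub>R v + s *\<^sub>R w)) (?B x) < e" using d(2)[OF near[of r s v w]] rs by auto
  moreover have "dist (?A (x + r' *\<^sub>R w + s' *\<^sub>R v)) (?A x) < e" using d(2)[OF near[of r' s' w v]] rs' by auto
  ultimately have "\<bar>?A x - ?B x\<bar> < 2 * e" by (simp add: dist_real_def)
  then show False by (simp add: e_def)
qed

text \<open>Only jets of the coordinates are demanded, because the curve to which this is applied is
  \<open>t \<mapsto> (x, Du(x))\<close> along a line, whose smoothness is that of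
  \<open>Du\<close>.\<close>

lemma J2_along_curve:
  fixes f :: "'a::euclidean_space \<Rightarrow> real"
  assumes U: "open U" and f: "Ck 2 U U f" and z: "z \<in> U"
    and J: "\<And>b. b \<in> Basis \<Longrightarrow> J2 (\<lambda>t. \<gamma> t \<bullet> b) (z \<bullet> b) (g1 \<bullet> b) (g2 \<bullet> b)"
  shows "J2 (\<lambda>t. f (\<gamma> t)) (f z) (partial_d U g1 f z) (partial_d U g1 (partial_d U g1 f) z + partial_d U g2 f z)"
proof -
  have "\<forall>b\<in>Basis. \<exists>d. (\<forall>\<^sub>F t in nhds 0. ((\<lambda>t. \<gamma> t \<bullet> b) has_real_derivative d t) (at t)) \<and> d 0 = g1 \<bullet> b \<and>
    (d has_real_derivative g2 \<bullet> b) (at 0)"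
    using J unfolding J2_def by blast
  from bchoice[OF this] obtain d where d: "\<And>b. b \<in> Basis \<Longrightarrow> \<forall>\<^sub>F t in nhds 0. ((\<lambda>t. \<gamma> t \<bullet> b) has_real_derivative d b t) (at t)"
    "\<And>b. b \<in> Basis \<Longrightarrow> d b 0 = g1 \<bullet> b" "\<And>b. b \<in> Basis \<Longrightarrow> (d b has_real_derivative g2 \<bullet> b) (at 0)"
    by blast
  have g0: "\<gamma> 0 = z" by (rule euclidean_eqI) (rule J2_value[OF J])
  have vd: "(\<gamma> has_vector_derivative (\<Sum>b\<in>Basis. d b t *\<^sub>R b)) (at t)"
    if "\<forall>b\<in>Basis. ((\<lambda>t. \<gamma> t \<bullet> b) has_real_derivative d b t) (at t)" for t
  proof -
    have "((\<lambda>s. \<Sum>b\<in>Basis. (\<gamma> s \<bullet> b) *\<^sub>R b) has_vector_derivative (\<Sum>b\<in>Basis. d b t *\<^sub>R b)) (at t)"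
    proof (rule has_vector_derivative_sum)
      fix b :: 'a assume "b \<in> Basis"
      then have "((\<lambda>t. \<gamma> t \<bullet> b) has_real_derivative d b t) (at t)" using that by blast
      from has_vector_derivative_scaleR[OF this has_vector_derivative_const[of b]]
      show "((\<lambda>s. (\<gamma> s \<bullet> b) *\<^sub>R b) has_vector_derivative d b t *\<^sub>R b) (at t)" by simp
    qed
    then show ?thesis by (simp add: euclidean_representation)
  qed
  have ev: "\<forall>\<^sub>F t in nhds 0. \<forall>b\<in>Basis. ((\<lambda>t. \<gamma> t \<bullet> b) has_real_derivative d b t) (at t)"
    using d(1) by (intro eventually_ball_finite) auto
  have g1: "(\<Sum>b\<in>Basis. d b 0 *\<^sub>R b) = g1" using d(2) by (simp add: euclidean_representation cong: sum.cong)
  have vd0: "(\<gamma> has_vector_derivative g1) (at 0)" using vd[OF eventually_nhds_x_imp_x[OF ev]] g1 by simp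
  have "isCont \<gamma> 0" using vd0 by (rule has_vector_derivative_continuous)
  then have "filterlim \<gamma> (nhds z) (nhds 0)" using g0 tendsto_at_iff_tendsto_nhds[of \<gamma> 0] by (simp add: isCont_def)
  then have evU: "\<forall>\<^sub>F t in nhds 0. \<gamma> t \<in> U" using U z by (rule topological_tendstoD)
  have df: "f differentiable (at y)" if "y \<in> U" for y using f that by (auto simp: numeral_2_eq_2)
  have dfb: "partial_d U b f differentiable (at y)" if "y \<in> U" for y b
    using Ck_partial_d[OF U, of 1 f b] f that by (auto simp: numeral_2_eq_2)
  have "\<forall>\<^sub>F t in nhds 0. ((\<lambda>t. f (\<gamma> t)) has_real_derivative (\<Sum>b\<in>Basis. d b t * partial_d U b f (\<gamma> t))) (at t)"
    using ev evU
  proof eventually_elim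
    case (elim t)
    have "((\<lambda>t. f (\<gamma> t)) has_real_derivative partial_d U (\<Sum>b\<in>Basis. d b t *\<^sub>R b) f (\<gamma> t)) (at t)"
      by (rule partial_d_chain[OF elim(2) df[OF elim(2)] vd[OF elim(1)]])
    then show ?case by (simp add: partial_d_linear[OF elim(2) df[OF elim(2)]])
  qed
  moreover have "((\<lambda>t. \<Sum>b\<in>Basis. d b t * partial_d U b f (\<gamma> t)) has_real_derivative
    (\<Sum>b\<in>Basis. d b 0 * partial_d U g1 (partial_d U b f) (\<gamma> 0) + (g2 \<bullet> b) * partial_d U b f (\<gamma> 0))) (at 0)"
  proof (rule DERIV_sum)
    fix b :: 'a assume b: "b \<in> Basis"
    have "((\<lambda>t. partial_d U b f (\<gamma> t)) has_real_derivative partial_d U g1 (partial_d U b f) (\<gamma> 0)) (at 0)"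
      by (rule partial_d_chain[where f = "partial_d U b f", OF _ dfb vd0]) (use z g0 in auto)
    from DERIV_mult'[OF d(3)[OF b] this]
    show "((\<lambda>t. d b t * partial_d U b f (\<gamma> t)) has_real_derivative
      d b 0 * partial_d U g1 (partial_d U b f) (\<gamma> 0) + (g2 \<bullet> b) * partial_d U b f (\<gamma> 0)) (at 0)" .
  qed
  moreover have "(\<Sum>b\<in>Basis. d b 0 * partial_d U g1 (partial_d U b f) (\<gamma> 0) + (g2 \<bullet> b) * partial_d U b f (\<gamma> 0)) =
    partial_d U g1 (partial_d U g1 f) z + partial_d U g2 f z"
  proof -
    have "partial_d U g1 (partial_d U g1 f) z = partial_d U g1 (\<lambda>y. \<Sum>b\<in>Basis. (g1 \<bullet> b) * partial_d U b f y) z"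
      by (rule partial_d_cong[OF U z]) (use df in \<open>auto intro: partial_d_basis\<close>)
    also have "\<dots> = (\<Sum>b\<in>Basis. (g1 \<bullet> b) * partial_d U g1 (partial_d U b f) z)"
      by (rule partial_d_lincomb[OF z]) (use dfb z in auto)
    finally show ?thesis using d(2) by (simp add: g0 sum.distrib partial_d_basis[OF z df[OF z], of g2])
  qed
  moreover have "(\<Sum>b\<in>Basis. d b 0 * partial_d U b f (\<gamma> 0)) = partial_d U g1 f z"
    using d(2) by (simp add: g0 partial_d_basis[OF z df[OF z], of g1])
  ultimately show ?thesis
    by (intro J2_I[where g = "\<lambda>t. \<Sum>b\<in>Basis. d b t * partial_d U b f (\<gamma> t)"]) (auto simp: g0)
qed

lemma J2_along_line:
  fixes f :: "'a::euclidean_space \<Rightarrow> real"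
  assumes "open U" "Ck 2 U U f" "x \<in> U"
  shows "J2 (\<lambda>t. f (x + t *\<^sub>R v)) (f x) (partial_d U v f x) (partial_d U v (partial_d U v f) x)"
proof -
  have "J2 (\<lambda>t. (x + t *\<^sub>R v) \<bullet> b) (x \<bullet> b) (v \<bullet> b) (0 \<bullet> b)" for b
    using J2_affine[of "x \<bullet> b" "v \<bullet> b"] by (simp add: inner_add_left)
  from J2_along_curve[OF assms this]
  have "J2 (\<lambda>t. f (x + t *\<^sub>R v)) (f x) (partial_d U v f x) (partial_d U v (partial_d U v f) x + partial_d U 0 f x)" .
  moreover have "partial_d U 0 f x = 0"
    using assms by (subst partial_d_basis) (auto simp: numeral_2_eq_2)
  ultimately show ?thesis by simp
qed

lemma partial_d2_expand:
  fixes f :: "'a::euclidean_space \<Rightarrow> real"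
  assumes U: "open U" and f: "Ck 2 U U f" and x: "x \<in> U"
  shows "partial_d U (\<Sum>i\<in>I. c i *\<^sub>R v i) (partial_d U (\<Sum>j\<in>J. d j *\<^sub>R w j) f) x =
    (\<Sum>i\<in>I. \<Sum>j\<in>J. c i * d j * partial_d U (v i) (partial_d U (w j) f) x)"
proof -
  have df: "f differentiable (at y)" if "y \<in> U" for y using f that by (auto simp: numeral_2_eq_2)
  have dfb: "partial_d U b f differentiable (at y)" if "y \<in> U" for y b
    using Ck_partial_d[OF U, of 1 f b] f that by (auto simp: numeral_2_eq_2)
  have "partial_d U u (partial_d U (\<Sum>j\<in>J. d j *\<^sub>R w j) f) x = (\<Sum>j\<in>J. d j * partial_d U u (partial_d U (w j) f) x)" for u
  proof -
    have "partial_d U u (partial_d U (\<Sum>j\<in>J. d j *\<^sub>R w j) f) x = partial_d U u (\<lambda>y. \<Sum>j\<in>J. d j * partial_d U (w j) f y) x"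
      by (intro partial_d_cong[OF U x] partial_d_linear df)
    also have "\<dots> = (\<Sum>j\<in>J. d j * partial_d U u (partial_d U (w j) f) x)"
      by (rule partial_d_lincomb[OF x]) (use dfb x in auto)
    finally show ?thesis .
  qed
  then show ?thesis
    unfolding partial_d_linear[OF x dfb[OF x]] by (simp add: sum_distrib_left mult.assoc)
qed

text \<open>Continuity up to the boundary bounds the derivatives in basis directions on all of
  \<open>K\<close>; general directions are expanded in the basis only at points of \<open>U\<close>,
  where \<open>f\<close> is differentiable.\<close>

lemma partial_d_bounds:
  fixes f :: "'a::euclidean_space \<Rightarrow> real"
  assumes U: "open U" "U \<subseteq> X" and f: "Ck 2 U X f" and K: "compact K" "K \<subseteq> X"
  obtains C where "C \<ge> 0" "\<And>z. z \<in> K \<Longrightarrow> \<bar>f z\<bar> \<le> C"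
    "\<And>z v. z \<in> K \<inter> U \<Longrightarrow> \<bar>partial_d U v f z\<bar> \<le> C * norm v"
    "\<And>z v w. z \<in> K \<inter> U \<Longrightarrow> \<bar>partial_d U v (partial_d U w f) z\<bar> \<le> C * norm v * norm w"
proof -
  have bd: "\<exists>C. \<forall>z\<in>K. \<bar>g z\<bar> \<le> C" if "continuous_on X g" for g :: "'a \<Rightarrow> real"
  proof -
    have "compact (g ` K)" using that K by (intro compact_continuous_image continuous_on_subset[OF that])
    from compact_imp_bounded[OF this] show ?thesis by (simp add: bounded_real)
  qed
  obtain C0 where C0: "\<And>z. z \<in> K \<Longrightarrow> \<bar>f z\<bar> \<le> C0" using bd f Ck_continuous by blast
  have "\<forall>b\<in>Basis. \<exists>C. \<forall>z\<in>K. \<bar>partial_d U b f z\<bar> \<le> C"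
    using f by (auto intro!: bd simp: numeral_2_eq_2)
  then obtain C1 where C1: "\<And>b z. b \<in> Basis \<Longrightarrow> z \<in> K \<Longrightarrow> \<bar>partial_d U b f z\<bar> \<le> C1 b" by metis
  have "\<forall>b\<in>Basis. \<forall>c\<in>Basis. \<exists>C. \<forall>z\<in>K. \<bar>partial_d U b (partial_d U c f) z\<bar> \<le> C"
    using f by (auto intro!: bd simp: numeral_2_eq_2)
  then obtain C2 where C2: "\<And>b c z. b \<in> Basis \<Longrightarrow> c \<in> Basis \<Longrightarrow> z \<in> K \<Longrightarrow> \<bar>partial_d U b (partial_d U c f) z\<bar> \<le> C2 b c" by metis
  define C where "C = \<bar>C0\<bar> + (\<Sum>b\<in>Basis. \<bar>C1 b\<bar>) + (\<Sum>b\<in>Basis. \<Sum>c\<in>Basis. \<bar>C2 b c\<bar>)"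
  have nn: "(\<Sum>b\<in>Basis. \<bar>C1 b\<bar>) \<ge> 0" "(\<Sum>b\<in>Basis. \<Sum>c\<in>Basis. \<bar>C2 b c\<bar>) \<ge> 0" by (auto intro!: sum_nonneg)
  have f': "Ck 2 U U f" using f U(2) by (rule Ck_subset)
  have df: "f differentiable (at y)" if "y \<in> U" for y using f that by (auto simp: numeral_2_eq_2)
  show thesis
  proof (rule that[of C])
    show "C \<ge> 0" using nn by (simp add: C_def)
    show "\<bar>f z\<bar> \<le> C" if "z \<in> K" for z unfolding C_def using C0[OF that] nn by linarith
    show "\<bar>partial_d U v f z\<bar> \<le> C * norm v" if z: "z \<in> K \<inter> U" for z v
    proof -
      have "\<bar>partial_d U v f z\<bar> = \<bar>\<Sum>b\<in>Basis. (v \<bullet> b) * partial_d U b f z\<bar>"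
        using z df by (subst partial_d_basis) auto
      also have "\<dots> \<le> (\<Sum>b\<in>Basis. \<bar>(v \<bullet> b) * partial_d U b f z\<bar>)" by (rule sum_abs)
      also have "\<dots> \<le> (\<Sum>b\<in>Basis. norm v * \<bar>C1 b\<bar>)"
      proof (rule sum_mono)
        fix b :: 'a assume b: "b \<in> Basis"
        show "\<bar>(v \<bullet> b) * partial_d U b f z\<bar> \<le> norm v * \<bar>C1 b\<bar>"
          unfolding abs_mult using C1[OF b, of z] z Basis_le_norm[OF b, of v] by (intro mult_mono) auto
      qed
      also have "\<dots> \<le> C * norm v" unfolding sum_distrib_left[symmetric]
        using nn by (subst mult.commute, intro mult_right_mono) (auto simp: C_def)
      finally show ?thesis .
    qed
    show "\<bar>partial_d U v (partial_d U w f) z\<bar> \<le> C * norm v * norm w" if z: "z \<in> K \<inter> U" for z v w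
    proof -
      have "partial_d U v (partial_d U w f) z =
        partial_d U (\<Sum>b\<in>Basis. (v \<bullet> b) *\<^sub>R b) (partial_d U (\<Sum>b\<in>Basis. (w \<bullet> b) *\<^sub>R b) f) z"
        by (simp only: euclidean_representation)
      also have "\<dots> = (\<Sum>b\<in>Basis. \<Sum>c\<in>Basis. (v \<bullet> b) * (w \<bullet> c) * partial_d U b (partial_d U c f) z)"
        using z by (intro partial_d2_expand U(1) f') auto
      finally have "\<bar>partial_d U v (partial_d U w f) z\<bar> \<le>
        (\<Sum>b\<in>Basis. \<bar>\<Sum>c\<in>Basis. (v \<bullet> b) * (w \<bullet> c) * partial_d U b (partial_d U c f) z\<bar>)" by (simp only: sum_abs)
      also have "\<dots> \<le> (\<Sum>b\<in>Basis. \<Sum>c\<in>Basis. \<bar>(v \<bullet> b) * (w \<bullet> c) * partial_d U b (partial_d U c f) z\<bar>)"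
        by (intro sum_mono sum_abs)
      also have "\<dots> \<le> (\<Sum>b\<in>Basis. \<Sum>c\<in>Basis. norm v * norm w * \<bar>C2 b c\<bar>)"
      proof (intro sum_mono)
        fix b c :: 'a assume b: "b \<in> Basis" and c: "c \<in> Basis"
        show "\<bar>(v \<bullet> b) * (w \<bullet> c) * partial_d U b (partial_d U c f) z\<bar> \<le> norm v * norm w * \<bar>C2 b c\<bar>"
          unfolding abs_mult using C2[OF b c, of z] z Basis_le_norm[OF b, of v] Basis_le_norm[OF c, of w]
          by (intro mult_mono) auto
      qed
      also have "\<dots> = norm v * norm w * (\<Sum>b\<in>Basis. \<Sum>c\<in>Basis. \<bar>C2 b c\<bar>)" by (simp add: sum_distrib_left)
      also have "\<dots> \<le> norm v * norm w * C" using nn by (intro mult_left_mono) (auto simp: C_def)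
      finally show ?thesis by (simp add: mult_ac)
    qed
  qed
qed

section \<open>The inequality at a maximum point\<close>

text \<open>The quadratic gradient term \<open>\<Sum> \<sigma>\<^sub>i \<phi>\<^sub>i\<^sup>2\<close> is compensated by the concavity terms
  \<open>(\<sigma>\<^sub>i - \<sigma>\<^sub>m) / (\<lambda>\<^sub>m - \<lambda>\<^sub>i)\<close> in the directions with \<open>\<lambda>\<^sub>i \<ge> - \<lambda>\<^sub>m / 2\<close>; in the remaining directions
  \<open>\<lambda>\<^sub>i\<^sup>2\<close> is comparable with \<open>\<lambda>\<^sub>m\<^sup>2\<close>.\<close>

lemma third_order_single:
  fixes s sm l lm S w f e C N \<kappa>1 \<kappa>2 :: real
  assumes pos: "s > 0" "sm > 0" "lm \<ge> 1" "S \<ge> 0" "C \<ge> 1" "N \<ge> 1" "\<kappa>1 \<ge> 0" "\<kappa>2 \<ge> 0"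
    and l: "l \<le> lm" "\<bar>l\<bar> \<le> N * lm"
    and S: "(lm - l) * S = s - sm"
    and w: "\<bar>w + lm * f\<bar> \<le> C * (1 + lm)"
    and f: "\<bar>f\<bar> \<le> C * (\<kappa>1 * (\<bar>l\<bar> + 1) + \<kappa>2)"
  shows "s * f\<^sup>2 - 2 / lm * (S * w\<^sup>2) \<le>
    16 * C\<^sup>2 * (N + 1)\<^sup>2 * ((\<kappa>1\<^sup>2 + \<kappa>2\<^sup>2 / lm\<^sup>2) * (sm * lm\<^sup>2 + s * l\<^sup>2) + (\<kappa>1\<^sup>2 + 1) * s)"
proof -
  define D where "D = 16 * C\<^sup>2 * (N + 1)\<^sup>2"
  have lm0: "lm > 0" using pos by linarith
  have N1: "(N + 1)\<^sup>2 \<ge> 1" using one_le_power[of "N + 1" 2] pos by linarith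
  have C1: "C\<^sup>2 \<ge> 1" using one_le_power[of C 2] pos by linarith
  have D16: "D \<ge> 16 * C\<^sup>2" unfolding D_def using N1 C1 by (simp add: mult_le_cancel_left1)
  have D0: "D \<ge> 0" by (simp add: D_def)
  have f2: "f\<^sup>2 \<le> C\<^sup>2 * (2 * \<kappa>1\<^sup>2 * (\<bar>l\<bar> + 1)\<^sup>2 + 2 * \<kappa>2\<^sup>2)"
  proof -
    have "f\<^sup>2 \<le> (C * (\<kappa>1 * (\<bar>l\<bar> + 1) + \<kappa>2))\<^sup>2" using f by (metis abs_ge_zero power2_abs power_mono)
    also have "\<dots> = C\<^sup>2 * (\<kappa>1 * (\<bar>l\<bar> + 1) + \<kappa>2)\<^sup>2" by (rule power_mult_distrib)
    also have "\<dots> \<le> C\<^sup>2 * (2 * \<kappa>1\<^sup>2 * (\<bar>l\<bar> + 1)\<^sup>2 + 2 * \<kappa>2\<^sup>2)"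
    proof (rule mult_left_mono)
      have "(a + b)\<^sup>2 \<le> 2 * a\<^sup>2 + 2 * b\<^sup>2" for a b :: real
        using zero_le_power2[of "a - b"] by (simp add: power2_eq_square algebra_simps)
      from this[of "\<kappa>1 * (\<bar>l\<bar> + 1)" \<kappa>2]
      show "(\<kappa>1 * (\<bar>l\<bar> + 1) + \<kappa>2)\<^sup>2 \<le> 2 * \<kappa>1\<^sup>2 * (\<bar>l\<bar> + 1)\<^sup>2 + 2 * \<kappa>2\<^sup>2" by (simp add: power_mult_distrib)
    qed simp
    finally show ?thesis .
  qed
  have split: "(\<kappa>1\<^sup>2 + \<kappa>2\<^sup>2 / lm\<^sup>2) * (sm * lm\<^sup>2 + s * l\<^sup>2) =
    sm * (\<kappa>1\<^sup>2 * lm\<^sup>2 + \<kappa>2\<^sup>2) + s * (\<kappa>1\<^sup>2 * l\<^sup>2 + \<kappa>2\<^sup>2 * l\<^sup>2 / lm\<^sup>2)"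
    using lm0 by (simp add: field_simps)
  show ?thesis
  proof (cases "l \<ge> - (lm / 2)")
    case True
    have sd: "0 \<le> s - sm" unfolding S[symmetric] using l pos by simp
    \<comment> \<open>The threshold \<open>- (lm / 2)\<close> gives
      \<open>lm - l \<le> 3 / 2 * lm\<close> and thus a factor \<open>4 / 3\<close> in
      \<open>A\<close>, which exactly pays for the factor \<open>3 / 4\<close> lost when
      \<open>w\<close> is replaced by \<open>- lm * f\<close>.\<close>
    have "s - sm \<le> 3 / 2 * lm * S" unfolding S[symmetric] using True pos by (intro mult_right_mono) auto
    then have A: "4 / 3 * (s - sm) * (w\<^sup>2 / lm\<^sup>2) \<le> 2 / lm * (S * w\<^sup>2)"
    proof -
      assume *: "s - sm \<le> 3 / 2 * lm * S"
      have "4 / 3 * (s - sm) * (w\<^sup>2 / lm\<^sup>2) \<le> 4 / 3 * (3 / 2 * lm * S) * (w\<^sup>2 / lm\<^sup>2)"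
        using * by (intro mult_right_mono mult_left_mono) auto
      also have "\<dots> = 2 / lm * (S * w\<^sup>2)" using lm0 by (simp add: power2_eq_square)
      finally show ?thesis .
    qed
    define e where "e = w + lm * f"
    have e2: "e\<^sup>2 \<le> 4 * C\<^sup>2 * lm\<^sup>2"
    proof -
      have "C * 1 \<le> C * lm" using pos by (intro mult_left_mono) auto
      then have "C * (1 + lm) \<le> 2 * C * lm" by (simp add: algebra_simps)
      then have "\<bar>e\<bar> \<le> 2 * C * lm" using w unfolding e_def by linarith
      then have "e\<^sup>2 \<le> (2 * C * lm)\<^sup>2" by (metis abs_ge_zero power2_abs power_mono)
      then show ?thesis by (simp add: power_mult_distrib)
    qed
    have "w\<^sup>2 \<ge> 3 / 4 * (lm * f)\<^sup>2 - 3 * e\<^sup>2"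
      using zero_le_power2[of "lm * f / 2 - 2 * e"] unfolding e_def by (simp add: power2_eq_square algebra_simps)
    then have "w\<^sup>2 / lm\<^sup>2 \<ge> (3 / 4 * (lm * f)\<^sup>2 - 3 * e\<^sup>2) / lm\<^sup>2" by (intro divide_right_mono) auto
    then have "w\<^sup>2 / lm\<^sup>2 \<ge> 3 / 4 * f\<^sup>2 - 3 * (e\<^sup>2 / lm\<^sup>2)"
      using lm0 by (simp add: diff_divide_distrib power_mult_distrib)
    moreover have "e\<^sup>2 / lm\<^sup>2 \<le> 4 * C\<^sup>2" using e2 lm0 by (simp add: divide_le_eq)
    ultimately have "w\<^sup>2 / lm\<^sup>2 \<ge> 3 / 4 * f\<^sup>2 - 12 * C\<^sup>2" by linarith
    then have "4 / 3 * (s - sm) * (3 / 4 * f\<^sup>2 - 12 * C\<^sup>2) \<le> 4 / 3 * (s - sm) * (w\<^sup>2 / lm\<^sup>2)"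
      using sd by (intro mult_left_mono) auto
    moreover have "4 / 3 * (s - sm) * (3 / 4 * f\<^sup>2 - 12 * C\<^sup>2) = (s - sm) * f\<^sup>2 - 16 * C\<^sup>2 * (s - sm)"
      by (simp add: field_simps)
    ultimately have "(s - sm) * f\<^sup>2 - 16 * C\<^sup>2 * (s - sm) \<le> 2 / lm * (S * w\<^sup>2)" using A by linarith
    moreover have "16 * C\<^sup>2 * (s - sm) \<le> 16 * C\<^sup>2 * s" using pos by simp
    ultimately have B: "s * f\<^sup>2 - 2 / lm * (S * w\<^sup>2) \<le> sm * f\<^sup>2 + 16 * C\<^sup>2 * s" by (simp add: algebra_simps)
    have "f\<^sup>2 \<le> D * (\<kappa>1\<^sup>2 * lm\<^sup>2 + \<kappa>2\<^sup>2)"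
    proof -
      have "\<bar>l\<bar> + 1 \<le> (N + 1) * lm" using l pos by (simp add: algebra_simps)
      then have "(\<bar>l\<bar> + 1)\<^sup>2 \<le> ((N + 1) * lm)\<^sup>2" by (intro power_mono) auto
      then have l2: "(\<bar>l\<bar> + 1)\<^sup>2 \<le> (N + 1)\<^sup>2 * lm\<^sup>2" by (simp only: power_mult_distrib)
      have "f\<^sup>2 \<le> C\<^sup>2 * (2 * \<kappa>1\<^sup>2 * ((N + 1)\<^sup>2 * lm\<^sup>2) + 2 * \<kappa>2\<^sup>2)"
        using f2 l2 by (elim order_trans) (intro mult_left_mono add_mono; simp)
      also have "\<dots> \<le> C\<^sup>2 * (16 * (N + 1)\<^sup>2 * (\<kappa>1\<^sup>2 * lm\<^sup>2) + 16 * (N + 1)\<^sup>2 * \<kappa>2\<^sup>2)"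
      proof (intro mult_left_mono add_mono)
        show "2 * \<kappa>1\<^sup>2 * ((N + 1)\<^sup>2 * lm\<^sup>2) \<le> 16 * (N + 1)\<^sup>2 * (\<kappa>1\<^sup>2 * lm\<^sup>2)" by (simp add: mult_ac)
        show "2 * \<kappa>2\<^sup>2 \<le> 16 * (N + 1)\<^sup>2 * \<kappa>2\<^sup>2" using N1 by (intro mult_right_mono) auto
      qed simp
      also have "\<dots> = D * (\<kappa>1\<^sup>2 * lm\<^sup>2 + \<kappa>2\<^sup>2)" by (simp add: D_def algebra_simps)
      finally show ?thesis .
    qed
    then have "sm * f\<^sup>2 \<le> sm * (D * (\<kappa>1\<^sup>2 * lm\<^sup>2 + \<kappa>2\<^sup>2))" using pos by (intro mult_left_mono) auto
    moreover have "16 * C\<^sup>2 * s \<le> D * ((\<kappa>1\<^sup>2 + 1) * s)"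
    proof -
      have "16 * C\<^sup>2 * s \<le> D * s" using D16 pos by (intro mult_right_mono) auto
      also have "\<dots> \<le> D * ((\<kappa>1\<^sup>2 + 1) * s)" using D0 pos by (intro mult_left_mono) (auto simp: algebra_simps)
      finally show ?thesis .
    qed
    moreover have "0 \<le> D * (s * (\<kappa>1\<^sup>2 * l\<^sup>2 + \<kappa>2\<^sup>2 * l\<^sup>2 / lm\<^sup>2))" using pos D0 by simp
    ultimately show ?thesis using B unfolding split D_def[symmetric] by (simp add: algebra_simps)
  next
    case False
    then have "lm / 2 \<le> \<bar>l\<bar>" by linarith
    then have "(lm / 2)\<^sup>2 \<le> \<bar>l\<bar>\<^sup>2" using lm0 by (intro power_mono) auto
    then have l1: "1 \<le> 4 * (l\<^sup>2 / lm\<^sup>2)" using lm0 by (simp add: power2_eq_square field_simps)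
    have "f\<^sup>2 \<le> C\<^sup>2 * (2 * \<kappa>1\<^sup>2 * (2 * l\<^sup>2 + 2) + 2 * \<kappa>2\<^sup>2 * (4 * (l\<^sup>2 / lm\<^sup>2)))"
    proof -
      have "(\<bar>l\<bar> + 1)\<^sup>2 \<le> 2 * l\<^sup>2 + 2"
        using zero_le_power2[of "\<bar>l\<bar> - 1"] by (simp add: power2_eq_square algebra_simps)
      moreover have "2 * \<kappa>2\<^sup>2 * 1 \<le> 2 * \<kappa>2\<^sup>2 * (4 * (l\<^sup>2 / lm\<^sup>2))" using l1 by (intro mult_left_mono) auto
      ultimately show ?thesis using f2 by (elim order_trans) (intro mult_left_mono add_mono; simp)
    qed
    also have "\<dots> \<le> C\<^sup>2 * (16 * (\<kappa>1\<^sup>2 * l\<^sup>2 + \<kappa>2\<^sup>2 * l\<^sup>2 / lm\<^sup>2 + (\<kappa>1\<^sup>2 + 1)))"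
    proof (intro mult_left_mono)
      define x y z where "x = \<kappa>1\<^sup>2 * l\<^sup>2" and "y = \<kappa>2\<^sup>2 * l\<^sup>2 / lm\<^sup>2" and "z = \<kappa>1\<^sup>2"
      have nn: "0 \<le> x" "0 \<le> y" "0 \<le> z" by (auto simp: x_def y_def z_def)
      have "2 * \<kappa>1\<^sup>2 * (2 * l\<^sup>2 + 2) + 2 * \<kappa>2\<^sup>2 * (4 * (l\<^sup>2 / lm\<^sup>2)) =
        4 * x + 4 * z + 8 * y" by (simp add: x_def y_def z_def algebra_simps)
      also have "\<dots> \<le> 16 * (x + y + (z + 1))" using nn(1) nn(2) nn(3) by (simp add: distrib_left add_mono)
      finally show "2 * \<kappa>1\<^sup>2 * (2 * l\<^sup>2 + 2) + 2 * \<kappa>2\<^sup>2 * (4 * (l\<^sup>2 / lm\<^sup>2)) \<le>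
        16 * (\<kappa>1\<^sup>2 * l\<^sup>2 + \<kappa>2\<^sup>2 * l\<^sup>2 / lm\<^sup>2 + (\<kappa>1\<^sup>2 + 1))" by (simp add: x_def y_def z_def)
    qed simp
    also have "\<dots> = 16 * C\<^sup>2 * (\<kappa>1\<^sup>2 * l\<^sup>2 + \<kappa>2\<^sup>2 * l\<^sup>2 / lm\<^sup>2 + (\<kappa>1\<^sup>2 + 1))" by simp
    also have "\<dots> \<le> D * (\<kappa>1\<^sup>2 * l\<^sup>2 + \<kappa>2\<^sup>2 * l\<^sup>2 / lm\<^sup>2 + (\<kappa>1\<^sup>2 + 1))"
      using D16 by (intro mult_right_mono) auto
    finally have "s * f\<^sup>2 \<le> s * (D * (\<kappa>1\<^sup>2 * l\<^sup>2 + \<kappa>2\<^sup>2 * l\<^sup>2 / lm\<^sup>2 + (\<kappa>1\<^sup>2 + 1)))"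
      using pos by (intro mult_left_mono) auto
    moreover have "0 \<le> 2 / lm * (S * w\<^sup>2)" using pos by simp
    moreover have "0 \<le> D * (sm * (\<kappa>1\<^sup>2 * lm\<^sup>2 + \<kappa>2\<^sup>2))" using pos D0 by simp
    ultimately show ?thesis unfolding split D_def[symmetric] by (simp add: algebra_simps)
  qed
qed

text \<open>Each single estimate uses the term \<open>\<sigma> m * (lam m)\<^sup>2\<close>; summing
  puts \<open>CARD('n)\<close> copies of it under \<open>Q\<close>, which raises the power of
  \<open>N + 1\<close> from two to three.\<close>

lemma third_order:
  fixes \<sigma> lam w f S :: "'n::finite \<Rightarrow> real" and C \<kappa>1 \<kappa>2 :: real
  defines "N \<equiv> real CARD('n)"
  assumes pos: "\<And>a. \<sigma> a > 0" "lam m \<ge> 1" "C \<ge> 1" "\<kappa>1 \<ge> 0" "\<kappa>2 \<ge> 0"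
    and S0: "\<And>i. i \<noteq> m \<Longrightarrow> S i \<ge> 0"
    and l: "\<And>i. lam i \<le> lam m" "\<And>i. \<bar>lam i\<bar> \<le> N * lam m"
    and S: "\<And>i. i \<noteq> m \<Longrightarrow> (lam m - lam i) * S i = \<sigma> i - \<sigma> m"
    and w: "\<And>i. i \<noteq> m \<Longrightarrow> \<bar>w i + lam m * f i\<bar> \<le> C * (1 + lam m)"
    and f: "\<And>i. \<bar>f i\<bar> \<le> C * (\<kappa>1 * (\<bar>lam i\<bar> + 1) + \<kappa>2)"
  shows "(\<Sum>i\<in>UNIV. \<sigma> i * (f i)\<^sup>2) - 2 / lam m * (\<Sum>i\<in>UNIV - {m}. S i * (w i)\<^sup>2) \<le>
    16 * C\<^sup>2 * (N + 1) ^ 3 * ((\<kappa>1\<^sup>2 + \<kappa>2\<^sup>2 / (lam m)\<^sup>2) * (\<Sum>i\<in>UNIV. \<sigma> i * (lam i)\<^sup>2) + (\<kappa>1\<^sup>2 + 1) * (\<Sum>i\<in>UNIV. \<sigma> i))"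
proof -
  define Q T where "Q = (\<Sum>i\<in>UNIV. \<sigma> i * (lam i)\<^sup>2)" and "T = (\<Sum>i\<in>UNIV. \<sigma> i)"
  \<comment> \<open>At the index \<open>m\<close> there is no concavity term; the values
    \<open>S' m = 0\<close> and \<open>w' m = - lam m * f m\<close> make the single estimate
    applicable there as well.\<close>
  define S' where "S' i = (if i = m then 0 else S i)" for i
  define w' where "w' i = (if i = m then - lam m * f m else w i)" for i
  define D where "D = 16 * C\<^sup>2 * (N + 1)\<^sup>2"
  have N: "N \<ge> 1" unfolding N_def by (simp add: Suc_le_eq)
  have eq: "(\<Sum>i\<in>UNIV - {m}. S i * (w i)\<^sup>2) = (\<Sum>i\<in>UNIV. S' i * (w' i)\<^sup>2)"
  proof -
    have "(\<Sum>i\<in>UNIV. S' i * (w' i)\<^sup>2) = S' m * (w' m)\<^sup>2 + (\<Sum>i\<in>UNIV - {m}. S' i * (w' i)\<^sup>2)"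
      by (rule sum.remove) auto
    also have "\<dots> = (\<Sum>i\<in>UNIV - {m}. S i * (w i)\<^sup>2)" by (simp add: S'_def w'_def)
    finally show ?thesis by simp
  qed
  have single: "\<sigma> i * (f i)\<^sup>2 - 2 / lam m * (S' i * (w' i)\<^sup>2) \<le>
    D * ((\<kappa>1\<^sup>2 + \<kappa>2\<^sup>2 / (lam m)\<^sup>2) * (\<sigma> m * (lam m)\<^sup>2 + \<sigma> i * (lam i)\<^sup>2) + (\<kappa>1\<^sup>2 + 1) * \<sigma> i)" for i
    unfolding D_def
    by (rule third_order_single) (use pos S0 l S w f N in \<open>auto simp: S'_def w'_def\<close>)
  have Qm: "\<sigma> m * (lam m)\<^sup>2 \<le> Q"
    unfolding Q_def by (rule member_le_sum) (use pos(1) in \<open>auto simp: less_imp_le\<close>)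
  have T0: "T \<ge> 0" unfolding T_def using pos(1) by (simp add: sum_nonneg less_imp_le)
  have "(\<Sum>i\<in>UNIV. \<sigma> i * (f i)\<^sup>2) - 2 / lam m * (\<Sum>i\<in>UNIV - {m}. S i * (w i)\<^sup>2)
    = (\<Sum>i\<in>UNIV. \<sigma> i * (f i)\<^sup>2 - 2 / lam m * (S' i * (w' i)\<^sup>2))"
    unfolding eq by (simp add: sum_subtractf sum_distrib_left)
  also have "\<dots> \<le> (\<Sum>i\<in>UNIV. D * ((\<kappa>1\<^sup>2 + \<kappa>2\<^sup>2 / (lam m)\<^sup>2) * (\<sigma> m * (lam m)\<^sup>2 + \<sigma> i * (lam i)\<^sup>2) + (\<kappa>1\<^sup>2 + 1) * \<sigma> i))"
    by (intro sum_mono single)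
  also have "\<dots> = D * ((\<kappa>1\<^sup>2 + \<kappa>2\<^sup>2 / (lam m)\<^sup>2) * (N * (\<sigma> m * (lam m)\<^sup>2) + Q) + (\<kappa>1\<^sup>2 + 1) * T)"
    unfolding Q_def T_def N_def by (simp add: sum_distrib_left[symmetric] sum.distrib)
  also have "\<dots> \<le> D * ((\<kappa>1\<^sup>2 + \<kappa>2\<^sup>2 / (lam m)\<^sup>2) * ((N + 1) * Q) + (N + 1) * ((\<kappa>1\<^sup>2 + 1) * T))"
  proof (intro mult_left_mono add_mono)
    show "N * (\<sigma> m * (lam m)\<^sup>2) + Q \<le> (N + 1) * Q" using Qm N by (simp add: algebra_simps)
    have "0 \<le> N * ((\<kappa>1\<^sup>2 + 1) * T)" using T0 N by simp
    then show "(\<kappa>1\<^sup>2 + 1) * T \<le> (N + 1) * ((\<kappa>1\<^sup>2 + 1) * T)" by (simp add: algebra_simps)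
  qed (auto simp: D_def)
  also have "\<dots> = 16 * C\<^sup>2 * (N + 1) ^ 3 * ((\<kappa>1\<^sup>2 + \<kappa>2\<^sup>2 / (lam m)\<^sup>2) * Q + (\<kappa>1\<^sup>2 + 1) * T)"
  proof -
    have "D * (K * ((N + 1) * Q) + (N + 1) * K') = 16 * C\<^sup>2 * (N + 1) ^ 3 * (K * Q + K')" for K K'
      by (simp add: D_def power2_eq_square power3_eq_cube algebra_simps)
    then show ?thesis .
  qed
  finally show ?thesis unfolding Q_def T_def .
qed

text \<open>The loss quadratic in \<open>\<kappa>1\<close> is beaten by the gain linear in
  \<open>\<kappa>1\<close> before \<open>\<kappa>2\<close> is known. The terms in \<open>T\<close>
  then fix \<open>\<kappa>2\<close>, whose own quadratic loss carries \<open>1 / lm\<^sup>2\<close>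
  and is removed by a large \<open>lm\<close>.\<close>

lemma choose_constants:
  fixes C C1 e b :: real
  assumes "C \<ge> 1" "C1 \<ge> C" "e > 0" "b > 0"
  obtains \<kappa>1 \<kappa>2 L where "0 < \<kappa>1" "\<kappa>1 \<le> 1" "0 < \<kappa>2" "1 \<le> L"
    "\<And>lm Q T X. 1 \<le> lm \<Longrightarrow> T \<ge> 0 \<Longrightarrow> b * lm \<le> Q \<Longrightarrow>
      X \<le> C1 * ((\<kappa>1\<^sup>2 + \<kappa>2\<^sup>2 / lm\<^sup>2) * Q + (\<kappa>1\<^sup>2 + 1) * T) \<Longrightarrow>
      \<kappa>1 * (Q / 2 - C * (1 + T)) + \<kappa>2 * (e * T - C) - C * (1 + T) - C / lm * Q \<le> X \<Longrightarrow> lm \<le> L"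
proof -
  \<comment> \<open>\<open>C1 * \<kappa>1\<^sup>2 = \<kappa>1 / 8\<close>; together with two losses
    of \<open>\<kappa>1 / 16\<close> this still leaves a quarter of \<open>\<kappa>1 * Q\<close>
    from the good half.\<close>
  define \<kappa>1 where "\<kappa>1 = 1 / (8 * C1)"
  \<comment> \<open>The factor \<open>4\<close> pays for
    \<open>C1 * (\<kappa>1\<^sup>2 + 1) \<le> 2 * C1\<close> and for \<open>\<kappa>1 * C\<close>
    and \<open>C\<close>, each at most \<open>C1\<close>.\<close>
  define \<kappa>2 where "\<kappa>2 = 4 * C1 / e"
  \<comment> \<open>Beyond the second entry, \<open>C1 * \<kappa>2\<^sup>2 / lm\<^sup>2\<close> and
    \<open>C / lm\<close> are at most \<open>\<kappa>1 / 16\<close>; beyond the third, the remaining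
    inequality \<open>\<kappa>1 / 4 * (b * lm) \<le> C * (1 + \<kappa>1 + \<kappa>2)\<close>
    fails.\<close>
  define L where "L = Max {1, 16 * C1 * (\<kappa>2\<^sup>2 + 1) / \<kappa>1, 4 * C * (1 + \<kappa>1 + \<kappa>2) / (\<kappa>1 * b)}"
  have C1: "C1 \<ge> 1" using assms by linarith
  have k1: "0 < \<kappa>1" "\<kappa>1 \<le> 1" "C1 * \<kappa>1 = 1 / 8" using C1 by (auto simp: \<kappa>1_def divide_simps)
  have k2: "0 < \<kappa>2" "\<kappa>2 * e = 4 * C1" using C1 assms by (auto simp: \<kappa>2_def)
  have L: "1 \<le> L" "16 * C1 * (\<kappa>2\<^sup>2 + 1) / \<kappa>1 \<le> L" "4 * C * (1 + \<kappa>1 + \<kappa>2) / (\<kappa>1 * b) \<le> L"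
    unfolding L_def by (auto intro: Max_ge)
  show thesis
  proof (rule that[OF k1(1,2) k2(1) L(1)])
    fix lm Q T X :: real
    assume lm: "1 \<le> lm" and T: "T \<ge> 0" and Q: "b * lm \<le> Q"
      and X: "X \<le> C1 * ((\<kappa>1\<^sup>2 + \<kappa>2\<^sup>2 / lm\<^sup>2) * Q + (\<kappa>1\<^sup>2 + 1) * T)"
        "\<kappa>1 * (Q / 2 - C * (1 + T)) + \<kappa>2 * (e * T - C) - C * (1 + T) - C / lm * Q \<le> X"
    show "lm \<le> L"
    proof (rule ccontr)
      assume "\<not> lm \<le> L"
      then have big: "16 * C1 * (\<kappa>2\<^sup>2 + 1) / \<kappa>1 < lm" "4 * C * (1 + \<kappa>1 + \<kappa>2) / (\<kappa>1 * b) < lm" using L by auto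
      have Q0: "Q \<ge> 0" using Q assms(4) lm by (smt (verit) mult_nonneg_nonneg)
      have b1: "16 * C1 * (\<kappa>2\<^sup>2 + 1) < \<kappa>1 * lm" using big(1) k1 by (simp add: divide_less_eq mult.commute)
      have t1: "C1 * (\<kappa>2\<^sup>2 / lm\<^sup>2) \<le> \<kappa>1 / 16"
      proof -
        have "16 * C1 * \<kappa>2\<^sup>2 \<le> \<kappa>1 * lm" using b1 C1 by (simp add: algebra_simps)
        also have "\<dots> \<le> \<kappa>1 * lm\<^sup>2" using k1 lm by (intro mult_left_mono) (auto simp: power2_eq_square)
        finally show ?thesis using lm by (simp add: divide_le_eq)
      qed
      have t2: "C / lm \<le> \<kappa>1 / 16"
      proof -
        have "0 \<le> 16 * C1 * \<kappa>2\<^sup>2" using C1 by simp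
        then have "16 * C1 < \<kappa>1 * lm" using b1 by (simp add: algebra_simps)
        then have "16 * C \<le> \<kappa>1 * lm" using assms(2) by linarith
        then show ?thesis using lm by (simp add: divide_le_eq)
      qed
      have "C1 * \<kappa>1\<^sup>2 = \<kappa>1 / 8" using k1(3) by (simp add: power2_eq_square mult.assoc[symmetric])
      then have i1: "C1 * ((\<kappa>1\<^sup>2 + \<kappa>2\<^sup>2 / lm\<^sup>2) * Q) \<le> (3 / 16 * \<kappa>1) * Q"
        using t1 Q0 mult_right_mono[of "C1 * \<kappa>1\<^sup>2 + C1 * (\<kappa>2\<^sup>2 / lm\<^sup>2)" "3 / 16 * \<kappa>1" Q]
        unfolding mult.assoc[symmetric] distrib_left by linarith
      have i2: "C / lm * Q \<le> \<kappa>1 / 16 * Q" using t2 Q0 by (rule mult_right_mono)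
      have i3: "C1 * ((\<kappa>1\<^sup>2 + 1) * T) + \<kappa>1 * (C * T) + C * T \<le> \<kappa>2 * (e * T)"
      proof -
        have "\<kappa>1\<^sup>2 \<le> 1" using k1 by (simp add: power_le_one)
        then have "C1 * (\<kappa>1\<^sup>2 + 1) \<le> C1 * 2" using C1 by (intro mult_left_mono) auto
        moreover have "\<kappa>1 * C \<le> 1 * C" using k1 assms by (intro mult_right_mono) auto
        ultimately have "C1 * (\<kappa>1\<^sup>2 + 1) + \<kappa>1 * C + C \<le> \<kappa>2 * e" using k2(2) assms(2) by linarith
        from mult_right_mono[OF this T] show ?thesis by (simp add: algebra_simps)
      qed
      define A1 A2 A3 A4 A5 A6 q where "A1 = C1 * ((\<kappa>1\<^sup>2 + \<kappa>2\<^sup>2 / lm\<^sup>2) * Q)" and "A2 = C1 * ((\<kappa>1\<^sup>2 + 1) * T)"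
        and "A3 = C / lm * Q" and "A4 = \<kappa>1 * (C * T)" and "A5 = C * T" and "A6 = \<kappa>2 * (e * T)" and "q = \<kappa>1 * Q"
      have "A1 \<le> 3 / 16 * q" "A3 \<le> q / 16" "A2 + A4 + A5 \<le> A6"
        using i1 i2 i3 by (simp_all add: A1_def A2_def A3_def A4_def A5_def A6_def q_def)
      moreover have "X \<le> A1 + A2" using X(1) by (simp add: A1_def A2_def distrib_left)
      moreover have "q / 2 - \<kappa>1 * C - A4 + A6 - \<kappa>2 * C - (C + A5) - A3 \<le> X"
        using X(2) unfolding A3_def A4_def A5_def A6_def q_def by (simp add: algebra_simps)
      ultimately have "q / 4 \<le> C + \<kappa>1 * C + \<kappa>2 * C" by linarith
      then have "\<kappa>1 / 4 * Q \<le> C * (1 + \<kappa>1 + \<kappa>2)" by (simp add: q_def algebra_simps)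
      moreover have "\<kappa>1 / 4 * (b * lm) \<le> \<kappa>1 / 4 * Q" using Q k1 by (intro mult_left_mono) auto
      ultimately have "\<kappa>1 * b * lm \<le> 4 * C * (1 + \<kappa>1 + \<kappa>2)" by (simp add: algebra_simps)
      then have "lm \<le> 4 * C * (1 + \<kappa>1 + \<kappa>2) / (\<kappa>1 * b)" using k1 assms by (simp add: pos_le_divide_eq mult.commute)
      then show False using big by linarith
    qed
  qed
qed

text \<open>In the following lemma \<open>U1\<close>, \<open>U2\<close>, \<open>U3\<close> are the derivatives of the solution in a frame
  diagonalising the augmented Hessian with eigenvalues \<open>lam\<close>, \<open>U4 a\<close> its derivative \<open>u\<^sub>m\<^sub>m\<^sub>a\<^sub>a\<close>;
  \<open>xd\<close>, \<open>pd\<close>, \<open>xm\<close>, \<open>pm\<close> are the \<open>x\<close>- and \<open>p\<close>-derivatives of the diagonal entries of the matrix and of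
  its \<open>m\<close>-th diagonal entry.\<close>

lemma differentiated_equation:
  fixes \<sigma> lam U1 U4 Q1 Q2 Bx Bp xm pm f f2 h h2 :: "'n::finite \<Rightarrow> real"
    and U2 xd pd a :: "'n \<Rightarrow> 'n \<Rightarrow> real" and U3 :: "'n \<Rightarrow> 'n \<Rightarrow> 'n \<Rightarrow> real" and \<Lambda> E \<kappa>1 \<kappa>2 e C0 :: real
  defines "N \<equiv> real CARD('n)" and "T \<equiv> \<Sum>a\<in>UNIV. \<sigma> a" and "Q \<equiv> \<Sum>a\<in>UNIV. \<sigma> a * (lam a)\<^sup>2"
    and "\<beta> \<equiv> \<lambda>d. Bp d + (\<Sum>a\<in>UNIV. \<sigma> a * pd a d)"
  assumes pos: "\<And>a. \<sigma> a > 0" "lam m \<ge> 1" "\<Lambda> \<ge> 1" "\<kappa>1 \<ge> 0" "\<kappa>2 \<ge> 0"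
    and lam: "\<And>i. \<bar>lam i\<bar> \<le> N * lam m"
    and sym: "\<And>i j l. U3 i j l = U3 l i j" "\<And>i j l. U3 i j l = U3 j i l"
    and U2: "\<And>i j. U2 i j = (if i = j then lam i else 0) + a i j"
    and bounds: "\<And>i j. \<bar>a i j\<bar> \<le> \<Lambda>" "\<And>i j. \<bar>xd i j\<bar> \<le> \<Lambda>" "\<And>i j. \<bar>pd i j\<bar> \<le> \<Lambda>" "\<And>i. \<bar>xm i\<bar> \<le> \<Lambda>"
      "\<And>i. \<bar>pm i\<bar> \<le> \<Lambda>" "\<And>i. \<bar>Bx i\<bar> \<le> \<Lambda>" "\<And>i. \<bar>Bp i\<bar> \<le> \<Lambda>" "\<And>i. \<bar>U1 i\<bar> \<le> \<Lambda>"
    and Q1: "\<And>a. Q1 a \<le> \<Lambda> * (1 + (lam a)\<^sup>2)"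
    and Q2: "\<And>a. a \<noteq> m \<Longrightarrow> - (\<Lambda> * (1 + lam m)) \<le> Q2 a" "- (\<Lambda> * (1 + (lam m)\<^sup>2)) \<le> Q2 m"
    and E1: "\<And>c. (\<Sum>i\<in>UNIV. \<sigma> i * (U3 c i i - xd i c - (\<Sum>b\<in>UNIV. U2 c b * pd i b))) = Bx c + (\<Sum>b\<in>UNIV. U2 c b * Bp b)"
    and E2: "2 * E + (\<Sum>d\<in>UNIV. U3 m m d * Bp d) - \<Lambda> * (1 + lam m) \<le>
      (\<Sum>i\<in>UNIV. \<sigma> i * (U4 i - Q2 i - (\<Sum>d\<in>UNIV. U3 m m d * pd i d)))"
    and max1: "\<And>c. U3 c m m - xm c - (\<Sum>b\<in>UNIV. U2 c b * pm b) = - lam m * f c"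
    and max2: "\<And>c. (U4 c - Q1 c - (\<Sum>d\<in>UNIV. U3 c c d * pm d)) / lam m - (f c)\<^sup>2 + f2 c \<le> 0"
    and f: "\<And>c. f c = \<kappa>1 * (\<Sum>d\<in>UNIV. U1 d * U2 d c) + \<kappa>2 * h c"
    and f2: "\<And>c. f2 c = \<kappa>1 * (\<Sum>d\<in>UNIV. (U2 d c)\<^sup>2 + U1 d * U3 c c d) + \<kappa>2 * h2 c"
    and h: "e * T - C0 \<le> (\<Sum>c\<in>UNIV. \<sigma> c * h2 c) - (\<Sum>d\<in>UNIV. \<beta> d * h d)"
  defines "C \<equiv> 10 * (N + 1)\<^sup>2 * \<Lambda> ^ 3 * (N + 1)\<^sup>2"
  shows "\<kappa>1 * (Q / 2 - C * (1 + T)) + \<kappa>2 * (e * T - C0) - C * (1 + T) - C / lam m * Q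
    \<le> (\<Sum>c\<in>UNIV. \<sigma> c * (f c)\<^sup>2) - 2 / lam m * E"
proof -
  define lm where "lm = lam m"
  have lm: "lm \<ge> 1" "lm > 0" using pos by (auto simp: lm_def)
  have N: "N \<ge> 1" unfolding N_def by (simp add: Suc_le_eq)
  have T0: "T \<ge> 0" unfolding T_def using pos(1) by (simp add: sum_nonneg less_imp_le)
  have Q0: "Q \<ge> 0" unfolding Q_def using pos(1) by (simp add: sum_nonneg less_imp_le)
  define c1 where "c1 = \<Lambda> + N * ((N + \<Lambda>) * \<Lambda>)"
  have L0: "\<Lambda> \<ge> 0" "\<Lambda> > 0" using pos by auto
  have U2b: "\<bar>U2 i j\<bar> \<le> (N + \<Lambda>) * lm" for i j
  proof -
    have "\<bar>U2 i j\<bar> \<le> N * lm + \<Lambda>" unfolding U2 using lam[of i] bounds(1)[of i j] N lm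
      by (auto simp: lm_def intro!: order_trans[OF abs_triangle_ineq] add_mono)
    also have "\<dots> \<le> (N + \<Lambda>) * lm" using lm L0 by (simp add: algebra_simps)
    finally show ?thesis .
  qed
  have lin: "\<bar>x + (\<Sum>b\<in>UNIV. U2 c b * y b)\<bar> \<le> c1 * lm" if "\<bar>x\<bar> \<le> \<Lambda>" "\<And>b. \<bar>y b\<bar> \<le> \<Lambda>" for x y c
  proof -
    have "\<bar>\<Sum>b\<in>UNIV. U2 c b * y b\<bar> \<le> (\<Sum>b\<in>UNIV. \<bar>U2 c b * y b\<bar>)" by (rule sum_abs)
    also have "\<dots> \<le> (\<Sum>b\<in>(UNIV :: 'n set). (N + \<Lambda>) * lm * \<Lambda>)"
      unfolding abs_mult using U2b that(2) N lm L0 by (intro sum_mono mult_mono) auto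
    also have "\<dots> = N * ((N + \<Lambda>) * \<Lambda>) * lm" by (simp add: N_def)
    finally have "\<bar>x + (\<Sum>b\<in>UNIV. U2 c b * y b)\<bar> \<le> \<Lambda> + N * ((N + \<Lambda>) * \<Lambda>) * lm" using that(1) by linarith
    also have "\<dots> \<le> c1 * lm" using lm L0 mult_left_mono[of 1 lm \<Lambda>] by (simp add: c1_def algebra_simps)
    finally show ?thesis .
  qed
  have c1: "c1 \<ge> 0" "c1 \<ge> \<Lambda>" using N L0 by (auto simp: c1_def)
  have wsum: "\<bar>\<Sum>i\<in>UNIV. \<sigma> i * y i\<bar> \<le> T * K" if "\<And>i. \<bar>y i\<bar> \<le> K" for y K
  proof -
    have "\<bar>\<Sum>i\<in>UNIV. \<sigma> i * y i\<bar> \<le> (\<Sum>i\<in>UNIV. \<bar>\<sigma> i * y i\<bar>)" by (rule sum_abs)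
    also have "\<dots> \<le> (\<Sum>i\<in>UNIV. \<sigma> i * K)"
      unfolding abs_mult using that pos(1) by (intro sum_mono mult_mono) (auto simp: less_imp_le)
    also have "\<dots> = T * K" by (simp add: T_def sum_distrib_right)
    finally show ?thesis .
  qed
  \<comment> \<open>The once differentiated equation trades the weighted third derivatives for
    second ones, hence for a bound linear in \<open>lm\<close>.\<close>
  have sU3: "(\<Sum>i\<in>UNIV. \<sigma> i * U3 i i c) = (\<Sum>i\<in>UNIV. \<sigma> i * (xd i c + (\<Sum>b\<in>UNIV. U2 c b * pd i b))) + (Bx c + (\<Sum>b\<in>UNIV. U2 c b * Bp b))" for c
  proof -
    have "U3 i i c = U3 c i i" for i using sym by metis
    then show ?thesis using E1[of c] by (simp add: algebra_simps sum.distrib sum_subtractf)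
  qed
  have sU3b: "\<bar>\<Sum>i\<in>UNIV. \<sigma> i * U3 i i c\<bar> \<le> (T + 1) * (c1 * lm)" for c
  proof -
    have "\<bar>\<Sum>i\<in>UNIV. \<sigma> i * (xd i c + (\<Sum>b\<in>UNIV. U2 c b * pd i b))\<bar> \<le> T * (c1 * lm)"
      by (intro wsum lin bounds)
    moreover have "\<bar>Bx c + (\<Sum>b\<in>UNIV. U2 c b * Bp b)\<bar> \<le> c1 * lm" by (intro lin bounds)
    moreover have "(T + 1) * (c1 * lm) = T * (c1 * lm) + c1 * lm" by (simp add: algebra_simps)
    ultimately show ?thesis unfolding sU3 by linarith
  qed
  have beta: "\<bar>\<beta> d\<bar> \<le> (T + 1) * \<Lambda>" for d
    unfolding \<beta>_def using bounds(7)[of d] wsum[of "\<lambda>a. pd a d" \<Lambda>] bounds(3) by (simp add: algebra_simps)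
  \<comment> \<open>The fourth derivatives u_mmcc are those of the twice differentiated equation.
    The third derivatives that remain are either contracted with \<sigma>, and covered by
    \<open>sU3b\<close>, or carry the indices \<open>m m\<close>.\<close>
  have R: "(\<Sum>c\<in>UNIV. \<sigma> c * (U4 c - Q1 c - (\<Sum>d\<in>UNIV. U3 c c d * pm d))) \<ge>
    2 * E + (\<Sum>d\<in>UNIV. \<beta> d * U3 m m d) - (T + 1) * (2 * \<Lambda> * lm) - 2 * \<Lambda> * (T + Q) - \<Lambda> * N * ((T + 1) * (c1 * lm))"
  proof -
    have s1: "(\<Sum>c\<in>UNIV. \<sigma> c * (\<Sum>d\<in>UNIV. U3 c c d * pm d)) = (\<Sum>d\<in>UNIV. pm d * (\<Sum>c\<in>UNIV. \<sigma> c * U3 c c d))"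
      by (simp add: sum_distrib_left mult_ac) (rule sum.swap)
    have s2: "(\<Sum>c\<in>UNIV. \<sigma> c * (\<Sum>d\<in>UNIV. U3 m m d * pd c d)) = (\<Sum>d\<in>UNIV. (\<Sum>a\<in>UNIV. \<sigma> a * pd a d) * U3 m m d)"
      by (simp add: sum_distrib_left sum_distrib_right mult_ac) (rule sum.swap)
    have "\<bar>\<Sum>d\<in>UNIV. pm d * (\<Sum>c\<in>UNIV. \<sigma> c * U3 c c d)\<bar> \<le> (\<Sum>d\<in>UNIV. \<bar>pm d * (\<Sum>c\<in>UNIV. \<sigma> c * U3 c c d)\<bar>)" by (rule sum_abs)
    also have "\<dots> \<le> (\<Sum>d\<in>(UNIV :: 'n set). \<Lambda> * ((T + 1) * (c1 * lm)))"
      unfolding abs_mult using bounds(5) sU3b L0 by (intro sum_mono mult_mono) auto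
    also have "\<dots> = \<Lambda> * N * ((T + 1) * (c1 * lm))" by (simp add: N_def)
    finally have s1b: "(\<Sum>d\<in>UNIV. pm d * (\<Sum>c\<in>UNIV. \<sigma> c * U3 c c d)) \<le> \<Lambda> * N * ((T + 1) * (c1 * lm))" by linarith
    have s3: "(\<Sum>c\<in>UNIV. \<sigma> c * Q1 c) \<le> \<Lambda> * (T + Q)"
    proof -
      have "(\<Sum>c\<in>UNIV. \<sigma> c * Q1 c) \<le> (\<Sum>c\<in>UNIV. \<sigma> c * (\<Lambda> * (1 + (lam c)\<^sup>2)))"
        using Q1 pos(1) by (intro sum_mono mult_left_mono) (auto simp: less_imp_le)
      also have "\<dots> = \<Lambda> * (T + Q)" by (simp add: T_def Q_def sum_distrib_left sum.distrib algebra_simps)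
      finally show ?thesis .
    qed
    have s4: "(\<Sum>c\<in>UNIV. \<sigma> c * Q2 c) \<ge> - (T * (2 * \<Lambda> * lm)) - \<Lambda> * (T + Q)"
    proof -
      have "(\<Sum>c\<in>UNIV. \<sigma> c * (- (2 * \<Lambda> * lm) - \<Lambda> * (1 + (lam c)\<^sup>2))) \<le> (\<Sum>c\<in>UNIV. \<sigma> c * Q2 c)"
      proof (intro sum_mono mult_left_mono)
        fix c
        have "\<Lambda> * (1 + lm) \<le> 2 * \<Lambda> * lm" using lm L0 by (simp add: algebra_simps)
        moreover have "0 \<le> \<Lambda> * (1 + (lam c)\<^sup>2)" "0 \<le> 2 * \<Lambda> * lm" using L0 lm by auto
        ultimately show "- (2 * \<Lambda> * lm) - \<Lambda> * (1 + (lam c)\<^sup>2) \<le> Q2 c"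
          using Q2(1)[of c] Q2(2) unfolding lm_def[symmetric] by (cases "c = m") (auto simp: lm_def)
      qed (use pos(1) in \<open>simp add: less_imp_le\<close>)
      moreover have "(\<Sum>c\<in>UNIV. \<sigma> c * (- (2 * \<Lambda> * lm) - \<Lambda> * (1 + (lam c)\<^sup>2))) = - (T * (2 * \<Lambda> * lm)) - \<Lambda> * (T + Q)"
        by (simp add: T_def Q_def sum_distrib_left sum_distrib_right sum_subtractf sum_negf sum.distrib algebra_simps)
      ultimately show ?thesis by simp
    qed
    have s5: "(\<Sum>d\<in>UNIV. \<beta> d * U3 m m d) = (\<Sum>d\<in>UNIV. U3 m m d * Bp d) + (\<Sum>c\<in>UNIV. \<sigma> c * (\<Sum>d\<in>UNIV. U3 m m d * pd c d))"
      unfolding s2 \<beta>_def by (simp add: algebra_simps sum.distrib)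
    have s6: "\<Lambda> * (1 + lam m) \<le> 2 * \<Lambda> * lm" using lm L0 by (simp add: lm_def algebra_simps)
    have "(\<Sum>c\<in>UNIV. \<sigma> c * (U4 c - Q1 c - (\<Sum>d\<in>UNIV. U3 c c d * pm d))) =
      (\<Sum>i\<in>UNIV. \<sigma> i * (U4 i - Q2 i - (\<Sum>d\<in>UNIV. U3 m m d * pd i d))) + (\<Sum>c\<in>UNIV. \<sigma> c * Q2 c) - (\<Sum>c\<in>UNIV. \<sigma> c * Q1 c)
      + (\<Sum>c\<in>UNIV. \<sigma> c * (\<Sum>d\<in>UNIV. U3 m m d * pd c d)) - (\<Sum>c\<in>UNIV. \<sigma> c * (\<Sum>d\<in>UNIV. U3 c c d * pm d))"
      by (simp add: right_diff_distrib sum_subtractf)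
    then show ?thesis using E2 s1 s1b s3 s4 s5 s6 by (simp add: algebra_simps)
  qed
  \<comment> \<open>The first-order condition at the maximum replaces u_mmd by
    \<open>- lm * f d\<close>, up to an error of at most \<open>c1 * lm\<close>.\<close>
  have V: "(\<Sum>d\<in>UNIV. \<beta> d * U3 m m d) \<ge> - lm * (\<Sum>d\<in>UNIV. \<beta> d * f d) - N * ((T + 1) * \<Lambda> * (c1 * lm))"
  proof -
    have eq: "U3 m m d = - lm * f d + (xm d + (\<Sum>b\<in>UNIV. U2 d b * pm b))" for d
      using max1[of d] sym by (metis (no_types, lifting) add_diff_cancel_left' diff_add_cancel diff_diff_eq lm_def)
    have "\<bar>\<Sum>d\<in>UNIV. \<beta> d * (xm d + (\<Sum>b\<in>UNIV. U2 d b * pm b))\<bar> \<le> (\<Sum>d\<in>UNIV. \<bar>\<beta> d * (xm d + (\<Sum>b\<in>UNIV. U2 d b * pm b))\<bar>)"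
      by (rule sum_abs)
    also have "\<dots> \<le> (\<Sum>d\<in>(UNIV :: 'n set). (T + 1) * \<Lambda> * (c1 * lm))"
      unfolding abs_mult using beta lin[OF bounds(4) bounds(5)] T0 L0 by (intro sum_mono mult_mono) auto
    also have "\<dots> = N * ((T + 1) * \<Lambda> * (c1 * lm))" by (simp add: N_def)
    finally have *: "\<bar>\<Sum>d\<in>UNIV. \<beta> d * (xm d + (\<Sum>b\<in>UNIV. U2 d b * pm b))\<bar> \<le> N * ((T + 1) * \<Lambda> * (c1 * lm))" .
    have "(\<Sum>d\<in>UNIV. \<beta> d * U3 m m d) = - lm * (\<Sum>d\<in>UNIV. \<beta> d * f d) + (\<Sum>d\<in>UNIV. \<beta> d * (xm d + (\<Sum>b\<in>UNIV. U2 d b * pm b)))"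
      unfolding eq distrib_left sum.distrib[symmetric] sum_distrib_left by (intro sum.cong refl) (simp add: algebra_simps)
    then show ?thesis using * by linarith
  qed
  have W: "(\<Sum>c\<in>UNIV. \<sigma> c * f2 c) - (\<Sum>d\<in>UNIV. \<beta> d * f d) \<ge>
    \<kappa>1 * (Q / 2 - \<Lambda>\<^sup>2 * T - N * (\<Lambda> * ((T + 1) * \<Lambda>))) + \<kappa>2 * (e * T - C0)"
  proof -
    \<comment> \<open>The linearised operator applied to the first derivative u_d. By
      \<open>sU3\<close> the derivatives of third and second order cancel and only explicit
      \<open>x\<close>-derivatives are left, so the gradient term costs no power of
      \<open>lm\<close>.\<close>
    define Z where "Z d = (\<Sum>c\<in>UNIV. \<sigma> c * U3 c c d) - (\<Sum>b\<in>UNIV. \<beta> b * U2 d b)" for d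
    have Z: "Z d = (\<Sum>i\<in>UNIV. \<sigma> i * xd i d) + Bx d" for d
    proof -
      have "(\<Sum>b\<in>UNIV. \<beta> b * U2 d b) = (\<Sum>b\<in>UNIV. U2 d b * Bp b) + (\<Sum>i\<in>UNIV. \<sigma> i * (\<Sum>b\<in>UNIV. U2 d b * pd i b))"
        unfolding \<beta>_def by (simp add: distrib_left distrib_right sum.distrib sum_distrib_left sum_distrib_right mult_ac) (rule sum.swap)
      then show ?thesis unfolding Z_def sU3 by (simp add: distrib_left sum.distrib)
    qed
    have Zb: "\<bar>Z d\<bar> \<le> (T + 1) * \<Lambda>" for d
      unfolding Z using bounds(6)[of d] wsum[of "\<lambda>a. xd a d" \<Lambda>] bounds(2) by (simp add: algebra_simps)
    have "\<bar>\<Sum>d\<in>UNIV. U1 d * Z d\<bar> \<le> (\<Sum>d\<in>UNIV. \<bar>U1 d * Z d\<bar>)" by (rule sum_abs)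
    also have "\<dots> \<le> (\<Sum>d\<in>(UNIV :: 'n set). \<Lambda> * ((T + 1) * \<Lambda>))"
      unfolding abs_mult using bounds(8) Zb L0 by (intro sum_mono mult_mono) auto
    also have "\<dots> = N * (\<Lambda> * ((T + 1) * \<Lambda>))" by (simp add: N_def)
    finally have UZ: "\<bar>\<Sum>d\<in>UNIV. U1 d * Z d\<bar> \<le> N * (\<Lambda> * ((T + 1) * \<Lambda>))" .
    have sq: "(\<Sum>c\<in>UNIV. \<sigma> c * (\<Sum>d\<in>UNIV. (U2 d c)\<^sup>2)) \<ge> Q / 2 - \<Lambda>\<^sup>2 * T"
    proof -
      have "(lam c)\<^sup>2 / 2 - \<Lambda>\<^sup>2 \<le> (\<Sum>d\<in>UNIV. (U2 d c)\<^sup>2)" for c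
      proof -
        have "(lam c)\<^sup>2 / 2 - (a c c)\<^sup>2 \<le> (lam c + a c c)\<^sup>2"
          using zero_le_power2[of "lam c / 2 + a c c"] zero_le_power2[of "lam c + 2 * a c c"] by (simp add: power2_eq_square algebra_simps)
        moreover have "(a c c)\<^sup>2 \<le> \<Lambda>\<^sup>2" using bounds(1)[of c c] by (metis abs_ge_zero power2_abs power_mono)
        moreover have "(U2 c c)\<^sup>2 \<le> (\<Sum>d\<in>UNIV. (U2 d c)\<^sup>2)" by (rule member_le_sum) auto
        ultimately show ?thesis by (simp add: U2)
      qed
      then have "(\<Sum>c\<in>UNIV. \<sigma> c * ((lam c)\<^sup>2 / 2 - \<Lambda>\<^sup>2)) \<le> (\<Sum>c\<in>UNIV. \<sigma> c * (\<Sum>d\<in>UNIV. (U2 d c)\<^sup>2))"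
        using pos(1) by (intro sum_mono mult_left_mono) (auto simp: less_imp_le)
      moreover have "(\<Sum>c\<in>UNIV. \<sigma> c * ((lam c)\<^sup>2 / 2 - \<Lambda>\<^sup>2)) = Q / 2 - \<Lambda>\<^sup>2 * T"
        by (simp add: Q_def T_def right_diff_distrib sum_subtractf sum_divide_distrib sum_distrib_right mult.commute[of "\<Lambda>\<^sup>2"])
      ultimately show ?thesis by simp
    qed
    have "(\<Sum>c\<in>UNIV. \<sigma> c * f2 c) - (\<Sum>d\<in>UNIV. \<beta> d * f d) =
      \<kappa>1 * ((\<Sum>c\<in>UNIV. \<sigma> c * (\<Sum>d\<in>UNIV. (U2 d c)\<^sup>2)) + (\<Sum>d\<in>UNIV. U1 d * Z d)) +
      \<kappa>2 * ((\<Sum>c\<in>UNIV. \<sigma> c * h2 c) - (\<Sum>d\<in>UNIV. \<beta> d * h d))"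
    proof -
      have 1: "(\<Sum>c\<in>UNIV. \<sigma> c * f2 c) = \<kappa>1 * ((\<Sum>c\<in>UNIV. \<sigma> c * (\<Sum>d\<in>UNIV. (U2 d c)\<^sup>2)) + (\<Sum>c\<in>UNIV. \<sigma> c * (\<Sum>d\<in>UNIV. U1 d * U3 c c d)))
        + \<kappa>2 * (\<Sum>c\<in>UNIV. \<sigma> c * h2 c)"
        unfolding f2 by (simp add: distrib_left sum.distrib sum_distrib_left mult_ac)
      have 2: "(\<Sum>d\<in>UNIV. \<beta> d * f d) = \<kappa>1 * (\<Sum>d\<in>UNIV. \<beta> d * (\<Sum>c\<in>UNIV. U1 c * U2 c d)) + \<kappa>2 * (\<Sum>d\<in>UNIV. \<beta> d * h d)"
        unfolding f by (simp add: distrib_left sum.distrib sum_distrib_left mult_ac)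
      have 3: "(\<Sum>c\<in>UNIV. \<sigma> c * (\<Sum>d\<in>UNIV. U1 d * U3 c c d)) = (\<Sum>d\<in>UNIV. U1 d * (\<Sum>c\<in>UNIV. \<sigma> c * U3 c c d))"
        by (simp add: sum_distrib_left mult_ac) (rule sum.swap)
      have 4: "(\<Sum>d\<in>UNIV. \<beta> d * (\<Sum>c\<in>UNIV. U1 c * U2 c d)) = (\<Sum>c\<in>UNIV. U1 c * (\<Sum>d\<in>UNIV. \<beta> d * U2 c d))"
        by (simp add: sum_distrib_left mult_ac) (rule sum.swap)
      show ?thesis unfolding 1 2 3 4 Z_def by (simp add: right_diff_distrib sum_subtractf algebra_simps)
    qed
    also have "\<dots> \<ge> \<kappa>1 * (Q / 2 - \<Lambda>\<^sup>2 * T - N * (\<Lambda> * ((T + 1) * \<Lambda>))) + \<kappa>2 * (e * T - C0)"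
      using sq UZ h pos(4,5) by (intro add_mono mult_left_mono) auto
    finally show ?thesis .
  qed
  have M: "(\<Sum>c\<in>UNIV. \<sigma> c * (U4 c - Q1 c - (\<Sum>d\<in>UNIV. U3 c c d * pm d))) / lm \<le> (\<Sum>c\<in>UNIV. \<sigma> c * (f c)\<^sup>2) - (\<Sum>c\<in>UNIV. \<sigma> c * f2 c)"
  proof -
    have "(\<Sum>c\<in>UNIV. \<sigma> c * ((U4 c - Q1 c - (\<Sum>d\<in>UNIV. U3 c c d * pm d)) / lm - (f c)\<^sup>2 + f2 c)) \<le> 0"
      using max2 pos(1) unfolding lm_def by (intro sum_nonpos mult_nonneg_nonpos) (auto simp: less_imp_le)
    moreover have "(\<Sum>c\<in>UNIV. \<sigma> c * (g c / lm - (f c)\<^sup>2 + f2 c)) =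
      (\<Sum>c\<in>UNIV. \<sigma> c * g c) / lm - (\<Sum>c\<in>UNIV. \<sigma> c * (f c)\<^sup>2) + (\<Sum>c\<in>UNIV. \<sigma> c * f2 c)" for g
      by (simp add: distrib_left right_diff_distrib sum.distrib sum_subtractf sum_divide_distrib)
    ultimately show ?thesis by simp
  qed
  \<comment> \<open>\<open>r * lm\<close> collects the errors linear in \<open>lm\<close>; division
    by \<open>lm\<close> turns them into a multiple of \<open>1 + T\<close>.\<close>
  define r where "r = (T + 1) * (2 * \<Lambda>) + 2 * \<Lambda> * T + \<Lambda> * N * ((T + 1) * c1) + N * ((T + 1) * \<Lambda> * c1)"
  have "(2 * E - lm * (\<Sum>d\<in>UNIV. \<beta> d * f d) - r * lm - 2 * \<Lambda> * Q) / lm \<le>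
    (\<Sum>c\<in>UNIV. \<sigma> c * (U4 c - Q1 c - (\<Sum>d\<in>UNIV. U3 c c d * pm d))) / lm"
  proof (rule divide_right_mono)
    have "2 * \<Lambda> * T * 1 \<le> 2 * \<Lambda> * T * lm" using lm L0 T0 by (intro mult_left_mono) auto
    then show "2 * E - lm * (\<Sum>d\<in>UNIV. \<beta> d * f d) - r * lm - 2 * \<Lambda> * Q \<le>
      (\<Sum>c\<in>UNIV. \<sigma> c * (U4 c - Q1 c - (\<Sum>d\<in>UNIV. U3 c c d * pm d)))"
      using R V by (simp add: r_def algebra_simps)
  qed (use lm in simp)
  also have "(2 * E - lm * (\<Sum>d\<in>UNIV. \<beta> d * f d) - r * lm - 2 * \<Lambda> * Q) / lm =
    2 / lm * E - (\<Sum>d\<in>UNIV. \<beta> d * f d) - r - 2 * \<Lambda> / lm * Q"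
    using lm by (simp add: diff_divide_distrib)
  finally have F: "2 / lm * E - (\<Sum>d\<in>UNIV. \<beta> d * f d) - r - 2 * \<Lambda> / lm * Q \<le>
    (\<Sum>c\<in>UNIV. \<sigma> c * (f c)\<^sup>2) - (\<Sum>c\<in>UNIV. \<sigma> c * f2 c)" using M by linarith
  have L2: "\<Lambda> \<le> \<Lambda> ^ 3" "\<Lambda>\<^sup>2 \<le> \<Lambda> ^ 3" "1 \<le> \<Lambda> ^ 3" "\<Lambda> \<le> \<Lambda>\<^sup>2"
    using pos(3) by (auto intro: self_le_power power_increasing one_le_power)
  have N2: "1 \<le> (N + 1)\<^sup>2" using N by (simp add: one_le_power)
  \<comment> \<open>A common majorant of the powers of \<open>N\<close> that occur; the constant of
    the lemma is \<open>10 * (P * \<Lambda> ^ 3)\<close>.\<close>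
  define P where "P = (N + 1)\<^sup>2 * (N + 1)\<^sup>2"
  have P1: "1 \<le> P" "N \<le> P" "N\<^sup>2 \<le> P" "N ^ 3 \<le> P" "N\<^sup>2 + N ^ 3 + N\<^sup>2 \<le> P"
  proof -
    have "P = N ^ 4 + 4 * N ^ 3 + 6 * N\<^sup>2 + 4 * N + 1" unfolding P_def by (simp add: power2_eq_square power3_eq_cube power4_eq_xxxx algebra_simps)
    moreover have "N ^ 4 \<ge> 0" "N ^ 3 \<ge> 0" "N\<^sup>2 \<ge> 0" using N by auto
    ultimately show "1 \<le> P" "N \<le> P" "N\<^sup>2 \<le> P" "N ^ 3 \<le> P" "N\<^sup>2 + N ^ 3 + N\<^sup>2 \<le> P" using N by linarith+
  qed
  have C: "C = 10 * (P * \<Lambda> ^ 3)" unfolding C_def P_def by (simp add: mult_ac)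
  have PL: "\<Lambda> ^ 3 \<le> P * \<Lambda> ^ 3" using P1(1) L2(3) L0 mult_right_mono[of 1 P "\<Lambda> ^ 3"] by simp
  have Nc: "\<Lambda> * N * c1 \<le> P * \<Lambda> ^ 3"
  proof -
    have "\<Lambda> * N * c1 = N * \<Lambda>\<^sup>2 + N ^ 3 * \<Lambda>\<^sup>2 + N\<^sup>2 * \<Lambda> ^ 3" unfolding c1_def by (simp add: power2_eq_square power3_eq_cube algebra_simps)
    also have "\<dots> \<le> N\<^sup>2 * \<Lambda> ^ 3 + N ^ 3 * \<Lambda> ^ 3 + N\<^sup>2 * \<Lambda> ^ 3"
      using N L2 L0 by (intro add_mono mult_mono) (auto simp: power2_eq_square)
    also have "\<dots> = (N\<^sup>2 + N ^ 3 + N\<^sup>2) * \<Lambda> ^ 3" by (simp add: algebra_simps)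
    also have "\<dots> \<le> P * \<Lambda> ^ 3" using P1 L2 L0 by (intro mult_right_mono) auto
    finally show ?thesis .
  qed
  have rC: "r \<le> C * (1 + T)"
  proof -
    have "r \<le> (T + 1) * (4 * \<Lambda> + 2 * (\<Lambda> * N * c1))" unfolding r_def using L0 by (simp add: algebra_simps)
    also have "\<dots> \<le> (T + 1) * C" using T0 L2 PL Nc unfolding C by (intro mult_left_mono) linarith+
    finally show ?thesis by (simp add: algebra_simps)
  qed
  have QC: "2 * \<Lambda> / lm * Q \<le> C / lm * Q"
    using lm Q0 L2 PL unfolding C by (intro mult_right_mono divide_right_mono) linarith+
  have kC: "\<kappa>1 * (Q / 2 - C * (1 + T)) \<le> \<kappa>1 * (Q / 2 - \<Lambda>\<^sup>2 * T - N * (\<Lambda> * ((T + 1) * \<Lambda>)))"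
  proof (intro mult_left_mono pos(4))
    have "N * \<Lambda>\<^sup>2 \<le> P * \<Lambda> ^ 3" using P1 L2 N by (intro mult_mono) auto
    then have "(\<Lambda>\<^sup>2 + N * \<Lambda>\<^sup>2) * (1 + T) \<le> C * (1 + T)" using T0 L2 PL unfolding C by (intro mult_right_mono) linarith+
    moreover have "\<Lambda>\<^sup>2 * T + N * (\<Lambda> * ((T + 1) * \<Lambda>)) \<le> (\<Lambda>\<^sup>2 + N * \<Lambda>\<^sup>2) * (1 + T)" by (simp add: algebra_simps power2_eq_square)
    ultimately show "Q / 2 - C * (1 + T) \<le> Q / 2 - \<Lambda>\<^sup>2 * T - N * (\<Lambda> * ((T + 1) * \<Lambda>))" by linarith
  qed
  show ?thesis using F W rC QC kC unfolding lm_def[symmetric] by linarith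
qed

section \<open>Gradient, Hessian and the coefficient functions\<close>

lemma Ck_2_differentiable: "Ck 2 U X f \<Longrightarrow> x \<in> U \<Longrightarrow> f differentiable (at x)"
  by (rule Ck_differentiable) auto

lemma Ck_2_partial_d: "open U \<Longrightarrow> Ck 2 U U f \<Longrightarrow> Ck 1 U U (partial_d U v f)"
  using Ck_partial_d[of U 1 f v] by (simp add: numeral_2_eq_2)

lemma Ck_3_partial_d: "open U \<Longrightarrow> Ck 3 U U f \<Longrightarrow> Ck 2 U U (partial_d U v f)"
  using Ck_partial_d[of U 2 f v] by (simp add: numeral_3_eq_3 numeral_2_eq_2)

lemma Ck_4_partial_d: "open U \<Longrightarrow> Ck 4 U U f \<Longrightarrow> Ck 3 U U (partial_d U v f)"
  using Ck_partial_d[of U 3 f v] by (simp only: Suc_numeral semiring_norm)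

lemma partial_d_commute3:
  assumes U: "open U" and f: "Ck 3 U U f" and x: "x \<in> U"
  shows "partial_d U a (partial_d U b (partial_d U c f)) x = partial_d U b (partial_d U a (partial_d U c f)) x"
    and "partial_d U a (partial_d U b (partial_d U c f)) x = partial_d U c (partial_d U a (partial_d U b f)) x"
proof -
  have f2: "Ck 2 U U f" using Ck_le[OF f] by simp
  show 1: "partial_d U a (partial_d U b (partial_d U c f)) x = partial_d U b (partial_d U a (partial_d U c f)) x" for a b c
    by (rule partial_d_commute[OF U Ck_3_partial_d[OF U f] x])
  have "partial_d U a (partial_d U b (partial_d U c f)) x = partial_d U a (partial_d U c (partial_d U b f)) x"
    by (rule partial_d_cong[OF U x]) (rule partial_d_commute[OF U f2])
  also have "\<dots> = partial_d U c (partial_d U a (partial_d U b f)) x" by (rule 1)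
  finally show "partial_d U a (partial_d U b (partial_d U c f)) x = partial_d U c (partial_d U a (partial_d U b f)) x" .
qed

lemma partial_d_commute4:
  assumes U: "open U" and f: "Ck 4 U U f" and x: "x \<in> U"
  shows "partial_d U a (partial_d U a (partial_d U b (partial_d U b f))) x =
    partial_d U b (partial_d U b (partial_d U a (partial_d U a f))) x"
proof -
  have f3: "Ck 3 U U f" using Ck_le[OF f] by simp
  have "partial_d U a (partial_d U a (partial_d U b (partial_d U b f))) x =
    partial_d U b (partial_d U a (partial_d U a (partial_d U b f))) x"
    by (rule partial_d_commute3(2)[OF U Ck_4_partial_d[OF U f] x])
  also have "\<dots> = partial_d U b (partial_d U b (partial_d U a (partial_d U a f))) x"
    by (rule partial_d_cong[OF U x]) (rule partial_d_commute3(2)[OF U f3])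
  finally show ?thesis .
qed

lemma vec_basis_expansion: "(v :: real^'n) = (\<Sum>i\<in>UNIV. (v $ i) *\<^sub>R axis i 1)"
  by (simp add: scalar_mult_eq_scaleR[symmetric] basis_expansion)

lemma grad_inner:
  assumes "x \<in> \<Omega>" "f differentiable (at x)"
  shows "v \<bullet> grad \<Omega> f x = partial_d \<Omega> v f x"
proof -
  have "partial_d \<Omega> v f x = partial_d \<Omega> (\<Sum>i\<in>UNIV. (v $ i) *\<^sub>R axis i 1) f x"
    using vec_basis_expansion[of v] by simp
  also have "\<dots> = v \<bullet> grad \<Omega> f x"
    unfolding partial_d_linear[OF assms] by (simp add: grad_def inner_vec_def)
  finally show ?thesis by simp
qed

lemma hess_inner:
  assumes "open \<Omega>" "x \<in> \<Omega>" "Ck 2 \<Omega> \<Omega> f"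
  shows "v \<bullet> (hess \<Omega> f x *v w) = partial_d \<Omega> v (partial_d \<Omega> w f) x"
proof -
  have "partial_d \<Omega> v (partial_d \<Omega> w f) x =
    partial_d \<Omega> (\<Sum>i\<in>UNIV. (v $ i) *\<^sub>R axis i 1) (partial_d \<Omega> (\<Sum>i\<in>UNIV. (w $ i) *\<^sub>R axis i 1) f) x"
    using vec_basis_expansion[of v] vec_basis_expansion[of w] by simp
  also have "\<dots> = v \<bullet> (hess \<Omega> f x *v w)"
    unfolding partial_d2_expand[OF assms(1,3,2)]
    by (simp add: hess_def inner_vec_def matrix_vector_mult_def sum_distrib_left mult_ac)
  finally show ?thesis by simp
qed

lemma hess_symmetric:
  assumes "open \<Omega>" "x \<in> \<Omega>" "Ck 2 \<Omega> \<Omega> f"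
  shows "transpose (hess \<Omega> f x) = hess \<Omega> f x"
  using partial_d_commute[OF assms(1,3,2)] by (simp add: vec_eq_iff transpose_def hess_def)

lemma inner_matrix_entries: "v \<bullet> (M *v w) = (\<Sum>(i, j)\<in>UNIV. (v $ i * w $ j) * M $ i $ j)" for M :: "real^'n^'n"
proof -
  have "v \<bullet> (M *v w) = (\<Sum>i\<in>UNIV. \<Sum>j\<in>UNIV. (v $ i * w $ j) * M $ i $ j)"
    by (simp add: inner_vec_def matrix_vector_mult_def sum_distrib_left mult_ac)
  then show ?thesis by (simp add: sum.cartesian_product)
qed

section \<open>Entries of a matrix function in arbitrary directions\<close>

definition mat_entry :: "('z \<Rightarrow> real^'n^'n) \<Rightarrow> real^'n \<Rightarrow> real^'n \<Rightarrow> 'z \<Rightarrow> real" where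
  "mat_entry A \<xi> \<eta> z = \<xi> \<bullet> (A z *v \<eta>)"

lemma mat_entry_lincomb:
  "mat_entry A \<xi> \<eta> = (\<lambda>z. \<Sum>ij\<in>UNIV. (\<xi> $ fst ij * \<eta> $ snd ij) * A z $ fst ij $ snd ij)"
  by (simp add: mat_entry_def inner_matrix_entries case_prod_unfold fun_eq_iff)

lemma Ck_mat_entry:
  assumes "open U" "\<And>i j. Ck 2 U U (\<lambda>z. A z $ i $ j)"
  shows "Ck 2 U U (mat_entry A \<xi> \<eta>)"
  unfolding mat_entry_lincomb by (rule Ck_lincomb[OF assms(1)]) (auto intro: assms(2))

lemma partial_d_mat_entry:
  assumes U: "open U" and A: "\<And>i j. Ck 2 U U (\<lambda>z. A z $ i $ j)" and z: "z \<in> U"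
  shows "partial_d U v (mat_entry A \<xi> \<eta>) z =
      (\<Sum>ij\<in>UNIV. (\<xi> $ fst ij * \<eta> $ snd ij) * partial_d U v (\<lambda>z. A z $ fst ij $ snd ij) z)"
    and "partial_d U w (partial_d U v (mat_entry A \<xi> \<eta>)) z =
      (\<Sum>ij\<in>UNIV. (\<xi> $ fst ij * \<eta> $ snd ij) * partial_d U w (partial_d U v (\<lambda>z. A z $ fst ij $ snd ij)) z)"
proof -
  have first: "partial_d U v (mat_entry A \<xi> \<eta>) z =
      (\<Sum>ij\<in>UNIV. (\<xi> $ fst ij * \<eta> $ snd ij) * partial_d U v (\<lambda>z. A z $ fst ij $ snd ij) z)" if "z \<in> U" for z
    unfolding mat_entry_lincomb using that A by (intro partial_d_lincomb Ck_2_differentiable)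
  show "partial_d U v (mat_entry A \<xi> \<eta>) z =
      (\<Sum>ij\<in>UNIV. (\<xi> $ fst ij * \<eta> $ snd ij) * partial_d U v (\<lambda>z. A z $ fst ij $ snd ij) z)"
    by (rule first[OF z])
  have "partial_d U w (partial_d U v (mat_entry A \<xi> \<eta>)) z =
    partial_d U w (\<lambda>z. \<Sum>ij\<in>UNIV. (\<xi> $ fst ij * \<eta> $ snd ij) * partial_d U v (\<lambda>z. A z $ fst ij $ snd ij) z) z"
    by (rule partial_d_cong[OF U z first])
  also have "\<dots> = (\<Sum>ij\<in>UNIV. (\<xi> $ fst ij * \<eta> $ snd ij) * partial_d U w (partial_d U v (\<lambda>z. A z $ fst ij $ snd ij)) z)"
    by (intro partial_d_lincomb z Ck_differentiable[OF Ck_2_partial_d[OF U A]]) auto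
  finally show "partial_d U w (partial_d U v (mat_entry A \<xi> \<eta>)) z =
      (\<Sum>ij\<in>UNIV. (\<xi> $ fst ij * \<eta> $ snd ij) * partial_d U w (partial_d U v (\<lambda>z. A z $ fst ij $ snd ij)) z)" .
qed

lemma mat_entry_bounds:
  fixes A :: "'a::euclidean_space \<Rightarrow> real^'n^'n"
  assumes U: "open U" "U \<subseteq> X" and A: "\<And>i j. Ck 2 U X (\<lambda>z. A z $ i $ j)" and K: "compact K" "K \<subseteq> X"
  obtains C where "C \<ge> 0" "\<And>z \<xi> \<eta>. z \<in> K \<Longrightarrow> norm \<xi> \<le> 1 \<Longrightarrow> norm \<eta> \<le> 1 \<Longrightarrow> \<bar>mat_entry A \<xi> \<eta> z\<bar> \<le> C"
    "\<And>z v \<xi> \<eta>. z \<in> K \<inter> U \<Longrightarrow> norm \<xi> \<le> 1 \<Longrightarrow> norm \<eta> \<le> 1 \<Longrightarrow> \<bar>partial_d U v (mat_entry A \<xi> \<eta>) z\<bar> \<le> C * norm v"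
    "\<And>z v w \<xi> \<eta>. z \<in> K \<inter> U \<Longrightarrow> norm \<xi> \<le> 1 \<Longrightarrow> norm \<eta> \<le> 1 \<Longrightarrow>
      \<bar>partial_d U v (partial_d U w (mat_entry A \<xi> \<eta>)) z\<bar> \<le> C * norm v * norm w"
proof -
  have "\<exists>C. C \<ge> 0 \<and> (\<forall>z\<in>K. \<bar>A z $ fst ij $ snd ij\<bar> \<le> C) \<and>
    (\<forall>z\<in>K \<inter> U. \<forall>v. \<bar>partial_d U v (\<lambda>z. A z $ fst ij $ snd ij) z\<bar> \<le> C * norm v) \<and>
    (\<forall>z\<in>K \<inter> U. \<forall>v w. \<bar>partial_d U v (partial_d U w (\<lambda>z. A z $ fst ij $ snd ij)) z\<bar> \<le> C * norm v * norm w)" for ij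
    by (rule partial_d_bounds[OF U A[of "fst ij" "snd ij"] K]) blast
  then obtain C where C: "\<And>ij. C ij \<ge> 0" "\<And>ij z. z \<in> K \<Longrightarrow> \<bar>A z $ fst ij $ snd ij\<bar> \<le> C ij"
    "\<And>ij z v. z \<in> K \<inter> U \<Longrightarrow> \<bar>partial_d U v (\<lambda>z. A z $ fst ij $ snd ij) z\<bar> \<le> C ij * norm v"
    "\<And>ij z v w. z \<in> K \<inter> U \<Longrightarrow> \<bar>partial_d U v (partial_d U w (\<lambda>z. A z $ fst ij $ snd ij)) z\<bar> \<le> C ij * norm v * norm w"
    by metis
  have A': "Ck 2 U U (\<lambda>z. A z $ i $ j)" for i j using A U(2) by (rule Ck_subset)
  have gen: "\<bar>\<Sum>ij\<in>UNIV. (\<xi> $ fst ij * \<eta> $ snd ij) * f ij\<bar> \<le> (\<Sum>ij\<in>UNIV. C ij) * r"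
    if "norm \<xi> \<le> 1" "norm \<eta> \<le> 1" "\<And>ij. \<bar>f ij\<bar> \<le> C ij * r" for f r and \<xi> \<eta> :: "real^'n"
  proof -
    have "\<bar>\<Sum>ij\<in>UNIV. (\<xi> $ fst ij * \<eta> $ snd ij) * f ij\<bar> \<le> (\<Sum>ij\<in>UNIV. \<bar>(\<xi> $ fst ij * \<eta> $ snd ij) * f ij\<bar>)" by (rule sum_abs)
    also have "\<dots> \<le> (\<Sum>ij\<in>UNIV. C ij * r)"
    proof (rule sum_mono)
      fix ij :: "'n \<times> 'n"
      have "\<bar>\<xi> $ fst ij\<bar> \<le> 1" "\<bar>\<eta> $ snd ij\<bar> \<le> 1"
        using component_le_norm_cart[of \<xi> "fst ij"] component_le_norm_cart[of \<eta> "snd ij"] that by linarith+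
      then have "\<bar>\<xi> $ fst ij * \<eta> $ snd ij\<bar> \<le> 1" by (simp add: abs_mult mult_le_one)
      then show "\<bar>(\<xi> $ fst ij * \<eta> $ snd ij) * f ij\<bar> \<le> C ij * r"
        using mult_mono[of "\<bar>\<xi> $ fst ij * \<eta> $ snd ij\<bar>" 1 "\<bar>f ij\<bar>" "C ij * r"] that(3)[of ij]
        by (simp add: abs_mult)
    qed
    finally show ?thesis by (simp add: sum_distrib_right)
  qed
  show thesis
  proof (rule that[of "\<Sum>ij\<in>UNIV. C ij"])
    show "(\<Sum>ij\<in>UNIV. C ij) \<ge> 0" using C(1) by (simp add: sum_nonneg)
    show "\<bar>mat_entry A \<xi> \<eta> z\<bar> \<le> (\<Sum>ij\<in>UNIV. C ij)" if "z \<in> K" "norm \<xi> \<le> 1" "norm \<eta> \<le> 1" for z \<xi> \<eta>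
      unfolding mat_entry_lincomb using gen[OF that(2,3), of "\<lambda>ij. A z $ fst ij $ snd ij" 1] C(2)[OF that(1)] by simp
    show "\<bar>partial_d U v (mat_entry A \<xi> \<eta>) z\<bar> \<le> (\<Sum>ij\<in>UNIV. C ij) * norm v"
      if "z \<in> K \<inter> U" "norm \<xi> \<le> 1" "norm \<eta> \<le> 1" for z v \<xi> \<eta>
      using that by (subst partial_d_mat_entry(1)[OF U(1) A']) (auto intro!: gen C(3))
    show "\<bar>partial_d U v (partial_d U w (mat_entry A \<xi> \<eta>)) z\<bar> \<le> (\<Sum>ij\<in>UNIV. C ij) * norm v * norm w"
      if z: "z \<in> K \<inter> U" "norm \<xi> \<le> 1" "norm \<eta> \<le> 1" for z v w \<xi> \<eta>
      using z gen[OF z(2,3), of "\<lambda>ij. partial_d U v (partial_d U w (\<lambda>z. A z $ fst ij $ snd ij)) z" "norm v * norm w"]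
        C(4)[OF z(1), where v = v and w = w]
      by (subst partial_d_mat_entry(2)[OF U(1) A']) (auto simp: mult.assoc)
  qed
qed

lemma Pair_zero_expansion: "((0 :: real^'n), (v :: real^'n)) = (\<Sum>i\<in>UNIV. (v $ i) *\<^sub>R (0, axis i 1))"
proof -
  have "(\<Sum>i\<in>UNIV. (v $ i) *\<^sub>R ((0 :: real^'n), axis i 1 :: real^'n)) = (0, \<Sum>i\<in>UNIV. (v $ i) *\<^sub>R axis i 1)"
    by (simp add: prod_eq_iff fst_sum snd_sum)
  then show ?thesis using vec_basis_expansion[of v] by simp
qed

lemma sum_D2p:
  assumes "open \<Omega>" "Ck 2 (\<Omega> \<times> UNIV) (\<Omega> \<times> UNIV) f" "z \<in> \<Omega> \<times> UNIV"
  shows "(\<Sum>k\<in>UNIV. \<Sum>l\<in>UNIV. D2p \<Omega> k l f z * \<eta> $ k * \<eta> $ l) =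
    partial_d (\<Omega> \<times> UNIV) (0, \<eta>) (partial_d (\<Omega> \<times> UNIV) (0, \<eta>) f) z"
proof -
  have U: "open (\<Omega> \<times> (UNIV :: (real^'n) set))" using assms(1) by (simp add: open_Times)
  show ?thesis
    unfolding Pair_zero_expansion[of \<eta>] partial_d2_expand[OF U assms(2,3)] D2p_def
    by (intro sum.cong refl) (simp add: mult_ac)
qed

lemma regular_matrix_mat_entry:
  assumes \<Omega>: "open \<Omega>" and A: "\<And>i j. Ck 2 (\<Omega> \<times> UNIV) (\<Omega> \<times> UNIV) (\<lambda>z. A z $ i $ j)"
    and reg: "regular_matrix \<Omega> A" and x: "x \<in> \<Omega>" and orth: "\<xi> \<bullet> \<eta> = 0"
  shows "0 \<le> partial_d (\<Omega> \<times> UNIV) (0, \<eta>) (partial_d (\<Omega> \<times> UNIV) (0, \<eta>) (mat_entry A \<xi> \<xi>)) (x, p)"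
proof -
  have U: "open (\<Omega> \<times> (UNIV :: (real^'n) set))" and z: "(x, p) \<in> \<Omega> \<times> UNIV"
    using \<Omega> x by (auto simp: open_Times)
  have "x \<in> closure \<Omega>" using x closure_subset by blast
  then have "0 \<le> (\<Sum>i\<in>UNIV. \<Sum>j\<in>UNIV. \<Sum>k\<in>UNIV. \<Sum>l\<in>UNIV.
    D2p \<Omega> k l (\<lambda>z. A z $ i $ j) (x, p) * \<xi> $ i * \<xi> $ j * \<eta> $ k * \<eta> $ l)"
    using reg orth unfolding regular_matrix_def by blast
  also have "\<dots> = (\<Sum>i\<in>UNIV. \<Sum>j\<in>UNIV. (\<xi> $ i * \<xi> $ j) * (\<Sum>k\<in>UNIV. \<Sum>l\<in>UNIV.
    D2p \<Omega> k l (\<lambda>z. A z $ i $ j) (x, p) * \<eta> $ k * \<eta> $ l))"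
    by (simp add: sum_distrib_left mult_ac)
  also have "\<dots> = (\<Sum>i\<in>UNIV. \<Sum>j\<in>UNIV. (\<xi> $ i * \<xi> $ j) *
    partial_d (\<Omega> \<times> UNIV) (0, \<eta>) (partial_d (\<Omega> \<times> UNIV) (0, \<eta>) (\<lambda>z. A z $ i $ j)) (x, p))"
    unfolding sum_D2p[OF \<Omega> A z] ..
  also have "\<dots> = partial_d (\<Omega> \<times> UNIV) (0, \<eta>) (partial_d (\<Omega> \<times> UNIV) (0, \<eta>) (mat_entry A \<xi> \<xi>)) (x, p)"
    unfolding partial_d_mat_entry(2)[OF U A z] by (simp add: sum.cartesian_product case_prod_unfold)
  finally show ?thesis .
qed

section \<open>Convexity of the root of the right-hand side\<close>

lemma partial_d_powr:
  assumes U: "open U" and f: "Ck 2 U U f" and pos: "\<forall>z\<in>U. f z > 0" and z: "z \<in> U"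
  shows "partial_d U v (\<lambda>z. f z powr \<alpha>) z = \<alpha> * f z powr (\<alpha> - 1) * partial_d U v f z"
    and "partial_d U v (partial_d U w (\<lambda>z. f z powr \<alpha>)) z =
      \<alpha> * f z powr (\<alpha> - 1) * (partial_d U v (partial_d U w f) z + (\<alpha> - 1) * partial_d U v f z * partial_d U w f z / f z)"
proof -
  have D: "((\<lambda>z. f z powr r) has_derivative (\<lambda>v. r * f z powr (r - 1) * partial_d U v f z)) (at z)" if "z \<in> U" for z r
  proof -
    have "(f has_derivative (\<lambda>v. partial_d U v f z)) (at z)"
      using that f by (intro partial_d_has_derivative Ck_2_differentiable)
    moreover have "((\<lambda>y. y powr r) has_derivative (\<lambda>y. r * f z powr (r - 1) * y)) (at (f z))"
      using has_real_derivative_powr[OF pos[rule_format, OF that], of r] by (simp add: has_field_derivative_def)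
    ultimately show ?thesis by (rule has_derivative_compose)
  qed
  have first: "partial_d U v (\<lambda>z. f z powr \<alpha>) z = \<alpha> * f z powr (\<alpha> - 1) * partial_d U v f z" if "z \<in> U" for v z
    by (rule partial_d_eqI[OF that D[OF that]])
  show "partial_d U v (\<lambda>z. f z powr \<alpha>) z = \<alpha> * f z powr (\<alpha> - 1) * partial_d U v f z"
    by (rule first[OF z])
  have "partial_d U v (partial_d U w (\<lambda>z. f z powr \<alpha>)) z =
    partial_d U v (\<lambda>z. \<alpha> * f z powr (\<alpha> - 1) * partial_d U w f z) z"
    by (rule partial_d_cong[OF U z first])
  also have "\<dots> = \<alpha> * f z powr (\<alpha> - 1) * partial_d U v (partial_d U w f) z +
      \<alpha> * ((\<alpha> - 1) * f z powr (\<alpha> - 1 - 1) * partial_d U v f z) * partial_d U w f z"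
  proof (rule partial_d_eqI[OF z])
    have "(partial_d U w f has_derivative (\<lambda>v. partial_d U v (partial_d U w f) z)) (at z)"
      by (intro partial_d_has_derivative z Ck_differentiable[OF Ck_2_partial_d[OF U f]]) simp
    from has_derivative_mult[OF has_derivative_mult_right[OF D[OF z, of "\<alpha> - 1"], of \<alpha>] this]
    show "((\<lambda>z. \<alpha> * f z powr (\<alpha> - 1) * partial_d U w f z) has_derivative
      (\<lambda>v. \<alpha> * f z powr (\<alpha> - 1) * partial_d U v (partial_d U w f) z +
      \<alpha> * ((\<alpha> - 1) * f z powr (\<alpha> - 1 - 1) * partial_d U v f z) * partial_d U w f z)) (at z)" .
  qed
  also have "f z powr (\<alpha> - 1 - 1) = f z powr (\<alpha> - 1) / f z"
    using pos z powr_diff[of "f z" "\<alpha> - 1" 1] by (simp add: less_imp_le)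
  finally show "partial_d U v (partial_d U w (\<lambda>z. f z powr \<alpha>)) z =
      \<alpha> * f z powr (\<alpha> - 1) * (partial_d U v (partial_d U w f) z + (\<alpha> - 1) * partial_d U v f z * partial_d U w f z / f z)"
    by (simp add: algebra_simps)
qed

text \<open>The second derivative of \<open>B powr (1 / real k)\<close> is a positive factor times
  D^2 B - (1 - 1/k) (DB)^2 / B. The factor \<open>(k - 1) / k\<close> is the one in
  \<open>esym_concave\<close> for order \<open>k\<close>, so that the two quadratic terms
  match.\<close>

lemma convex_in_p_powr:
  assumes \<Omega>: "open \<Omega>" and B: "Ck 2 (\<Omega> \<times> UNIV) (\<Omega> \<times> UNIV) B" and pos: "\<forall>z\<in>\<Omega> \<times> UNIV. B z > 0"
    and conv: "convex_in_p \<Omega> (\<lambda>z. B z powr (1 / real k))" and k: "1 \<le> k" and x: "x \<in> \<Omega>"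
  shows "(real k - 1) / real k * (partial_d (\<Omega> \<times> UNIV) (0, \<eta>) B (x, p))\<^sup>2 / B (x, p)
    \<le> partial_d (\<Omega> \<times> UNIV) (0, \<eta>) (partial_d (\<Omega> \<times> UNIV) (0, \<eta>) B) (x, p)"
proof -
  let ?U = "\<Omega> \<times> (UNIV :: (real^'n) set)" and ?\<alpha> = "1 / real k"
  have U: "open ?U" and z: "(x, p) \<in> ?U" using \<Omega> x by (auto simp: open_Times)
  let ?c = "?\<alpha> * B (x, p) powr (?\<alpha> - 1)"
  have c: "?c > 0" using pos z k by (auto intro!: divide_pos_pos simp: less_imp_neq[symmetric])
  have lin: "partial_d ?U (0, \<eta>) B (x, p) = (\<Sum>k\<in>UNIV. \<eta> $ k * partial_d ?U (0, axis k 1) B (x, p))"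
    unfolding Pair_zero_expansion[of \<eta>] by (rule partial_d_linear[OF z Ck_2_differentiable[OF B z]])
  have "0 \<le> (\<Sum>k\<in>UNIV. \<Sum>l\<in>UNIV. D2p \<Omega> k l (\<lambda>z. B z powr ?\<alpha>) (x, p) * \<eta> $ k * \<eta> $ l)"
    using conv x unfolding convex_in_p_def by blast
  also have "\<dots> = ?c * ((\<Sum>k\<in>UNIV. \<Sum>l\<in>UNIV. D2p \<Omega> k l B (x, p) * \<eta> $ k * \<eta> $ l) + (?\<alpha> - 1) / B (x, p) *
    (\<Sum>k\<in>UNIV. \<Sum>l\<in>UNIV. (\<eta> $ k * partial_d ?U (0, axis k 1) B (x, p)) * (\<eta> $ l * partial_d ?U (0, axis l 1) B (x, p))))"
  proof -
    have "c * (X + r * Y * Z / b) * e * f = c * (X * e * f + r / b * ((e * Y) * (f * Z)))" for c X r Y Z b e f :: real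
      by (simp add: algebra_simps)
    then show ?thesis
      unfolding D2p_def partial_d_powr(2)[OF U B pos z] by (simp only: sum_distrib_left sum.distrib[symmetric])
  qed
  also have "\<dots> = ?c * (partial_d ?U (0, \<eta>) (partial_d ?U (0, \<eta>) B) (x, p) + (?\<alpha> - 1) / B (x, p) * (partial_d ?U (0, \<eta>) B (x, p))\<^sup>2)"
    unfolding sum_D2p[OF \<Omega> B z] lin power2_eq_square sum_product ..
  finally have "0 \<le> partial_d ?U (0, \<eta>) (partial_d ?U (0, \<eta>) B) (x, p) + (?\<alpha> - 1) / B (x, p) * (partial_d ?U (0, \<eta>) B (x, p))\<^sup>2"
    using c unfolding zero_le_mult_iff[of ?c] by linarith
  moreover have "?\<alpha> - 1 = - ((real k - 1) / real k)" using k by (simp add: field_simps)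
  ultimately show ?thesis by simp
qed

lemma partial_d_split:
  fixes q :: "'n::finite \<Rightarrow> real^'n" and v :: "real^'n"
  assumes "orthonormal_frame q" "z \<in> U" "f differentiable (at z)"
  shows "partial_d U (v, w) f z = partial_d U (v, 0) f z + (\<Sum>b\<in>UNIV. (w \<bullet> q b) * partial_d U (0, q b) f z)"
proof -
  have lin: "linear (\<lambda>v. partial_d U v f z)"
    using partial_d_has_derivative[OF assms(2,3)] by (rule has_derivative_linear)
  have "(0 :: real^'n, w) = (\<Sum>b\<in>UNIV. (w \<bullet> q b) *\<^sub>R (0 :: real^'n, q b))"
    using frame_expand[OF assms(1), of w] by (simp add: prod_eq_iff fst_sum snd_sum)
  moreover have "partial_d U (v, w) f z = partial_d U ((v, 0) + (0, w)) f z" by simp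
  ultimately have "partial_d U (v, w) f z = partial_d U ((v, 0) + (\<Sum>b\<in>UNIV. (w \<bullet> q b) *\<^sub>R (0, q b))) f z" by (simp only:)
  then show ?thesis by (simp only: linear_add[OF lin] partial_d_linear[OF assms(2,3)])
qed

lemma partial_d2_add:
  fixes f :: "'a::euclidean_space \<Rightarrow> real"
  assumes U: "open U" and f: "Ck 2 U U f" and z: "z \<in> U"
  shows "partial_d U (s *\<^sub>R v + t *\<^sub>R w) (partial_d U (s *\<^sub>R v + t *\<^sub>R w) f) z = s\<^sup>2 * partial_d U v (partial_d U v f) z +
    2 * (s * t) * partial_d U v (partial_d U w f) z + t\<^sup>2 * partial_d U w (partial_d U w f) z"
proof -
  \<comment> \<open>The two-term sum is indexed by \<open>bool\<close> to fit
    \<open>partial_d2_expand\<close>.\<close>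
  have "s *\<^sub>R v + t *\<^sub>R w = (\<Sum>b\<in>UNIV. (if b then s else t) *\<^sub>R (if b then v else w))" by (simp add: UNIV_bool)
  then show ?thesis
    by (simp only: partial_d2_expand[OF U f z])
      (simp add: UNIV_bool partial_d_commute[OF U f z, of w v] power2_eq_square)
qed

section \<open>The test function at an interior maximum\<close>

lemma taylor_second_order_lower:
  fixes f :: "'a::euclidean_space \<Rightarrow> real"
  assumes U: "open U" and f: "Ck 2 U U f"
    and seg: "\<And>t. 0 \<le> t \<Longrightarrow> t \<le> 1 \<Longrightarrow> z + t *\<^sub>R v \<in> U"
    and low: "\<And>t. 0 \<le> t \<Longrightarrow> t \<le> 1 \<Longrightarrow> c \<le> partial_d U v (partial_d U v f) (z + t *\<^sub>R v)"
  shows "c / 2 \<le> f (z + v) - f z - partial_d U v f z"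
proof -
  define F where "F t = f (z + t *\<^sub>R v)" for t
  define F1 where "F1 t = partial_d U v f (z + t *\<^sub>R v)" for t
  define F2 where "F2 t = partial_d U v (partial_d U v f) (z + t *\<^sub>R v)" for t
  have D1: "(F has_real_derivative F1 t) (at t)" if "0 \<le> t" "t \<le> 1" for t
    unfolding F_def F1_def
    by (rule partial_d_chain[where \<gamma> = "\<lambda>t. z + t *\<^sub>R v", OF seg[OF that] Ck_2_differentiable[OF f seg[OF that]]]) (auto intro!: derivative_eq_intros)
  have D2: "(F1 has_real_derivative F2 t) (at t)" if "0 \<le> t" "t \<le> 1" for t
    unfolding F1_def F2_def
    by (rule partial_d_chain[where \<gamma> = "\<lambda>t. z + t *\<^sub>R v" and f = "partial_d U v f", OF seg[OF that] Ck_differentiable[OF Ck_2_partial_d[OF U f] _ seg[OF that]]])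
      (auto intro!: derivative_eq_intros)
  define G where "G t = F t - F 0 - t * F1 0 - t\<^sup>2 / 2 * c" for t
  have DG: "(G has_real_derivative (F1 t - F1 0 - t * c)) (at t)" if "0 \<le> t" "t \<le> 1" for t
    unfolding G_def by (rule derivative_eq_intros D1[OF that] refl | simp)+
  have nonneg: "F1 t - F1 0 - t * c \<ge> 0" if t: "0 \<le> t" "t \<le> 1" for t
  proof (cases "t = 0")
    case False
    then obtain s where s: "0 < s" "s < t" "F1 t - F1 0 = (t - 0) * F2 s"
      using MVT2[of 0 t F1 F2] D2 t by auto
    have "c \<le> F2 s" using low[of s] s t by (simp add: F2_def)
    then have "t * c \<le> t * F2 s" using t by (intro mult_left_mono) auto
    then show ?thesis using s by simp
  qed simp
  have "G 0 \<le> G 1"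
    by (rule DERIV_nonneg_imp_nondecreasing[of 0 1 G]) (use DG nonneg in \<open>auto intro!: exI\<close>)
  then show ?thesis by (simp add: G_def F_def F1_def)
qed

text \<open>The situation at a point \<open>x0\<close> where the largest eigenvalue of the augmented Hessian is attained in the
  direction \<open>q m\<close> of an eigenframe \<open>q\<close>: the constant \<open>\<Lambda>\<close> controls all data near \<open>(x0, Du(x0))\<close>, and \<open>\<delta>\<close>
  measures the strict admissibility of \<open>usub\<close>. The order of the operator is \<open>k + 1\<close>.\<close>

locale eigenframe_point =
  fixes \<Omega> :: "(real^'n) set" and k :: nat
    and A :: "(real^'n) \<times> (real^'n) \<Rightarrow> real^'n^'n" and B :: "(real^'n) \<times> (real^'n) \<Rightarrow> real"
    and u usub :: "real^'n \<Rightarrow> real" and x0 :: "real^'n" and q :: "'n \<Rightarrow> real^'n"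
    and lam :: "'n \<Rightarrow> real" and m :: 'n and \<Lambda> \<delta> :: real
  assumes open_dom: "open \<Omega>" and x0: "x0 \<in> \<Omega>"
    and A2: "\<And>i j. Ck 2 (\<Omega> \<times> UNIV) (\<Omega> \<times> UNIV) (\<lambda>z. A z $ i $ j)"
    and A_sym: "\<And>x p. x \<in> \<Omega> \<Longrightarrow> transpose (A (x, p)) = A (x, p)"
    and reg: "regular_matrix \<Omega> A"
    and B2: "Ck 2 (\<Omega> \<times> UNIV) (\<Omega> \<times> UNIV) B" and B_pos: "\<forall>z\<in>\<Omega> \<times> UNIV. B z > 0"
    and conv: "convex_in_p \<Omega> (\<lambda>z. B z powr (1 / real (Suc k)))"
    and u4: "Ck 4 \<Omega> \<Omega> u" and us2: "Ck 2 \<Omega> \<Omega> usub"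
    and eqn: "\<And>x. x \<in> \<Omega> \<Longrightarrow> pminor_sum (Suc k) (aug_hess \<Omega> A u x) = B (x, grad \<Omega> u x)"
    and frame: "orthonormal_frame q"
    and eigen: "\<And>i j. q i \<bullet> (aug_hess \<Omega> A u x0 *v q j) = (if i = j then lam i else 0)"
    and cone: "esym_cone (Suc k) UNIV lam" and lam_max: "\<And>i. lam i \<le> lam m" and lam_m: "1 \<le> lam m"
    and \<Lambda>1: "\<Lambda> \<ge> 1" and \<delta>0: "\<delta> > 0"
    and bound_A0: "\<And>\<xi> \<eta>. norm \<xi> \<le> 1 \<Longrightarrow> norm \<eta> \<le> 1 \<Longrightarrow> \<bar>mat_entry A \<xi> \<eta> (x0, grad \<Omega> u x0)\<bar> \<le> \<Lambda>"
    and bound_A1: "\<And>\<xi> \<eta> v. norm \<xi> \<le> 1 \<Longrightarrow> norm \<eta> \<le> 1 \<Longrightarrow>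
      \<bar>partial_d (\<Omega> \<times> UNIV) v (mat_entry A \<xi> \<eta>) (x0, grad \<Omega> u x0)\<bar> \<le> \<Lambda> * norm v"
    and bound_A2: "\<And>\<xi> \<eta> v w t. norm \<xi> \<le> 1 \<Longrightarrow> norm \<eta> \<le> 1 \<Longrightarrow> 0 \<le> t \<Longrightarrow> t \<le> 1 \<Longrightarrow>
      \<bar>partial_d (\<Omega> \<times> UNIV) v (partial_d (\<Omega> \<times> UNIV) w (mat_entry A \<xi> \<eta>))
        (x0, grad \<Omega> u x0 + t *\<^sub>R (grad \<Omega> usub x0 - grad \<Omega> u x0))\<bar> \<le> \<Lambda> * norm v * norm w"
    and bound_B0: "B (x0, grad \<Omega> u x0) \<le> \<Lambda>" "1 \<le> \<Lambda> * B (x0, grad \<Omega> u x0)"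
    and bound_B1: "\<And>v. \<bar>partial_d (\<Omega> \<times> UNIV) v B (x0, grad \<Omega> u x0)\<bar> \<le> \<Lambda> * norm v"
    and bound_B2: "\<And>v w. \<bar>partial_d (\<Omega> \<times> UNIV) v (partial_d (\<Omega> \<times> UNIV) w B) (x0, grad \<Omega> u x0)\<bar> \<le> \<Lambda> * norm v * norm w"
    and bound_u: "\<bar>u x0\<bar> \<le> \<Lambda>" "\<bar>usub x0\<bar> \<le> \<Lambda>" "norm (grad \<Omega> u x0) \<le> \<Lambda>" "norm (grad \<Omega> usub x0) \<le> \<Lambda>"
    and strict: "\<And>j. j \<le> Suc k \<Longrightarrow> 0 < pminor_sum j (aug_hess \<Omega> A usub x0 - \<delta> *\<^sub>R mat 1)"
begin

abbreviation dom :: "((real^'n) \<times> (real^'n)) set" where "dom \<equiv> \<Omega> \<times> UNIV"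
abbreviation pt :: "(real^'n) \<times> (real^'n)" where "pt \<equiv> (x0, grad \<Omega> u x0)"
abbreviation d :: "'n \<Rightarrow> (real^'n \<Rightarrow> real) \<Rightarrow> real^'n \<Rightarrow> real" where "d a \<equiv> partial_d \<Omega> (q a)"

lemma dom: "open dom" "pt \<in> dom"
  using open_dom x0 by (auto simp: open_Times)

lemma norm_q [simp]: "norm (q a) = 1"
  using frame by (simp add: orthonormal_frame_def norm_eq_sqrt_inner)

lemma Ck_u: "Ck 2 \<Omega> \<Omega> u" "Ck 3 \<Omega> \<Omega> u" "Ck 2 \<Omega> \<Omega> (partial_d \<Omega> v u)" "Ck 3 \<Omega> \<Omega> (partial_d \<Omega> v u)"
  "Ck 2 \<Omega> \<Omega> (partial_d \<Omega> w (partial_d \<Omega> v u))"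
  using Ck_le[OF u4, of 2] Ck_le[OF u4, of 3] Ck_4_partial_d[OF open_dom u4]
    Ck_3_partial_d[OF open_dom Ck_4_partial_d[OF open_dom u4]] Ck_le[OF Ck_4_partial_d[OF open_dom u4], of 2] by simp_all

lemma Ck_entry: "Ck 2 dom dom (mat_entry A \<xi> \<eta>)"
  by (rule Ck_mat_entry[OF dom(1) A2])

section \<open>Derivatives of the solution in the frame\<close>

definition U1 where "U1 a = d a u x0"
definition U2 where "U2 a b = d a (d b u) x0"
definition U3 where "U3 a b c = d a (d b (d c u)) x0"
text \<open>Velocity at \<open>0\<close> of the curve
  \<open>t \<mapsto> (x0 + t *\<^sub>R q c, Du(x0 + t *\<^sub>R q c))\<close>; \<open>h\<close> is
  its acceleration, whose first component vanishes because the base points move on a line.\<close>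

definition g where "g c = (q c, grad \<Omega> (d c u) x0)"
definition h where "h c = ((0 :: real^'n), grad \<Omega> (d c (d c u)) x0)"

lemma U2_sym: "U2 a b = U2 b a"
  unfolding U2_def by (rule partial_d_commute[OF open_dom Ck_u(1) x0])

lemma U3_sym: "U3 i j l = U3 l i j" "U3 i j l = U3 j i l"
  unfolding U3_def using partial_d_commute3[OF open_dom Ck_u(2) x0] by blast+

lemma grad_d: "grad \<Omega> (d c u) x0 \<bullet> q b = U2 c b" "grad \<Omega> (d c (d c u)) x0 \<bullet> q b = U3 c c b"
proof -
  show "grad \<Omega> (d c u) x0 \<bullet> q b = U2 c b"
    using grad_inner[OF x0 Ck_2_differentiable[OF Ck_u(3) x0], of "q b" "q c"] U2_sym[of b c]
    by (simp add: U2_def inner_commute)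
  show "grad \<Omega> (d c (d c u)) x0 \<bullet> q b = U3 c c b"
    using grad_inner[OF x0 Ck_2_differentiable[OF Ck_u(5) x0], of "q b" "q c" "q c"] U3_sym(1)[of c c b]
    by (simp add: U3_def inner_commute)
qed

lemma eventually_line: "\<forall>\<^sub>F t in nhds 0. x0 + t *\<^sub>R v \<in> \<Omega>"
proof (rule topological_tendstoD[OF _ open_dom])
  have "isCont (\<lambda>t. x0 + t *\<^sub>R v) 0" by (intro continuous_intros)
  then show "((\<lambda>t. x0 + t *\<^sub>R v) \<longlongrightarrow> x0) (nhds 0)"
    using tendsto_at_iff_tendsto_nhds[of "\<lambda>t. x0 + t *\<^sub>R v" 0] by (simp add: isCont_def)
qed (rule x0)

lemma J2_curve:
  assumes f: "Ck 2 dom dom f"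
  shows "J2 (\<lambda>t. f (x0 + t *\<^sub>R q c, grad \<Omega> u (x0 + t *\<^sub>R q c))) (f pt) (partial_d dom (g c) f pt)
    (partial_d dom (g c) (partial_d dom (g c) f) pt + partial_d dom (h c) f pt)"
proof (rule J2_along_curve[OF dom(1) f dom(2)])
  fix b :: "(real^'n) \<times> (real^'n)" assume "b \<in> Basis"
  then consider e where "b = (e, 0)" | e where "b = (0, e)" by (auto simp: Basis_prod_def)
  then show "J2 (\<lambda>t. (x0 + t *\<^sub>R q c, grad \<Omega> u (x0 + t *\<^sub>R q c)) \<bullet> b) (pt \<bullet> b) (g c \<bullet> b) (h c \<bullet> b)"
  proof cases
    case 1
    then show ?thesis using J2_affine[of "x0 \<bullet> e" "q c \<bullet> e"] by (simp add: g_def h_def inner_add_left)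
  next
    case 2
    have J: "J2 (\<lambda>t. partial_d \<Omega> e u (x0 + t *\<^sub>R q c)) (partial_d \<Omega> e u x0) (d c (partial_d \<Omega> e u) x0) (d c (d c (partial_d \<Omega> e u)) x0)"
      by (rule J2_along_line[OF open_dom Ck_u(3) x0])
    have gi: "grad \<Omega> u y \<bullet> e = partial_d \<Omega> e u y" if "y \<in> \<Omega>" for y
      using grad_inner[OF that Ck_2_differentiable[OF Ck_u(1) that], of e] by (simp add: inner_commute)
    have "d c (partial_d \<Omega> e u) x0 = grad \<Omega> (d c u) x0 \<bullet> e"
      using grad_inner[OF x0 Ck_2_differentiable[OF Ck_u(3) x0], of e "q c"] partial_d_commute[OF open_dom Ck_u(1) x0]
      by (simp add: inner_commute)
    moreover have "d c (d c (partial_d \<Omega> e u)) x0 = grad \<Omega> (d c (d c u)) x0 \<bullet> e"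
      using grad_inner[OF x0 Ck_2_differentiable[OF Ck_u(5) x0], of e "q c" "q c"]
        partial_d_commute3(2)[OF open_dom Ck_u(2) x0, of "q c" "q c" e] by (simp add: inner_commute)
    ultimately have "J2 (\<lambda>t. partial_d \<Omega> e u (x0 + t *\<^sub>R q c)) (pt \<bullet> b) (g c \<bullet> b) (h c \<bullet> b)"
      using J gi[OF x0] 2 by (simp add: g_def h_def)
    then show ?thesis
    proof (rule J2_cong_ev)
      show "\<forall>\<^sub>F t in nhds 0. partial_d \<Omega> e u (x0 + t *\<^sub>R q c) = (x0 + t *\<^sub>R q c, grad \<Omega> u (x0 + t *\<^sub>R q c)) \<bullet> b"
        using eventually_line[of "q c"] by eventually_elim (simp add: 2 gi)
    qed
  qed
qed

lemma partial_d_g: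
  assumes "Ck 2 dom dom f"
  shows "partial_d dom (g c) f pt = partial_d dom (q c, 0) f pt + (\<Sum>b\<in>UNIV. U2 c b * partial_d dom (0, q b) f pt)"
    and "partial_d dom (h c) f pt = (\<Sum>b\<in>UNIV. U3 c c b * partial_d dom (0, q b) f pt)"
proof -
  note D = Ck_2_differentiable[OF assms dom(2)]
  show "partial_d dom (g c) f pt = partial_d dom (q c, 0) f pt + (\<Sum>b\<in>UNIV. U2 c b * partial_d dom (0, q b) f pt)"
    unfolding g_def partial_d_split[OF frame dom(2) D, of "q c" "grad \<Omega> (d c u) x0"] grad_d ..
  have "partial_d dom (0, 0) f pt = 0"
    using partial_d_linear[OF dom(2) D, of "\<lambda>_. 0" "\<lambda>_. 0" "{}"] by (simp add: zero_prod_def)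
  then show "partial_d dom (h c) f pt = (\<Sum>b\<in>UNIV. U3 c c b * partial_d dom (0, q b) f pt)"
    unfolding h_def partial_d_split[OF frame dom(2) D, of 0 "grad \<Omega> (d c (d c u)) x0"] grad_d by simp
qed

abbreviation ent where "ent i j \<equiv> mat_entry A (q i) (q j)"

text \<open>Derivative along \<open>q c\<close> of the entry \<open>(i, j)\<close> of the augmented
  Hessian in the fixed frame; \<open>W2\<close> is the second derivative.\<close>

definition W1 where "W1 c i j = U3 c i j - partial_d dom (g c) (ent i j) pt"
definition W2 where "W2 c i j = d c (d c (d i (d j u))) x0 - partial_d dom (g c) (partial_d dom (g c) (ent i j)) pt - partial_d dom (h c) (ent i j) pt"

lemma aug_hess_entry:
  assumes "x \<in> \<Omega>"
  shows "q i \<bullet> (aug_hess \<Omega> A u x *v q j) = d i (d j u) x - ent i j (x, grad \<Omega> u x)"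
  using hess_inner[OF open_dom assms Ck_u(1)]
  by (simp add: aug_hess_def matrix_vector_mult_diff_rdistrib inner_diff_right mat_entry_def)

lemma J2_entry:
  "J2 (\<lambda>t. frame_matrix q (aug_hess \<Omega> A u (x0 + t *\<^sub>R q c)) $ i $ j) (if i = j then lam i else 0) (W1 c i j) (W2 c i j)"
proof -
  have "J2 (\<lambda>t. d i (d j u) (x0 + t *\<^sub>R q c) - ent i j (x0 + t *\<^sub>R q c, grad \<Omega> u (x0 + t *\<^sub>R q c)))
    (d i (d j u) x0 - ent i j pt) (W1 c i j) (W2 c i j)"
    using J2_diff[OF J2_along_line[OF open_dom Ck_u(5) x0] J2_curve[OF Ck_entry]]
    unfolding W1_def W2_def U3_def diff_diff_eq .
  moreover have "d i (d j u) x0 - ent i j pt = (if i = j then lam i else 0)"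
    using aug_hess_entry[OF x0, of i j] eigen[of i j] by simp
  ultimately have "J2 (\<lambda>t. d i (d j u) (x0 + t *\<^sub>R q c) - ent i j (x0 + t *\<^sub>R q c, grad \<Omega> u (x0 + t *\<^sub>R q c)))
    (if i = j then lam i else 0) (W1 c i j) (W2 c i j)" by simp
  then show ?thesis
  proof (rule J2_cong_ev)
    show "\<forall>\<^sub>F t in nhds 0. d i (d j u) (x0 + t *\<^sub>R q c) - ent i j (x0 + t *\<^sub>R q c, grad \<Omega> u (x0 + t *\<^sub>R q c))
      = frame_matrix q (aug_hess \<Omega> A u (x0 + t *\<^sub>R q c)) $ i $ j"
      using eventually_line[of "q c"] by eventually_elim (simp add: frame_matrix_def aug_hess_entry)
  qed
qed

definition \<sigma> where "\<sigma> i = esym k (UNIV - {i}) lam"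
abbreviation S2 where "S2 i l \<equiv> esym_pred k (UNIV - {i} - {l}) lam"

lemma \<sigma>_pos: "\<sigma> i > 0"
  using esym_cone_remove[of UNIV i k lam] cone by (simp add: \<sigma>_def esym_cone_def)

text \<open>Near \<open>x0\<close> both sides of the equation are the same function on each line in
  a frame direction. The left side is expanded through principal minors in the fixed frame, the
  right side by the chain rule along \<open>(x, Du(x))\<close>.\<close>

lemma equation_jets:
  shows "esym (Suc k) UNIV lam = B pt"
    and "(\<Sum>i\<in>UNIV. W1 c i i * \<sigma> i) = partial_d dom (g c) B pt"
    and "(\<Sum>i\<in>UNIV. W2 c i i * \<sigma> i) + (\<Sum>i\<in>UNIV. \<Sum>l\<in>UNIV - {i}. (W1 c i i * W1 c l l - W1 c i l * W1 c l i) * S2 i l)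
      = partial_d dom (g c) (partial_d dom (g c) B) pt + partial_d dom (h c) B pt"
proof -
  have J1: "J2 (\<lambda>t. pminor_sum (Suc k) (frame_matrix q (aug_hess \<Omega> A u (x0 + t *\<^sub>R q c)))) (esym (Suc k) UNIV lam)
    (\<Sum>i\<in>UNIV. W1 c i i * \<sigma> i)
    ((\<Sum>i\<in>UNIV. W2 c i i * \<sigma> i) + (\<Sum>i\<in>UNIV. \<Sum>l\<in>UNIV - {i}. (W1 c i i * W1 c l l - W1 c i l * W1 c l i) * S2 i l))" for c
    unfolding \<sigma>_def by (rule J2_pminor_sum[OF J2_entry])
  have J2: "J2 (\<lambda>t. pminor_sum (Suc k) (frame_matrix q (aug_hess \<Omega> A u (x0 + t *\<^sub>R q c)))) (B pt)
    (partial_d dom (g c) B pt) (partial_d dom (g c) (partial_d dom (g c) B) pt + partial_d dom (h c) B pt)" for c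
  proof (rule J2_cong_ev[OF J2_curve[OF B2]])
    show "\<forall>\<^sub>F t in nhds 0. B (x0 + t *\<^sub>R q c, grad \<Omega> u (x0 + t *\<^sub>R q c)) =
      pminor_sum (Suc k) (frame_matrix q (aug_hess \<Omega> A u (x0 + t *\<^sub>R q c)))"
      using eventually_line[of "q c"] by eventually_elim (simp add: pminor_sum_frame_matrix[OF frame] eqn)
  qed
  show "esym (Suc k) UNIV lam = B pt" using J2_unique(1)[OF J1[of m] J2[of m]] .
  show "(\<Sum>i\<in>UNIV. W1 c i i * \<sigma> i) = partial_d dom (g c) B pt" using J2_unique(2)[OF J1 J2] .
  show "(\<Sum>i\<in>UNIV. W2 c i i * \<sigma> i) + (\<Sum>i\<in>UNIV. \<Sum>l\<in>UNIV - {i}. (W1 c i i * W1 c l l - W1 c i l * W1 c l i) * S2 i l)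
      = partial_d dom (g c) (partial_d dom (g c) B) pt + partial_d dom (h c) B pt" using J2_unique(3)[OF J1 J2] .
qed

text \<open>The \<open>1\<close> bounds the \<open>x\<close>-component \<open>q c\<close> of
  \<open>g c\<close>; the other summand bounds the part of its \<open>p\<close>-component that does
  not grow with \<open>lam c\<close>.\<close>

definition R where "R = 1 + real CARD('n) * \<Lambda>"

lemma R_ge: "R \<ge> 1 + real CARD('n)" "R \<ge> 1" "R \<ge> 2"
proof -
  have "real CARD('n) * 1 \<le> real CARD('n) * \<Lambda>" using \<Lambda>1 by (intro mult_left_mono) auto
  moreover have "real CARD('n) \<ge> 1" by (simp add: Suc_le_eq)
  ultimately show "R \<ge> 1 + real CARD('n)" "R \<ge> 1" "R \<ge> 2" unfolding R_def by linarith+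
qed

lemma U2_eq: "U2 i j = (if i = j then lam i else 0) + ent i j pt"
  using aug_hess_entry[OF x0, of i j] eigen[of i j] by (simp add: U2_def)

text \<open>The only part of \<open>D(u_c)\<close> that can be large points in the direction
  \<open>q c\<close> itself. This is what lets regularity act on the terms quadratic in
  \<open>lam m\<close>.\<close>

lemma grad_d_split: "grad \<Omega> (d c u) x0 = lam c *\<^sub>R q c + (\<Sum>b\<in>UNIV. ent c b pt *\<^sub>R q b)"
proof -
  have "grad \<Omega> (d c u) x0 = (\<Sum>b\<in>UNIV. U2 c b *\<^sub>R q b)"
    using frame_expand[OF frame, of "grad \<Omega> (d c u) x0"] by (simp add: grad_d)
  also have "\<dots> = (\<Sum>b\<in>UNIV. (if c = b then lam c else 0) *\<^sub>R q b) + (\<Sum>b\<in>UNIV. ent c b pt *\<^sub>R q b)"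
    by (simp add: U2_eq scaleR_add_left sum.distrib)
  also have "(\<Sum>b\<in>UNIV. (if c = b then lam c else 0) *\<^sub>R q b) = lam c *\<^sub>R q c"
    by (simp add: if_distrib[where f = "\<lambda>x. x *\<^sub>R _"] cong: if_cong)
  finally show ?thesis .
qed

lemma norm_ent_sum: "norm (\<Sum>b\<in>UNIV. ent c b pt *\<^sub>R q b) \<le> real CARD('n) * \<Lambda>"
proof -
  have "norm (\<Sum>b\<in>UNIV. ent c b pt *\<^sub>R q b) \<le> (\<Sum>b\<in>UNIV. norm (ent c b pt *\<^sub>R q b))" by (rule norm_sum)
  also have "\<dots> \<le> (\<Sum>b\<in>(UNIV :: 'n set). \<Lambda>)" by (intro sum_mono) (simp add: bound_A0)
  finally show ?thesis by simp
qed

lemma norm_g: "norm (grad \<Omega> (d c u) x0) \<le> R + \<bar>lam c\<bar>" "norm (g c) \<le> R + \<bar>lam c\<bar>"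
proof -
  have *: "norm (grad \<Omega> (d c u) x0) \<le> \<bar>lam c\<bar> + real CARD('n) * \<Lambda>"
    unfolding grad_d_split using norm_triangle_ineq[of "lam c *\<^sub>R q c" "\<Sum>b\<in>UNIV. ent c b pt *\<^sub>R q b"] norm_ent_sum[of c] by simp
  then show "norm (grad \<Omega> (d c u) x0) \<le> R + \<bar>lam c\<bar>" by (simp add: R_def)
  have "norm (g c) \<le> norm (q c) + norm (grad \<Omega> (d c u) x0)" unfolding g_def by (rule norm_Pair_le)
  then show "norm (g c) \<le> R + \<bar>lam c\<bar>" using * by (simp add: R_def)
qed

text \<open>The trace is positive in the cone, so a negative eigenvalue is outweighed by the others,
  each of which is at most \<open>lam m\<close>.\<close>

lemma lam_abs: "\<bar>lam i\<bar> \<le> real CARD('n) * lam m"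
proof -
  have N: "real CARD('n) \<ge> 1" by (simp add: Suc_le_eq)
  have "0 < esym 1 UNIV lam" using cone by (simp add: esym_cone_def)
  then have "0 < (\<Sum>i\<in>UNIV. lam i)" by (simp add: esym_1)
  also have "\<dots> = lam i + (\<Sum>j\<in>UNIV - {i}. lam j)" by (rule sum.remove) auto
  also have "(\<Sum>j\<in>UNIV - {i}. lam j) \<le> (\<Sum>j\<in>UNIV - {i}. lam m)" by (intro sum_mono lam_max)
  also have "\<dots> = (real CARD('n) - 1) * lam m" using N by (simp add: card_Diff_singleton of_nat_diff)
  finally have "- lam i \<le> (real CARD('n) - 1) * lam m" by simp
  also have "\<dots> \<le> real CARD('n) * lam m" using lam_m by (intro mult_right_mono) auto
  finally have "- lam i \<le> real CARD('n) * lam m" .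
  moreover have "lam i \<le> 1 * lam m" using lam_max by simp
  moreover have "1 * lam m \<le> real CARD('n) * lam m" using N lam_m by (intro mult_right_mono) auto
  ultimately show ?thesis by linarith
qed

text \<open>A common majorant for the pointwise bounds below; \<open>6 * \<Lambda> ^ 3\<close> stems
  from \<open>second_derivative_B\<close> and \<open>R\<^sup>2\<close> from squaring
  \<open>norm (g c)\<close>.\<close>

definition \<Lambda>' where "\<Lambda>' = 6 * \<Lambda> ^ 3 * R\<^sup>2"

lemma \<Lambda>'_ge: "\<Lambda> \<le> \<Lambda>'" "2 * \<Lambda> * R\<^sup>2 \<le> \<Lambda>'" "6 * \<Lambda> ^ 3 * R \<le> \<Lambda>'" "2 * \<Lambda> * R \<le> \<Lambda>'" "\<Lambda>' \<ge> 1"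
proof -
  have L: "\<Lambda> \<le> \<Lambda> ^ 3" "1 \<le> \<Lambda> ^ 3" using \<Lambda>1 by (auto intro: self_le_power one_le_power)
  have R: "R \<le> R\<^sup>2" "1 \<le> R\<^sup>2" using R_ge by (auto intro: self_le_power one_le_power)
  have "\<Lambda> * R\<^sup>2 \<le> \<Lambda> ^ 3 * R\<^sup>2" using L by (intro mult_right_mono) auto
  moreover have "\<Lambda> * 1 \<le> \<Lambda> * R\<^sup>2" "\<Lambda> * R \<le> \<Lambda> * R\<^sup>2" using R \<Lambda>1 by (intro mult_left_mono; simp)+
  moreover have "\<Lambda> ^ 3 * R \<le> \<Lambda> ^ 3 * R\<^sup>2" using R L \<Lambda>1 by (intro mult_left_mono) auto
  ultimately show "\<Lambda> \<le> \<Lambda>'" "2 * \<Lambda> * R\<^sup>2 \<le> \<Lambda>'" "6 * \<Lambda> ^ 3 * R \<le> \<Lambda>'" "2 * \<Lambda> * R \<le> \<Lambda>'" "\<Lambda>' \<ge> 1"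
    using \<Lambda>1 unfolding \<Lambda>'_def by linarith+
qed

lemma bound_A2_pt: "norm \<xi> \<le> 1 \<Longrightarrow> norm \<eta> \<le> 1 \<Longrightarrow>
  \<bar>partial_d dom v (partial_d dom w (mat_entry A \<xi> \<eta>)) pt\<bar> \<le> \<Lambda> * norm v * norm w"
  using bound_A2[of \<xi> \<eta> 0 v w] by simp

text \<open>A loss of order \<open>(lam c)\<^sup>2\<close> is affordable here: weighted with
  \<sigma> it sums to a multiple of \<open>T + Q\<close>, which is later divided by
  \<open>lam m\<close>.\<close>

lemma second_derivative_gg: "\<bar>partial_d dom (g c) (partial_d dom (g c) (ent i j)) pt\<bar> \<le> \<Lambda>' * (1 + (lam c)\<^sup>2)"
proof -
  have "\<bar>partial_d dom (g c) (partial_d dom (g c) (ent i j)) pt\<bar> \<le> \<Lambda> * norm (g c) * norm (g c)"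
    by (rule bound_A2_pt) simp_all
  also have "\<dots> = \<Lambda> * (norm (g c))\<^sup>2" by (simp add: power2_eq_square)
  also have "\<dots> \<le> \<Lambda> * (2 * R\<^sup>2 * (1 + (lam c)\<^sup>2))"
  proof (rule mult_left_mono)
    have "(norm (g c))\<^sup>2 \<le> (R + \<bar>lam c\<bar>)\<^sup>2" using norm_g by (intro power_mono) auto
    also have "\<dots> \<le> 2 * R\<^sup>2 + 2 * (lam c)\<^sup>2"
      using zero_le_power2[of "R - \<bar>lam c\<bar>"] by (simp add: power2_eq_square algebra_simps)
    also have "\<dots> \<le> 2 * R\<^sup>2 * (1 + (lam c)\<^sup>2)"
      using mult_right_mono[of 1 "R\<^sup>2" "(lam c)\<^sup>2"] one_le_power[of R 2] R_ge(2) by (simp add: algebra_simps)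
    finally show "(norm (g c))\<^sup>2 \<le> 2 * R\<^sup>2 * (1 + (lam c)\<^sup>2)" .
  qed (use \<Lambda>1 in simp)
  also have "\<dots> = 2 * \<Lambda> * R\<^sup>2 * (1 + (lam c)\<^sup>2)" by simp
  also have "\<dots> \<le> \<Lambda>' * (1 + (lam c)\<^sup>2)" using \<Lambda>'_ge by (intro mult_right_mono) auto
  finally show ?thesis .
qed

text \<open>In \<open>g m\<close> the large part is \<open>lam m\<close> times the
  \<open>p\<close>-direction \<open>q m\<close>, which is orthogonal to \<open>q i\<close>.
  Regularity therefore gives the term of order \<open>(lam m)\<^sup>2\<close> a sign, and only the
  cross term, linear in \<open>lam m\<close>, is lost.\<close>

lemma second_derivative_regular:
  assumes "i \<noteq> m"
  shows "- (\<Lambda>' * (1 + lam m)) \<le> partial_d dom (g m) (partial_d dom (g m) (ent i i)) pt"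
proof -
  define e r where "e = ((0 :: real^'n), q m)" and "r = (q m, \<Sum>b\<in>UNIV. ent m b pt *\<^sub>R q b)"
  have "g m = lam m *\<^sub>R e + 1 *\<^sub>R r" unfolding g_def grad_d_split e_def r_def by simp
  then have eq: "partial_d dom (g m) (partial_d dom (g m) (ent i i)) pt =
    (lam m)\<^sup>2 * partial_d dom e (partial_d dom e (ent i i)) pt + 2 * (lam m * 1) * partial_d dom e (partial_d dom r (ent i i)) pt +
    1\<^sup>2 * partial_d dom r (partial_d dom r (ent i i)) pt"
    by (simp only: partial_d2_add[OF dom(1) Ck_entry dom(2)])
  have "norm r \<le> norm (q m) + norm (\<Sum>b\<in>UNIV. ent m b pt *\<^sub>R q b)" unfolding r_def by (rule norm_Pair_le)
  then have r: "norm r \<le> R" using norm_ent_sum[of m] by (simp add: R_def)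
  have e: "norm e = 1" by (simp add: e_def norm_Pair)
  have "q i \<bullet> q m = 0" using assms frame by (simp add: orthonormal_frame_def)
  then have "0 \<le> partial_d dom e (partial_d dom e (ent i i)) pt"
    unfolding e_def by (rule regular_matrix_mat_entry[OF open_dom A2 reg x0])
  then have t1: "0 \<le> (lam m)\<^sup>2 * partial_d dom e (partial_d dom e (ent i i)) pt" by simp
  have "\<bar>partial_d dom e (partial_d dom r (ent i i)) pt\<bar> \<le> \<Lambda> * norm e * norm r" by (rule bound_A2_pt) simp_all
  also have "\<dots> \<le> \<Lambda> * R" using r \<Lambda>1 by (simp add: e)
  finally have *: "2 * lam m * \<bar>partial_d dom e (partial_d dom r (ent i i)) pt\<bar> \<le> 2 * lam m * (\<Lambda> * R)"
    using lam_m by (intro mult_left_mono) auto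
  then have t2: "- (2 * lam m * (\<Lambda> * R)) \<le> 2 * (lam m * 1) * partial_d dom e (partial_d dom r (ent i i)) pt"
  proof -
    have "- (2 * lam m * y) \<le> 2 * (lam m * 1) * x" if "2 * lam m * \<bar>x\<bar> \<le> 2 * lam m * y" for x y
    proof -
      have "2 * lam m * (- x) \<le> 2 * lam m * \<bar>x\<bar>" using lam_m by (intro mult_left_mono) auto
      from order_trans[OF this that] show ?thesis by (simp add: algebra_simps)
    qed
    then show ?thesis using * by blast
  qed
  have "\<bar>partial_d dom r (partial_d dom r (ent i i)) pt\<bar> \<le> \<Lambda> * norm r * norm r" by (rule bound_A2_pt) simp_all
  also have "\<dots> \<le> \<Lambda> * R * R" using r \<Lambda>1 R_ge by (intro mult_mono) auto
  finally have t3: "- (\<Lambda> * R\<^sup>2) \<le> 1\<^sup>2 * partial_d dom r (partial_d dom r (ent i i)) pt" by (simp add: power2_eq_square)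
  have "2 * lam m * (\<Lambda> * R) + \<Lambda> * R\<^sup>2 \<le> 2 * \<Lambda> * R\<^sup>2 * (1 + lam m)"
  proof -
    have "R \<le> R\<^sup>2" using R_ge by (auto intro: self_le_power)
    then have "(2 * lam m * \<Lambda>) * R \<le> (2 * lam m * \<Lambda>) * R\<^sup>2" using lam_m \<Lambda>1 by (intro mult_left_mono) auto
    moreover have "0 \<le> \<Lambda> * R\<^sup>2" using \<Lambda>1 by simp
    ultimately show ?thesis by (simp add: algebra_simps)
  qed
  also have "\<dots> \<le> \<Lambda>' * (1 + lam m)" using \<Lambda>'_ge lam_m by (intro mult_right_mono) auto
  finally show ?thesis unfolding eq using t1 t2 t3 by linarith
qed

text \<open>Convexity concerns the \<open>p\<close>-part of \<open>g m\<close> only. Completing that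
  part to the full derivative of \<open>B\<close> along \<open>g m\<close> costs a term linear in
  \<open>lam m\<close>, since the \<open>x\<close>-part is bounded and \<open>B\<close> is bounded
  below by \<open>1 / \<Lambda>\<close>.\<close>

lemma second_derivative_B:
  "real k / real (Suc k) * (partial_d dom (g m) B pt)\<^sup>2 / B pt - \<Lambda>' * (1 + lam m) \<le> partial_d dom (g m) (partial_d dom (g m) B) pt"
proof -
  define e r where "e = (q m, 0 :: real^'n)" and "r = ((0 :: real^'n), grad \<Omega> (d m u) x0)"
  define \<rho> where "\<rho> = R + lam m"
  have gm: "g m = 1 *\<^sub>R e + 1 *\<^sub>R r" unfolding g_def e_def r_def by simp
  have e: "norm e = 1" and r: "norm r \<le> \<rho>" using norm_g(1)[of m] lam_m by (auto simp: e_def r_def norm_Pair \<rho>_def)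
  have \<rho>: "\<rho> \<ge> 1" using R_ge lam_m by (simp add: \<rho>_def)
  have B0: "B pt > 0" using B_pos dom(2) by blast
  define y1 y2 where "y1 = partial_d dom e B pt" and "y2 = partial_d dom r B pt"
  have y: "partial_d dom (g m) B pt = y1 + y2"
    using partial_d_linear[OF dom(2) Ck_2_differentiable[OF B2 dom(2)], of "\<lambda>_. 1" "\<lambda>b. if b then e else r" UNIV]
    by (simp add: UNIV_bool y1_def y2_def gm add.commute)
  have yb: "\<bar>y1\<bar> \<le> \<Lambda>" "\<bar>y2\<bar> \<le> \<Lambda> * \<rho>"
  proof -
    show "\<bar>y1\<bar> \<le> \<Lambda>" using bound_B1[of e] by (simp add: y1_def e)
    have "\<bar>y2\<bar> \<le> \<Lambda> * norm r" unfolding y2_def by (rule bound_B1)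
    also have "\<dots> \<le> \<Lambda> * \<rho>" using r \<Lambda>1 by simp
    finally show "\<bar>y2\<bar> \<le> \<Lambda> * \<rho>" .
  qed
  define c where "c = real k / real (Suc k)"
  have c: "0 \<le> c" "c \<le> 1" by (auto simp: c_def)
  have conv': "c * y2\<^sup>2 / B pt \<le> partial_d dom r (partial_d dom r B) pt"
    using convex_in_p_powr[OF open_dom B2 B_pos conv _ x0, of "grad \<Omega> (d m u) x0" "grad \<Omega> u x0"] by (simp add: c_def y2_def r_def)
  have "partial_d dom (g m) (partial_d dom (g m) B) pt =
    1\<^sup>2 * partial_d dom e (partial_d dom e B) pt + 2 * (1 * 1) * partial_d dom e (partial_d dom r B) pt + 1\<^sup>2 * partial_d dom r (partial_d dom r B) pt"
    unfolding gm by (rule partial_d2_add[OF dom(1) B2 dom(2)])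
  moreover have "\<bar>partial_d dom e (partial_d dom e B) pt\<bar> \<le> \<Lambda>" using bound_B2[of e e] by (simp add: e)
  moreover have "\<bar>partial_d dom e (partial_d dom r B) pt\<bar> \<le> \<Lambda> * \<rho>"
  proof -
    have "\<bar>partial_d dom e (partial_d dom r B) pt\<bar> \<le> \<Lambda> * norm e * norm r" by (rule bound_B2)
    also have "\<dots> \<le> \<Lambda> * \<rho>" using r \<Lambda>1 by (simp add: e)
    finally show ?thesis .
  qed
  ultimately have lower: "c * y2\<^sup>2 / B pt - \<Lambda> - 2 * (\<Lambda> * \<rho>) \<le> partial_d dom (g m) (partial_d dom (g m) B) pt"
    using conv' by simp
  have upper: "c * (y1 + y2)\<^sup>2 / B pt \<le> c * y2\<^sup>2 / B pt + 3 * \<Lambda> ^ 3 * \<rho>"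
  proof -
    have "(y1 + y2)\<^sup>2 = y2\<^sup>2 + y1 * (y1 + 2 * y2)" by (simp add: power2_eq_square algebra_simps)
    moreover have "y1 * (y1 + 2 * y2) \<le> \<Lambda> * (3 * \<Lambda> * \<rho>)"
    proof -
      have "\<Lambda> * 1 \<le> \<Lambda> * \<rho>" using \<rho> \<Lambda>1 by (intro mult_left_mono) auto
      then have "\<bar>y1 + 2 * y2\<bar> \<le> 3 * \<Lambda> * \<rho>" using yb by linarith
      then have "\<bar>y1 * (y1 + 2 * y2)\<bar> \<le> \<Lambda> * (3 * \<Lambda> * \<rho>)" unfolding abs_mult using yb by (intro mult_mono) auto
      then show ?thesis by linarith
    qed
    ultimately have "(y1 + y2)\<^sup>2 \<le> y2\<^sup>2 + 3 * \<Lambda>\<^sup>2 * \<rho>" by (simp add: power2_eq_square)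
    then have "c * (y1 + y2)\<^sup>2 / B pt \<le> c * (y2\<^sup>2 + 3 * \<Lambda>\<^sup>2 * \<rho>) / B pt"
      using c B0 by (intro divide_right_mono mult_left_mono) auto
    also have "\<dots> = c * y2\<^sup>2 / B pt + c * (3 * \<Lambda>\<^sup>2 * \<rho>) * (1 / B pt)" by (simp add: distrib_left add_divide_distrib)
    also have "c * (3 * \<Lambda>\<^sup>2 * \<rho>) * (1 / B pt) \<le> 1 * (3 * \<Lambda>\<^sup>2 * \<rho>) * \<Lambda>"
      using c B0 bound_B0 \<rho> \<Lambda>1 by (intro mult_mono) (auto simp: divide_le_eq)
    also have "1 * (3 * \<Lambda>\<^sup>2 * \<rho>) * \<Lambda> = 3 * \<Lambda> ^ 3 * \<rho>" by (simp add: power2_eq_square power3_eq_cube)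
    finally show ?thesis by simp
  qed
  have "\<Lambda> + 2 * (\<Lambda> * \<rho>) + 3 * \<Lambda> ^ 3 * \<rho> \<le> 6 * \<Lambda> ^ 3 * \<rho>"
  proof -
    have "\<Lambda> \<le> \<Lambda> ^ 3" using \<Lambda>1 by (intro self_le_power) auto
    then have "\<Lambda> * \<rho> \<le> \<Lambda> ^ 3 * \<rho>" using \<rho> by (intro mult_right_mono) auto
    moreover have "\<Lambda> * 1 \<le> \<Lambda> * \<rho>" using \<rho> \<Lambda>1 by (intro mult_left_mono) auto
    ultimately show ?thesis by linarith
  qed
  also have "\<dots> \<le> 6 * \<Lambda> ^ 3 * (R * (1 + lam m))"
    using R_ge lam_m \<Lambda>1 mult_right_mono[of 1 R "lam m"] by (intro mult_left_mono) (auto simp: \<rho>_def algebra_simps)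
  also have "\<dots> = 6 * \<Lambda> ^ 3 * R * (1 + lam m)" by simp
  also have "\<dots> \<le> \<Lambda>' * (1 + lam m)" using \<Lambda>'_ge lam_m by (intro mult_right_mono) auto
  finally have "\<Lambda> + 2 * (\<Lambda> * \<rho>) + 3 * \<Lambda> ^ 3 * \<rho> \<le> \<Lambda>' * (1 + lam m)" .
  then show ?thesis unfolding y c_def[symmetric] using lower upper by linarith
qed

section \<open>Terms of the twice differentiated equation\<close>

definition xd where "xd i c = partial_d dom (q c, 0) (ent i i) pt"
definition pd where "pd i b = partial_d dom (0, q b) (ent i i) pt"
definition Bx where "Bx c = partial_d dom (q c, 0) B pt"
definition Bp where "Bp b = partial_d dom (0, q b) B pt"
definition Q1 where "Q1 c = partial_d dom (g c) (partial_d dom (g c) (ent m m)) pt"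
definition Q2 where "Q2 i = partial_d dom (g m) (partial_d dom (g m) (ent i i)) pt"
definition U4 where "U4 i = d i (d i (d m (d m u))) x0"
text \<open>Concavity terms with exactly one index \<open>m\<close>. By \<open>W1_bound\<close> the
  factor \<open>W1 m m i\<close> is close to the derivative along \<open>q i\<close> of the entry
  that the test function contains.\<close>

definition E where "E = (\<Sum>i\<in>UNIV - {m}. S2 m i * (W1 m m i)\<^sup>2)"

lemma first_derivative_equation:
  "(\<Sum>i\<in>UNIV. \<sigma> i * (U3 c i i - xd i c - (\<Sum>b\<in>UNIV. U2 c b * pd i b))) = Bx c + (\<Sum>b\<in>UNIV. U2 c b * Bp b)"
proof -
  have "W1 c i i = U3 c i i - xd i c - (\<Sum>b\<in>UNIV. U2 c b * pd i b)" for i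
    unfolding W1_def partial_d_g(1)[OF Ck_entry] xd_def pd_def by simp
  then show ?thesis
    using equation_jets(2)[of c] unfolding partial_d_g(1)[OF B2] Bx_def Bp_def by (simp add: mult.commute)
qed

lemma W1_sym: "W1 c i j = W1 c j i"
proof -
  have "ent i j z = ent j i z" if "z \<in> dom" for z
    using that A_sym inner_matrix_symmetric[of "A z" "q j" "q i"]
    by (cases z) (auto simp: mat_entry_def inner_commute)
  then have "partial_d dom (g c) (ent i j) pt = partial_d dom (g c) (ent j i) pt"
    by (intro partial_d_cong[OF dom]) auto
  moreover have "U3 c i j = U3 c j i" using U3_sym by metis
  ultimately show ?thesis by (simp add: W1_def)
qed

lemma S2_sym: "S2 i l = S2 l i"
proof -
  have "UNIV - {i} - {l} = UNIV - {l} - {i}" by auto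
  then show ?thesis by simp
qed

lemma S2_nonneg: "i \<noteq> l \<Longrightarrow> 0 \<le> S2 i l"
  by (rule esym_pred_nonneg) (use cone in auto)

text \<open>The diagonal products \<open>Y\<close> are bounded by concavity with the same factor
  \<open>k / (k + 1)\<close> with which convexity bounds the second derivative of \<open>B\<close>,
  so both cancel. Of the off-diagonal terms those with one index \<open>m\<close> are kept; symmetry
  counts them twice.\<close>

lemma second_derivative_equation:
  "2 * E + (\<Sum>b\<in>UNIV. U3 m m b * Bp b) - \<Lambda>' * (1 + lam m) \<le>
    (\<Sum>i\<in>UNIV. \<sigma> i * (U4 i - Q2 i - (\<Sum>b\<in>UNIV. U3 m m b * pd i b)))"
proof -
  define Y Z where "Y = (\<Sum>i\<in>UNIV. \<Sum>l\<in>UNIV - {i}. W1 m i i * W1 m l l * S2 i l)"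
    and "Z = (\<Sum>i\<in>UNIV. \<Sum>l\<in>UNIV - {i}. S2 i l * (W1 m i l)\<^sup>2)"
  have W2: "W2 m i i = U4 i - Q2 i - (\<Sum>b\<in>UNIV. U3 m m b * pd i b)" for i
    unfolding W2_def partial_d_g(2)[OF Ck_entry] U4_def Q2_def pd_def
    using partial_d_commute4[OF open_dom u4 x0, of "q m" "q i"] by simp
  have "(\<Sum>i\<in>UNIV. \<Sum>l\<in>UNIV - {i}. (W1 m i i * W1 m l l - W1 m i l * W1 m l i) * S2 i l) = Y - Z"
    unfolding Y_def Z_def sum_subtractf[symmetric]
  proof (intro sum.cong refl)
    fix i l
    show "(W1 m i i * W1 m l l - W1 m i l * W1 m l i) * S2 i l = W1 m i i * W1 m l l * S2 i l - S2 i l * (W1 m i l)\<^sup>2"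
      unfolding W1_sym[of m l i] by (simp add: left_diff_distrib power2_eq_square)
  qed
  then have eq: "(\<Sum>i\<in>UNIV. \<sigma> i * (U4 i - Q2 i - (\<Sum>b\<in>UNIV. U3 m m b * pd i b))) =
    partial_d dom (g m) (partial_d dom (g m) B) pt + (\<Sum>b\<in>UNIV. U3 m m b * Bp b) - Y + Z"
    using equation_jets(3)[of m] unfolding W2 partial_d_g(2)[OF B2] Bp_def by (simp add: mult.commute)
  have B0: "B pt > 0" using B_pos dom(2) by blast
  have "Y \<le> real k / real (Suc k) * (partial_d dom (g m) B pt)\<^sup>2 / B pt"
  proof -
    have "real (Suc k) * Y * B pt \<le> real k * (partial_d dom (g m) B pt)\<^sup>2"
      using esym_concave[OF finite cone, of "\<lambda>i. W1 m i i"] equation_jets(1) equation_jets(2)[of m]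
      by (simp add: Y_def \<sigma>_def)
    then have "Y \<le> (real k * (partial_d dom (g m) B pt)\<^sup>2) / (real (Suc k) * B pt)"
      using B0 by (subst pos_le_divide_eq) (auto simp: mult_ac simp del: of_nat_Suc)
    then show ?thesis by (simp only: times_divide_eq_left divide_divide_eq_left)
  qed
  moreover have "2 * E \<le> Z"
  proof -
    define s where "s i l = S2 i l * (W1 m i l)\<^sup>2" for i l
    have nn: "0 \<le> s i l" if "i \<noteq> l" for i l using S2_nonneg[OF that] by (simp add: s_def)
    have sm: "s i m = s m i" for i unfolding s_def by (simp add: S2_sym[of i m] W1_sym[of m i m])
    have "Z = (\<Sum>l\<in>UNIV - {m}. s m l) + (\<Sum>i\<in>UNIV - {m}. \<Sum>l\<in>UNIV - {i}. s i l)"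
      unfolding Z_def s_def[symmetric] by (rule sum.remove) auto
    moreover have "(\<Sum>i\<in>UNIV - {m}. s i m) \<le> (\<Sum>i\<in>UNIV - {m}. \<Sum>l\<in>UNIV - {i}. s i l)"
      by (intro sum_mono member_le_sum) (auto intro: nn)
    ultimately show ?thesis unfolding sm by (simp add: E_def s_def)
  qed
  ultimately show ?thesis unfolding eq using second_derivative_B by linarith
qed

text \<open>Third derivatives of \<open>u\<close> are symmetric, so the entry \<open>(m, i)\<close>
  differentiated along \<open>q m\<close> and the entry \<open>(m, m)\<close> differentiated along
  \<open>q i\<close> differ only by first derivatives of \<open>A\<close>. This ties the concavity
  terms to the first-order condition at the maximum.\<close>

lemma W1_bound: "\<bar>W1 m m i - (U3 i m m - xd m i - (\<Sum>b\<in>UNIV. U2 i b * pd m b))\<bar> \<le> \<Lambda>' * (1 + lam m)"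
proof -
  have "W1 m m i - (U3 i m m - xd m i - (\<Sum>b\<in>UNIV. U2 i b * pd m b)) =
    partial_d dom (g i) (ent m m) pt - partial_d dom (g m) (ent m i) pt"
    unfolding W1_def partial_d_g(1)[OF Ck_entry, where c = i] xd_def pd_def using U3_sym(1)[of m m i] by simp
  moreover have "\<bar>partial_d dom (g c) (ent j l) pt\<bar> \<le> \<Lambda> * (R + \<bar>lam c\<bar>)" for c j l
  proof -
    have "\<Lambda> * norm (g c) \<le> \<Lambda> * (R + \<bar>lam c\<bar>)" using norm_g(2)[of c] \<Lambda>1 by (intro mult_left_mono) auto
    then show ?thesis using bound_A1[of "q j" "q l" "g c"] by simp
  qed
  ultimately have "\<bar>W1 m m i - (U3 i m m - xd m i - (\<Sum>b\<in>UNIV. U2 i b * pd m b))\<bar> \<le> \<Lambda> * (R + \<bar>lam i\<bar>) + \<Lambda> * (R + \<bar>lam m\<bar>)"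
    by (smt (verit))
  also have "\<dots> \<le> \<Lambda> * (2 * R * (1 + lam m))"
  proof -
    have "\<bar>lam i\<bar> + lam m \<le> (real CARD('n) + 1) * lam m" using lam_abs[of i] by (simp add: algebra_simps)
    also have "\<dots> \<le> R * lam m" using R_ge lam_m by (intro mult_right_mono) auto
    finally have 1: "\<bar>lam i\<bar> + \<bar>lam m\<bar> \<le> R * lam m" using lam_m by simp
    have "0 \<le> R * lam m" using R_ge lam_m by simp
    then have "(R + \<bar>lam i\<bar>) + (R + \<bar>lam m\<bar>) \<le> 2 * R * (1 + lam m)" using 1 by (simp add: algebra_simps)
    then have "\<Lambda> * ((R + \<bar>lam i\<bar>) + (R + \<bar>lam m\<bar>)) \<le> \<Lambda> * (2 * R * (1 + lam m))" using \<Lambda>1 by (intro mult_left_mono) auto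
    then show ?thesis by (simp add: distrib_left)
  qed
  also have "\<dots> = 2 * \<Lambda> * R * (1 + lam m)" by simp
  also have "\<dots> \<le> \<Lambda>' * (1 + lam m)" using \<Lambda>'_ge lam_m by (intro mult_right_mono) auto
  finally show ?thesis .
qed

text \<open>The barrier is \<open>exp (K (usub - u))\<close>; \<open>K\<close> is chosen so that its gradient term absorbs the part of the
  Taylor remainder of the matrix in \<open>p\<close> that regularity does not control.\<close>

definition K where "K = 25 * \<Lambda> ^ 4 / (2 * \<delta>)"
definition v where "v x = usub x - u x" for x
definition v1 where "v1 c = d c usub x0 - d c u x0"
definition v2 where "v2 c = d c (d c usub) x0 - d c (d c u) x0"
definition \<eta> where "\<eta> = exp (K * v x0)"
definition h1 where "h1 c = K * \<eta> * v1 c"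
definition h2 where "h2 c = K\<^sup>2 * \<eta> * (v1 c)\<^sup>2 + K * \<eta> * v2 c"
definition Dv where "Dv = grad \<Omega> usub x0 - grad \<Omega> u x0"
definition T where "T = (\<Sum>i\<in>UNIV. \<sigma> i)"
definition Q where "Q = (\<Sum>i\<in>UNIV. \<sigma> i * (lam i)\<^sup>2)"
text \<open>First-order coefficients of the linearised equation: on a function with derivatives h_c
  and h_cc in the frame the operator is the sum of \<sigma>_c h_cc minus the sum of \<beta>_b
  h_b.\<close>

definition \<beta> where "\<beta> b = Bp b + (\<Sum>i\<in>UNIV. \<sigma> i * pd i b)"

lemma K_pos: "K > 0"
  using \<Lambda>1 \<delta>0 by (simp add: K_def)

lemma T_nonneg: "T \<ge> 0"
  unfolding T_def using \<sigma>_pos by (simp add: sum_nonneg less_imp_le)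

lemma Dv_q: "Dv \<bullet> q c = v1 c"
  unfolding Dv_def v1_def inner_diff_left
  using grad_inner[OF x0 Ck_2_differentiable[OF us2 x0], of "q c"] grad_inner[OF x0 Ck_2_differentiable[OF Ck_u(1) x0], of "q c"]
  by (simp add: inner_commute)

lemma norm_Dv: "norm Dv \<le> 2 * \<Lambda>"
  unfolding Dv_def using norm_triangle_ineq4[of "grad \<Omega> usub x0" "grad \<Omega> u x0"] bound_u by linarith

lemma v1_abs: "\<bar>v1 c\<bar> \<le> 2 * \<Lambda>"
  using Cauchy_Schwarz_ineq2[of Dv "q c"] norm_Dv by (simp add: Dv_q)

text \<open>Taylor expansion of \<open>A\<close> in \<open>p\<close> from \<open>Du\<close> to the
  gradient of \<open>usub\<close>. The part of \<open>Dv\<close> orthogonal to \<open>q i\<close>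
  has a sign by regularity; the square of the parallel part and the cross term contribute
  \<open>2 * \<Lambda>\<^sup>2 * \<bar>v1 i\<bar>\<close> and
  \<open>8 * \<Lambda>\<^sup>2 * \<bar>v1 i\<bar>\<close>, halved by the Taylor formula.\<close>

lemma regular_remainder:
  "- (5 * \<Lambda>\<^sup>2) * \<bar>v1 i\<bar> \<le> mat_entry A (q i) (q i) (x0, grad \<Omega> usub x0) - ent i i pt - (\<Sum>b\<in>UNIV. v1 b * pd i b)"
proof -
  define e r where "e = ((0 :: real^'n), q i)" and "r = ((0 :: real^'n), Dv - v1 i *\<^sub>R q i)"
  have eq: "(0, Dv) = v1 i *\<^sub>R e + 1 *\<^sub>R r" by (simp add: e_def r_def)
  have low: "- (10 * \<Lambda>\<^sup>2 * \<bar>v1 i\<bar>) \<le> partial_d dom (0, Dv) (partial_d dom (0, Dv) (ent i i)) (pt + t *\<^sub>R (0, Dv))"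
    if t: "0 \<le> t" "t \<le> 1" for t
  proof -
    let ?z = "(x0, grad \<Omega> u x0 + t *\<^sub>R Dv)"
    have z: "?z \<in> dom" using x0 by simp
    have "partial_d dom (0, Dv) (partial_d dom (0, Dv) (ent i i)) ?z =
      (v1 i)\<^sup>2 * partial_d dom e (partial_d dom e (ent i i)) ?z + 2 * (v1 i * 1) * partial_d dom e (partial_d dom r (ent i i)) ?z +
      1\<^sup>2 * partial_d dom r (partial_d dom r (ent i i)) ?z"
      unfolding eq by (rule partial_d2_add[OF dom(1) Ck_entry z])
    moreover have "0 \<le> partial_d dom r (partial_d dom r (ent i i)) ?z"
      unfolding r_def
    proof (rule regular_matrix_mat_entry[OF open_dom A2 reg x0])
      show "q i \<bullet> (Dv - v1 i *\<^sub>R q i) = 0"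
        using Dv_q[of i] frame by (simp add: inner_diff_right orthonormal_frame_def inner_commute)
    qed
    moreover have "\<bar>(v1 i)\<^sup>2 * partial_d dom e (partial_d dom e (ent i i)) ?z\<bar> \<le> 2 * \<Lambda>\<^sup>2 * \<bar>v1 i\<bar>"
    proof -
      have "\<bar>partial_d dom e (partial_d dom e (ent i i)) ?z\<bar> \<le> \<Lambda>"
        using bound_A2[of "q i" "q i" t e e] t by (simp add: Dv_def e_def norm_Pair)
      then have "\<bar>v1 i\<bar> * \<bar>v1 i\<bar> * \<bar>partial_d dom e (partial_d dom e (ent i i)) ?z\<bar> \<le> (2 * \<Lambda>) * \<bar>v1 i\<bar> * \<Lambda>"
        using v1_abs[of i] \<Lambda>1 by (intro mult_mono) auto
      then show ?thesis by (simp add: abs_mult power2_eq_square mult_ac)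
    qed
    moreover have "\<bar>2 * (v1 i * 1) * partial_d dom e (partial_d dom r (ent i i)) ?z\<bar> \<le> 8 * \<Lambda>\<^sup>2 * \<bar>v1 i\<bar>"
    proof -
      have "norm r \<le> norm Dv + \<bar>v1 i\<bar>"
        using norm_triangle_ineq4[of Dv "v1 i *\<^sub>R q i"] by (simp add: r_def norm_Pair)
      then have r: "norm r \<le> 4 * \<Lambda>" using norm_Dv v1_abs[of i] by linarith
      have "\<bar>partial_d dom e (partial_d dom r (ent i i)) ?z\<bar> \<le> \<Lambda> * norm e * norm r"
        using bound_A2[of "q i" "q i" t e r] t by (simp add: Dv_def)
      also have "\<dots> \<le> \<Lambda> * (4 * \<Lambda>)" using r \<Lambda>1 by (simp add: e_def norm_Pair)
      finally have "\<bar>v1 i\<bar> * \<bar>partial_d dom e (partial_d dom r (ent i i)) ?z\<bar> \<le> \<bar>v1 i\<bar> * (\<Lambda> * (4 * \<Lambda>))"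
        by (intro mult_left_mono) auto
      then show ?thesis by (simp add: abs_mult power2_eq_square mult_ac)
    qed
    ultimately have "- (10 * \<Lambda>\<^sup>2 * \<bar>v1 i\<bar>) \<le> partial_d dom (0, Dv) (partial_d dom (0, Dv) (ent i i)) ?z" by simp
    then show ?thesis by simp
  qed
  have seg: "pt + t *\<^sub>R (0, Dv) \<in> dom" for t using x0 by simp
  have "- (10 * \<Lambda>\<^sup>2 * \<bar>v1 i\<bar>) / 2 \<le> ent i i (pt + (0, Dv)) - ent i i pt - partial_d dom (0, Dv) (ent i i) pt"
    by (rule taylor_second_order_lower[OF dom(1) Ck_entry seg low])
  moreover have "pt + (0, Dv) = (x0, grad \<Omega> usub x0)" by (simp add: Dv_def)
  moreover have "partial_d dom (0, Dv) (ent i i) pt = (\<Sum>b\<in>UNIV. v1 b * pd i b)"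
  proof -
    have "partial_d dom (0, 0) (ent i i) pt = 0"
      using partial_d_linear[OF dom(2) Ck_2_differentiable[OF Ck_entry dom(2)], of "\<lambda>_. 0" "\<lambda>_. 0" "{}"]
      by (simp add: zero_prod_def)
    then show ?thesis
      using partial_d_split[OF frame dom(2) Ck_2_differentiable[OF Ck_entry dom(2)], of 0 Dv] by (simp add: Dv_q pd_def)
  qed
  ultimately show ?thesis by simp
qed

text \<open>The linearised operator applied to \<open>usub - u\<close>: the strictly admissible
  Hessian contributes at least \<open>\<delta> * T\<close> by
  \<open>esym_derivative_matrix_nonneg\<close>, the solution only \<open>(k + 1) * B\<close> by
  Euler's identity, and half of \<open>\<delta> * T\<close> is given up to the Taylor remainder of
  \<open>A\<close>.\<close>

lemma barrier_linear:
  "\<delta> / 2 * T - (real (Suc k) * \<Lambda> + 2 * \<Lambda>\<^sup>2) \<le> (\<Sum>c\<in>UNIV. \<sigma> c * v2 c) - (\<Sum>b\<in>UNIV. \<beta> b * v1 b) + K * (\<Sum>c\<in>UNIV. \<sigma> c * (v1 c)\<^sup>2)"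
proof -
  define w where "w i = q i \<bullet> (aug_hess \<Omega> A usub x0 *v q i)" for i
  define rem where "rem i = mat_entry A (q i) (q i) (x0, grad \<Omega> usub x0) - ent i i pt - (\<Sum>b\<in>UNIV. v1 b * pd i b)" for i
  have "aug_hess \<Omega> A usub x0 - \<delta> *\<^sub>R mat 1 = hess \<Omega> usub x0 - A (x0, grad \<Omega> usub x0) - \<delta> *\<^sub>R mat 1" by (simp add: aug_hess_def)
  then have "transpose (aug_hess \<Omega> A usub x0 - \<delta> *\<^sub>R mat 1) = aug_hess \<Omega> A usub x0 - \<delta> *\<^sub>R mat 1"
    using hess_symmetric[OF open_dom x0 us2] A_sym[OF x0, of "grad \<Omega> usub x0"]
    by (simp add: transpose_def vec_eq_iff mat_def)
  from esym_derivative_matrix_nonneg[OF this strict cone frame]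
  have "0 \<le> (\<Sum>i\<in>UNIV. (w i - \<delta>) * \<sigma> i)"
    using frame by (simp add: w_def \<sigma>_def matrix_vector_mult_diff_rdistrib scaleR_matrix_vector_assoc[symmetric] inner_diff_right orthonormal_frame_def)
  then have w: "\<delta> * T \<le> (\<Sum>i\<in>UNIV. \<sigma> i * w i)" by (simp add: T_def algebra_simps sum_subtractf sum_distrib_left)
  have lamsum: "(\<Sum>i\<in>UNIV. \<sigma> i * lam i) \<le> real (Suc k) * \<Lambda>"
  proof -
    have "(\<Sum>i\<in>UNIV. \<sigma> i * lam i) = real (Suc k) * B pt"
      using sum_mult_esym_remove[of UNIV lam k] by (simp add: \<sigma>_def equation_jets(1)[symmetric] mult.commute)
    also have "\<dots> \<le> real (Suc k) * \<Lambda>" using bound_B0 by (intro mult_left_mono) auto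
    finally show ?thesis .
  qed
  have Bsum: "(\<Sum>b\<in>UNIV. Bp b * v1 b) \<le> 2 * \<Lambda>\<^sup>2"
  proof -
    have "partial_d dom (0, 0) B pt = 0"
      using partial_d_linear[OF dom(2) Ck_2_differentiable[OF B2 dom(2)], of "\<lambda>_. 0" "\<lambda>_. 0" "{}"] by (simp add: zero_prod_def)
    then have "partial_d dom (0, Dv) B pt = (\<Sum>b\<in>UNIV. Bp b * v1 b)"
      using partial_d_split[OF frame dom(2) Ck_2_differentiable[OF B2 dom(2)], of 0 Dv] by (simp add: Dv_q Bp_def mult.commute)
    moreover have "\<bar>partial_d dom (0, Dv) B pt\<bar> \<le> \<Lambda> * norm Dv" using bound_B1[of "(0, Dv)"] by (simp add: norm_Pair)
    moreover have "\<Lambda> * norm Dv \<le> \<Lambda> * (2 * \<Lambda>)" using norm_Dv \<Lambda>1 by (intro mult_left_mono) auto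
    ultimately show ?thesis by (simp add: power2_eq_square)
  qed
  have v2: "v2 i = w i - lam i + (rem i + (\<Sum>b\<in>UNIV. v1 b * pd i b))" for i
    using hess_inner[OF open_dom x0 us2, of "q i" "q i"] aug_hess_entry[OF x0, of i i] eigen[of i i]
    by (simp add: v2_def w_def rem_def aug_hess_def matrix_vector_mult_diff_rdistrib inner_diff_right mat_entry_def)
  have single: "- (\<delta> / 2) \<le> rem i + K * (v1 i)\<^sup>2" for i
  proof -
    \<comment> \<open>Completing the square at the price \<open>\<delta> / 2\<close>; this is the
      origin of \<open>25 * \<Lambda> ^ 4 / (2 * \<delta>)\<close> in \<open>K\<close>.\<close>
    have "0 \<le> (5 * \<Lambda>\<^sup>2 * \<bar>v1 i\<bar> - \<delta>)\<^sup>2 / (2 * \<delta>)" using \<delta>0 by simp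
    also have "\<dots> = K * (v1 i)\<^sup>2 - 5 * \<Lambda>\<^sup>2 * \<bar>v1 i\<bar> + \<delta> / 2"
      using \<delta>0 by (simp add: K_def power2_eq_square power4_eq_xxxx field_simps)
    finally show ?thesis using regular_remainder[of i] unfolding rem_def by linarith
  qed
  have "(\<Sum>i\<in>UNIV. \<sigma> i * - (\<delta> / 2)) \<le> (\<Sum>i\<in>UNIV. \<sigma> i * (rem i + K * (v1 i)\<^sup>2))"
    using single \<sigma>_pos by (intro sum_mono mult_left_mono) (auto simp: less_imp_le)
  then have remsum: "- (\<delta> / 2 * T) \<le> (\<Sum>i\<in>UNIV. \<sigma> i * rem i) + K * (\<Sum>i\<in>UNIV. \<sigma> i * (v1 i)\<^sup>2)"
    by (simp add: T_def sum_distrib_left sum_divide_distrib sum_negf distrib_left sum.distrib mult_ac)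
  have "(\<Sum>b\<in>UNIV. \<beta> b * v1 b) = (\<Sum>b\<in>UNIV. Bp b * v1 b) + (\<Sum>i\<in>UNIV. \<sigma> i * (\<Sum>b\<in>UNIV. v1 b * pd i b))"
    unfolding \<beta>_def by (simp add: distrib_left distrib_right sum.distrib sum_distrib_left sum_distrib_right mult_ac) (rule sum.swap)
  moreover have "(\<Sum>c\<in>UNIV. \<sigma> c * v2 c) = (\<Sum>i\<in>UNIV. \<sigma> i * w i) - (\<Sum>i\<in>UNIV. \<sigma> i * lam i) + (\<Sum>i\<in>UNIV. \<sigma> i * rem i) +
    (\<Sum>i\<in>UNIV. \<sigma> i * (\<Sum>b\<in>UNIV. v1 b * pd i b))"
    unfolding v2 by (simp add: distrib_left right_diff_distrib sum.distrib sum_subtractf)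
  ultimately show ?thesis using w lamsum Bsum remsum by (simp add: algebra_simps)
qed

lemma \<eta>_bounds: "exp (- (2 * K * \<Lambda>)) \<le> \<eta>" "\<eta> \<le> exp (2 * K * \<Lambda>)" "\<eta> > 0"
proof -
  have "\<bar>v x0\<bar> \<le> 2 * \<Lambda>" using bound_u unfolding v_def by linarith
  then have "K * \<bar>v x0\<bar> \<le> K * (2 * \<Lambda>)" using K_pos by (intro mult_left_mono) auto
  then have "\<bar>K * v x0\<bar> \<le> 2 * K * \<Lambda>" using K_pos by (simp add: abs_mult)
  then show "exp (- (2 * K * \<Lambda>)) \<le> \<eta>" "\<eta> \<le> exp (2 * K * \<Lambda>)" "\<eta> > 0" unfolding \<eta>_def by (auto simp: abs_le_iff)
qed

text \<open>The exponential contributes the square of the first derivative with the factor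
  \<open>K\<^sup>2 * \<eta>\<close>; after the common factor \<open>K * \<eta>\<close> is taken out,
  it is the term with \<open>K\<close> in \<open>barrier_linear\<close>.\<close>

lemma barrier:
  "K * exp (- (2 * K * \<Lambda>)) * \<delta> / 2 * T - K * exp (2 * K * \<Lambda>) * (real (Suc k) * \<Lambda> + 2 * \<Lambda>\<^sup>2)
    \<le> (\<Sum>c\<in>UNIV. \<sigma> c * h2 c) - (\<Sum>b\<in>UNIV. \<beta> b * h1 b)"
proof -
  define c0 where "c0 = real (Suc k) * \<Lambda> + 2 * \<Lambda>\<^sup>2"
  have c0: "c0 \<ge> 0" using \<Lambda>1 by (simp add: c0_def)
  have "K * exp (- (2 * K * \<Lambda>)) * (\<delta> / 2 * T) \<le> K * \<eta> * (\<delta> / 2 * T)"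
    using \<eta>_bounds K_pos T_nonneg \<delta>0 by (intro mult_right_mono mult_left_mono) auto
  moreover have "K * \<eta> * c0 \<le> K * exp (2 * K * \<Lambda>) * c0"
    using \<eta>_bounds K_pos c0 by (intro mult_right_mono mult_left_mono) auto
  moreover have "K * \<eta> * (\<delta> / 2 * T - c0) \<le> K * \<eta> * ((\<Sum>c\<in>UNIV. \<sigma> c * v2 c) - (\<Sum>b\<in>UNIV. \<beta> b * v1 b) + K * (\<Sum>c\<in>UNIV. \<sigma> c * (v1 c)\<^sup>2))"
    using barrier_linear \<eta>_bounds K_pos unfolding c0_def by (intro mult_left_mono) auto
  moreover have "K * \<eta> * ((\<Sum>c\<in>UNIV. \<sigma> c * v2 c) - (\<Sum>b\<in>UNIV. \<beta> b * v1 b) + K * (\<Sum>c\<in>UNIV. \<sigma> c * (v1 c)\<^sup>2)) =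
    (\<Sum>c\<in>UNIV. \<sigma> c * h2 c) - (\<Sum>b\<in>UNIV. \<beta> b * h1 b)"
    unfolding h1_def h2_def
    by (simp add: distrib_left right_diff_distrib sum.distrib sum_distrib_left power2_eq_square mult_ac)
  ultimately show ?thesis unfolding c0_def[symmetric] by (simp add: right_diff_distrib)
qed

section \<open>First- and second-order conditions for the test function\<close>

definition \<phi> where "\<phi> \<kappa>1 \<kappa>2 x = \<kappa>1 / 2 * (grad \<Omega> u x \<bullet> grad \<Omega> u x) + \<kappa>2 * exp (K * (usub x - u x))"
definition f where "f \<kappa>1 \<kappa>2 c = \<kappa>1 * (\<Sum>b\<in>UNIV. U1 b * U2 b c) + \<kappa>2 * h1 c"
definition f2 where "f2 \<kappa>1 \<kappa>2 c = \<kappa>1 * (\<Sum>b\<in>UNIV. (U2 b c)\<^sup>2 + U1 b * U3 c c b) + \<kappa>2 * h2 c"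

lemma J2_exp: "J2 F a b c \<Longrightarrow> J2 (\<lambda>t. exp (F t)) (exp a) (exp a * b) (exp a * b\<^sup>2 + exp a * c)"
  by (rule J2_compose[where F' = exp]) (auto intro!: always_eventually derivative_eq_intros)

lemma J2_phi: "J2 (\<lambda>t. \<phi> \<kappa>1 \<kappa>2 (x0 + t *\<^sub>R q c)) (\<phi> \<kappa>1 \<kappa>2 x0) (f \<kappa>1 \<kappa>2 c) (f2 \<kappa>1 \<kappa>2 c)"
proof -
  have Ju: "J2 (\<lambda>t. d b u (x0 + t *\<^sub>R q c)) (U1 b) (U2 b c) (U3 c c b)" for b
    using J2_along_line[OF open_dom Ck_u(3) x0, of "q b" "q c"] U2_sym[of b c] by (simp add: U1_def U2_def U3_def)
  have sq: "grad \<Omega> u y \<bullet> grad \<Omega> u y = (\<Sum>b\<in>UNIV. d b u y * d b u y)" if "y \<in> \<Omega>" for y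
    unfolding frame_parseval[OF frame, of "grad \<Omega> u y" "grad \<Omega> u y"]
    using grad_inner[OF that Ck_2_differentiable[OF Ck_u(1) that]] by (simp add: inner_commute)
  have J1: "J2 (\<lambda>t. \<kappa>1 / 2 * (\<Sum>b\<in>UNIV. d b u (x0 + t *\<^sub>R q c) * d b u (x0 + t *\<^sub>R q c)))
    (\<kappa>1 / 2 * (\<Sum>b\<in>UNIV. U1 b * U1 b)) (\<kappa>1 / 2 * (\<Sum>b\<in>UNIV. U1 b * U2 b c + U2 b c * U1 b))
    (\<kappa>1 / 2 * (\<Sum>b\<in>UNIV. U1 b * U3 c c b + 2 * (U2 b c * U2 b c) + U3 c c b * U1 b))"
    by (intro J2_cmult J2_sum J2_mult Ju)
  have J2: "J2 (\<lambda>t. \<kappa>2 * exp (K * (usub (x0 + t *\<^sub>R q c) - u (x0 + t *\<^sub>R q c)))) (\<kappa>2 * \<eta>) (\<kappa>2 * (\<eta> * (K * v1 c)))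
    (\<kappa>2 * (\<eta> * (K * v1 c)\<^sup>2 + \<eta> * (K * v2 c)))"
    unfolding \<eta>_def v_def v1_def v2_def
    by (intro J2_cmult J2_exp J2_diff J2_along_line[OF open_dom us2 x0] J2_along_line[OF open_dom Ck_u(1) x0])
  have "J2 (\<lambda>t. \<kappa>1 / 2 * (\<Sum>b\<in>UNIV. d b u (x0 + t *\<^sub>R q c) * d b u (x0 + t *\<^sub>R q c)) +
      \<kappa>2 * exp (K * (usub (x0 + t *\<^sub>R q c) - u (x0 + t *\<^sub>R q c)))) (\<phi> \<kappa>1 \<kappa>2 x0) (f \<kappa>1 \<kappa>2 c) (f2 \<kappa>1 \<kappa>2 c)"
  proof -
    have "\<kappa>1 / 2 * (\<Sum>b\<in>UNIV. U1 b * U1 b) + \<kappa>2 * \<eta> = \<phi> \<kappa>1 \<kappa>2 x0"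
      unfolding \<phi>_def sq[OF x0] by (simp add: U1_def \<eta>_def v_def)
    moreover have "\<kappa>1 / 2 * (\<Sum>b\<in>UNIV. U1 b * U2 b c + U2 b c * U1 b) + \<kappa>2 * (\<eta> * (K * v1 c)) = f \<kappa>1 \<kappa>2 c"
      unfolding f_def h1_def by (simp add: sum.distrib sum_distrib_left mult_ac)
    moreover have "\<kappa>1 / 2 * (\<Sum>b\<in>UNIV. U1 b * U3 c c b + 2 * (U2 b c * U2 b c) + U3 c c b * U1 b) +
      \<kappa>2 * (\<eta> * (K * v1 c)\<^sup>2 + \<eta> * (K * v2 c)) = f2 \<kappa>1 \<kappa>2 c"
    proof -
      have "(\<Sum>b\<in>UNIV. U1 b * U3 c c b + 2 * (U2 b c * U2 b c) + U3 c c b * U1 b) = 2 * (\<Sum>b\<in>UNIV. (U2 b c)\<^sup>2 + U1 b * U3 c c b)"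
        unfolding sum_distrib_left by (intro sum.cong refl) (simp add: power2_eq_square)
      then show ?thesis unfolding f2_def h2_def by (simp add: power_mult_distrib mult_ac)
    qed
    ultimately show ?thesis using J2_add[OF J1 J2] by simp
  qed
  then show ?thesis
  proof (rule J2_cong_ev)
    show "\<forall>\<^sub>F t in nhds 0. \<kappa>1 / 2 * (\<Sum>b\<in>UNIV. d b u (x0 + t *\<^sub>R q c) * d b u (x0 + t *\<^sub>R q c)) +
      \<kappa>2 * exp (K * (usub (x0 + t *\<^sub>R q c) - u (x0 + t *\<^sub>R q c))) = \<phi> \<kappa>1 \<kappa>2 (x0 + t *\<^sub>R q c)"
      using eventually_line[of "q c"] by eventually_elim (simp add: \<phi>_def sq)
  qed
qed

lemma maximum_conditions:
  assumes max: "\<forall>x\<in>\<Omega>. (q m \<bullet> (aug_hess \<Omega> A u x *v q m)) * exp (\<phi> \<kappa>1 \<kappa>2 x) \<le> lam m * exp (\<phi> \<kappa>1 \<kappa>2 x0)"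
  shows "U3 c m m - xd m c - (\<Sum>b\<in>UNIV. U2 c b * pd m b) = - lam m * f \<kappa>1 \<kappa>2 c"
    and "(U4 c - Q1 c - (\<Sum>b\<in>UNIV. U3 c c b * pd m b)) / lam m - (f \<kappa>1 \<kappa>2 c)\<^sup>2 + f2 \<kappa>1 \<kappa>2 c \<le> 0"
proof -
  let ?f = "f \<kappa>1 \<kappa>2 c" and ?f2 = "f2 \<kappa>1 \<kappa>2 c" and ?e = "exp (\<phi> \<kappa>1 \<kappa>2 x0)"
  have W1: "W1 c m m = U3 c m m - xd m c - (\<Sum>b\<in>UNIV. U2 c b * pd m b)"
    unfolding W1_def partial_d_g(1)[OF Ck_entry] xd_def pd_def by simp
  have W2: "W2 c m m = U4 c - Q1 c - (\<Sum>b\<in>UNIV. U3 c c b * pd m b)"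
    unfolding W2_def partial_d_g(2)[OF Ck_entry] U4_def Q1_def pd_def by simp
  have J: "J2 (\<lambda>t. frame_matrix q (aug_hess \<Omega> A u (x0 + t *\<^sub>R q c)) $ m $ m * exp (\<phi> \<kappa>1 \<kappa>2 (x0 + t *\<^sub>R q c)))
    (lam m * ?e) (lam m * (?e * ?f) + W1 c m m * ?e)
    (lam m * (?e * ?f\<^sup>2 + ?e * ?f2) + 2 * (W1 c m m * (?e * ?f)) + W2 c m m * ?e)"
    using J2_mult[OF J2_entry[of c m m] J2_exp[OF J2_phi]] by simp
  have ev: "\<forall>\<^sub>F t in nhds 0. frame_matrix q (aug_hess \<Omega> A u (x0 + t *\<^sub>R q c)) $ m $ m * exp (\<phi> \<kappa>1 \<kappa>2 (x0 + t *\<^sub>R q c)) \<le> lam m * ?e"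
    using eventually_line[of "q c"] by eventually_elim (simp add: frame_matrix_def max)
  have "lam m * (?e * ?f) + W1 c m m * ?e = ?e * (lam m * ?f + W1 c m m)" by (simp add: algebra_simps)
  then have "lam m * ?f + W1 c m m = 0" using J2_local_max(1)[OF J ev] by simp
  then have w1: "W1 c m m = - lam m * ?f" by simp
  then show "U3 c m m - xd m c - (\<Sum>b\<in>UNIV. U2 c b * pd m b) = - lam m * f \<kappa>1 \<kappa>2 c" using W1 by simp
  \<comment> \<open>With \<open>W1 c m m = - lam m * ?f\<close> the mixed term equals
    \<open>- 2 * lam m * ?f\<^sup>2\<close> and turns the coefficient of \<open>?f\<^sup>2\<close>
    from \<open>+1\<close> into \<open>-1\<close>.\<close>
  have "lam m * (?e * ?f\<^sup>2 + ?e * ?f2) + 2 * (W1 c m m * (?e * ?f)) + W2 c m m * ?e = ?e * (lam m * (W2 c m m / lam m - ?f\<^sup>2 + ?f2))"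
    using lam_m unfolding w1 by (simp add: algebra_simps power2_eq_square)
  then have "W2 c m m / lam m - ?f\<^sup>2 + ?f2 \<le> 0"
    using J2_local_max(2)[OF J ev] lam_m by (simp add: mult_le_0_iff)
  then show "(U4 c - Q1 c - (\<Sum>b\<in>UNIV. U3 c c b * pd m b)) / lam m - (f \<kappa>1 \<kappa>2 c)\<^sup>2 + f2 \<kappa>1 \<kappa>2 c \<le> 0" using W2 by simp
qed

lemma U1_abs: "\<bar>U1 b\<bar> \<le> \<Lambda>"
  using Cauchy_Schwarz_ineq2[of "q b" "grad \<Omega> u x0"] bound_u(3) grad_inner[OF x0 Ck_2_differentiable[OF Ck_u(1) x0], of "q b"]
  by (simp add: U1_def)

lemma f_abs:
  assumes "\<kappa>1 \<ge> 0" "\<kappa>2 \<ge> 0" "C \<ge> \<Lambda> * R" "C \<ge> K * exp (2 * K * \<Lambda>) * (2 * \<Lambda>)"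
  shows "\<bar>f \<kappa>1 \<kappa>2 c\<bar> \<le> C * (\<kappa>1 * (\<bar>lam c\<bar> + 1) + \<kappa>2)"
proof -
  have "(\<Sum>b\<in>UNIV. U1 b * U2 b c) = (\<Sum>b\<in>UNIV. U1 b * (if b = c then lam b else 0)) + (\<Sum>b\<in>UNIV. U1 b * ent b c pt)"
    unfolding U2_eq by (simp add: distrib_left sum.distrib)
  also have "(\<Sum>b\<in>UNIV. U1 b * (if b = c then lam b else 0)) = U1 c * lam c"
    by (simp add: if_distrib[where f = "\<lambda>x. _ * x"] cong: if_cong)
  finally have eq: "(\<Sum>b\<in>UNIV. U1 b * U2 b c) = U1 c * lam c + (\<Sum>b\<in>UNIV. U1 b * ent b c pt)" .
  have "\<bar>\<Sum>b\<in>UNIV. U1 b * ent b c pt\<bar> \<le> (\<Sum>b\<in>UNIV. \<bar>U1 b * ent b c pt\<bar>)" by (rule sum_abs)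
  also have "\<dots> \<le> (\<Sum>b\<in>(UNIV :: 'n set). \<Lambda> * \<Lambda>)"
    unfolding abs_mult using U1_abs bound_A0 \<Lambda>1 by (intro sum_mono mult_mono) auto
  also have "\<dots> = \<Lambda> * (real CARD('n) * \<Lambda>)" by simp
  also have "\<dots> \<le> \<Lambda> * R" using \<Lambda>1 by (simp add: R_def)
  finally have s: "\<bar>\<Sum>b\<in>UNIV. U1 b * ent b c pt\<bar> \<le> \<Lambda> * R" .
  have "\<bar>U1 c * lam c\<bar> \<le> \<Lambda> * R * \<bar>lam c\<bar>"
  proof -
    have "\<Lambda> * 1 \<le> \<Lambda> * R" using R_ge \<Lambda>1 by (intro mult_left_mono) auto
    then show ?thesis unfolding abs_mult using U1_abs[of c] by (intro mult_right_mono) auto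
  qed
  then have "\<bar>\<Sum>b\<in>UNIV. U1 b * U2 b c\<bar> \<le> \<Lambda> * R * (\<bar>lam c\<bar> + 1)" unfolding eq using s by (simp add: algebra_simps)
  also have "\<dots> \<le> C * (\<bar>lam c\<bar> + 1)" using assms(3) by (intro mult_right_mono) auto
  finally have 1: "\<kappa>1 * \<bar>\<Sum>b\<in>UNIV. U1 b * U2 b c\<bar> \<le> \<kappa>1 * (C * (\<bar>lam c\<bar> + 1))" using assms(1) by (intro mult_left_mono)
  have "\<bar>h1 c\<bar> = K * \<eta> * \<bar>v1 c\<bar>" using K_pos \<eta>_bounds by (simp add: h1_def abs_mult)
  also have "\<dots> \<le> K * exp (2 * K * \<Lambda>) * (2 * \<Lambda>)"
    using K_pos \<eta>_bounds v1_abs[of c] by (intro mult_mono) auto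
  finally have 2: "\<kappa>2 * \<bar>h1 c\<bar> \<le> \<kappa>2 * C" using assms(2,4) by (intro mult_left_mono) auto
  have "\<bar>f \<kappa>1 \<kappa>2 c\<bar> \<le> \<kappa>1 * \<bar>\<Sum>b\<in>UNIV. U1 b * U2 b c\<bar> + \<kappa>2 * \<bar>h1 c\<bar>"
    unfolding f_def using assms abs_triangle_ineq[of "\<kappa>1 * (\<Sum>b\<in>UNIV. U1 b * U2 b c)" "\<kappa>2 * h1 c"] by (simp add: abs_mult)
  then show ?thesis using 1 2 by (simp add: algebra_simps)
qed

text \<open>A further factor \<open>lam m\<close> in \<open>esym_max_weight\<close>, together with
  the lower bound of \<open>B\<close>. This linear growth of \<open>Q\<close> is what finally bounds
  \<open>lam m\<close> in \<open>choose_constants\<close>.\<close>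

lemma Q_lower: "real (Suc k) / (real CARD('n) * \<Lambda>) * lam m \<le> Q"
proof -
  have N: "real CARD('n) > 0" by simp
  have "real (Suc k) / \<Lambda> \<le> real (Suc k) * B pt"
    using bound_B0(2) \<Lambda>1 mult_left_mono[OF bound_B0(2), of "real (Suc k)"] by (simp add: divide_le_eq mult_ac)
  also have "\<dots> \<le> real CARD('n) * (lam m * \<sigma> m)"
    using esym_max_weight[OF finite cone, of m] lam_max by (simp add: equation_jets(1) \<sigma>_def)
  finally have "real (Suc k) / \<Lambda> / real CARD('n) \<le> real CARD('n) * (lam m * \<sigma> m) / real CARD('n)"
    by (rule divide_right_mono) simp
  then have "real (Suc k) / (real CARD('n) * \<Lambda>) \<le> lam m * \<sigma> m" using N by (simp add: mult.commute)
  then have "real (Suc k) / (real CARD('n) * \<Lambda>) * lam m \<le> lam m * \<sigma> m * lam m" using lam_m by (intro mult_right_mono) auto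
  also have "\<dots> = \<sigma> m * (lam m)\<^sup>2" by (simp add: power2_eq_square)
  also have "\<dots> \<le> Q" unfolding Q_def by (rule member_le_sum) (use \<sigma>_pos in \<open>auto simp: less_imp_le\<close>)
  finally show ?thesis .
qed

text \<open>\<open>X\<close> is the gradient term diminished by the concavity terms.
  \<open>third_order\<close> bounds it from above and \<open>differentiated_equation\<close> from
  below; with suitable constants the two bounds exclude large \<open>lam m\<close>.\<close>

lemma interior_inequalities:
  fixes \<kappa>1 \<kappa>2 C :: real
  defines "N \<equiv> real CARD('n)"
  assumes \<kappa>: "\<kappa>1 \<ge> 0" "\<kappa>2 \<ge> 0"
    and C: "C \<ge> 10 * (N + 1)\<^sup>2 * \<Lambda>' ^ 3 * (N + 1)\<^sup>2" "C \<ge> \<Lambda>'" "C \<ge> \<Lambda> * R" "C \<ge> K * exp (2 * K * \<Lambda>) * (2 * \<Lambda>)"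
      "C \<ge> K * exp (2 * K * \<Lambda>) * (real (Suc k) * \<Lambda> + 2 * \<Lambda>\<^sup>2)"
    and max: "\<forall>x\<in>\<Omega>. (q m \<bullet> (aug_hess \<Omega> A u x *v q m)) * exp (\<phi> \<kappa>1 \<kappa>2 x) \<le> lam m * exp (\<phi> \<kappa>1 \<kappa>2 x0)"
  defines "X \<equiv> (\<Sum>c\<in>UNIV. \<sigma> c * (f \<kappa>1 \<kappa>2 c)\<^sup>2) - 2 / lam m * E"
  shows "X \<le> 16 * C\<^sup>2 * (N + 1) ^ 3 * ((\<kappa>1\<^sup>2 + \<kappa>2\<^sup>2 / (lam m)\<^sup>2) * Q + (\<kappa>1\<^sup>2 + 1) * T)"
    and "\<kappa>1 * (Q / 2 - C * (1 + T)) + \<kappa>2 * (K * exp (- (2 * K * \<Lambda>)) * \<delta> / 2 * T - C) - C * (1 + T) - C / lam m * Q \<le> X"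
proof -
  note mc = maximum_conditions[OF max]
  have C1: "C \<ge> 1" using C(2) \<Lambda>'_ge by linarith
  have q: "\<bar>partial_d dom (q c, 0) F pt\<bar> \<le> \<Lambda>'" "\<bar>partial_d dom (0, q c) F pt\<bar> \<le> \<Lambda>'"
    if "\<And>w. \<bar>partial_d dom w F pt\<bar> \<le> \<Lambda> * norm w" for F c
    using that[of "(q c, 0)"] that[of "(0, q c)"] \<Lambda>'_ge(1) by (auto simp: norm_Pair)
  show "X \<le> 16 * C\<^sup>2 * (N + 1) ^ 3 * ((\<kappa>1\<^sup>2 + \<kappa>2\<^sup>2 / (lam m)\<^sup>2) * Q + (\<kappa>1\<^sup>2 + 1) * T)"
    unfolding X_def E_def Q_def T_def N_def
  proof (rule third_order)
    show "\<bar>W1 m m i + lam m * f \<kappa>1 \<kappa>2 i\<bar> \<le> C * (1 + lam m)" for i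
    proof -
      have "\<bar>W1 m m i + lam m * f \<kappa>1 \<kappa>2 i\<bar> \<le> \<Lambda>' * (1 + lam m)" using W1_bound[of i] unfolding mc(1) by simp
      also have "\<dots> \<le> C * (1 + lam m)" using C(2) lam_m by (intro mult_right_mono) auto
      finally show ?thesis .
    qed
    show "(lam m - lam i) * S2 m i = \<sigma> i - \<sigma> m" if "i \<noteq> m" for i
      unfolding \<sigma>_def by (rule esym_pred_diff) (use that in auto)
    show "\<bar>f \<kappa>1 \<kappa>2 i\<bar> \<le> C * (\<kappa>1 * (\<bar>lam i\<bar> + 1) + \<kappa>2)" for i using f_abs \<kappa> C by blast
  qed (use \<sigma>_pos lam_m C1 \<kappa> S2_nonneg lam_max lam_abs in auto)
  define Cd where "Cd = 10 * (N + 1)\<^sup>2 * \<Lambda>' ^ 3 * (N + 1)\<^sup>2"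
  define c0 where "c0 = K * exp (2 * K * \<Lambda>) * (real (Suc k) * \<Lambda> + 2 * \<Lambda>\<^sup>2)"
  have main: "\<kappa>1 * (Q / 2 - Cd * (1 + T)) + \<kappa>2 * (K * exp (- (2 * K * \<Lambda>)) * \<delta> / 2 * T - c0) - Cd * (1 + T) - Cd / lam m * Q \<le> X"
    unfolding X_def Q_def T_def Cd_def N_def
  proof (rule differentiated_equation[where ?U2.0 = U2 and ?U3.0 = U3 and a = "\<lambda>i j. ent i j pt" and ?Q1.0 = Q1 and ?Q2.0 = Q2
      and xd = xd and pd = pd and xm = "xd m" and pm = "pd m" and Bx = Bx and Bp = Bp and ?U1.0 = U1 and ?U4.0 = U4
      and ?f2.0 = "f2 \<kappa>1 \<kappa>2" and h = h1 and ?h2.0 = h2])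
    show "\<bar>ent i j pt\<bar> \<le> \<Lambda>'" for i j using bound_A0[of "q i" "q j"] \<Lambda>'_ge(1) by simp
    show "\<bar>xd i j\<bar> \<le> \<Lambda>'" "\<bar>pd i j\<bar> \<le> \<Lambda>'" "\<bar>xd m i\<bar> \<le> \<Lambda>'" "\<bar>pd m i\<bar> \<le> \<Lambda>'" for i j
      unfolding xd_def pd_def by (rule q, rule bound_A1, simp, simp)+
    show "\<bar>Bx i\<bar> \<le> \<Lambda>'" "\<bar>Bp i\<bar> \<le> \<Lambda>'" for i unfolding Bx_def Bp_def by (rule q, rule bound_B1)+
    show "\<bar>U1 i\<bar> \<le> \<Lambda>'" for i using U1_abs[of i] \<Lambda>'_ge(1) by linarith
    show "Q1 c \<le> \<Lambda>' * (1 + (lam c)\<^sup>2)" for c using second_derivative_gg[of c m m] unfolding Q1_def by linarith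
    show "- (\<Lambda>' * (1 + lam m)) \<le> Q2 c" if "c \<noteq> m" for c unfolding Q2_def using second_derivative_regular[OF that] .
    show "- (\<Lambda>' * (1 + (lam m)\<^sup>2)) \<le> Q2 m" using second_derivative_gg[of m m m] unfolding Q2_def by linarith
    show "(U4 c - Q1 c - (\<Sum>d\<in>UNIV. U3 c c d * pd m d)) / lam m - (f \<kappa>1 \<kappa>2 c)\<^sup>2 + f2 \<kappa>1 \<kappa>2 c \<le> 0" for c by (rule mc(2))
    show "K * exp (- (2 * K * \<Lambda>)) * \<delta> / 2 * (\<Sum>a\<in>UNIV. \<sigma> a) - c0
      \<le> (\<Sum>c\<in>UNIV. \<sigma> c * h2 c) - (\<Sum>d\<in>UNIV. (Bp d + (\<Sum>a\<in>UNIV. \<sigma> a * pd a d)) * h1 d)"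
      using barrier unfolding T_def \<beta>_def c0_def .
    show "U3 c m m - xd m c - (\<Sum>b\<in>UNIV. U2 c b * pd m b) = - lam m * f \<kappa>1 \<kappa>2 c" for c by (rule mc(1))
  qed (use \<sigma>_pos lam_m \<Lambda>'_ge(5) \<kappa> lam_abs U3_sym U2_eq first_derivative_equation second_derivative_equation in
      \<open>auto simp: f_def f2_def\<close>)
  have Q0: "Q \<ge> 0" unfolding Q_def using \<sigma>_pos by (simp add: sum_nonneg less_imp_le)
  have "\<kappa>1 * (Q / 2 - C * (1 + T)) \<le> \<kappa>1 * (Q / 2 - Cd * (1 + T))"
    using \<kappa>(1) C(1) T_nonneg mult_right_mono[of Cd C "1 + T"] by (intro mult_left_mono) (auto simp: Cd_def)
  moreover have "\<kappa>2 * (K * exp (- (2 * K * \<Lambda>)) * \<delta> / 2 * T - C) \<le> \<kappa>2 * (K * exp (- (2 * K * \<Lambda>)) * \<delta> / 2 * T - c0)"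
    using \<kappa>(2) C(5) by (intro mult_left_mono) (auto simp: c0_def)
  moreover have "Cd * (1 + T) \<le> C * (1 + T)" using C(1) T_nonneg by (intro mult_right_mono) (auto simp: Cd_def)
  moreover have "Cd / lam m * Q \<le> C / lam m * Q"
    using C(1) lam_m Q0 by (intro mult_right_mono divide_right_mono) (auto simp: Cd_def)
  ultimately show "\<kappa>1 * (Q / 2 - C * (1 + T)) + \<kappa>2 * (K * exp (- (2 * K * \<Lambda>)) * \<delta> / 2 * T - C) - C * (1 + T) - C / lam m * Q \<le> X"
    using main by linarith
qed

end

text \<open>Stated outside the locale to fix the order of quantifiers: the constants are chosen from
  \<open>\<Lambda>\<close>, \<open>\<delta>\<close>, \<open>k\<close> and the dimension before
  domain, coefficients and solution are given.\<close>

lemma interior_estimate: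
  fixes \<Lambda> \<delta> :: real and k :: nat
  assumes "\<Lambda> \<ge> 1" "\<delta> > 0"
  obtains \<kappa>1 \<kappa>2 K L :: real where "\<kappa>1 > 0" "\<kappa>2 > 0" "K > 0" "L \<ge> 1"
    "\<And>(\<Omega> :: (real^'n) set) A B u usub x0 q lam m. eigenframe_point \<Omega> k A B u usub x0 q lam m \<Lambda> \<delta> \<Longrightarrow>
      (\<And>x. x \<in> \<Omega> \<Longrightarrow> (q m \<bullet> (aug_hess \<Omega> A u x *v q m)) *
          exp (\<kappa>1 / 2 * (grad \<Omega> u x \<bullet> grad \<Omega> u x) + \<kappa>2 * exp (K * (usub x - u x)))
        \<le> lam m * exp (\<kappa>1 / 2 * (grad \<Omega> u x0 \<bullet> grad \<Omega> u x0) + \<kappa>2 * exp (K * (usub x0 - u x0)))) \<Longrightarrow> lam m \<le> L"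
proof -
  \<comment> \<open>Copies of the quantities of the locale, all of which are expressed through
    \<open>\<Lambda>\<close>, \<open>\<delta>\<close> and the dimension.\<close>
  define N R \<Lambda>' K where "N = real CARD('n)" and "R = 1 + N * \<Lambda>" and "\<Lambda>' = 6 * \<Lambda> ^ 3 * R\<^sup>2" and "K = 25 * \<Lambda> ^ 4 / (2 * \<delta>)"
  define C where "C = Max {1, 10 * (N + 1)\<^sup>2 * \<Lambda>' ^ 3 * (N + 1)\<^sup>2, \<Lambda>', \<Lambda> * R, K * exp (2 * K * \<Lambda>) * (2 * \<Lambda>),
    K * exp (2 * K * \<Lambda>) * (real (Suc k) * \<Lambda> + 2 * \<Lambda>\<^sup>2)}"
  have C: "C \<ge> 1" "C \<ge> 10 * (N + 1)\<^sup>2 * \<Lambda>' ^ 3 * (N + 1)\<^sup>2" "C \<ge> \<Lambda>'" "C \<ge> \<Lambda> * R" "C \<ge> K * exp (2 * K * \<Lambda>) * (2 * \<Lambda>)"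
    "C \<ge> K * exp (2 * K * \<Lambda>) * (real (Suc k) * \<Lambda> + 2 * \<Lambda>\<^sup>2)"
    unfolding C_def by (intro Max_ge; simp)+
  have N: "N \<ge> 1" unfolding N_def by (simp add: Suc_le_eq)
  define C1 e b where "C1 = 16 * C\<^sup>2 * (N + 1) ^ 3" and "e = K * exp (- (2 * K * \<Lambda>)) * \<delta> / 2"
    and "b = real (Suc k) / (N * \<Lambda>)"
  have K: "K > 0" using assms by (simp add: K_def)
  have "C1 \<ge> C"
  proof -
    have "C * 1 \<le> C\<^sup>2 * (16 * (N + 1) ^ 3)"
    proof (rule mult_mono)
      show "C \<le> C\<^sup>2" using C(1) by (intro self_le_power) auto
      show "1 \<le> 16 * (N + 1) ^ 3" using one_le_power[of "N + 1" 3] N by linarith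
    qed (use C(1) in auto)
    then show ?thesis by (simp add: C1_def mult_ac)
  qed
  moreover have "e > 0" "b > 0" using assms K N by (auto simp: e_def b_def)
  ultimately obtain \<kappa>1 \<kappa>2 L where \<kappa>: "0 < \<kappa>1" "\<kappa>1 \<le> 1" "0 < \<kappa>2" "1 \<le> L"
    and fin: "\<And>lm Q T X. 1 \<le> lm \<Longrightarrow> T \<ge> 0 \<Longrightarrow> b * lm \<le> Q \<Longrightarrow>
      X \<le> C1 * ((\<kappa>1\<^sup>2 + \<kappa>2\<^sup>2 / lm\<^sup>2) * Q + (\<kappa>1\<^sup>2 + 1) * T) \<Longrightarrow>
      \<kappa>1 * (Q / 2 - C * (1 + T)) + \<kappa>2 * (e * T - C) - C * (1 + T) - C / lm * Q \<le> X \<Longrightarrow> lm \<le> L"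
    using choose_constants[OF C(1), of C1 e b] by metis
  show thesis
  proof (rule that[OF \<kappa>(1) \<kappa>(3) K \<kappa>(4)])
    fix \<Omega> :: "(real^'n) set" and A B u usub x0 and q :: "'n \<Rightarrow> real^'n" and lam m
    assume pt: "eigenframe_point \<Omega> k A B u usub x0 q lam m \<Lambda> \<delta>"
      and max: "\<And>x. x \<in> \<Omega> \<Longrightarrow> (q m \<bullet> (aug_hess \<Omega> A u x *v q m)) *
          exp (\<kappa>1 / 2 * (grad \<Omega> u x \<bullet> grad \<Omega> u x) + \<kappa>2 * exp (K * (usub x - u x)))
        \<le> lam m * exp (\<kappa>1 / 2 * (grad \<Omega> u x0 \<bullet> grad \<Omega> u x0) + \<kappa>2 * exp (K * (usub x0 - u x0)))"
    interpret P: eigenframe_point \<Omega> k A B u usub x0 q lam m \<Lambda> \<delta> by (rule pt)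
    have eqs: "P.R = R" "P.\<Lambda>' = \<Lambda>'" "P.K = K"
      by (simp_all add: P.R_def R_def P.\<Lambda>'_def \<Lambda>'_def P.K_def K_def N_def)
    have max': "\<forall>x\<in>\<Omega>. (q m \<bullet> (aug_hess \<Omega> A u x *v q m)) * exp (P.\<phi> \<kappa>1 \<kappa>2 x) \<le> lam m * exp (P.\<phi> \<kappa>1 \<kappa>2 x0)"
      unfolding P.\<phi>_def eqs using max by blast
    note I = P.interior_inequalities[unfolded eqs, folded N_def, OF less_imp_le[OF \<kappa>(1)] less_imp_le[OF \<kappa>(3)] C(2) C(3) C(4) C(5) C(6) max']
    show "lam m \<le> L"
      by (rule fin[OF P.lam_m P.T_nonneg P.Q_lower[folded N_def, folded b_def] I(1)[folded C1_def] I(2)[folded e_def]])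
  qed
qed

section \<open>Global estimate\<close>

lemma continuous_on_pminor_sum:
  fixes F :: "'a::topological_space \<Rightarrow> real^'n^'n"
  assumes "\<And>i j. continuous_on S (\<lambda>x. F x $ i $ j)"
  shows "continuous_on S (\<lambda>x. pminor_sum k (F x))"
proof -
  have "continuous_on S (\<lambda>x. (if i \<in> I then F x $ i else axis i 1) $ j)" for I i j
    using assms by (cases "i \<in> I") auto
  then show ?thesis unfolding pminor_sum_def det_def vec_lambda_beta
    by (intro continuous_on_sum continuous_on_mult continuous_on_prod continuous_on_const)
qed

text \<open>With \<open>t\<close> subtracted on the diagonal of a strictly admissible matrix field,
  this produces the margin \<open>\<delta>\<close>.\<close>

lemma uniform_positivity:
  fixes F :: "'a::metric_space \<Rightarrow> real \<Rightarrow> real"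
  assumes S: "compact S" and F: "continuous_on (S \<times> {0..1}) (\<lambda>(x, t). F x t)" and pos: "\<And>x. x \<in> S \<Longrightarrow> 0 < F x 0"
  obtains e where "0 < e" "\<And>x t. x \<in> S \<Longrightarrow> 0 \<le> t \<Longrightarrow> t \<le> e \<Longrightarrow> 0 < F x t"
proof (cases "S = {}")
  case True
  then show ?thesis using that[of 1] by auto
next
  case False
  have "continuous_on S (\<lambda>x. case (x, 0) of (x, t) \<Rightarrow> F x t)"
    by (rule continuous_on_compose2[OF F]) (auto intro!: continuous_intros)
  then have "continuous_on S (\<lambda>x. F x 0)" by simp
  then obtain x0 where x0: "x0 \<in> S" "\<And>x. x \<in> S \<Longrightarrow> F x0 0 \<le> F x 0"
    using continuous_attains_inf[OF S False] by blast
  have "uniformly_continuous_on (S \<times> {0..1}) (\<lambda>(x, t). F x t)"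
    using S F by (intro compact_uniformly_continuous compact_Times) auto
  from this[unfolded uniformly_continuous_on_def, rule_format, OF pos[OF x0(1)]]
  obtain e where e: "e > 0" "\<forall>z\<in>S \<times> {0..1}. \<forall>z'\<in>S \<times> {0..1}. dist z' z < e \<longrightarrow>
      dist (case z' of (x, t) \<Rightarrow> F x t) (case z of (x, t) \<Rightarrow> F x t) < F x0 0"
    by (elim exE conjE)
  show thesis
  proof (rule that[of "min 1 (e / 2)"])
    fix x t assume x: "x \<in> S" and t: "0 \<le> t" "t \<le> min 1 (e / 2)"
    have "dist (x, t) (x, 0) < e" using t e(1) by (simp add: dist_Pair_Pair)
    then have "\<bar>F x t - F x 0\<bar> < F x0 0" using e(2)[rule_format, of "(x, 0)" "(x, t)"] x t by (simp add: dist_real_def)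
    then show "0 < F x t" using x0(2)[OF x] by linarith
  qed (use e in auto)
qed

text \<open>Admissibility puts the eigenvalues only into the closed cone, and the equation adds a
  positive function of top order. In the closure all S_j are nonnegative and
  \<open>esym_Suc_le\<close> persists, so S_{j+1} > 0 forces S_j to be nonzero, hence
  positive.\<close>

lemma Gamma_cone_interior:
  fixes v :: "real^'n"
  assumes v: "v \<in> Gamma_cone (Suc k)" and pos: "elem_sym (Suc k) v > 0"
  shows "esym_cone (Suc k) UNIV (($) v)"
proof -
  define D :: "(real^'n) set" where "D = (\<Inter>j\<in>{..k}. {v. 0 \<le> elem_sym j v} \<inter>
    {v. real (Suc j) * elem_sym (Suc j) v \<le> (\<Sum>i\<in>UNIV. v $ i) * elem_sym j v})"
  have cont: "continuous_on UNIV (\<lambda>v :: real^'n. elem_sym j v)" for j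
    unfolding elem_sym_def by (intro continuous_intros)
  have "closed D"
    unfolding D_def by (intro closed_INT ballI closed_Int closed_Collect_le continuous_intros cont)
  moreover have "Gamma_plus (Suc k) \<subseteq> D"
  proof
    fix w :: "real^'n" assume "w \<in> Gamma_plus (Suc k)"
    then have cone: "esym_cone (Suc k) UNIV (($) w)"
      unfolding esym_cone_def Gamma_plus_def elem_sym_eq_esym
      by (auto simp: esym_0[OF finite]) (metis esym_0[OF finite] atLeastAtMost_iff not_less_eq_eq le_0_eq zero_less_one One_nat_def)
    have "real (Suc j) * esym (Suc j) UNIV (($) w) \<le> (\<Sum>i\<in>UNIV. w $ i) * esym j UNIV (($) w)" if "j \<le> k" for j
      by (rule esym_Suc_le[OF finite esym_cone_mono[OF cone]]) (use that in simp)
    then show "w \<in> D"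
      using cone unfolding D_def elem_sym_eq_esym by (auto simp: esym_cone_def less_imp_le)
  qed
  ultimately have "closure (Gamma_plus (Suc k)) \<subseteq> D" by (rule closure_minimal[rotated])
  then have vD: "0 \<le> elem_sym j v" "real (Suc j) * elem_sym (Suc j) v \<le> (\<Sum>i\<in>UNIV. v $ i) * elem_sym j v" if "j \<le> k" for j
    using v that unfolding Gamma_cone_def D_def by auto
  \<comment> \<open>Induction on \<open>Suc k - j\<close>: positivity descends from the top
    order.\<close>
  have "elem_sym j v > 0" if "j \<le> Suc k" for j
    using that
  proof (induction "Suc k - j" arbitrary: j)
    case 0
    then show ?case using pos by (simp add: le_antisym)
  next
    case (Suc n)
    have "elem_sym (Suc j) v > 0" by (rule Suc.hyps) (use Suc in auto)
    then have "0 < real (Suc j) * elem_sym (Suc j) v" by simp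
    then have "0 < (\<Sum>i\<in>UNIV. v $ i) * elem_sym j v" using vD(2)[of j] Suc by linarith
    then have "elem_sym j v \<noteq> 0" by auto
    then show ?case using vD(1)[of j] Suc by linarith
  qed
  then show ?thesis by (simp add: esym_cone_def elem_sym_eq_esym)
qed

lemma axis_Basis: "axis i (1 :: real) \<in> Basis"
  by (simp add: axis_in_Basis_iff)

lemma continuous_on_grad: "Ck 2 \<Omega> X u \<Longrightarrow> continuous_on X (grad \<Omega> u)"
  unfolding grad_def by (intro continuous_on_vec_lambda) (auto simp: numeral_2_eq_2 axis_Basis)

lemma continuous_on_hess_entry: "Ck 2 \<Omega> X u \<Longrightarrow> continuous_on X (\<lambda>x. hess \<Omega> u x $ i $ j)"
  by (simp add: hess_def numeral_2_eq_2 axis_Basis)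

lemma continuous_on_hess: "Ck 2 \<Omega> X u \<Longrightarrow> continuous_on X (hess \<Omega> u)"
  unfolding hess_def by (intro continuous_on_vec_lambda) (auto simp: numeral_2_eq_2 axis_Basis)

lemma continuous_on_aug_hess_entry:
  assumes u: "Ck 2 \<Omega> X u" and A: "\<And>i j. continuous_on (X \<times> UNIV) (\<lambda>z. A z $ i $ j)"
  shows "continuous_on X (\<lambda>x. aug_hess \<Omega> A u x $ i $ j)"
proof -
  have "continuous_on X (\<lambda>x. A (x, grad \<Omega> u x) $ i $ j)"
    by (rule continuous_on_compose2[OF A, of X "\<lambda>x. (x, grad \<Omega> u x)"])
      (auto intro!: continuous_intros continuous_on_grad[OF u])
  then show ?thesis using continuous_on_hess_entry[OF u, of i j] by (simp add: aug_hess_def continuous_on_diff)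
qed

lemma closure_le:
  fixes f :: "'a::metric_space \<Rightarrow> real"
  assumes "continuous_on (closure S) f" "\<And>x. x \<in> S \<Longrightarrow> f x \<le> c" "x \<in> closure S"
  shows "f x \<le> c"
  using continuous_le_on_closure[OF assms(1,3)] assms(2) by auto

section \<open>Matrix norms and quadratic forms\<close>

lemma matrix_entry_le_norm: "\<bar>M $ i $ j\<bar> \<le> norm M" for M :: "real^'n^'n"
  by (rule order_trans[OF component_le_norm_cart Finite_Cartesian_Product.norm_nth_le])

lemma norm_matrix_le:
  fixes M :: "real^'n^'n"
  assumes "\<And>i j. \<bar>M $ i $ j\<bar> \<le> c"
  shows "norm M \<le> (real CARD('n))\<^sup>2 * c"
proof -
  have "norm (M $ i) \<le> real CARD('n) * c" for i
  proof -
    have "norm (M $ i) \<le> (\<Sum>j\<in>UNIV. \<bar>M $ i $ j\<bar>)" by (rule norm_le_l1_cart)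
    also have "\<dots> \<le> (\<Sum>j\<in>(UNIV :: 'n set). c)" by (intro sum_mono assms)
    finally show ?thesis by simp
  qed
  then have "(\<Sum>i\<in>UNIV. norm (M $ i)) \<le> (\<Sum>i\<in>(UNIV :: 'n set). real CARD('n) * c)" by (intro sum_mono)
  moreover have "norm M \<le> (\<Sum>i\<in>UNIV. norm (M $ i))" unfolding norm_vec_def by (rule L2_set_le_sum) simp
  ultimately show ?thesis by (simp add: power2_eq_square)
qed

lemma quadratic_form_le:
  fixes M :: "real^'n^'n"
  assumes "norm \<xi> \<le> 1" "norm \<eta> \<le> 1"
  shows "\<bar>\<xi> \<bullet> (M *v \<eta>)\<bar> \<le> (real CARD('n))\<^sup>2 * norm M"
proof -
  have "\<bar>\<xi> \<bullet> (M *v \<eta>)\<bar> \<le> (\<Sum>(i, j)\<in>UNIV. \<bar>(\<xi> $ i * \<eta> $ j) * M $ i $ j\<bar>)"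
    unfolding inner_matrix_entries by (intro order_trans[OF sum_abs] sum_mono) auto
  also have "\<dots> \<le> (\<Sum>ij\<in>(UNIV :: ('n \<times> 'n) set). norm M)"
  proof (rule sum_mono, clarify)
    fix i j :: 'n
    have "\<bar>\<xi> $ i\<bar> \<le> 1" "\<bar>\<eta> $ j\<bar> \<le> 1"
      using component_le_norm_cart[of \<xi> i] component_le_norm_cart[of \<eta> j] assms by linarith+
    then have "\<bar>\<xi> $ i\<bar> * \<bar>\<eta> $ j\<bar> \<le> 1 * 1" by (intro mult_mono) auto
    then have "\<bar>\<xi> $ i\<bar> * \<bar>\<eta> $ j\<bar> * \<bar>M $ i $ j\<bar> \<le> 1 * norm M" using matrix_entry_le_norm by (intro mult_mono) auto
    then show "\<bar>(\<xi> $ i * \<eta> $ j) * M $ i $ j\<bar> \<le> norm M" by (simp add: abs_mult)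
  qed
  also have "\<dots> = (real CARD('n))\<^sup>2 * norm M" by (simp add: card_cartesian_product UNIV_Times_UNIV[symmetric] power2_eq_square del: UNIV_Times_UNIV)
  finally show ?thesis .
qed

text \<open>An upper bound on the eigenvalues also controls the negative ones, because the trace is
  nonnegative; the entries are then read off in the eigenframe.\<close>

lemma eigen_norm_bound:
  fixes W :: "real^'n^'n"
  assumes q: "orthonormal_frame q" "\<And>a. W *v q a = \<mu> a *\<^sub>R q a"
    and up: "\<And>a. \<mu> a \<le> P" and sum: "0 \<le> (\<Sum>a\<in>UNIV. \<mu> a)" and P: "P \<ge> 0"
  shows "norm W \<le> (real CARD('n))\<^sup>2 * (real CARD('n) * (real CARD('n) * P))"
proof (rule norm_matrix_le)
  fix i j
  have N: "real CARD('n) \<ge> 1" by (simp add: Suc_le_eq)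
  have mu: "\<bar>\<mu> a\<bar> \<le> real CARD('n) * P" for a
  proof -
    have "(\<Sum>a\<in>UNIV. \<mu> a) = \<mu> a + (\<Sum>b\<in>UNIV - {a}. \<mu> b)" by (rule sum.remove) auto
    moreover have "(\<Sum>b\<in>UNIV - {a}. \<mu> b) \<le> (\<Sum>b\<in>UNIV - {a}. P)" by (intro sum_mono up)
    moreover have "(\<Sum>b\<in>UNIV - {a}. P) = (real CARD('n) - 1) * P" using N by (simp add: card_Diff_singleton of_nat_diff)
    ultimately have "- \<mu> a \<le> (real CARD('n) - 1) * P" using sum by linarith
    moreover have "1 * P \<le> real CARD('n) * P" using N P by (intro mult_right_mono) auto
    moreover have "(real CARD('n) - 1) * P = real CARD('n) * P - P" by (simp add: algebra_simps)
    ultimately show ?thesis using up[of a] P by linarith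
  qed
  have W: "W $ i $ j = axis i 1 \<bullet> (W *v axis j 1)"
    by (simp add: inner_axis' matrix_vector_mul_component inner_axis)
  have "W *v axis j 1 = W *v (\<Sum>a\<in>UNIV. (axis j 1 \<bullet> q a) *\<^sub>R q a)"
    using frame_expand[OF q(1), of "axis j 1"] by simp
  also have "\<dots> = (\<Sum>a\<in>UNIV. (axis j 1 \<bullet> q a) *\<^sub>R (\<mu> a *\<^sub>R q a))"
    by (simp add: linear_sum[OF matrix_vector_mul_linear] matrix_vector_mult_scaleR q(2))
  finally have "W $ i $ j = (\<Sum>a\<in>UNIV. (axis j 1 \<bullet> q a) * (\<mu> a * (axis i 1 \<bullet> q a)))"
    unfolding W by (simp add: inner_sum_right mult.assoc)
  then have "\<bar>W $ i $ j\<bar> \<le> (\<Sum>a\<in>UNIV. \<bar>(axis j 1 \<bullet> q a) * (\<mu> a * (axis i 1 \<bullet> q a))\<bar>)" by (simp only: sum_abs)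
  also have "\<dots> \<le> (\<Sum>a\<in>(UNIV :: 'n set). 1 * (real CARD('n) * P * 1))"
  proof (rule sum_mono)
    fix a
    have nq: "norm (q a) = 1" using q(1) by (simp add: orthonormal_frame_def norm_eq_sqrt_inner)
    have "\<bar>axis l 1 \<bullet> q a\<bar> \<le> 1" for l using Cauchy_Schwarz_ineq2[of "axis l 1" "q a"] nq by (simp add: norm_axis_1)
    then show "\<bar>(axis j 1 \<bullet> q a) * (\<mu> a * (axis i 1 \<bullet> q a))\<bar> \<le> 1 * (real CARD('n) * P * 1)"
      unfolding abs_mult using mu[of a] N P by (intro mult_mono) auto
  qed
  finally show "\<bar>W $ i $ j\<bar> \<le> real CARD('n) * (real CARD('n) * P)" by simp
qed

lemma eigen_quadratic_le:
  fixes W :: "real^'n^'n"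
  assumes W: "transpose W = W" and q: "orthonormal_frame q" "\<And>a. W *v q a = \<mu> a *\<^sub>R q a" and up: "\<And>a. \<mu> a \<le> P" and \<xi>: "norm \<xi> = 1"
  shows "\<xi> \<bullet> (W *v \<xi>) \<le> P"
proof -
  have "\<xi> \<bullet> (W *v \<xi>) = (\<Sum>a\<in>UNIV. (\<xi> \<bullet> q a) * ((W *v \<xi>) \<bullet> q a))" by (rule frame_parseval[OF q(1)])
  also have "\<dots> = (\<Sum>a\<in>UNIV. \<mu> a * (\<xi> \<bullet> q a)\<^sup>2)"
    unfolding inner_matrix_symmetric[OF W] q(2) by (simp add: power2_eq_square mult_ac)
  also have "\<dots> \<le> (\<Sum>a\<in>UNIV. P * (\<xi> \<bullet> q a)\<^sup>2)" by (intro sum_mono mult_right_mono up) auto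
  also have "\<dots> = P * (\<xi> \<bullet> \<xi>)" unfolding frame_parseval[OF q(1), of \<xi> \<xi>] by (simp add: sum_distrib_left power2_eq_square)
  finally show ?thesis using \<xi> by (simp add: dot_square_norm)
qed

text \<open>The data without the solution: constants obtained here before \<open>u\<close> is
  introduced cannot depend on it. The order of the operator is again \<open>k + 1\<close>.\<close>

locale augmented_hessian_problem =
  fixes \<Omega> :: "(real^'n) set" and k :: nat
    and A :: "(real^'n) \<times> (real^'n) \<Rightarrow> real^'n^'n" and B :: "(real^'n) \<times> (real^'n) \<Rightarrow> real" and usub :: "real^'n \<Rightarrow> real"
  assumes open_dom: "open \<Omega>" and ne: "\<Omega> \<noteq> {}" and bdd: "bounded \<Omega>"
    and A2: "\<And>i j. Ck 2 (\<Omega> \<times> UNIV) (closure \<Omega> \<times> UNIV) (\<lambda>z. A z $ i $ j)"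
    and A_sym: "\<And>x p. x \<in> closure \<Omega> \<Longrightarrow> transpose (A (x, p)) = A (x, p)"
    and reg: "regular_matrix \<Omega> A"
    and B2: "Ck 2 (\<Omega> \<times> UNIV) (closure \<Omega> \<times> UNIV) B"
    and B_pos: "\<And>x p. x \<in> closure \<Omega> \<Longrightarrow> B (x, p) > 0"
    and conv: "convex_in_p \<Omega> (\<lambda>z. B z powr (1 / real (Suc k)))"
    and us2: "Ck 2 \<Omega> (closure \<Omega>) usub"
    and us_strict: "\<And>x. x \<in> closure \<Omega> \<Longrightarrow> eigenvalue_vector (aug_hess \<Omega> A usub x) \<in> Gamma_plus (Suc k)"
begin

lemma compact_closure_dom: "compact (closure \<Omega>)"
  using bdd by (simp add: compact_closure)

text \<open>Second derivatives commute in the domain; at boundary points they are limits from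
  inside, so symmetry passes to the closure by continuity.\<close>

lemma aug_hess_symmetric:
  assumes u: "Ck 2 \<Omega> (closure \<Omega>) u" and x: "x \<in> closure \<Omega>"
  shows "transpose (aug_hess \<Omega> A u x) = aug_hess \<Omega> A u x"
proof -
  have "hess \<Omega> u x $ i $ j = hess \<Omega> u x $ j $ i" for i j
  proof -
    have "continuous_on (closure \<Omega>) (\<lambda>x. \<bar>hess \<Omega> u x $ i $ j - hess \<Omega> u x $ j $ i\<bar>)"
      by (intro continuous_intros continuous_on_hess_entry[OF u])
    moreover have "\<bar>hess \<Omega> u y $ i $ j - hess \<Omega> u y $ j $ i\<bar> \<le> 0" if "y \<in> \<Omega>" for y
      using hess_symmetric[OF open_dom that Ck_subset[OF u closure_subset]] by (simp add: transpose_def vec_eq_iff)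
    ultimately have "\<bar>hess \<Omega> u x $ i $ j - hess \<Omega> u x $ j $ i\<bar> \<le> 0" using x by (rule closure_le)
    then show ?thesis by simp
  qed
  then show ?thesis using A_sym[OF x, of "grad \<Omega> u x"] by (simp add: aug_hess_def transpose_def vec_eq_iff)
qed

text \<open>Compactness of the closure gives a margin for each order \<open>j\<close>; finitely many
  orders have a common one.\<close>

lemma strict_subsolution_margin:
  obtains \<delta> where "\<delta> > 0" "\<And>x j. x \<in> closure \<Omega> \<Longrightarrow> j \<le> Suc k \<Longrightarrow> 0 < pminor_sum j (aug_hess \<Omega> A usub x - \<delta> *\<^sub>R mat 1)"
proof -
  have "\<exists>e. 0 < e \<and> (\<forall>x t. x \<in> closure \<Omega> \<longrightarrow> 0 \<le> t \<longrightarrow> t \<le> e \<longrightarrow> 0 < pminor_sum j (aug_hess \<Omega> A usub x - t *\<^sub>R mat 1))"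
    if j: "j \<le> Suc k" for j
  proof (rule uniform_positivity[OF compact_closure_dom, of "\<lambda>x t. pminor_sum j (aug_hess \<Omega> A usub x - t *\<^sub>R mat 1)"])
    have ent: "continuous_on (closure \<Omega>) (\<lambda>x. aug_hess \<Omega> A usub x $ i $ l)" for i l
      by (rule continuous_on_aug_hess_entry[OF us2 Ck_continuous[OF A2]])
    have "continuous_on (closure \<Omega> \<times> {0..1}) (\<lambda>z. pminor_sum j (aug_hess \<Omega> A usub (fst z) - snd z *\<^sub>R mat 1))"
    proof (rule continuous_on_pminor_sum)
      fix i l
      have "continuous_on (closure \<Omega> \<times> {0..1::real}) (\<lambda>z. aug_hess \<Omega> A usub (fst z) $ i $ l)"
        by (rule continuous_on_compose2[OF ent]) (auto intro!: continuous_intros)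
      then show "continuous_on (closure \<Omega> \<times> {0..1}) (\<lambda>z. (aug_hess \<Omega> A usub (fst z) - snd z *\<^sub>R mat 1) $ i $ l)"
        unfolding vector_minus_component vector_scaleR_component
        by (intro continuous_on_diff continuous_on_scaleR continuous_on_snd continuous_on_const continuous_on_id)
    qed
    then show "continuous_on (closure \<Omega> \<times> {0..1}) (\<lambda>(x, t). pminor_sum j (aug_hess \<Omega> A usub x - t *\<^sub>R mat 1))"
      by (simp add: case_prod_unfold)
    show "0 < pminor_sum j (aug_hess \<Omega> A usub x - 0 *\<^sub>R mat 1)" if x: "x \<in> closure \<Omega>" for x
    proof (cases "j = 0")
      case True
      obtain q \<mu> where q: "orthonormal_frame q" "\<And>a. aug_hess \<Omega> A usub x *v q a = \<mu> a *\<^sub>R q a"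
        using spectral_theorem[OF aug_hess_symmetric[OF us2 x]] by blast
      show ?thesis using pminor_sum_eigen[OF q] True by simp
    next
      case False
      then have "elem_sym j (eigenvalue_vector (aug_hess \<Omega> A usub x)) > 0"
        using us_strict[OF x] j by (auto simp: Gamma_plus_def)
      then show ?thesis using elem_sym_eigenvalue_vector[OF aug_hess_symmetric[OF us2 x]] by simp
    qed
  qed blast
  then obtain e where e: "\<And>j. j \<le> Suc k \<Longrightarrow> 0 < e j"
    "\<And>j x t. j \<le> Suc k \<Longrightarrow> x \<in> closure \<Omega> \<Longrightarrow> 0 \<le> t \<Longrightarrow> t \<le> e j \<Longrightarrow> 0 < pminor_sum j (aug_hess \<Omega> A usub x - t *\<^sub>R mat 1)"
    by metis
  define \<delta> where "\<delta> = Min (e ` {..Suc k})"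
  have "\<delta> > 0" unfolding \<delta>_def using e(1) by (subst Min_gr_iff) auto
  moreover have "\<delta> \<le> e j" if "j \<le> Suc k" for j unfolding \<delta>_def using that by (intro Min_le) auto
  ultimately show thesis using that[of \<delta>] e(2) by (meson less_imp_le)
qed

text \<open>\<open>M\<close> is the only quantity through which later constants depend on the
  solution.\<close>

definition is_solution :: "real \<Rightarrow> (real^'n \<Rightarrow> real) \<Rightarrow> bool" where
  "is_solution M u \<longleftrightarrow> Ck 4 \<Omega> \<Omega> u \<and> Ck 2 \<Omega> (closure \<Omega>) u \<and> admissible (Suc k) \<Omega> A u \<and>
    (\<forall>x\<in>\<Omega>. S_mat (Suc k) (aug_hess \<Omega> A u x) = B (x, grad \<Omega> u x)) \<and> (\<forall>x\<in>\<Omega>. \<bar>u x\<bar> + norm (grad \<Omega> u x) \<le> M)"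

lemma norm_grad_le:
  assumes "x \<in> \<Omega>" "f differentiable (at x)" "\<And>v. \<bar>partial_d \<Omega> v f x\<bar> \<le> C * norm v" "C \<ge> 0"
  shows "norm (grad \<Omega> f x) \<le> C"
proof (cases "grad \<Omega> f x = 0")
  case False
  have "norm (grad \<Omega> f x) * norm (grad \<Omega> f x) \<le> C * norm (grad \<Omega> f x)"
    using assms(3)[of "grad \<Omega> f x"] grad_inner[OF assms(1,2), of "grad \<Omega> f x"] by (simp add: dot_square_norm power2_eq_square)
  then show ?thesis using False by simp
qed (use assms in simp)

lemma solution_cone:
  assumes u: "is_solution M u" and x: "x \<in> \<Omega>" and q: "orthonormal_frame q" "\<And>a. aug_hess \<Omega> A u x *v q a = \<mu> a *\<^sub>R q a"
  shows "esym_cone (Suc k) UNIV \<mu>" "pminor_sum (Suc k) (aug_hess \<Omega> A u x) = B (x, grad \<Omega> u x)"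
proof -
  have xc: "x \<in> closure \<Omega>" using x closure_subset by blast
  have sym: "transpose (aug_hess \<Omega> A u x) = aug_hess \<Omega> A u x"
    using u xc unfolding is_solution_def by (intro aug_hess_symmetric) auto
  show eq: "pminor_sum (Suc k) (aug_hess \<Omega> A u x) = B (x, grad \<Omega> u x)"
  proof -
    have "S_mat (Suc k) (aug_hess \<Omega> A u x) = B (x, grad \<Omega> u x)" using u x unfolding is_solution_def by blast
    then show ?thesis using S_mat_eq_pminor_sum[OF sym] by simp
  qed
  have "esym_cone (Suc k) UNIV (($) (eigenvalue_vector (aug_hess \<Omega> A u x)))"
  proof (rule Gamma_cone_interior)
    show "eigenvalue_vector (aug_hess \<Omega> A u x) \<in> Gamma_cone (Suc k)"
      using u x by (auto simp: is_solution_def admissible_def)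
    show "elem_sym (Suc k) (eigenvalue_vector (aug_hess \<Omega> A u x)) > 0"
      unfolding elem_sym_eigenvalue_vector[OF sym] eq using B_pos[OF xc] .
  qed
  then show "esym_cone (Suc k) UNIV \<mu>"
    unfolding esym_cone_def elem_sym_eq_esym[symmetric] elem_sym_eigenvalue_vector[OF sym] pminor_sum_eigen[OF q] .
qed

lemma uniform_constants:
  obtains \<Lambda> \<delta> where "\<Lambda> \<ge> 1" "\<delta> > 0" "M \<le> \<Lambda>" "\<And>x. x \<in> closure \<Omega> \<Longrightarrow> \<bar>usub x\<bar> \<le> \<Lambda>"
    "\<And>x p \<xi> \<eta>. x \<in> closure \<Omega> \<Longrightarrow> norm p \<le> M \<Longrightarrow> norm \<xi> \<le> 1 \<Longrightarrow> norm \<eta> \<le> 1 \<Longrightarrow> \<bar>mat_entry A \<xi> \<eta> (x, p)\<bar> \<le> \<Lambda>"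
    "\<And>u x q lam m. is_solution M u \<Longrightarrow> x \<in> \<Omega> \<Longrightarrow> orthonormal_frame q \<Longrightarrow>
      (\<And>a. aug_hess \<Omega> A u x *v q a = lam a *\<^sub>R q a) \<Longrightarrow> (\<And>a. lam a \<le> lam m) \<Longrightarrow> 1 \<le> lam m \<Longrightarrow>
      eigenframe_point \<Omega> k A B u usub x q lam m \<Lambda> \<delta>"
proof -
  let ?U = "\<Omega> \<times> (UNIV :: (real^'n) set)" and ?X = "closure \<Omega> \<times> (UNIV :: (real^'n) set)"
  have U: "open ?U" "?U \<subseteq> ?X" using open_dom closure_subset by (auto simp: open_Times)
  obtain Cu where Cu: "Cu \<ge> 0" "\<And>z. z \<in> closure \<Omega> \<Longrightarrow> \<bar>usub z\<bar> \<le> Cu"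
    "\<And>z v. z \<in> closure \<Omega> \<inter> \<Omega> \<Longrightarrow> \<bar>partial_d \<Omega> v usub z\<bar> \<le> Cu * norm v"
    using partial_d_bounds[OF open_dom closure_subset us2 compact_closure_dom order_refl] by metis
  \<comment> \<open>The ball contains the gradients of \<open>u\<close> and of \<open>usub\<close>,
    hence by convexity the segments between them; the entry \<open>0\<close> keeps it
    nonempty.\<close>
  define r where "r = max (max M Cu) 0"
  define K where "K = closure \<Omega> \<times> cball (0 :: real^'n) r"
  have K: "compact K" "K \<subseteq> ?X" "K \<noteq> {}"
    using compact_closure_dom ne by (auto simp: K_def r_def compact_Times)
  obtain CA where CA: "CA \<ge> 0" "\<And>z \<xi> \<eta>. z \<in> K \<Longrightarrow> norm \<xi> \<le> 1 \<Longrightarrow> norm \<eta> \<le> 1 \<Longrightarrow> \<bar>mat_entry A \<xi> \<eta> z\<bar> \<le> CA"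
    "\<And>z v \<xi> \<eta>. z \<in> K \<inter> ?U \<Longrightarrow> norm \<xi> \<le> 1 \<Longrightarrow> norm \<eta> \<le> 1 \<Longrightarrow> \<bar>partial_d ?U v (mat_entry A \<xi> \<eta>) z\<bar> \<le> CA * norm v"
    "\<And>z v w \<xi> \<eta>. z \<in> K \<inter> ?U \<Longrightarrow> norm \<xi> \<le> 1 \<Longrightarrow> norm \<eta> \<le> 1 \<Longrightarrow>
      \<bar>partial_d ?U v (partial_d ?U w (mat_entry A \<xi> \<eta>)) z\<bar> \<le> CA * norm v * norm w"
    by (fact mat_entry_bounds[OF U A2 K(1,2)])
  obtain CB where CB: "CB \<ge> 0" "\<And>z. z \<in> K \<Longrightarrow> \<bar>B z\<bar> \<le> CB"
    "\<And>z v. z \<in> K \<inter> ?U \<Longrightarrow> \<bar>partial_d ?U v B z\<bar> \<le> CB * norm v"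
    "\<And>z v w. z \<in> K \<inter> ?U \<Longrightarrow> \<bar>partial_d ?U v (partial_d ?U w B) z\<bar> \<le> CB * norm v * norm w"
    using partial_d_bounds[OF U B2 K(1,2)] by metis
  \<comment> \<open>The positive minimum of \<open>B\<close> over the compact set; its reciprocal
    enters \<open>\<Lambda>\<close>.\<close>
  obtain z0 where z0: "z0 \<in> K" "\<And>z. z \<in> K \<Longrightarrow> B z0 \<le> B z"
    using continuous_attains_inf[OF K(1,3) continuous_on_subset[OF Ck_continuous[OF B2] K(2)]] by blast
  have b0: "B z0 > 0" using B_pos z0(1) by (auto simp: K_def)
  obtain \<delta> where \<delta>: "\<delta> > 0" "\<And>x j. x \<in> closure \<Omega> \<Longrightarrow> j \<le> Suc k \<Longrightarrow> 0 < pminor_sum j (aug_hess \<Omega> A usub x - \<delta> *\<^sub>R mat 1)"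
    using strict_subsolution_margin by metis
  define \<Lambda> where "\<Lambda> = Max {1, M, Cu, CA, CB, 1 / B z0}"
  have \<Lambda>: "1 \<le> \<Lambda>" "M \<le> \<Lambda>" "Cu \<le> \<Lambda>" "CA \<le> \<Lambda>" "CB \<le> \<Lambda>" "1 / B z0 \<le> \<Lambda>"
    unfolding \<Lambda>_def by (intro Max_ge; simp)+
  have mono1: "c * norm v \<le> \<Lambda> * norm v" if "c \<le> \<Lambda>" for c and v :: "(real^'n) \<times> (real^'n)"
    using that by (intro mult_right_mono) auto
  have mono2: "c * norm v * norm w \<le> \<Lambda> * norm v * norm w" if "c \<le> \<Lambda>" for c and v w :: "(real^'n) \<times> (real^'n)"
    using that by (intro mult_right_mono) auto
  have A2': "Ck 2 ?U ?U (\<lambda>z. A z $ i $ j)" for i j using A2 U(2) by (rule Ck_subset)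
  have B2': "Ck 2 ?U ?U B" using B2 U(2) by (rule Ck_subset)
  have us2': "Ck 2 \<Omega> \<Omega> usub" using us2 closure_subset by (rule Ck_subset)
  show thesis
  proof (rule that[OF \<Lambda>(1) \<delta>(1) \<Lambda>(2)])
    show "\<bar>usub x\<bar> \<le> \<Lambda>" if "x \<in> closure \<Omega>" for x using Cu(2)[OF that] \<Lambda>(3) by linarith
    show "\<bar>mat_entry A \<xi> \<eta> (x, p)\<bar> \<le> \<Lambda>" if "x \<in> closure \<Omega>" "norm p \<le> M" "norm \<xi> \<le> 1" "norm \<eta> \<le> 1" for x p \<xi> \<eta>
    proof -
      have "norm p \<le> r" using that(2) by (simp add: r_def)
      then have "(x, p) \<in> K" using that(1) by (simp add: K_def)
      from CA(2)[OF this that(3,4)] show ?thesis using \<Lambda>(4) by linarith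
    qed
  next
    fix u x q lam m
    assume u: "is_solution M u" and x: "x \<in> \<Omega>" and q: "orthonormal_frame q"
      and eig: "\<And>a. aug_hess \<Omega> A u x *v q a = lam a *\<^sub>R q a" and lam: "\<And>a. lam a \<le> lam m" "1 \<le> lam m"
    let ?p = "grad \<Omega> u x" and ?p' = "grad \<Omega> usub x"
    have xc: "x \<in> closure \<Omega>" using x closure_subset by blast
    have uM: "\<bar>u x\<bar> + norm ?p \<le> M" using u x by (auto simp: is_solution_def)
    have p: "norm ?p \<le> M" "\<bar>u x\<bar> \<le> M" using uM norm_ge_zero[of ?p] abs_ge_zero[of "u x"] by linarith+
    have p': "norm ?p' \<le> Cu"
      by (rule norm_grad_le[OF x Ck_2_differentiable[OF us2' x] Cu(3) Cu(1)]) (use x xc in simp)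
    have seg: "(x, ?p + t *\<^sub>R (?p' - ?p)) \<in> K \<inter> ?U" if t: "0 \<le> t" "t \<le> 1" for t
    proof -
      have "?p + t *\<^sub>R (?p' - ?p) = (1 - t) *\<^sub>R ?p + t *\<^sub>R ?p'" by (simp add: algebra_simps)
      then have "norm (?p + t *\<^sub>R (?p' - ?p)) \<le> (1 - t) * norm ?p + t * norm ?p'"
        using norm_triangle_ineq[of "(1 - t) *\<^sub>R ?p" "t *\<^sub>R ?p'"] t by simp
      also have "\<dots> \<le> (1 - t) * r + t * r" using p p' t by (intro add_mono mult_left_mono) (auto simp: r_def)
      finally show ?thesis using x xc by (simp add: K_def algebra_simps)
    qed
    have z: "(x, ?p) \<in> K \<inter> ?U" using seg[of 0] by simp
    show "eigenframe_point \<Omega> k A B u usub x q lam m \<Lambda> \<delta>"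
    proof (rule eigenframe_point.intro)
      show "open \<Omega>" "x \<in> \<Omega>" "regular_matrix \<Omega> A" "orthonormal_frame q" "1 \<le> \<Lambda>" "0 < \<delta>" "1 \<le> lam m"
        "convex_in_p \<Omega> (\<lambda>z. B z powr (1 / real (Suc k)))"
        using open_dom x reg q \<Lambda>(1) \<delta>(1) lam(2) conv by auto
      show "Ck 2 ?U ?U (\<lambda>z. A z $ i $ j)" for i j by (rule A2')
      show "Ck 2 ?U ?U B" by (rule B2')
      show "Ck 2 \<Omega> \<Omega> usub" by (rule us2')
      show "transpose (A (y, p)) = A (y, p)" if "y \<in> \<Omega>" for y p using A_sym that closure_subset by blast
      show "\<forall>z\<in>?U. B z > 0" using B_pos closure_subset by blast
      show "Ck 4 \<Omega> \<Omega> u" using u by (simp add: is_solution_def)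
      show "pminor_sum (Suc k) (aug_hess \<Omega> A u y) = B (y, grad \<Omega> u y)" if "y \<in> \<Omega>" for y
      proof -
        have "y \<in> closure \<Omega>" using that closure_subset by blast
        then obtain q' \<mu> where "orthonormal_frame q'" "\<And>a. aug_hess \<Omega> A u y *v q' a = \<mu> a *\<^sub>R q' a"
          using spectral_theorem[OF aug_hess_symmetric] u unfolding is_solution_def by metis
        then show ?thesis using solution_cone(2)[OF u that] by blast
      qed
      show "q i \<bullet> (aug_hess \<Omega> A u x *v q j) = (if i = j then lam i else 0)" for i j
        using q unfolding eig orthonormal_frame_def by simp
      show "esym_cone (Suc k) UNIV lam" by (rule solution_cone(1)[OF u x q eig])
      show "lam i \<le> lam m" for i by (rule lam(1))
      show "\<bar>mat_entry A \<xi> \<eta> (x, ?p)\<bar> \<le> \<Lambda>" if "norm \<xi> \<le> 1" "norm \<eta> \<le> 1" for \<xi> \<eta>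
        using CA(2)[of "(x, ?p)" \<xi> \<eta>] z that \<Lambda>(4) by simp
      show "\<bar>partial_d ?U v (mat_entry A \<xi> \<eta>) (x, ?p)\<bar> \<le> \<Lambda> * norm v" if "norm \<xi> \<le> 1" "norm \<eta> \<le> 1" for \<xi> \<eta> v
        by (rule order_trans[OF CA(3)[OF z that] mono1[OF \<Lambda>(4)]])
      show "\<bar>partial_d ?U v (partial_d ?U w (mat_entry A \<xi> \<eta>)) (x, ?p + t *\<^sub>R (?p' - ?p))\<bar> \<le> \<Lambda> * norm v * norm w"
        if "norm \<xi> \<le> 1" "norm \<eta> \<le> 1" "0 \<le> t" "t \<le> 1" for \<xi> \<eta> v w t
        by (rule order_trans[OF CA(4)[OF seg[OF that(3,4)] that(1,2)] mono2[OF \<Lambda>(4)]])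
      show "B (x, ?p) \<le> \<Lambda>" using CB(2)[of "(x, ?p)"] z \<Lambda>(5) by auto
      have "1 / B z0 * B z0 \<le> \<Lambda> * B (x, ?p)" using \<Lambda> z0(2)[of "(x, ?p)"] z b0 by (intro mult_mono) auto
      then show "1 \<le> \<Lambda> * B (x, ?p)" using b0 by simp
      show "\<bar>partial_d ?U v B (x, ?p)\<bar> \<le> \<Lambda> * norm v" for v by (rule order_trans[OF CB(3)[OF z] mono1[OF \<Lambda>(5)]])
      show "\<bar>partial_d ?U v (partial_d ?U w B) (x, ?p)\<bar> \<le> \<Lambda> * norm v * norm w" for v w
        by (rule order_trans[OF CB(4)[OF z] mono2[OF \<Lambda>(5)]])
      show "\<bar>u x\<bar> \<le> \<Lambda>" "norm ?p \<le> \<Lambda>" using p \<Lambda>(2) by auto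
      show "\<bar>usub x\<bar> \<le> \<Lambda>" using Cu(2)[OF xc] \<Lambda>(3) by linarith
      show "norm ?p' \<le> \<Lambda>" using p' \<Lambda>(3) by linarith
      show "0 < pminor_sum j (aug_hess \<Omega> A usub x - \<delta> *\<^sub>R mat 1)" if "j \<le> Suc k" for j by (rule \<delta>(2)[OF xc that])
    qed
  qed
qed

text \<open>At a maximum of the weighted quadratic form over the closure and all unit vectors, the
  form is bounded by the boundary Hessian or by the interior estimate. The weight lies between
  \<open>1\<close> and \<open>F\<close>, so the bound spreads to every point.\<close>

lemma hessian_bound:
  "\<exists>C. \<forall>u. is_solution M u \<longrightarrow>
    (SUP x\<in>\<Omega>. norm (hess \<Omega> u x)) \<le> C * (1 + (SUP x\<in>frontier \<Omega>. norm (hess \<Omega> u x)))"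
proof -
  define N where "N = real CARD('n)"
  have N: "N \<ge> 1" unfolding N_def by (simp add: Suc_le_eq)
  obtain \<Lambda> \<delta> where \<Lambda>1: "\<Lambda> \<ge> 1" and \<delta>: "\<delta> > 0" and M\<Lambda>: "M \<le> \<Lambda>" and us: "\<And>x. x \<in> closure \<Omega> \<Longrightarrow> \<bar>usub x\<bar> \<le> \<Lambda>"
    and bA: "\<And>x p \<xi> \<eta>. x \<in> closure \<Omega> \<Longrightarrow> norm p \<le> M \<Longrightarrow> norm \<xi> \<le> 1 \<Longrightarrow> norm \<eta> \<le> 1 \<Longrightarrow> \<bar>mat_entry A \<xi> \<eta> (x, p)\<bar> \<le> \<Lambda>"
    and pt: "\<And>u x q lam m. is_solution M u \<Longrightarrow> x \<in> \<Omega> \<Longrightarrow> orthonormal_frame q \<Longrightarrow>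
      (\<And>a. aug_hess \<Omega> A u x *v q a = lam a *\<^sub>R q a) \<Longrightarrow> (\<And>a. lam a \<le> lam m) \<Longrightarrow> 1 \<le> lam m \<Longrightarrow>
      eigenframe_point \<Omega> k A B u usub x q lam m \<Lambda> \<delta>"
    by (fact uniform_constants[of M])
  note \<Lambda> = \<Lambda>1 M\<Lambda>
  obtain \<kappa>1 \<kappa>2 K L :: real where \<kappa>: "\<kappa>1 > 0" "\<kappa>2 > 0" "K > 0" "L \<ge> 1"
    and int: "\<And>(\<Omega> :: (real^'n) set) A B u usub x0 q lam m. eigenframe_point \<Omega> k A B u usub x0 q lam m \<Lambda> \<delta> \<Longrightarrow>
      (\<And>x. x \<in> \<Omega> \<Longrightarrow> (q m \<bullet> (aug_hess \<Omega> A u x *v q m)) *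
          exp (\<kappa>1 / 2 * (grad \<Omega> u x \<bullet> grad \<Omega> u x) + \<kappa>2 * exp (K * (usub x - u x)))
        \<le> lam m * exp (\<kappa>1 / 2 * (grad \<Omega> u x0 \<bullet> grad \<Omega> u x0) + \<kappa>2 * exp (K * (usub x0 - u x0)))) \<Longrightarrow> lam m \<le> L"
    by (fact interior_estimate[OF \<Lambda>(1) \<delta>, where k = k and ?'n = 'n])
  \<comment> \<open>Upper bound of the weight on the closure; from below the weight is at least
    \<open>1\<close>, its exponent being nonnegative.\<close>
  define F where "F = exp (\<kappa>1 / 2 * \<Lambda>\<^sup>2 + \<kappa>2 * exp (K * (2 * \<Lambda>)))"
  \<comment> \<open>From the inside: the bound \<open>P0\<close> relative to \<open>1 + H\<close>,
    the variation of the weight, and the passage from eigenvalues to the matrix norm. The last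
    summand bounds \<open>A\<close>.\<close>
  define C where "C = N\<^sup>2 * (N * (N * ((L + N\<^sup>2 + \<Lambda>) * F))) + N\<^sup>2 * \<Lambda>"
  have "(SUP x\<in>\<Omega>. norm (hess \<Omega> u x)) \<le> C * (1 + (SUP x\<in>frontier \<Omega>. norm (hess \<Omega> u x)))" if u: "is_solution M u" for u
  proof -
    have u2: "Ck 2 \<Omega> (closure \<Omega>) u" and uM: "\<And>x. x \<in> \<Omega> \<Longrightarrow> \<bar>u x\<bar> + norm (grad \<Omega> u x) \<le> M"
      using u by (auto simp: is_solution_def)
    define H where "H = (SUP x\<in>frontier \<Omega>. norm (hess \<Omega> u x))"
    have Hx: "norm (hess \<Omega> u x) \<le> H" if "x \<in> frontier \<Omega>" for x
      unfolding H_def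
    proof (rule cSUP_upper[OF that])
      have "compact (frontier \<Omega>)" using bdd by (simp add: compact_frontier_bounded)
      moreover have "continuous_on (frontier \<Omega>) (\<lambda>x. norm (hess \<Omega> u x))"
        by (rule continuous_on_subset[of "closure \<Omega>"])
          (auto intro!: continuous_intros continuous_on_hess[OF u2] simp: frontier_def)
      ultimately show "bdd_above ((\<lambda>x. norm (hess \<Omega> u x)) ` frontier \<Omega>)"
        by (intro bounded_imp_bdd_above compact_imp_bounded compact_continuous_image)
    qed
    \<comment> \<open>A nonempty bounded set has a boundary point; this gives the supremum
      \<open>H\<close> a sign.\<close>
    have "frontier \<Omega> \<noteq> {}" using ne bdd not_bounded_UNIV by (metis frontier_eq_empty)
    then obtain y where "y \<in> frontier \<Omega>" by blast
    then have H0: "H \<ge> 0" using Hx[of y] norm_ge_zero[of "hess \<Omega> u y"] by linarith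
    have uc: "\<bar>u x\<bar> + norm (grad \<Omega> u x) \<le> M" if "x \<in> closure \<Omega>" for x
      by (rule closure_le[OF _ uM that])
        (intro continuous_intros Ck_continuous[OF u2] continuous_on_grad[OF u2], assumption)
    define \<phi> where "\<phi> x = \<kappa>1 / 2 * (grad \<Omega> u x \<bullet> grad \<Omega> u x) + \<kappa>2 * exp (K * (usub x - u x))" for x
    have \<phi>0: "0 \<le> \<phi> x" for x unfolding \<phi>_def using \<kappa> by simp
    have \<phi>F: "exp (\<phi> x) \<le> F" if x: "x \<in> closure \<Omega>" for x
    proof -
      have g: "norm (grad \<Omega> u x) \<le> \<Lambda>" "\<bar>u x\<bar> \<le> \<Lambda>"
        using uc[OF x] \<Lambda>(2) norm_ge_zero[of "grad \<Omega> u x"] abs_ge_zero[of "u x"] by linarith+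
      have "grad \<Omega> u x \<bullet> grad \<Omega> u x \<le> \<Lambda>\<^sup>2" unfolding dot_square_norm using g by (intro power_mono) auto
      moreover have "usub x - u x \<le> 2 * \<Lambda>" using us[OF x] g by linarith
      ultimately show ?thesis unfolding \<phi>_def F_def using \<kappa> by (simp add: add_mono mult_left_mono)
    qed
    define G where "G z = (snd z \<bullet> (aug_hess \<Omega> A u (fst z) *v snd z)) * exp (\<phi> (fst z))" for z :: "(real^'n) \<times> (real^'n)"
    let ?S = "closure \<Omega> \<times> sphere (0 :: real^'n) 1"
    have ent: "continuous_on (closure \<Omega>) (\<lambda>x. aug_hess \<Omega> A u x $ i $ l)" for i l
      by (rule continuous_on_aug_hess_entry[OF u2 Ck_continuous[OF A2]])
    have c\<phi>: "continuous_on (closure \<Omega>) \<phi>"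
      unfolding \<phi>_def by (intro continuous_intros Ck_continuous[OF u2] Ck_continuous[OF us2] continuous_on_grad[OF u2])
    have "continuous_on ?S G"
    proof -
      have c1: "continuous_on ?S (\<lambda>z. aug_hess \<Omega> A u (fst z) $ i $ l)" for i l
        by (rule continuous_on_compose2[OF ent]) (auto intro!: continuous_intros)
      have c2: "continuous_on ?S (\<lambda>z. \<phi> (fst z))"
        by (rule continuous_on_compose2[OF c\<phi>]) (auto intro!: continuous_intros)
      have c3: "continuous_on ?S (\<lambda>z. snd z $ i)" for i by (intro continuous_intros)
      show ?thesis
        unfolding G_def inner_matrix_entries case_prod_unfold
        by (intro continuous_on_mult continuous_on_sum continuous_on_exp c1 c2 c3)
    qed
    moreover have "compact ?S" using compact_closure_dom by (intro compact_Times compact_sphere)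
    moreover have "?S \<noteq> {}"
    proof -
      have "norm (axis undefined 1 :: real^'n) = 1" by (simp add: norm_axis_1)
      then have "axis undefined 1 \<in> sphere (0 :: real^'n) 1" by simp
      then show ?thesis using ne closure_subset by blast
    qed
    ultimately obtain z0 where z0: "z0 \<in> ?S" "\<And>z. z \<in> ?S \<Longrightarrow> G z \<le> G z0"
      using continuous_attains_sup by (metis (no_types, lifting))
    obtain x0 \<xi>0 where z0_eq: "z0 = (x0, \<xi>0)" by (cases z0)
    have x0: "x0 \<in> closure \<Omega>" "norm \<xi>0 = 1" using z0(1) by (auto simp: z0_eq)
    \<comment> \<open>Covers both positions of the maximum: \<open>L\<close> bounds the top
      eigenvalue at an interior point, \<open>N\<^sup>2 * H + \<Lambda>\<close> the quadratic form
      at a boundary point.\<close>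
    define P0 where "P0 = L + N\<^sup>2 * H + \<Lambda>"
    have P0: "P0 \<ge> 0" using \<kappa> N H0 \<Lambda> by (simp add: P0_def)
    have top: "\<xi>0 \<bullet> (aug_hess \<Omega> A u x0 *v \<xi>0) \<le> P0"
    proof (cases "x0 \<in> \<Omega>")
      case False
      then have fr: "x0 \<in> frontier \<Omega>" using x0 open_dom by (simp add: frontier_def interior_open)
      have "norm (grad \<Omega> u x0) \<le> M" using uc[OF x0(1)] abs_ge_zero[of "u x0"] by linarith
      then have "\<bar>mat_entry A \<xi>0 \<xi>0 (x0, grad \<Omega> u x0)\<bar> \<le> \<Lambda>" using bA x0 by simp
      moreover have "\<bar>\<xi>0 \<bullet> (hess \<Omega> u x0 *v \<xi>0)\<bar> \<le> N\<^sup>2 * norm (hess \<Omega> u x0)"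
        unfolding N_def by (rule quadratic_form_le) (use x0 in auto)
      moreover have "N\<^sup>2 * norm (hess \<Omega> u x0) \<le> N\<^sup>2 * H" using Hx[OF fr] by (intro mult_left_mono) auto
      moreover have "\<xi>0 \<bullet> (aug_hess \<Omega> A u x0 *v \<xi>0) = \<xi>0 \<bullet> (hess \<Omega> u x0 *v \<xi>0) - mat_entry A \<xi>0 \<xi>0 (x0, grad \<Omega> u x0)"
        by (simp add: aug_hess_def mat_entry_def matrix_vector_mult_diff_rdistrib inner_diff_right)
      ultimately show ?thesis using \<kappa>(4) unfolding P0_def by linarith
    next
      case True
      have sym: "transpose (aug_hess \<Omega> A u x0) = aug_hess \<Omega> A u x0" by (rule aug_hess_symmetric[OF u2 x0(1)])
      obtain q \<mu> where q: "orthonormal_frame q" "\<And>a. aug_hess \<Omega> A u x0 *v q a = \<mu> a *\<^sub>R q a"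
        using spectral_theorem[OF sym] by blast
      have "Max (range \<mu>) \<in> range \<mu>" by (intro Max_in) auto
      then obtain m where m: "\<mu> m = Max (range \<mu>)" by (metis imageE)
      have mu: "\<mu> a \<le> \<mu> m" for a unfolding m by (rule Max_ge) auto
      have le: "\<xi>0 \<bullet> (aug_hess \<Omega> A u x0 *v \<xi>0) \<le> \<mu> m" by (rule eigen_quadratic_le[OF sym q mu x0(2)])
      have nq: "norm (q m) = 1" and qq: "q m \<bullet> q m = 1" using q(1) by (simp_all add: orthonormal_frame_def norm_eq_sqrt_inner)
      have "\<mu> m \<le> L"
      proof (cases "1 \<le> \<mu> m")
        case big: True
        have "(q m \<bullet> (aug_hess \<Omega> A u x *v q m)) * exp (\<phi> x) \<le> \<mu> m * exp (\<phi> x0)" if "x \<in> \<Omega>" for x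
        proof -
          have "(x, q m) \<in> ?S" using that closure_subset nq by auto
          then have "G (x, q m) \<le> G z0" by (rule z0(2))
          also have "\<dots> \<le> \<mu> m * exp (\<phi> x0)" using le by (simp add: G_def z0_eq)
          finally show ?thesis by (simp add: G_def)
        qed
        then show ?thesis using int[OF pt[OF u True q mu big]] unfolding \<phi>_def by blast
      qed (use \<kappa> in linarith)
      then show ?thesis using le H0 \<Lambda> N unfolding P0_def by (smt (verit) mult_nonneg_nonneg zero_le_power2)
    qed
    \<comment> \<open>Only positive values have to be bounded, and these increase on multiplication
      with the weight.\<close>
    have quad: "\<xi> \<bullet> (aug_hess \<Omega> A u x *v \<xi>) \<le> P0 * F" if x: "x \<in> \<Omega>" and \<xi>: "norm \<xi> = 1" for x \<xi>
    proof (cases "\<xi> \<bullet> (aug_hess \<Omega> A u x *v \<xi>) \<le> 0")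
      case True
      moreover have "0 \<le> P0 * F" using P0 by (simp add: F_def)
      ultimately show ?thesis by linarith
    next
      case False
      have "(x, \<xi>) \<in> ?S" using x \<xi> closure_subset by auto
      then have "G (x, \<xi>) \<le> G z0" by (rule z0(2))
      also have "\<dots> \<le> P0 * exp (\<phi> x0)" using top by (simp add: G_def z0_eq)
      also have "\<dots> \<le> P0 * F" using P0 \<phi>F[OF x0(1)] by (intro mult_left_mono) auto
      finally have "(\<xi> \<bullet> (aug_hess \<Omega> A u x *v \<xi>)) * exp (\<phi> x) \<le> P0 * F" by (simp add: G_def)
      moreover have "(\<xi> \<bullet> (aug_hess \<Omega> A u x *v \<xi>)) * 1 \<le> (\<xi> \<bullet> (aug_hess \<Omega> A u x *v \<xi>)) * exp (\<phi> x)"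
        using False \<phi>0[of x] by (intro mult_left_mono) auto
      ultimately show ?thesis by simp
    qed
    have bound: "norm (hess \<Omega> u x) \<le> C * (1 + H)" if x: "x \<in> \<Omega>" for x
    proof -
      have xc: "x \<in> closure \<Omega>" using x closure_subset by blast
      obtain q \<mu> where q: "orthonormal_frame q" "\<And>a. aug_hess \<Omega> A u x *v q a = \<mu> a *\<^sub>R q a"
        using spectral_theorem[OF aug_hess_symmetric[OF u2 xc]] by blast
      have nq: "norm (q a) = 1" "q a \<bullet> q a = 1" for a using q(1) by (simp_all add: orthonormal_frame_def norm_eq_sqrt_inner)
      have mu: "\<mu> a \<le> P0 * F" for a using quad[OF x nq(1)[of a]] by (simp add: q(2) nq)
      have "0 < esym 1 UNIV \<mu>" using solution_cone(1)[OF u x q] by (simp add: esym_cone_def)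
      then have "0 \<le> (\<Sum>a\<in>UNIV. \<mu> a)" by (simp add: esym_1)
      then have W: "norm (aug_hess \<Omega> A u x) \<le> N\<^sup>2 * (N * (N * (P0 * F)))"
        unfolding N_def by (rule eigen_norm_bound[OF q mu]) (use P0 in \<open>simp add: F_def\<close>)
      have "norm (A (x, grad \<Omega> u x)) \<le> N\<^sup>2 * \<Lambda>"
        unfolding N_def
      proof (rule norm_matrix_le)
        fix i j
        have "norm (grad \<Omega> u x) \<le> M" using uc[OF xc] abs_ge_zero[of "u x"] by linarith
        then have "\<bar>mat_entry A (axis i 1) (axis j 1) (x, grad \<Omega> u x)\<bar> \<le> \<Lambda>" using bA xc by (simp add: norm_axis_1)
        then show "\<bar>A (x, grad \<Omega> u x) $ i $ j\<bar> \<le> \<Lambda>"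
          by (simp add: mat_entry_def inner_axis' matrix_vector_mul_component inner_axis)
      qed
      moreover have "hess \<Omega> u x = aug_hess \<Omega> A u x + A (x, grad \<Omega> u x)" by (simp add: aug_hess_def)
      ultimately have "norm (hess \<Omega> u x) \<le> N\<^sup>2 * (N * (N * (P0 * F))) + N\<^sup>2 * \<Lambda>"
        using W norm_triangle_ineq[of "aug_hess \<Omega> A u x" "A (x, grad \<Omega> u x)"] by simp
      also have "\<dots> \<le> N\<^sup>2 * (N * (N * ((L + N\<^sup>2 + \<Lambda>) * (1 + H) * F))) + N\<^sup>2 * \<Lambda> * (1 + H)"
      proof (intro add_mono mult_left_mono mult_right_mono)
        have "0 \<le> (L + \<Lambda>) * H + N\<^sup>2" using \<kappa> \<Lambda> H0 by simp
        then show "P0 \<le> (L + N\<^sup>2 + \<Lambda>) * (1 + H)" unfolding P0_def by (simp add: algebra_simps)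
        have "0 \<le> N\<^sup>2 * \<Lambda> * H" using H0 \<Lambda> by simp
        then show "N\<^sup>2 * \<Lambda> \<le> N\<^sup>2 * \<Lambda> * (1 + H)" by (simp add: algebra_simps)
      qed (use N in \<open>auto simp: F_def\<close>)
      also have "\<dots> = C * (1 + H)" unfolding C_def by (simp add: algebra_simps)
      finally show ?thesis .
    qed
    show ?thesis unfolding H_def[symmetric] by (rule cSUP_least[OF ne bound])
  qed
  then show ?thesis by blast
qed

end

theorem theorem1p1:
  fixes \<Omega> :: "(real^'n) set" and k :: nat
    and A :: "(real^'n) \<times> (real^'n) \<Rightarrow> real^'n^'n"
    and B :: "(real^'n) \<times> (real^'n) \<Rightarrow> real"
    and usub :: "real^'n \<Rightarrow> real"
  assumes "open \<Omega>" and "connected \<Omega>" and "\<Omega> \<noteq> {}" and "bounded \<Omega>"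
    and "1 \<le> k" and "k \<le> CARD('n)"
    and "\<And>i j. Ck 2 (\<Omega> \<times> UNIV) (closure \<Omega> \<times> UNIV) (\<lambda>z. A z $ i $ j)"
    and "\<And>x p. x \<in> closure \<Omega> \<Longrightarrow> transpose (A (x, p)) = A (x, p)"
    and "regular_matrix \<Omega> A"
    and "Ck 2 (\<Omega> \<times> UNIV) (closure \<Omega> \<times> UNIV) B"
    and "\<And>x p. x \<in> closure \<Omega> \<Longrightarrow> B (x, p) > 0"
    and "convex_in_p \<Omega> (\<lambda>z. B z powr (1 / real k))"
    and "Ck 2 \<Omega> (closure \<Omega>) usub"
    and "admissible k \<Omega> A usub"
    and "\<And>x. x \<in> closure \<Omega> \<Longrightarrow> eigenvalue_vector (aug_hess \<Omega> A usub x) \<in> Gamma_plus k"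
  shows "\<exists>C :: real \<Rightarrow> real. \<forall>\<phi> u.
           smooth_on_set (frontier \<Omega>) \<phi> \<longrightarrow>
           Ck 4 \<Omega> \<Omega> u \<longrightarrow> Ck 2 \<Omega> (closure \<Omega>) u \<longrightarrow>
           admissible k \<Omega> A u \<longrightarrow>
           (\<forall>x\<in>\<Omega>. S_mat k (aug_hess \<Omega> A u x) = B (x, grad \<Omega> u x)) \<longrightarrow>
           (\<forall>x\<in>frontier \<Omega>. u x = \<phi> x) \<longrightarrow>
           (SUP x\<in>\<Omega>. norm (hess \<Omega> u x))
             \<le> C (SUP x\<in>\<Omega>. \<bar>u x\<bar> + norm (grad \<Omega> u x)) * (1 + (SUP x\<in>frontier \<Omega>. norm (hess \<Omega> u x)))"
proof -
  \<comment> \<open>Orders are shifted by one, so that the first derivatives of the operator have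
    order \<open>k'\<close> without truncated subtraction.\<close>
  obtain k' where k: "k = Suc k'" using \<open>1 \<le> k\<close> by (cases k) auto
  interpret augmented_hessian_problem \<Omega> k' A B usub
    by (rule augmented_hessian_problem.intro) (use assms in \<open>auto simp: k\<close>)
  \<comment> \<open>For fixed data the constant of \<open>hessian_bound\<close> is determined by
    \<open>M\<close>; one choice for each \<open>M\<close> makes it a function.\<close>
  obtain C where C: "\<And>M u. is_solution M u \<Longrightarrow>
    (SUP x\<in>\<Omega>. norm (hess \<Omega> u x)) \<le> C M * (1 + (SUP x\<in>frontier \<Omega>. norm (hess \<Omega> u x)))"
    using hessian_bound by metis
  show ?thesis
  proof (intro exI allI impI)
    fix \<phi> u
    assume u: "Ck 4 \<Omega> \<Omega> u" "Ck 2 \<Omega> (closure \<Omega>) u" "admissible k \<Omega> A u"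
      "\<forall>x\<in>\<Omega>. S_mat k (aug_hess \<Omega> A u x) = B (x, grad \<Omega> u x)"
    \<comment> \<open>The supremum in the conclusion bounds the values of \<open>u\<close> and its
      gradient only if it is finite, which holds by continuity on the compact closure.\<close>
    have "bdd_above ((\<lambda>x. \<bar>u x\<bar> + norm (grad \<Omega> u x)) ` \<Omega>)"
    proof (rule bdd_above_mono)
      have "continuous_on (closure \<Omega>) (\<lambda>x. \<bar>u x\<bar> + norm (grad \<Omega> u x))"
        by (intro continuous_intros Ck_continuous[OF u(2)] continuous_on_grad[OF u(2)])
      then show "bdd_above ((\<lambda>x. \<bar>u x\<bar> + norm (grad \<Omega> u x)) ` closure \<Omega>)"
        using compact_closure_dom by (intro bounded_imp_bdd_above compact_imp_bounded compact_continuous_image)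
    qed (use closure_subset in blast)
    then have "is_solution (SUP x\<in>\<Omega>. \<bar>u x\<bar> + norm (grad \<Omega> u x)) u"
      using u cSUP_upper by (auto simp: is_solution_def k)
    then show "(SUP x\<in>\<Omega>. norm (hess \<Omega> u x))
             \<le> C (SUP x\<in>\<Omega>. \<bar>u x\<bar> + norm (grad \<Omega> u x)) * (1 + (SUP x\<in>frontier \<Omega>. norm (hess \<Omega> u x)))"
      by (rule C)
  qed
qed

end
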